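(* Assume that hypothesis (H) and intrinsic ultracontractivity [IU] hold. Then for every $0<q<1$, every probability measure $\nu$ on $(0,\infty)$ and every bounded Borel function $f$ on $(0,\infty)$, $$\lim_{t\to\infty}\mathbb E_\nu\big(f(X_{qt})\,\big|\,T_0>t\big)=\int_0^\infty f(y)\,\nu_1(dy),$$ where $\nu_1(dy)=\eta_1(y)^2\mu(dy)$.
   Context: Let $\alpha\in C^1(0,\infty)$ (possibly exploding at $0$) and let $X$ be the diffusion on $(0,\infty)$ solving $dX_t=dB_t-\alpha(X_t)\,dt$, $X_0=x>0$, with $B$ a standard Brownian motion, up to its explosion time $\tau$; its generator is $Lu=\frac12 u''-\alpha u'$. Put $Q(y)=\int_1^y 2\alpha(x)\,dx$ and $\mu(dy)=e^{-Q(y)}dy$ (an infinite measure on $(0,\infty)$). For $a\in(0,\infty)$ let $T_a=\inf\{0\le t<\tau: X_t=a\}$, $T_\infty=\lim_n T_n$, $T_0=\lim_n T_{1/n}$. $\mathbb P_x,\mathbb E_x$ refer to $X$ started at $x$, and $\mathbb P_\nu=\int\mathbb P_x\,\nu(dx)$. Hypothesis (H) means all of: (H1) for all $x>0$, $\mathbb P_x(\tau=T_0<T_\infty)=1$; (H2) for every $\varepsilon>0$, $\mu(0,\varepsilon)=\infty$; (H3) $\int_1^\infty e^{Q(y)}\left(\int_y^\infty e^{-Q(z)}dz\right)dy<\infty$. Under (H), the killed semigroup $P_tf(x)=\mathbb E_x[f(X_t),T_0>t]$ is a symmetric sub-Markovian contraction semigroup on $L^2(\mu)$ with generator $L$; $-L$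 has purely discrete spectrum of simple eigenvalues $0<\lambda_1<\lambda_2<\cdots\to\infty$, eigenfunctions forming an orthonormal basis of $L^2(\mu)$, with $\eta_1>0$ the eigenfunction for $\lambda_1$, $\|\eta_1\|_{L^2(\mu)}=1$. For $t>0$, $x>0$ there is a density $r(t,x,\cdot)\in L^2(\mu)$ with $\mathbb E_x[f(X_t),T_0>t]=\int_0^\infty r(t,x,y)f(y)\mu(dy)$ for bounded Borel $f$. The semigroup is intrinsically ultracontractive [IU] if for every $t>0$ there is $c_t>0$ with $r(t,x,y)\le c_t\eta_1(x)\eta_1(y)$ for all $x,y\in(0,\infty)$. *)

theory Defs
  imports "HOL-Probability.Probability"
begin

(* Standard one-dimensional Brownian motion on the probability space M,
   indexed by times t >= 0 (values at negative times are irrelevant). *)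
definition brownian_motion :: "'w measure \<Rightarrow> (real \<Rightarrow> 'w \<Rightarrow> real) \<Rightarrow> bool" where
  "brownian_motion M B \<longleftrightarrow> prob_space M \<and>
     (\<forall>t. B t \<in> borel_measurable M) \<and>
     (\<forall>\<omega>\<in>space M. B 0 \<omega> = 0 \<and> continuous_on {0..} (\<lambda>t. B t \<omega>)) \<and>
     (\<forall>s t. 0 \<le> s \<and> s < t \<longrightarrow>
        distributed M lborel (\<lambda>\<omega>. B t \<omega> - B s \<omega>) (normal_density 0 (sqrt (t - s)))) \<and>
     (\<forall>(ts :: nat \<Rightarrow> real) n. 0 \<le> ts 0 \<and> (\<forall>i<n. ts i < ts (Suc i)) \<longrightarrow>
        prob_space.indep_vars M (\<lambda>_. borel) (\<lambda>i \<omega>. B (ts (Suc i)) \<omega> - B (ts i) \<omega>) {..<n})"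

(* y solves  y(s) = x + b(s) - int_0^s alpha(y(u)) du  on [0,T], staying in (0,oo).
   For a Brownian path b this is exactly the SDE dX = dB - alpha(X) dt, X_0 = x. *)
definition sde_sol_on ::
  "(real \<Rightarrow> real) \<Rightarrow> real \<Rightarrow> (real \<Rightarrow> real) \<Rightarrow> real \<Rightarrow> (real \<Rightarrow> real) \<Rightarrow> bool" where
  "sde_sol_on \<alpha> x b T y \<longleftrightarrow> 0 \<le> T \<and> continuous_on {0..T} y \<and>
     (\<forall>s\<in>{0..T}. 0 < y s \<and> y s = x + b s - integral {0..s} (\<lambda>u. \<alpha> (y u)))"

definition expl_time :: "(real \<Rightarrow> real) \<Rightarrow> real \<Rightarrow> (real \<Rightarrow> real) \<Rightarrow> ereal" where
  "expl_time \<alpha> x b = Sup {ereal T | T. \<exists>y. sde_sol_on \<alpha> x b T y}"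

definition diff_path :: "(real \<Rightarrow> real) \<Rightarrow> real \<Rightarrow> (real \<Rightarrow> real) \<Rightarrow> real \<Rightarrow> real" where
  "diff_path \<alpha> x b t = (THE v. \<exists>T y. t \<le> T \<and> sde_sol_on \<alpha> x b T y \<and> y t = v)"

definition hit_time :: "(real \<Rightarrow> real) \<Rightarrow> real \<Rightarrow> (real \<Rightarrow> real) \<Rightarrow> real \<Rightarrow> ereal" where
  "hit_time \<alpha> x b a =
     Inf {ereal t | t. 0 \<le> t \<and> ereal t < expl_time \<alpha> x b \<and> diff_path \<alpha> x b t = a}"

definition T_zero :: "(real \<Rightarrow> real) \<Rightarrow> real \<Rightarrow> (real \<Rightarrow> real) \<Rightarrow> ereal" where
  "T_zero \<alpha> x b = lim (\<lambda>n. hit_time \<alpha> x b (1 / real (Suc n)))"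

definition T_infty :: "(real \<Rightarrow> real) \<Rightarrow> real \<Rightarrow> (real \<Rightarrow> real) \<Rightarrow> ereal" where
  "T_infty \<alpha> x b = lim (\<lambda>n. hit_time \<alpha> x b (real (Suc n)))"

definition Qpot :: "(real \<Rightarrow> real) \<Rightarrow> real \<Rightarrow> real" where
  "Qpot \<alpha> y = (LBINT u=ereal 1..ereal y. 2 * \<alpha> u)"

definition mu :: "(real \<Rightarrow> real) \<Rightarrow> real measure" where
  "mu \<alpha> = density lborel (\<lambda>y. ennreal (indicator {0<..} y * exp (- Qpot \<alpha> y)))"

definition killed_exp ::
  "'w measure \<Rightarrow> (real \<Rightarrow> 'w \<Rightarrow> real) \<Rightarrow> (real \<Rightarrow> real) \<Rightarrow> real \<Rightarrow> real \<Rightarrow> real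
     \<Rightarrow> (real \<Rightarrow> real) \<Rightarrow> real" where
  "killed_exp M B \<alpha> x s t f =
     (\<integral>\<omega>. indicator {\<omega>. ereal t < T_zero \<alpha> x (\<lambda>u. B u \<omega>)} \<omega>
            * f (diff_path \<alpha> x (\<lambda>u. B u \<omega>) s) \<partial>M)"

definition hypH :: "'w measure \<Rightarrow> (real \<Rightarrow> 'w \<Rightarrow> real) \<Rightarrow> (real \<Rightarrow> real) \<Rightarrow> bool" where
  "hypH M B \<alpha> \<longleftrightarrow>
     (\<forall>x>0. AE \<omega> in M. expl_time \<alpha> x (\<lambda>u. B u \<omega>) = T_zero \<alpha> x (\<lambda>u. B u \<omega>)
                        \<and> T_zero \<alpha> x (\<lambda>u. B u \<omega>) < T_infty \<alpha> x (\<lambda>u. B u \<omega>)) \<and>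
     (\<forall>\<epsilon>>0. emeasure (mu \<alpha>) {0<..<\<epsilon>} = \<infinity>) \<and>
     (\<integral>\<^sup>+ y. indicator {1..} y * ennreal (exp (Qpot \<alpha> y)) *
         (\<integral>\<^sup>+ z. indicator {y..} z * ennreal (exp (- Qpot \<alpha> z)) \<partial>lborel) \<partial>lborel) < \<infinity>"

end

theory Submission
  imports Defs
begin

text \<open>
  Conditioning is removed by the ground state transform: on the killed semigroup \<open>P\<^sub>t\<close> put
  \<open>Q\<^sub>t(x, dy) = e\<^bsup>\<lambda>t\<^esup> \<eta>(y) P\<^sub>t(x, dy) / \<eta>(x)\<close>, a Markov semigroup since \<open>\<eta>\<close> is an eigenfunction.
  Intrinsic ultracontractivity says \<open>Q\<^sub>1(x, \<cdot>) \<le> C \<pi>\<close> with \<open>\<pi> = \<eta>\<^sup>2 \<mu>\<close>, so from every starting point most of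
  the mass is in a fixed compact interval after unit time. There the Cameron--Martin formula gives a
  minorization of the kernel by Lebesgue measure. Together these are a uniform Doeblin condition,
  hence \<open>Q\<^sub>t g\<close> converges uniformly to a constant for every bounded measurable \<open>g\<close>.

  The limit law annihilates the generator of \<open>Q\<close> on test functions. As the scale function of \<open>Q\<close> is
  unbounded at infinity, this forces it to be \<open>\<pi>\<close>.

  Since \<open>\<pi>\<close> is invariant, the upper bound on the kernel also yields a lower bound
  \<open>c \<pi> \<le> Q\<^sub>t(x, \<cdot>)\<close>, so \<open>1/\<eta>\<close> is \<open>\<pi>\<close>-integrable and \<open>w = Q\<^sub>1(1/\<eta>)\<close> is bounded. The conditional expectation is the
  quotient of the \<open>\<nu>\<close>-integrals of \<open>\<eta> Q\<^bsub>qt\<^esub>(f Q\<^bsub>(1-q)t-1\<^esub> w)\<close> and \<open>\<eta> Q\<^bsub>t-1\<^esub> w\<close>, where both \<open>Q\<close>-terms converge uniformly.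
\<close>

section \<open>Pathwise solutions of the equation\<close>

text \<open>The noise is additive, so the process is handled path by path: a Brownian path is a
  fixed continuous input and no stochastic integral occurs. The price is measurability and transfer
  of laws. Solutions of truncated equations are written as countable limits of Riemann sums, which
  makes them measurable functionals on the product path space; identities in law (Markov property,
  Cameron--Martin) then reduce to comparing Gaussian increments on finite grids. The generator comes
  from a second-order Taylor expansion and a quantitative maximal inequality.

  The hypotheses bound the kernel \<open>r\<close> but do not state its symmetry, so invariance of
  \<open>pi\<close> has to be derived. The limit functional \<open>erg\<close> exists by contraction
  alone; the kernel bound makes it continuous in L1(\<open>pi\<close>), and this continuity is what
  allows its identification from compactly supported test functions. Those give slightly too few
  generator images: besides mean zero a second linear condition appears. It is met by a correction
  placed far out, whose coefficient tends to 0 while its L1(\<open>pi\<close>) size stays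
  bounded.\<close>

lemma gronwall:
  fixes f :: "real \<Rightarrow> real"
  assumes cont: "continuous_on {0..T} f" and L: "0 \<le> L"
    and le: "\<And>s. s \<in> {0..T} \<Longrightarrow> f s \<le> A + L * integral {0..s} f" and s: "s \<in> {0..T}"
  shows "f s \<le> A * exp (L * s)"
proof -
  define F where "F u = integral {0..u} f" for u
  \<comment> \<open>The integrating factor makes exp(-L u)(A + L F u) nonincreasing; the sign is
    flipped because the monotonicity rule below is stated for increasing functions.\<close>
  define G where "G u = - (exp (- L * u) * (A + L * F u))" for u
  have dF: "(F has_real_derivative f u) (at u within {0..T})" if "u \<in> {0..T}" for u
    unfolding F_def using integral_has_real_derivative[OF cont that] .
  have dG: "(G has_real_derivative L * exp (- L * u) * (A + L * F u) - exp (- L * u) * (L * f u)) (at u within {0..T})"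
    if "u \<in> {0..T}" for u
    unfolding G_def using dF[OF that] by (auto intro!: derivative_eq_intros)
  have "G 0 \<le> G s"
  proof (rule DERIV_nonneg_imp_increasing_open[of 0 s])
    show "0 \<le> s" using s by simp
    show "\<exists>y. (G has_real_derivative y) (at u) \<and> y \<ge> 0" if "0 < u" "u < s" for u
    proof (intro exI conjI)
      have u: "u \<in> {0<..<T}" "u \<in> {0..T}" using that s by auto
      show "(G has_real_derivative L * exp (- L * u) * (A + L * F u) - exp (- L * u) * (L * f u)) (at u)"
        using dG[OF u(2)] u(1) by (simp add: at_within_Icc_at)
      have "L * f u \<le> L * (A + L * F u)" using le[OF u(2)] L unfolding F_def by (intro mult_left_mono) auto
      then have "exp (- L * u) * (L * f u) \<le> exp (- L * u) * (L * (A + L * F u))" by (rule mult_left_mono) simp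
      then show "0 \<le> L * exp (- L * u) * (A + L * F u) - exp (- L * u) * (L * f u)" by (simp add: algebra_simps)
    qed
    have "continuous_on {0..T} G"
      by (rule continuous_on_eq_continuous_within[THEN iffD2]) (blast intro: dG DERIV_continuous)
    then show "continuous_on {0..s} G" by (rule continuous_on_subset) (use s in auto)
  qed
  then have "exp (- L * s) * (A + L * F s) \<le> A" by (simp add: G_def F_def)
  then have "A + L * F s \<le> A * exp (L * s)" by (simp add: exp_minus field_simps)
  with le[OF s] show ?thesis by (simp add: F_def)
qed

text \<open>Stands in for the integral in the Picard scheme. A limit of sums over the points t
  j/(n+1) is a countable expression in the values of \<open>g\<close> on [0,t], so it is measurable
  in any parameter and makes sense for every path, continuous or not.\<close>

definition riemann_lim :: "(real \<Rightarrow> real) \<Rightarrow> real \<Rightarrow> real" where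
  "riemann_lim g t = lim (\<lambda>n. (\<Sum>j<Suc n. t / real (Suc n) * g (t * real j / real (Suc n))))"

lemma integral_uniform_partition:
  fixes g :: "real \<Rightarrow> real"
  assumes "continuous_on {0..real n * d} g" "0 \<le> d" "k \<le> n"
  shows "integral {0..real k * d} g = (\<Sum>j<k. integral {real j * d..real (Suc j) * d} g)"
  using assms(3)
proof (induction k)
  case (Suc k)
  have le: "real (Suc k) * d \<le> real n * d" using Suc.prems assms(2) by (intro mult_right_mono) auto
  have "g integrable_on {0..real (Suc k) * d}"
    by (rule integrable_continuous_real, rule continuous_on_subset[OF assms(1)]) (use le in auto)
  then have "integral {0..real k * d} g + integral {real k * d..real (Suc k) * d} g = integral {0..real (Suc k) * d} g"
    by (intro Henstock_Kurzweil_Integration.integral_combine) (use assms(2) in \<open>auto intro: mult_right_mono\<close>)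
  with Suc show ?case by simp
qed simp

lemma riemann_lim_eq_integral:
  assumes cont: "continuous_on {0..t} g" and t: "0 \<le> t"
  shows "riemann_lim g t = integral {0..t} g"
proof -
  have "(\<lambda>n. (\<Sum>j<Suc n. t / real (Suc n) * g (t * real j / real (Suc n)))) \<longlonglongrightarrow> integral {0..t} g"
  proof (rule LIMSEQ_I)
    fix r :: real assume r: "0 < r"
    \<comment> \<open>Dividing by t + 1 instead of t also covers t = 0.\<close>
    define e where "e = r / (t + 1)"
    have e: "0 < e" "e * t < r"
      using r t by (simp_all add: e_def field_simps)
    have "uniformly_continuous_on {0..t} g"
      by (rule compact_uniformly_continuous[OF cont]) simp
    then obtain d where d: "0 < d" "\<And>u v. u \<in> {0..t} \<Longrightarrow> v \<in> {0..t} \<Longrightarrow> dist v u < d \<Longrightarrow> dist (g v) (g u) < e"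
      using e(1) unfolding uniformly_continuous_on_def by metis
    obtain N where N: "t / d < real N" using reals_Archimedean2 by blast
    have "norm ((\<Sum>j<Suc n. t / real (Suc n) * g (t * real j / real (Suc n))) - integral {0..t} g) < r" if n: "n \<ge> N" for n
    proof -
      define h where "h = t / real (Suc n)"
      have h: "0 \<le> h" "h < d" "real (Suc n) * h = t"
      proof -
        show "0 \<le> h" using t by (simp add: h_def)
        have "t / d < real (Suc n)" using N n by linarith
        then show "h < d" using d(1) by (simp add: h_def field_simps)
        show "real (Suc n) * h = t" by (simp add: h_def)
      qed
      have int: "integral {0..t} g = (\<Sum>j<Suc n. integral {real j * h..real (Suc j) * h} g)"
        using integral_uniform_partition[of "Suc n" h g "Suc n"] cont h by simp
      have piece: "norm (h * g (real j * h) - integral {real j * h..real (Suc j) * h} g) \<le> e * h" if j: "j < Suc n" for j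
      proof -
        have le1: "0 \<le> real j * h" using h by simp
        have le2: "real (Suc j) * h \<le> t" using mult_right_mono[of "real (Suc j)" "real (Suc n)" h] j h by simp
        have le3: "real j * h \<le> real (Suc j) * h" using h(1) by (simp add: algebra_simps)
        have gi: "g integrable_on {real j * h..real (Suc j) * h}"
          by (rule integrable_continuous_real, rule continuous_on_subset[OF cont]) (use le1 le2 in auto)
        have "integral {real j * h..real (Suc j) * h} (\<lambda>u. g (real j * h) - g u)
            = h * g (real j * h) - integral {real j * h..real (Suc j) * h} g"
          using gi h(1) by (subst Henstock_Kurzweil_Integration.integral_diff) (auto simp: algebra_simps)
        moreover have "norm (integral (cbox (real j * h) (real (Suc j) * h)) (\<lambda>u. g (real j * h) - g u)) \<le> e * measure lborel (cbox (real j * h) (real (Suc j) * h))"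
        proof (rule integrable_bound)
          show "0 \<le> e" using e by simp
          show "(\<lambda>u. g (real j * h) - g u) integrable_on cbox (real j * h) (real (Suc j) * h)"
            using gi by (auto intro: integrable_diff)
          show "norm (g (real j * h) - g u) \<le> e" if "u \<in> cbox (real j * h) (real (Suc j) * h)" for u
          proof -
            have u: "real j * h \<le> u" "u \<le> real j * h + h" using that by (auto simp: algebra_simps)
            have "dist (g (real j * h)) (g u) < e"
              by (rule d(2)) (use u h le1 le2 le3 order_trans[OF le1 u(1)] in \<open>auto simp: dist_real_def algebra_simps\<close>)
            then show ?thesis by (simp add: dist_norm)
          qed
        qed
        ultimately show ?thesis using h(1) le3 by (simp add: algebra_simps)
      qed
      have "norm ((\<Sum>j<Suc n. h * g (real j * h)) - integral {0..t} g) \<le> (\<Sum>j<Suc n. e * h)"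
        unfolding int sum_subtractf[symmetric] by (rule sum_norm_le) (use piece in auto)
      also have "\<dots> = e * t" using h(3) by simp
      finally show ?thesis using e(2) by (simp add: h_def mult.commute)
    qed
    then show "\<exists>no. \<forall>n\<ge>no. norm ((\<Sum>j<Suc n. t / real (Suc n) * g (t * real j / real (Suc n))) - integral {0..t} g) < r"
      by blast
  qed
  then show ?thesis unfolding riemann_lim_def by (rule limI)
qed

section \<open>Picard iteration for a bounded Lipschitz drift\<close>

primrec picard :: "(real \<Rightarrow> real) \<Rightarrow> real \<Rightarrow> (real \<Rightarrow> real) \<Rightarrow> nat \<Rightarrow> real \<Rightarrow> real" where
  "picard \<beta> x w 0 = (\<lambda>t. x + w t)"
| "picard \<beta> x w (Suc k) = (\<lambda>t. x + w t - riemann_lim (\<lambda>u. \<beta> (picard \<beta> x w k u)) t)"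

definition lip_sol :: "(real \<Rightarrow> real) \<Rightarrow> real \<Rightarrow> (real \<Rightarrow> real) \<Rightarrow> real \<Rightarrow> real" where
  "lip_sol \<beta> x w t = lim (\<lambda>k. picard \<beta> x w k t)"

definition bdd_lip :: "real \<Rightarrow> real \<Rightarrow> (real \<Rightarrow> real) \<Rightarrow> bool" where
  "bdd_lip A L \<beta> \<longleftrightarrow> 0 \<le> L \<and> (\<forall>y. \<bar>\<beta> y\<bar> \<le> A) \<and> (\<forall>y z. \<bar>\<beta> y - \<beta> z\<bar> \<le> L * \<bar>y - z\<bar>)"

lemma bdd_lip_continuous: "bdd_lip A L \<beta> \<Longrightarrow> continuous_on S \<beta>"
proof -
  assume "bdd_lip A L \<beta>"
  then have "L-lipschitz_on UNIV \<beta>"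
    by (auto simp: bdd_lip_def lipschitz_on_def dist_real_def)
  then show ?thesis by (meson continuous_on_subset lipschitz_on_continuous_on subset_UNIV)
qed

lemma continuous_on_indefinite_integral:
  fixes g :: "real \<Rightarrow> real"
  shows "continuous_on {0..T} g \<Longrightarrow> continuous_on {0..T} (\<lambda>t. integral {0..t} g)"
  by (rule indefinite_integral_continuous_1) (rule integrable_continuous_real)

lemma picard_continuous:
  assumes "bdd_lip A L \<beta>" "continuous_on {0..T} w"
  shows "continuous_on {0..T} (picard \<beta> x w k)"
    "\<And>t. t \<in> {0..T} \<Longrightarrow> picard \<beta> x w (Suc k) t = x + w t - integral {0..t} (\<lambda>u. \<beta> (picard \<beta> x w k u))"
proof -
  have c: "continuous_on {0..T} (picard \<beta> x w k) \<and> (\<forall>t\<in>{0..T}. picard \<beta> x w (Suc k) t = x + w t - integral {0..t} (\<lambda>u. \<beta> (picard \<beta> x w k u)))"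
  proof (induction k)
    case 0
    have c0: "continuous_on {0..T} (picard \<beta> x w 0)" using assms(2) by (auto intro!: continuous_intros)
    have "continuous_on {0..T} (\<lambda>u. \<beta> (picard \<beta> x w 0 u))"
      using continuous_on_compose[OF c0 bdd_lip_continuous[OF assms(1)]] by (simp add: o_def)
    then show ?case using c0 by (auto intro!: riemann_lim_eq_integral elim!: continuous_on_subset)
  next
    case (Suc k)
    have "continuous_on {0..T} (\<lambda>u. \<beta> (picard \<beta> x w k u))"
      using continuous_on_compose[OF conjunct1[OF Suc] bdd_lip_continuous[OF assms(1)]] by (simp add: o_def)
    then have "continuous_on {0..T} (\<lambda>t. x + w t - integral {0..t} (\<lambda>u. \<beta> (picard \<beta> x w k u)))"
      using assms(2) by (auto intro!: continuous_intros continuous_on_indefinite_integral)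
    then have c1: "continuous_on {0..T} (picard \<beta> x w (Suc k))"
      by (rule continuous_on_eq) (use Suc in auto)
    have "continuous_on {0..T} (\<lambda>u. \<beta> (picard \<beta> x w (Suc k) u))"
      using continuous_on_compose[OF c1 bdd_lip_continuous[OF assms(1)]] by (simp only: o_def)
    then have "\<forall>t\<in>{0..T}. picard \<beta> x w (Suc (Suc k)) t = x + w t - integral {0..t} (\<lambda>u. \<beta> (picard \<beta> x w (Suc k) u))"
      unfolding picard.simps(2)[of \<beta> x w "Suc k"]
      by (auto intro!: riemann_lim_eq_integral elim!: continuous_on_subset simp del: picard.simps)
    with c1 show ?case by blast
  qed
  show "continuous_on {0..T} (picard \<beta> x w k)" using c ..
  show "\<And>t. t \<in> {0..T} \<Longrightarrow> picard \<beta> x w (Suc k) t = x + w t - integral {0..t} (\<lambda>u. \<beta> (picard \<beta> x w k u))"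
    using c by blast
qed

text \<open>Boundedness of the drift gives A T for the first step; each further step integrates L
  times the previous bound and so contributes L t/(k+1). The result is an exponential series that
  majorizes the increments.\<close>

lemma picard_step_le:
  assumes b: "bdd_lip A L \<beta>" and w: "continuous_on {0..T} w" and t: "t \<in> {0..T}"
  shows "\<bar>picard \<beta> x w (Suc k) t - picard \<beta> x w k t\<bar> \<le> A * T * ((L * t) ^ k / fact k)"
  using t
proof (induction k arbitrary: t)
  case 0
  have A: "0 \<le> A" "\<And>y. \<bar>\<beta> y\<bar> \<le> A" using b unfolding bdd_lip_def by (smt (verit))+
  have cont: "continuous_on {0..t} (\<lambda>u. \<beta> (picard \<beta> x w 0 u))"
    by (rule continuous_on_subset[OF continuous_on_compose[OF picard_continuous(1)[OF b w] bdd_lip_continuous[OF b], unfolded o_def]])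
      (use 0 in auto)
  have "norm (integral (cbox 0 t) (\<lambda>u. \<beta> (picard \<beta> x w 0 u))) \<le> A * measure lborel (cbox 0 t)"
    using A integrable_continuous_real[OF cont] by (intro integrable_bound) auto
  also have "\<dots> \<le> A * T" using A 0 by (auto intro: mult_left_mono)
  finally show ?case using picard_continuous(2)[OF b w 0, of x 0] by simp
next
  case (Suc k)
  have A: "0 \<le> A" "0 \<le> L" "\<And>y z. \<bar>\<beta> y - \<beta> z\<bar> \<le> L * \<bar>y - z\<bar>" using b unfolding bdd_lip_def by (smt (verit))+
  have T: "0 \<le> T" using Suc by auto
  have ci: "continuous_on {0..t} (\<lambda>u. \<beta> (picard \<beta> x w j u))" for j
    by (rule continuous_on_subset[OF continuous_on_compose[OF picard_continuous(1)[OF b w] bdd_lip_continuous[OF b], unfolded o_def]])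
      (use Suc.prems in auto)
  have eq: "picard \<beta> x w (Suc (Suc k)) t - picard \<beta> x w (Suc k) t
     = - integral {0..t} (\<lambda>u. \<beta> (picard \<beta> x w (Suc k) u) - \<beta> (picard \<beta> x w k u))"
    unfolding picard_continuous(2)[OF b w Suc.prems]
    by (subst Henstock_Kurzweil_Integration.integral_diff) (auto intro!: integrable_continuous_real ci simp del: picard.simps)
  have hi: "((\<lambda>u. L * (A * T * ((L * u) ^ k / fact k))) has_integral
      (A * T * ((L * t) ^ Suc k / fact (Suc k)) - A * T * ((L * 0) ^ Suc k / fact (Suc k)))) {0..t}"
  proof (rule fundamental_theorem_of_calculus)
    show "0 \<le> t" using Suc by simp
    fix u :: real
    show "((\<lambda>t. A * T * ((L * t) ^ Suc k / fact (Suc k))) has_vector_derivative L * (A * T * ((L * u) ^ k / fact k))) (at u within {0..t})"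
      unfolding has_real_derivative_iff_has_vector_derivative[symmetric]
      by (rule derivative_eq_intros refl | simp)+
  qed
  have "norm (integral {0..t} (\<lambda>u. \<beta> (picard \<beta> x w (Suc k) u) - \<beta> (picard \<beta> x w k u)))
      \<le> integral {0..t} (\<lambda>u. L * (A * T * ((L * u) ^ k / fact k)))"
  proof (rule integral_norm_bound_integral)
    show "(\<lambda>u. \<beta> (picard \<beta> x w (Suc k) u) - \<beta> (picard \<beta> x w k u)) integrable_on {0..t}"
      by (intro integrable_diff integrable_continuous_real ci)
    show "(\<lambda>u. L * (A * T * ((L * u) ^ k / fact k))) integrable_on {0..t}" using hi by blast
    show "norm (\<beta> (picard \<beta> x w (Suc k) u) - \<beta> (picard \<beta> x w k u)) \<le> L * (A * T * ((L * u) ^ k / fact k))"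
      if "u \<in> {0..t}" for u
    proof -
      have "u \<in> {0..T}" using that Suc.prems by auto
      from mult_left_mono[OF Suc.IH[OF this] A(2)] A(3)[of "picard \<beta> x w (Suc k) u" "picard \<beta> x w k u"]
      show ?thesis by (simp del: picard.simps)
    qed
  qed
  also have "\<dots> = A * T * ((L * t) ^ Suc k / fact (Suc k))" using integral_unique[OF hi] by (simp del: power_Suc fact_Suc)
  finally show ?case unfolding eq by (simp del: picard.simps)
qed

lemma picard_uniform_limit:
  assumes b: "bdd_lip A L \<beta>" and w: "continuous_on {0..T} w"
  shows "uniform_limit {0..T} (\<lambda>k. picard \<beta> x w k) (lip_sol \<beta> x w) sequentially"
proof (cases "0 \<le> T")
  case True
  have A: "0 \<le> A" "0 \<le> L" using b unfolding bdd_lip_def by (smt (verit))+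
  define M where "M k = A * T * ((L * T) ^ k / fact k)" for k
  have sM: "summable M"
  proof -
    have "(\<lambda>k. (L * T) ^ k / fact k) = (\<lambda>k. inverse (fact k) * (L*T) ^ k)" by (auto simp: field_simps)
    then show ?thesis unfolding M_def using summable_exp[of "L*T"] by (metis summable_mult)
  qed
  have "uniform_limit {0..T} (\<lambda>n t. \<Sum>k<n. picard \<beta> x w (Suc k) t - picard \<beta> x w k t)
    (\<lambda>t. suminf (\<lambda>k. picard \<beta> x w (Suc k) t - picard \<beta> x w k t)) sequentially"
  proof (rule Weierstrass_m_test[OF _ sM])
    fix k t assume t: "t \<in> {0..T}"
    have "A * T * ((L * t) ^ k / fact k) \<le> A * T * ((L * T) ^ k / fact k)"
      using A True t by (intro mult_left_mono divide_right_mono power_mono) auto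
    then show "norm (picard \<beta> x w (Suc k) t - picard \<beta> x w k t) \<le> M k"
      using picard_step_le[OF b w t, of x k] by (simp add: M_def del: picard.simps)
  qed
  then have u: "uniform_limit {0..T} (\<lambda>n t. picard \<beta> x w n t - picard \<beta> x w 0 t)
     (\<lambda>t. suminf (\<lambda>k. picard \<beta> x w (Suc k) t - picard \<beta> x w k t)) sequentially"
    by (subst (asm) sum_lessThan_telescope)
  have u2: "uniform_limit {0..T} (\<lambda>n t. picard \<beta> x w n t)
     (\<lambda>t. suminf (\<lambda>k. picard \<beta> x w (Suc k) t - picard \<beta> x w k t) + picard \<beta> x w 0 t) sequentially"
    using uniform_limit_add[OF u uniform_limit_const[of "\<lambda>t. picard \<beta> x w 0 t"]]
    by (simp del: picard.simps)
  show ?thesis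
  proof (rule uniform_limit_cong'[THEN iffD1, OF _ _ u2])
    fix t assume "t \<in> {0..T}"
    from tendsto_uniform_limitI[OF u2 this]
    show "suminf (\<lambda>k. picard \<beta> x w (Suc k) t - picard \<beta> x w k t) + picard \<beta> x w 0 t = lip_sol \<beta> x w t"
      unfolding lip_sol_def by (rule limI[symmetric])
  qed simp
qed simp

lemma lip_sol_eq:
  assumes b: "bdd_lip A L \<beta>" and w: "continuous_on {0..T} w"
  shows "continuous_on {0..T} (lip_sol \<beta> x w)"
    and "t \<in> {0..T} \<Longrightarrow> lip_sol \<beta> x w t = x + w t - integral {0..t} (\<lambda>u. \<beta> (lip_sol \<beta> x w u))"
proof -
  note ul = picard_uniform_limit[OF b w, of x]
  show "continuous_on {0..T} (lip_sol \<beta> x w)"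
    by (rule uniform_limit_theorem[OF _ ul]) (auto intro!: picard_continuous[OF b w] always_eventually)
  assume t: "t \<in> {0..T}"
  have A: "0 \<le> L" "\<And>y z. \<bar>\<beta> y - \<beta> z\<bar> \<le> L * \<bar>y - z\<bar>" using b unfolding bdd_lip_def by (smt (verit))+
  have lip: "uniformly_continuous_on UNIV \<beta>"
    by (rule lipschitz_on_uniformly_continuous[of L]) (auto simp: lipschitz_on_def A dist_real_def)
  have ul2: "uniform_limit {0..t} (\<lambda>k u. \<beta> (picard \<beta> x w k u)) (\<lambda>u. \<beta> (lip_sol \<beta> x w u)) sequentially"
    by (rule uniform_limit_compose[OF _ lip, unfolded o_def]) (use t in \<open>auto intro!: uniform_limit_on_subset[OF ul]\<close>)
  have ci: "continuous_on {0..t} (\<lambda>u. \<beta> (picard \<beta> x w j u))" for j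
    by (rule continuous_on_subset[OF continuous_on_compose[OF picard_continuous(1)[OF b w] bdd_lip_continuous[OF b], unfolded o_def]])
      (use t in auto)
  have li: "(\<lambda>k. integral {0..t} (\<lambda>u. \<beta> (picard \<beta> x w k u))) \<longlonglongrightarrow> integral {0..t} (\<lambda>u. \<beta> (lip_sol \<beta> x w u))"
  proof -
    obtain I J where IJ: "\<And>n. ((\<lambda>u. \<beta> (picard \<beta> x w n u)) has_integral I n) {0..t}"
        "((\<lambda>u. \<beta> (lip_sol \<beta> x w u)) has_integral J) {0..t}" "I \<longlonglongrightarrow> J"
      using uniform_limit_integral[OF ul2 ci] by auto
    have "I = (\<lambda>n. integral {0..t} (\<lambda>u. \<beta> (picard \<beta> x w n u)))" "J = integral {0..t} (\<lambda>u. \<beta> (lip_sol \<beta> x w u))"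
      using IJ(1,2)[THEN integral_unique] by (simp_all add: fun_eq_iff)
    then show ?thesis using IJ(3) by simp
  qed
  have "(\<lambda>k. picard \<beta> x w (Suc k) t) \<longlonglongrightarrow> x + w t - integral {0..t} (\<lambda>u. \<beta> (lip_sol \<beta> x w u))"
    unfolding picard_continuous(2)[OF b w t] by (intro tendsto_intros li)
  then have "(\<lambda>k. picard \<beta> x w k t) \<longlonglongrightarrow> x + w t - integral {0..t} (\<lambda>u. \<beta> (lip_sol \<beta> x w u))"
    by (rule LIMSEQ_imp_Suc)
  then show "lip_sol \<beta> x w t = x + w t - integral {0..t} (\<lambda>u. \<beta> (lip_sol \<beta> x w u))"
    unfolding lip_sol_def by (rule limI)
qed

text \<open>Gronwall for the distance of two solutions with the same drift. With e = 0 it gives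
  uniqueness; with driving paths that differ by a linear function it later gives Lipschitz
  dependence on the slope.\<close>

lemma lip_stability:
  assumes b: "bdd_lip A L \<beta>"
    and y1: "continuous_on {0..T} y1" "\<And>s. s \<in> {0..T} \<Longrightarrow> y1 s = p1 s - integral {0..s} (\<lambda>u. \<beta> (y1 u))"
    and y2: "continuous_on {0..T} y2" "\<And>s. s \<in> {0..T} \<Longrightarrow> y2 s = p2 s - integral {0..s} (\<lambda>u. \<beta> (y2 u))"
    and p: "\<And>s. s \<in> {0..T} \<Longrightarrow> \<bar>p1 s - p2 s\<bar> \<le> e" and s: "s \<in> {0..T}"
  shows "\<bar>y1 s - y2 s\<bar> \<le> e * exp (L * s)"
proof (rule gronwall[where f="\<lambda>s. \<bar>y1 s - y2 s\<bar>", OF _ _ _ s])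
  show "continuous_on {0..T} (\<lambda>s. \<bar>y1 s - y2 s\<bar>)" using y1 y2 by (intro continuous_intros)
  show L: "0 \<le> L" using b by (simp add: bdd_lip_def)
  fix s assume s: "s \<in> {0..T}"
  have c: "continuous_on {0..s} (\<lambda>u. \<beta> (y1 u))" "continuous_on {0..s} (\<lambda>u. \<beta> (y2 u))" "continuous_on {0..s} y1" "continuous_on {0..s} y2"
    using s y1(1) y2(1) continuous_on_compose[OF y1(1) bdd_lip_continuous[OF b]] continuous_on_compose[OF y2(1) bdd_lip_continuous[OF b]]
    by (auto simp: o_def elim!: continuous_on_subset)
  have "norm (integral {0..s} (\<lambda>u. \<beta> (y1 u) - \<beta> (y2 u))) \<le> integral {0..s} (\<lambda>u. L * \<bar>y1 u - y2 u\<bar>)"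
  proof (rule integral_norm_bound_integral)
    show "(\<lambda>u. \<beta> (y1 u) - \<beta> (y2 u)) integrable_on {0..s}" "(\<lambda>u. L * \<bar>y1 u - y2 u\<bar>) integrable_on {0..s}"
      using c by (auto intro!: integrable_continuous_real continuous_intros)
    show "norm (\<beta> (y1 u) - \<beta> (y2 u)) \<le> L * \<bar>y1 u - y2 u\<bar>" for u using b by (simp add: bdd_lip_def)
  qed
  moreover have "integral {0..s} (\<lambda>u. \<beta> (y1 u) - \<beta> (y2 u)) = integral {0..s} (\<lambda>u. \<beta> (y1 u)) - integral {0..s} (\<lambda>u. \<beta> (y2 u))"
    using c by (intro Henstock_Kurzweil_Integration.integral_diff integrable_continuous_real)
  ultimately show "\<bar>y1 s - y2 s\<bar> \<le> e + L * integral {0..s} (\<lambda>u. \<bar>y1 u - y2 u\<bar>)"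
    using y1(2)[OF s] y2(2)[OF s] p[OF s] by simp
qed

lemma lip_sol_unique:
  assumes b: "bdd_lip A L \<beta>" and w: "continuous_on {0..T} w"
    and y: "continuous_on {0..T} y" "\<And>s. s \<in> {0..T} \<Longrightarrow> y s = x + w s - integral {0..s} (\<lambda>u. \<beta> (y u))"
    and s: "s \<in> {0..T}"
  shows "lip_sol \<beta> x w s = y s"
proof -
  have "\<bar>lip_sol \<beta> x w s - y s\<bar> \<le> 0 * exp (L * s)"
    by (rule lip_stability[OF b lip_sol_eq(1)[OF b w] lip_sol_eq(2)[OF b w] y _ s]) auto
  then show ?thesis by simp
qed

section \<open>Localization: exhaustion of the half-line and truncated drift\<close>

definition lo :: "nat \<Rightarrow> real" where "lo N = 1 / (real N + 2)"
definition hi :: "nat \<Rightarrow> real" where "hi N = real N + 2"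

lemma lo_hi: "0 < lo N" "lo N < hi N" "lo N \<le> 1/2"
proof -
  show "0 < lo N" "lo N \<le> 1/2" by (auto simp: lo_def field_simps)
  then show "lo N < hi N" unfolding hi_def by linarith
qed

lemma lo_hi_mono: "N < N' \<Longrightarrow> lo N' < lo N" "N < N' \<Longrightarrow> hi N < hi N'" "N \<le> N' \<Longrightarrow> lo N' \<le> lo N" "N \<le> N' \<Longrightarrow> hi N \<le> hi N'"
  by (auto simp: lo_def hi_def field_simps)

lemma ex_lo_hi: "0 < a \<Longrightarrow> \<exists>N0. \<forall>N\<ge>N0. lo N < a \<and> b < hi N"
proof -
  assume a: "0 < a"
  obtain n where n: "max b (1/a) < real n" using reals_Archimedean2 by blast
  show ?thesis
  proof (intro exI allI impI)
    fix N assume "n \<le> N"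
    with n have "1/a < real N + 2" "b < real N + 2" by auto
    then show "lo N < a \<and> b < hi N" using a by (auto simp: lo_def hi_def field_simps)
  qed
qed

locale drift =
  fixes \<alpha> :: "real \<Rightarrow> real"
  assumes C1: "\<exists>\<alpha>'. (\<forall>x>0. (\<alpha> has_real_derivative \<alpha>' x) (at x)) \<and> continuous_on {0<..} \<alpha>'"
begin

lemma continuous_drift: "continuous_on {0<..} \<alpha>"
  using C1 by (metis DERIV_continuous continuous_at_imp_continuous_on greaterThan_iff)

lemma lipschitz_on_Icc:
  assumes a: "0 < a"
  shows "\<exists>L\<ge>0. \<forall>y\<in>{a..b}. \<forall>z\<in>{a..b}. \<bar>\<alpha> y - \<alpha> z\<bar> \<le> L * \<bar>y - z\<bar>"
proof -
  obtain \<alpha>' where d: "\<And>x. x > 0 \<Longrightarrow> (\<alpha> has_real_derivative \<alpha>' x) (at x)" and c: "continuous_on {0<..} \<alpha>'"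
    using C1 by blast
  have "continuous_on {a..b} \<alpha>'" by (rule continuous_on_subset[OF c]) (use a in auto)
  then have "bounded (\<alpha>' ` {a..b})" by (intro compact_imp_bounded compact_continuous_image) auto
  then obtain L where L: "\<And>x. x \<in> {a..b} \<Longrightarrow> \<bar>\<alpha>' x\<bar> \<le> L" by (fastforce simp: bounded_iff)
  have "\<bar>\<alpha> y - \<alpha> z\<bar> \<le> max 0 L * \<bar>y - z\<bar>" if "y \<in> {a..b}" "z \<in> {a..b}" for y z
  proof -
    have "norm (\<alpha> y - \<alpha> z) \<le> max 0 L * norm (y - z)"
    proof (rule field_differentiable_bound[of "{a..b}"])
      show "(\<alpha> has_field_derivative \<alpha>' u) (at u within {a..b})" if "u \<in> {a..b}" for u
        using d[of u] that a by (auto intro: has_field_derivative_at_within)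
      show "norm (\<alpha>' u) \<le> max 0 L" if "u \<in> {a..b}" for u using L[OF that] by auto
    qed (use that in auto)
    then show ?thesis by simp
  qed
  then show ?thesis by (intro exI[of _ "max 0 L"]) auto
qed

text \<open>Clamping the argument to a compact interval turns a C1 drift that may explode at 0 into
  a globally bounded Lipschitz one, to which the Picard scheme applies.\<close>

definition trunc_drift :: "nat \<Rightarrow> real \<Rightarrow> real" where
  "trunc_drift N y = \<alpha> (max (lo N) (min y (hi N)))"

lemma trunc_drift_eq: "y \<in> {lo N..hi N} \<Longrightarrow> trunc_drift N y = \<alpha> y"
  by (auto simp: trunc_drift_def max_def min_def)

lemma bdd_lip_trunc: "\<exists>A L. 0 \<le> A \<and> bdd_lip A L (trunc_drift N)"
proof -
  obtain L where L: "L \<ge> 0" "\<forall>y\<in>{lo N..hi N}. \<forall>z\<in>{lo N..hi N}. \<bar>\<alpha> y - \<alpha> z\<bar> \<le> L * \<bar>y - z\<bar>"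
    using lipschitz_on_Icc[OF lo_hi(1)] by blast
  have "continuous_on {lo N..hi N} \<alpha>" using lo_hi[of N] by (intro continuous_on_subset[OF continuous_drift]) auto
  then have "bounded (\<alpha> ` {lo N..hi N})" by (intro compact_imp_bounded compact_continuous_image) auto
  then obtain A where A: "\<And>x. x \<in> {lo N..hi N} \<Longrightarrow> \<bar>\<alpha> x\<bar> \<le> A" by (fastforce simp: bounded_iff)
  have in1: "max (lo N) (min y (hi N)) \<in> {lo N..hi N}" for y using lo_hi[of N] by auto
  have "\<bar>trunc_drift N y - trunc_drift N z\<bar> \<le> L * \<bar>y - z\<bar>" for y z
  proof -
    have "\<bar>trunc_drift N y - trunc_drift N z\<bar> \<le> L * \<bar>max (lo N) (min y (hi N)) - max (lo N) (min z (hi N))\<bar>"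
      unfolding trunc_drift_def using L(2) in1 by blast
    also have "\<dots> \<le> L * \<bar>y - z\<bar>" using L(1) by (intro mult_left_mono) (auto simp: max_def min_def)
    finally show ?thesis .
  qed
  moreover have "\<bar>trunc_drift N y\<bar> \<le> A" for y unfolding trunc_drift_def by (rule A[OF in1])
  moreover have "0 \<le> A" using A[of "lo N"] lo_hi[of N] by auto
  ultimately show ?thesis using L(1) unfolding bdd_lip_def by blast
qed

abbreviation tsol :: "nat \<Rightarrow> real \<Rightarrow> (real \<Rightarrow> real) \<Rightarrow> real \<Rightarrow> real" where
  "tsol N \<equiv> lip_sol (trunc_drift N)"

text \<open>For a continuous driving path and t >= 0 this is t < \<open>expl_time\<close>, see
  \<open>less_expl_time_iff\<close>; unlike the explosion time it visibly depends only on the path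
  up to t.\<close>

definition lives :: "real \<Rightarrow> (real \<Rightarrow> real) \<Rightarrow> real \<Rightarrow> bool" where
  "lives x b t \<longleftrightarrow> (\<exists>y. sde_sol_on \<alpha> x b t y)"

abbreviation pth :: "real \<Rightarrow> (real \<Rightarrow> real) \<Rightarrow> real \<Rightarrow> real" where
  "pth \<equiv> diff_path \<alpha>"

lemma tsol_eq:
  assumes "continuous_on {0..T} b"
  shows "continuous_on {0..T} (tsol N x b)"
    and "t \<in> {0..T} \<Longrightarrow> tsol N x b t = x + b t - integral {0..t} (\<lambda>u. trunc_drift N (tsol N x b u))"
  using bdd_lip_trunc[of N] lip_sol_eq assms by blast+

lemma sde_solD:
  assumes "sde_sol_on \<alpha> x b T y"
  shows "0 \<le> T" "continuous_on {0..T} y" "\<And>s. s \<in> {0..T} \<Longrightarrow> 0 < y s"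
    "\<And>s. s \<in> {0..T} \<Longrightarrow> y s = x + b s - integral {0..s} (\<lambda>u. \<alpha> (y u))"
  using assms unfolding sde_sol_on_def by blast+

lemma sde_solI:
  assumes "0 \<le> T" "continuous_on {0..T} y" "\<And>s. s \<in> {0..T} \<Longrightarrow> 0 < y s"
    "\<And>s. s \<in> {0..T} \<Longrightarrow> y s = x + b s - integral {0..s} (\<lambda>u. \<alpha> (y u))"
  shows "sde_sol_on \<alpha> x b T y"
  using assms unfolding sde_sol_on_def by blast

lemma sde_sol_restrict:
  "sde_sol_on \<alpha> x b T y \<Longrightarrow> 0 \<le> S \<Longrightarrow> S \<le> T \<Longrightarrow> sde_sol_on \<alpha> x b S y"
proof (rule sde_solI)
  assume y: "sde_sol_on \<alpha> x b T y" and S: "0 \<le> S" "S \<le> T"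
  show "continuous_on {0..S} y" by (rule continuous_on_subset[OF sde_solD(2)[OF y]]) (use S in auto)
  show "0 < y s" "y s = x + b s - integral {0..s} (\<lambda>u. \<alpha> (y u))" if "s \<in> {0..S}" for s
    using sde_solD(3,4)[OF y, of s] that S by auto
qed simp

lemma sde_sol_continuous_drift:
  assumes "sde_sol_on \<alpha> x b T y"
  shows "continuous_on {0..T} (\<lambda>u. \<alpha> (y u))"
proof -
  have "continuous_on (y ` {0..T}) \<alpha>" using assms
    by (intro continuous_on_subset[OF continuous_drift]) (auto dest: sde_solD(3)[OF assms])
  with assms show ?thesis using continuous_on_compose[of "{0..T}" y \<alpha>] sde_solD(2)[OF assms] by (auto simp: o_def)
qed

text \<open>The equation can be solved for \<open>b\<close>, so continuity of the driving path comes
  with any solution.\<close>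

lemma sde_sol_continuous_driver:
  assumes "sde_sol_on \<alpha> x b T y"
  shows "continuous_on {0..T} b"
proof -
  have "continuous_on {0..T} (\<lambda>s. y s - x + integral {0..s} (\<lambda>u. \<alpha> (y u)))"
    using assms by (intro continuous_intros continuous_on_indefinite_integral sde_sol_continuous_drift[OF assms])
      (rule sde_solD(2)[OF assms])
  then show ?thesis
    by (rule continuous_on_eq) (use sde_solD(4)[OF assms] in \<open>simp add: algebra_simps\<close>)
qed

lemma sde_sol_bounds:
  assumes "sde_sol_on \<alpha> x b T y"
  shows "\<exists>N0. \<forall>N\<ge>N0. \<forall>s\<in>{0..T}. y s \<in> {lo N..hi N}"
proof -
  note c = sde_solD(2,1,3)[OF assms]
  obtain s1 where s1: "s1 \<in> {0..T}" "\<And>s. s \<in> {0..T} \<Longrightarrow> y s1 \<le> y s"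
    using continuous_attains_inf[of "{0..T}" y] c by auto
  obtain s2 where s2: "s2 \<in> {0..T}" "\<And>s. s \<in> {0..T} \<Longrightarrow> y s \<le> y s2"
    using continuous_attains_sup[of "{0..T}" y] c by auto
  obtain N0 where "\<And>N. N\<ge>N0 \<Longrightarrow> lo N < y s1 \<and> y s2 < hi N" using ex_lo_hi[OF c(3)[OF s1(1)]] by blast
  then show ?thesis using s1(2) s2(2) by (intro exI[of _ N0]) (fastforce intro: less_imp_le less_le_trans le_less_trans)
qed

lemma sde_sol_tsol:
  assumes y: "sde_sol_on \<alpha> x b T y" and N: "\<And>s. s \<in> {0..T} \<Longrightarrow> y s \<in> {lo N..hi N}" and s: "s \<in> {0..T}"
  shows "tsol N x b s = y s"
proof -
  obtain A L where b: "bdd_lip A L (trunc_drift N)" using bdd_lip_trunc by blast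
  show ?thesis
  proof (rule lip_sol_unique[OF b sde_sol_continuous_driver[OF y] _ _ s])
    show "continuous_on {0..T} y" using y by (simp add: sde_sol_on_def)
    fix s assume s: "s \<in> {0..T}"
    have "integral {0..s} (\<lambda>u. trunc_drift N (y u)) = integral {0..s} (\<lambda>u. \<alpha> (y u))"
      by (rule integral_cong) (use s N in \<open>auto intro!: trunc_drift_eq\<close>)
    then show "y s = x + b s - integral {0..s} (\<lambda>u. trunc_drift N (y u))"
      using sde_solD(4)[OF y s] by simp
  qed
qed

text \<open>A solution on a compact time interval stays in some
  [\<open>lo N\<close>, \<open>hi N\<close>]; for N large enough for both, each coincides with the
  same truncated solution.\<close>

lemma sde_sol_unique:
  assumes y: "sde_sol_on \<alpha> x b T y" and z: "sde_sol_on \<alpha> x b T' z" and s: "0 \<le> s" "s \<le> T" "s \<le> T'"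
  shows "y s = z s"
proof -
  obtain N1 where N1: "\<forall>N\<ge>N1. \<forall>s\<in>{0..T}. y s \<in> {lo N..hi N}" using sde_sol_bounds[OF y] by blast
  obtain N2 where N2: "\<forall>N\<ge>N2. \<forall>s\<in>{0..T'}. z s \<in> {lo N..hi N}" using sde_sol_bounds[OF z] by blast
  have "tsol (max N1 N2) x b s = y s" by (rule sde_sol_tsol[OF y]) (use N1 s in auto)
  moreover have "tsol (max N1 N2) x b s = z s" by (rule sde_sol_tsol[OF z]) (use N2 s in auto)
  ultimately show ?thesis by simp
qed

lemma pth_eq:
  assumes y: "sde_sol_on \<alpha> x b T y" and t: "0 \<le> t" "t \<le> T"
  shows "pth x b t = y t"
  unfolding diff_path_def
proof (rule the_equality)
  show "\<exists>T y'. t \<le> T \<and> sde_sol_on \<alpha> x b T y' \<and> y' t = y t" using y t by blast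
  fix v assume "\<exists>T y'. t \<le> T \<and> sde_sol_on \<alpha> x b T y' \<and> y' t = v"
  then show "v = y t" using sde_sol_unique[OF _ y] t by blast
qed

lemma lives_pth: "lives x b t \<Longrightarrow> sde_sol_on \<alpha> x b t (pth x b)"
proof -
  assume "lives x b t"
  then obtain y where y: "sde_sol_on \<alpha> x b t y" by (auto simp: lives_def)
  have e: "pth x b s = y s" if "s \<in> {0..t}" for s using pth_eq[OF y] that by auto
  have "continuous_on {0..t} (pth x b)"
    by (rule continuous_on_eq[of _ y]) (use sde_solD(2)[OF y] e in auto)
  moreover have "integral {0..s} (\<lambda>u. \<alpha> (pth x b u)) = integral {0..s} (\<lambda>u. \<alpha> (y u))" if "s \<in> {0..t}" for s
    by (rule integral_cong) (use e that in auto)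
  ultimately show ?thesis using sde_solD[OF y] e by (intro sde_solI) auto
qed

lemma lives_mono: "lives x b t \<Longrightarrow> 0 \<le> s \<Longrightarrow> s \<le> t \<Longrightarrow> lives x b s"
  unfolding lives_def using sde_sol_restrict by blast

lemma lives_nonneg: "lives x b t \<Longrightarrow> 0 \<le> t"
  by (auto simp: lives_def sde_sol_on_def)

lemma pth_pos: "lives x b t \<Longrightarrow> 0 < pth x b t"
  using lives_pth lives_nonneg sde_solD(3) by fastforce

text \<open>After explosion \<open>diff_path\<close> is a definite description of an empty
  predicate, hence one fixed unknown real. The constant is tracked because measurability needs it
  and because \<open>killed_exp\<close> evaluates \<open>f\<close> there for nonpositive starting
  points.\<close>

lemma pth_junk: "0 \<le> t \<Longrightarrow> \<not> lives x b t \<Longrightarrow> pth x b t = (THE v. False)"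
proof -
  assume "0 \<le> t" "\<not> lives x b t"
  then have "(\<exists>T y. t \<le> T \<and> sde_sol_on \<alpha> x b T y \<and> y t = v) = False" for v
    using sde_sol_restrict unfolding lives_def by blast
  then have "(\<lambda>v. \<exists>T y. t \<le> T \<and> sde_sol_on \<alpha> x b T y \<and> y t = v) = (\<lambda>_. False)" by blast
  then show ?thesis unfolding diff_path_def by simp
qed

lemma sde_sol_cong:
  assumes "\<And>u. u \<in> {0..T} \<Longrightarrow> b u = b' u"
  shows "sde_sol_on \<alpha> x b T y \<longleftrightarrow> sde_sol_on \<alpha> x b' T y"
  unfolding sde_sol_on_def using assms by (intro conj_cong ball_cong) auto

lemma lives_cong:
  assumes "\<And>u. u \<in> {0..t} \<Longrightarrow> b u = b' u"
  shows "lives x b t \<longleftrightarrow> lives x b' t"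
  using sde_sol_cong[OF assms] by (simp add: lives_def)

lemma pth_cong:
  assumes "\<And>u. u \<in> {0..t} \<Longrightarrow> b u = b' u" and l: "lives x b t"
  shows "pth x b t = pth x b' t"
proof -
  have "sde_sol_on \<alpha> x b' t (pth x b)" using lives_pth[OF l] sde_sol_cong[of t b b'] assms(1) by blast
  then show ?thesis using pth_eq[of x b' t "pth x b" t] lives_nonneg[OF l] by simp
qed

lemma tsol_sde_sol:
  assumes b: "continuous_on {0..t} b" and t: "0 \<le> t" and N: "\<And>u. u \<in> {0..t} \<Longrightarrow> tsol N x b u \<in> {lo N..hi N}"
  shows "sde_sol_on \<alpha> x b t (tsol N x b)"
  unfolding sde_sol_on_def
proof (intro conjI ballI)
  fix s assume s: "s \<in> {0..t}"
  show "0 < tsol N x b s" using N[OF s] lo_hi(1)[of N] by auto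
  have "integral {0..s} (\<lambda>u. trunc_drift N (tsol N x b u)) = integral {0..s} (\<lambda>u. \<alpha> (tsol N x b u))"
    by (rule integral_cong) (use s N in \<open>auto intro!: trunc_drift_eq\<close>)
  then show "tsol N x b s = x + b s - integral {0..s} (\<lambda>u. \<alpha> (tsol N x b u))"
    using tsol_eq(2)[OF b s, of N x] by simp
qed (use t tsol_eq[OF b] in auto)

lemma lives_iff:
  assumes b: "continuous_on {0..t} b" and t: "0 \<le> t"
  shows "lives x b t \<longleftrightarrow> (\<exists>N. \<forall>u\<in>{0..t}. tsol N x b u \<in> {lo N..hi N})"
proof
  assume "lives x b t"
  then obtain y where y: "sde_sol_on \<alpha> x b t y" by (auto simp: lives_def)
  obtain N where N: "\<forall>s\<in>{0..t}. y s \<in> {lo N..hi N}" using sde_sol_bounds[OF y] by blast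
  then show "\<exists>N. \<forall>u\<in>{0..t}. tsol N x b u \<in> {lo N..hi N}" using sde_sol_tsol[OF y] by (metis (no_types, lifting))
next
  assume "\<exists>N. \<forall>u\<in>{0..t}. tsol N x b u \<in> {lo N..hi N}"
  then show "lives x b t" using tsol_sde_sol[OF assms] unfolding lives_def by blast
qed

lemma pth_tsol:
  assumes b: "continuous_on {0..t} b" and t: "0 \<le> t" and N: "\<And>u. u \<in> {0..t} \<Longrightarrow> tsol N x b u \<in> {lo N..hi N}"
  shows "lives x b t" "u \<in> {0..t} \<Longrightarrow> pth x b u = tsol N x b u"
  using tsol_sde_sol[OF assms] pth_eq[OF tsol_sde_sol[OF assms]] by (auto simp: lives_def)

lemma pth_lim:
  assumes "lives x b t"
  shows "(\<lambda>N. tsol N x b t) \<longlonglongrightarrow> pth x b t"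
proof -
  note y = lives_pth[OF assms]
  obtain N0 where N: "\<forall>N\<ge>N0. \<forall>s\<in>{0..t}. pth x b s \<in> {lo N..hi N}" using sde_sol_bounds[OF y] by blast
  then have "\<forall>N\<ge>N0. tsol N x b t = pth x b t" using sde_sol_tsol[OF y] lives_nonneg[OF assms] by auto
  then show ?thesis by (intro tendsto_eventually) (auto simp: eventually_sequentially)
qed

text \<open>At time t the solution lies in [\<open>lo N\<close>, \<open>hi N\<close>], hence in the
  interior of the next interval; by continuity the next truncated solution remains there a little
  longer. This makes the lifetime open on the right.\<close>

lemma lives_extend:
  assumes b: "continuous_on {0..} b" and l: "lives x b t"
  shows "\<exists>T>t. lives x b T"
proof -
  have t: "0 \<le> t" using l by (rule lives_nonneg)
  have cb: "continuous_on {0..T} b" for T by (rule continuous_on_subset[OF b]) auto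
  note y = lives_pth[OF l]
  obtain N where N: "\<forall>s\<in>{0..t}. pth x b s \<in> {lo N..hi N}" using sde_sol_bounds[OF y] by blast
  have lh: "lo (Suc N) < lo N" "hi N < hi (Suc N)" using lo_hi_mono by auto
  have eq: "tsol (Suc N) x b s = pth x b s" if "s \<in> {0..t}" for s
    by (rule sde_sol_tsol[OF y _ that]) (use N lh in force)
  have "tsol (Suc N) x b t \<in> {lo (Suc N)<..<hi (Suc N)}" using eq[of t] N lh t by force
  moreover have "continuous_on {0..t+1} (tsol (Suc N) x b)" using tsol_eq(1)[OF cb] .
  then have "((tsol (Suc N) x b) \<longlongrightarrow> tsol (Suc N) x b t) (at t within {0..t+1})"
    using t by (auto simp: continuous_on_def)
  ultimately have "\<forall>\<^sub>F u in at t within {0..t+1}. tsol (Suc N) x b u \<in> {lo (Suc N)<..<hi (Suc N)}"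
    by (intro topological_tendstoD) auto
  then obtain d where d: "d > 0" "\<And>u. u \<in> {0..t+1} \<Longrightarrow> u \<noteq> t \<Longrightarrow> dist u t < d \<Longrightarrow> tsol (Suc N) x b u \<in> {lo (Suc N)<..<hi (Suc N)}"
    by (auto simp: eventually_at)
  define T where "T = t + min (d/2) 1"
  have T: "T > t" "T \<le> t+1" using d(1) by (auto simp: T_def)
  have "tsol (Suc N) x b u \<in> {lo (Suc N)..hi (Suc N)}" if u: "u \<in> {0..T}" for u
  proof (cases "u \<le> t")
    case True
    then show ?thesis using eq[of u] N lh u by force
  next
    case False
    then have "tsol (Suc N) x b u \<in> {lo (Suc N)<..<hi (Suc N)}" using u T d(1) by (intro d(2)) (auto simp: dist_real_def T_def)
    then show ?thesis by auto
  qed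
  then show ?thesis using pth_tsol(1)[OF cb, of T] T t by (intro exI[of _ T]) auto
qed

lemma less_expl_time_iff:
  assumes b: "continuous_on {0..} b" and t: "0 \<le> t"
  shows "ereal t < expl_time \<alpha> x b \<longleftrightarrow> lives x b t"
proof
  assume "ereal t < expl_time \<alpha> x b"
  then obtain T where "t < T" "lives x b T" unfolding expl_time_def less_Sup_iff lives_def by fastforce
  then show "lives x b t" using lives_mono t by auto
next
  assume "lives x b t"
  then obtain T where T: "T > t" "lives x b T" using lives_extend[OF b] by blast
  then have "ereal T \<le> expl_time \<alpha> x b" unfolding expl_time_def lives_def by (auto intro!: Sup_upper)
  then show "ereal t < expl_time \<alpha> x b" using T(1) by (metis ereal_less(2) less_ereal.simps(1) order_less_le_trans)
qed

section \<open>Flow property: shifting and pasting solutions\<close>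

lemma sde_sol_shift:
  assumes y: "sde_sol_on \<alpha> x b (s+t) y" and st: "0 \<le> s" "0 \<le> t"
  shows "sde_sol_on \<alpha> (y s) (\<lambda>u. b (s+u) - b s) t (\<lambda>u. y (s+u))"
  unfolding sde_sol_on_def
proof (intro conjI ballI)
  have cy: "continuous_on {0..s+t} y" using y by (simp add: sde_sol_on_def)
  show "continuous_on {0..t} (\<lambda>u. y (s+u))"
    by (rule continuous_on_compose2[OF cy]) (use st in \<open>auto intro!: continuous_intros\<close>)
  fix u assume u: "u \<in> {0..t}"
  show "0 < y (s+u)" using sde_solD(3)[OF y, of "s+u"] u st by simp
  have ca: "continuous_on {0..s+u} (\<lambda>v. \<alpha> (y v))"
    by (rule continuous_on_subset[OF sde_sol_continuous_drift[OF y]]) (use u in auto)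
  have "integral {0..u} ((\<lambda>v. \<alpha> (y v)) \<circ> (\<lambda>v. v + s)) = integral {0+s..u+s} (\<lambda>v. \<alpha> (y v))"
    by (rule integral_shift) (use u st in \<open>auto intro!: continuous_on_subset[OF ca]\<close>)
  then have 1: "integral {0..u} (\<lambda>v. \<alpha> (y (s + v))) = integral {s..s+u} (\<lambda>v. \<alpha> (y v))" by (simp add: o_def add.commute)
  have 2: "integral {0..s} (\<lambda>v. \<alpha> (y v)) + integral {s..s+u} (\<lambda>v. \<alpha> (y v)) = integral {0..s+u} (\<lambda>v. \<alpha> (y v))"
    by (rule Henstock_Kurzweil_Integration.integral_combine) (use u st integrable_continuous_real[OF ca] in auto)
  have "y (s+u) = x + b (s+u) - integral {0..s+u} (\<lambda>v. \<alpha> (y v))" "y s = x + b s - integral {0..s} (\<lambda>v. \<alpha> (y v))"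
    using sde_solD(4)[OF y, of "s+u"] sde_solD(4)[OF y, of s] u st by auto
  then show "y (s+u) = y s + (b (s+u) - b s) - integral {0..u} (\<lambda>v. \<alpha> (y (s + v)))"
    using 1 2 by simp
qed (use st in auto)

lemma sde_sol_glue:
  assumes y: "sde_sol_on \<alpha> x b s y" and z: "sde_sol_on \<alpha> (y s) (\<lambda>u. b (s+u) - b s) t z"

  shows "sde_sol_on \<alpha> x b (s+t) (\<lambda>u. if u \<le> s then y u else z (u - s))" (is "sde_sol_on _ _ _ _ ?q")
  unfolding sde_sol_on_def
proof (intro conjI ballI)
  have st: "0 \<le> s" "0 \<le> t" using sde_solD(1)[OF y] sde_solD(1)[OF z] by auto
  then show "0 \<le> s + t" by simp
  have z0: "z 0 = y s" using sde_solD(4)[OF z, of 0] st by simp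
  have cy: "continuous_on {0..s} y" "continuous_on {0..t} z" using sde_solD(2)[OF y] sde_solD(2)[OF z] by auto
  have "continuous_on ({0..s} \<union> {s..s+t}) ?q"
  proof (rule continuous_on_If)
    show "continuous_on {s..s+t} (\<lambda>u. z (u - s))"
      by (rule continuous_on_compose2[OF cy(2)]) (auto intro!: continuous_intros)
  qed (use cy z0 in auto)
  then show cq: "continuous_on {0..s+t} ?q" using st by (simp add: ivl_disj_un_two_touch)
  fix u assume u: "u \<in> {0..s+t}"
  show "0 < ?q u" using sde_solD(3)[OF y, of u] sde_solD(3)[OF z, of "u-s"] u by auto
  have yeq: "integral {0..v} (\<lambda>v. \<alpha> (?q v)) = integral {0..v} (\<lambda>v. \<alpha> (y v))" if "v \<in> {0..s}" for v
    by (rule integral_cong) (use that in auto)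
  show "?q u = x + b u - integral {0..u} (\<lambda>v. \<alpha> (?q v))"
  proof (cases "u \<le> s")
    case True
    then show ?thesis using sde_solD(4)[OF y, of u] u yeq[of u] by auto
  next
    case False
    have pos: "\<forall>v\<in>{0..s+t}. 0 < ?q v" using sde_solD(3)[OF y] sde_solD(3)[OF z] by auto
    have "continuous_on (?q ` {0..s+t}) \<alpha>"
      by (intro continuous_on_subset[OF continuous_drift]) (use pos in auto)
    then have cq2: "continuous_on {0..s+t} (\<lambda>v. \<alpha> (?q v))"
      using continuous_on_compose[OF cq] by (simp add: o_def)
    have i: "(\<lambda>v. \<alpha> (?q v)) integrable_on {0..u}"
      by (rule integrable_continuous_real, rule continuous_on_subset[OF cq2]) (use u in auto)
    have 2: "integral {0..s} (\<lambda>v. \<alpha> (?q v)) + integral {s..u} (\<lambda>v. \<alpha> (?q v)) = integral {0..u} (\<lambda>v. \<alpha> (?q v))"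
      by (rule Henstock_Kurzweil_Integration.integral_combine) (use False st i in auto)
    have "integral {0..u-s} ((\<lambda>v. \<alpha> (?q v)) \<circ> (\<lambda>v. v + s)) = integral {0+s..(u-s)+s} (\<lambda>v. \<alpha> (?q v))"
      by (rule integral_shift) (use u st False in \<open>auto intro!: continuous_on_subset[OF cq2]\<close>)
    moreover have "integral {0..u-s} ((\<lambda>v. \<alpha> (?q v)) \<circ> (\<lambda>v. v + s)) = integral {0..u-s} (\<lambda>v. \<alpha> (z v))"
      by (rule integral_cong) (use z0 in auto)
    ultimately have 1: "integral {s..u} (\<lambda>v. \<alpha> (?q v)) = integral {0..u-s} (\<lambda>v. \<alpha> (z v))" by simp
    have "u - s \<in> {0..t}" using False u by auto
    then have "z (u-s) = y s + (b (s + (u-s)) - b s) - integral {0..u-s} (\<lambda>v. \<alpha> (z v))"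
      using z unfolding sde_sol_on_def by blast
    moreover have "y s = x + b s - integral {0..s} (\<lambda>v. \<alpha> (y v))" using sde_solD(4)[OF y, of s] st by simp
    ultimately show ?thesis using 1 2 yeq[of s] False st by simp
  qed
qed

text \<open>Deterministic core of the Markov property: restart from the current position, driven by
  the increments of the path after time \<open>s\<close>.\<close>

lemma lives_flow:
  assumes st: "0 \<le> s" "0 \<le> t"
  shows "lives x b (s+t) \<longleftrightarrow> lives x b s \<and> lives (pth x b s) (\<lambda>u. b (s+u) - b s) t" (is "?l \<longleftrightarrow> ?r")
    and "lives x b (s+t) \<Longrightarrow> pth x b (s+t) = pth (pth x b s) (\<lambda>u. b (s+u) - b s) t"
proof -
  show "?l \<longleftrightarrow> ?r"
  proof
    assume l: ?l
    show ?r using lives_mono[OF l] sde_sol_shift[OF lives_pth[OF l] st] st by (auto simp: lives_def)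
  next
    assume ?r then show ?l using sde_sol_glue[of x b s "pth x b" t] lives_pth by (fastforce simp: lives_def)
  qed
  assume l: ?l
  show "pth x b (s+t) = pth (pth x b s) (\<lambda>u. b (s+u) - b s) t"
    using pth_eq[OF sde_sol_shift[OF lives_pth[OF l] st], of t] st by simp
qed

end

section \<open>Measurable dependence on the driving path\<close>

lemma pred_Ball_countable:
  assumes "countable X" "\<And>i. i \<in> X \<Longrightarrow> Measurable.pred M (\<lambda>x. P x i)"
  shows "Measurable.pred M (\<lambda>x. \<forall>i\<in>X. P x i)"
  using assms unfolding pred_def by (intro sets.sets_Collect_countable_All') auto

lemma riemann_lim_measurable:
  assumes "\<And>u. u \<in> {0..t} \<Longrightarrow> (\<lambda>z. g z u) \<in> borel_measurable N" "0 \<le> t"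
  shows "(\<lambda>z. riemann_lim (g z) t) \<in> borel_measurable N"
  unfolding riemann_lim_def
proof (intro borel_measurable_lim_metric borel_measurable_sum borel_measurable_times borel_measurable_const)
  fix n j assume j: "j \<in> {..<Suc n}"
  have "t * real j \<le> t * real (Suc n)" using j assms(2) by (intro mult_left_mono) auto
  then have "t * real j / real (Suc n) \<in> {0..t}" using assms(2) by (simp add: field_simps)
  then show "(\<lambda>z. g z (t * real j / real (Suc n))) \<in> borel_measurable N" by (rule assms(1))
qed

lemma picard_measurable:
  assumes b: "\<beta> \<in> borel_measurable borel" and X: "X \<in> borel_measurable N"
    and W: "\<And>u. u \<in> {0..T} \<Longrightarrow> (\<lambda>z. W z u) \<in> borel_measurable N" and t: "t \<in> {0..T}"
  shows "(\<lambda>z. picard \<beta> (X z) (W z) k t) \<in> borel_measurable N"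
  using t
proof (induction k arbitrary: t)
  case 0
  then show ?case using X W by simp
next
  case (Suc k)
  have "(\<lambda>z. riemann_lim (\<lambda>u. \<beta> (picard \<beta> (X z) (W z) k u)) t) \<in> borel_measurable N"
    using Suc by (intro riemann_lim_measurable measurable_compose[OF _ b]) auto
  then show ?case using X W[OF Suc.prems] by simp
qed

lemma lip_sol_measurable:
  assumes "\<beta> \<in> borel_measurable borel" "X \<in> borel_measurable N"
    "\<And>u. u \<in> {0..T} \<Longrightarrow> (\<lambda>z. W z u) \<in> borel_measurable N" "t \<in> {0..T}"
  shows "(\<lambda>z. lip_sol \<beta> (X z) (W z) t) \<in> borel_measurable N"
  unfolding lip_sol_def by (intro borel_measurable_lim_metric picard_measurable[OF assms])

text \<open>Points t q with rational q are dense in [0,u] when u > 0, and membership in a closed set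
  passes to limits along a continuous path. The horizon u is kept apart from t because a path may
  live only up to u while test times are scaled by t.\<close>

lemma closed_from_scaled_rationals:
  fixes f :: "real \<Rightarrow> real"
  assumes c: "continuous_on {0..u} f" and u: "0 \<le> u" "u \<le> t" and C: "closed C"
    and q: "\<And>q. q \<in> \<rat> \<inter> {0..1} \<Longrightarrow> t * q \<le> u \<Longrightarrow> f (t * q) \<in> C" and v: "v \<in> {0..u}"
  shows "f v \<in> C"
proof (cases "u = 0")
  case True
  then show ?thesis using q[of 0] v by simp
next
  case False
  then have u0: "0 < u" "0 < t" using u by auto
  show ?thesis
  proof (rule ccontr)
    assume n: "f v \<notin> C"
    have "(f \<longlongrightarrow> f v) (at v within {0..u})" using c v by (simp add: continuous_on_def)
    then have "\<forall>\<^sub>F z in at v within {0..u}. f z \<in> - C" using n C by (intro topological_tendstoD) auto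
    then obtain d where d: "d > 0" "\<And>z. z \<in> {0..u} \<Longrightarrow> z \<noteq> v \<Longrightarrow> dist z v < d \<Longrightarrow> f z \<in> - C"
      by (auto simp: eventually_at)
    define l where "l = max 0 (v - d)"
    define r where "r = min u (v + d)"
    have lr: "l < r" using v d(1) u0 by (auto simp: l_def r_def)
    then have "l / t < r / t" using u0 by (simp add: divide_strict_right_mono)
    then obtain q where qq: "q \<in> \<rat>" "l / t < q" "q < r / t" using Rats_dense_in_real by blast
    have z: "l < t * q" "t * q < r" using qq u0 by (auto simp: field_simps)
    have q01: "0 \<le> q" "q \<le> 1"
    proof -
      have "0 \<le> l / t" using u0 by (auto simp: l_def)
      then show "0 \<le> q" using qq by linarith
      have "r \<le> t" using u by (auto simp: r_def)
      then have "r / t \<le> 1" using u0 by simp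
      then show "q \<le> 1" using qq by linarith
    qed
    have "f (t * q) \<in> C" by (rule q) (use qq q01 z in \<open>auto simp: r_def\<close>)
    moreover have "f (t * q) \<in> - C"
    proof (cases "t * q = v")
      case False
      show ?thesis by (rule d(2)) (use z False in \<open>auto simp: l_def r_def dist_real_def\<close>)
    qed (use n in auto)
    ultimately show False by simp
  qed
qed

context drift
begin

lemma trunc_drift_measurable[measurable]: "trunc_drift N \<in> borel_measurable borel"
  using bdd_lip_trunc[of N] bdd_lip_continuous borel_measurable_continuous_onI by blast

text \<open>Versions of survival and position that make sense, and are measurable, on all of the product
  path space, whose \<sigma>-algebra does not contain the set of continuous paths.\<close>

definition livesq :: "real \<Rightarrow> (real \<Rightarrow> real) \<Rightarrow> real \<Rightarrow> bool" where
  "livesq x w t \<longleftrightarrow> (\<exists>N. \<forall>q\<in>\<rat> \<inter> {0..1}. tsol N x w (t * q) \<in> {lo N..hi N})"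

definition posq :: "real \<Rightarrow> (real \<Rightarrow> real) \<Rightarrow> real \<Rightarrow> real" where
  "posq x w t = lim (\<lambda>N. tsol N x w t)"

lemma scaled_in_Icc: "0 \<le> t \<Longrightarrow> q \<in> \<rat> \<inter> {0..1} \<Longrightarrow> t * q \<in> {0..t::real}"
  by (auto simp: mult_left_le)

lemma livesq_measurable:
  assumes X: "X \<in> borel_measurable N" and W: "\<And>u. u \<in> {0..t} \<Longrightarrow> (\<lambda>z. W z u) \<in> borel_measurable N" and t: "0 \<le> t"
  shows "Measurable.pred N (\<lambda>z. livesq (X z) (W z) t)"
proof -
  have [measurable]: "(\<lambda>z. tsol n (X z) (W z) (t * q)) \<in> borel_measurable N" if "q \<in> \<rat> \<inter> {0..1}" for q n
    by (rule lip_sol_measurable[OF _ X W]) (use scaled_in_Icc[OF t that] in auto)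
  have c: "countable (\<rat> \<inter> {0..1::real})" by (intro countable_Int1 countable_rat)
  show ?thesis unfolding livesq_def
    by (intro pred_intros_countable(2) pred_Ball_countable c pred_sets2[of "{lo _..hi _}" borel]) auto
qed

lemma posq_measurable:
  assumes "X \<in> borel_measurable N" "\<And>u. u \<in> {0..t} \<Longrightarrow> (\<lambda>z. W z u) \<in> borel_measurable N" "0 \<le> t"
  shows "(\<lambda>z. posq (X z) (W z) t) \<in> borel_measurable N"
  unfolding posq_def
  by (intro borel_measurable_lim_metric lip_sol_measurable[OF _ assms(1,2)]) (use assms(3) in auto)

lemma livesq_iff:
  assumes b: "continuous_on {0..t} b" and t: "0 \<le> t"
  shows "livesq x b t \<longleftrightarrow> lives x b t"
proof -
  have "(\<forall>q\<in>\<rat> \<inter> {0..1}. tsol N x b (t * q) \<in> {lo N..hi N}) \<longleftrightarrow> (\<forall>u\<in>{0..t}. tsol N x b u \<in> {lo N..hi N})" for N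
  proof
    assume *: "\<forall>q\<in>\<rat> \<inter> {0..1}. tsol N x b (t * q) \<in> {lo N..hi N}"
    show "\<forall>u\<in>{0..t}. tsol N x b u \<in> {lo N..hi N}"
    proof
      fix u assume u: "u \<in> {0..t}"
      show "tsol N x b u \<in> {lo N..hi N}"
        by (rule closed_from_scaled_rationals[OF tsol_eq(1)[OF b] t order_refl closed_atLeastAtMost _ u]) (use * in blast)
    qed
  qed (use scaled_in_Icc[OF t] in blast)
  then show ?thesis unfolding livesq_def lives_iff[OF assms] by simp
qed

lemma posq_eq: "lives x b t \<Longrightarrow> posq x b t = pth x b t"
  unfolding posq_def by (rule limI[OF pth_lim])

lemma lives_measurable:
  assumes X: "X \<in> borel_measurable N" and W: "\<And>u. u \<in> {0..t} \<Longrightarrow> (\<lambda>z. W z u) \<in> borel_measurable N" and t: "0 \<le> t"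
    and c: "\<And>z. z \<in> space N \<Longrightarrow> continuous_on {0..t} (W z)"
  shows "Measurable.pred N (\<lambda>z. lives (X z) (W z) t)"
proof -
  have "Measurable.pred N (\<lambda>z. livesq (X z) (W z) t)" by (rule livesq_measurable[OF X _ t]) (rule W)
  then show ?thesis by (rule measurable_cong[THEN iffD1, rotated]) (rule livesq_iff[OF c t])
qed

text \<open>\<open>posq\<close> is measurable everywhere but agrees with the path only while it
  lives; past the lifetime the path is the constant of \<open>pth_junk\<close>.\<close>

lemma pth_measurable:
  assumes X: "X \<in> borel_measurable N" and W: "\<And>u. u \<in> {0..t} \<Longrightarrow> (\<lambda>z. W z u) \<in> borel_measurable N" and t: "0 \<le> t"
    and c: "\<And>z. z \<in> space N \<Longrightarrow> continuous_on {0..t} (W z)"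
  shows "(\<lambda>z. pth (X z) (W z) t) \<in> borel_measurable N"
proof -
  have [measurable]: "Measurable.pred N (\<lambda>z. lives (X z) (W z) t)" by (rule lives_measurable[OF X _ t c]) (rule W)
  have [measurable]: "(\<lambda>z. posq (X z) (W z) t) \<in> borel_measurable N" by (rule posq_measurable[OF X _ t]) (rule W)
  have "(\<lambda>z. if lives (X z) (W z) t then posq (X z) (W z) t else (THE v. False)) \<in> borel_measurable N" by measurable
  then show ?thesis by (rule measurable_cong[THEN iffD1, rotated]) (use pth_junk[OF t] posq_eq in auto)
qed

section \<open>Initial values and hitting times\<close>

lemma pth_0: "lives x b 0 \<Longrightarrow> b 0 = 0 \<Longrightarrow> pth x b 0 = x"
  using sde_solD(4)[OF lives_pth, of x b 0 0] by simp

lemma lives_0: "0 < x \<Longrightarrow> b 0 = 0 \<Longrightarrow> lives x b 0"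
  unfolding lives_def by (intro exI[of _ "\<lambda>_. x"] sde_solI) auto

lemma not_lives: "x \<le> 0 \<Longrightarrow> b 0 = 0 \<Longrightarrow> \<not> lives x b t"
  using sde_solD(3,4)[OF lives_pth, of x b t 0] lives_nonneg[of x b t] by fastforce

text \<open>Until level \<open>a\<close> is hit the path stays above it by the intermediate value
  theorem; conversely, being strictly above up to time t persists slightly beyond t, so the infimum
  exceeds t. If the path has exploded by time t without reaching \<open>a\<close>, the set of
  hitting times is empty and its infimum is infinite.\<close>

lemma less_hit_time_iff:
  assumes b: "continuous_on {0..} b" "b 0 = 0" and a: "a < x" "0 < x" and t: "0 \<le> t"
  shows "ereal t < hit_time \<alpha> x b a \<longleftrightarrow> (\<forall>u\<in>{0..t}. lives x b u \<longrightarrow> a < pth x b u)"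
proof
  assume l: "ereal t < hit_time \<alpha> x b a"
  show "\<forall>u\<in>{0..t}. lives x b u \<longrightarrow> a < pth x b u"
  proof (intro ballI impI, rule ccontr)
    fix u assume u: "u \<in> {0..t}" "lives x b u" "\<not> a < pth x b u"
    have c: "continuous_on {0..u} (pth x b)" using sde_solD(2)[OF lives_pth[OF u(2)]] .
    have "\<exists>v\<ge>0. v \<le> u \<and> pth x b v = a"
      by (rule IVT2'[of "pth x b" u a 0]) (use u c a pth_0[of x b] lives_0[of x b] b in auto)
    then obtain v where v: "0 \<le> v" "v \<le> u" "pth x b v = a" by blast
    have "hit_time \<alpha> x b a \<le> ereal v"
      unfolding hit_time_def using v less_expl_time_iff[OF b(1) v(1)] lives_mono[OF u(2) v(1,2)]
      by (intro Inf_lower) auto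
    also have "\<dots> \<le> ereal t" using v u by auto
    finally show False using l by simp
  qed
next
  assume r: "\<forall>u\<in>{0..t}. lives x b u \<longrightarrow> a < pth x b u"
  show "ereal t < hit_time \<alpha> x b a"
  proof (cases "lives x b t")
    case False
    have "{ereal u | u. 0 \<le> u \<and> ereal u < expl_time \<alpha> x b \<and> pth x b u = a} = {}"
    proof -
      have False if "0 \<le> u" "ereal u < expl_time \<alpha> x b" "pth x b u = a" for u
        using that less_expl_time_iff[OF b(1) that(1)] r False lives_mono[of x b u t] t
        by (metis atLeastAtMost_iff less_irrefl nle_le)
      then show ?thesis by blast
    qed
    then show ?thesis unfolding hit_time_def by (simp only: Inf_empty top_ereal_def) simp
  next
    case True
    then obtain T where T: "t < T" "lives x b T" using lives_extend[OF b(1)] by blast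
    have c: "continuous_on {0..T} (pth x b)" using sde_solD(2)[OF lives_pth[OF T(2)]] .
    have "(pth x b \<longlongrightarrow> pth x b t) (at t within {0..T})" using c t T by (simp add: continuous_on_def)
    then have "\<forall>\<^sub>F z in at t within {0..T}. a < pth x b z" using r t True by (intro order_tendstoD(1)) auto
    then obtain d where d: "d > 0" "\<And>z. z \<in> {0..T} \<Longrightarrow> z \<noteq> t \<Longrightarrow> dist z t < d \<Longrightarrow> a < pth x b z"
      by (auto simp: eventually_at)
    define e where "e = min d (T - t)"
    have e: "e > 0" using d T by (auto simp: e_def)
    have "ereal (t + e) \<le> hit_time \<alpha> x b a"
      unfolding hit_time_def
    proof (rule Inf_greatest)
      fix z assume "z \<in> {ereal u | u. 0 \<le> u \<and> ereal u < expl_time \<alpha> x b \<and> pth x b u = a}"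
      then obtain u where u: "z = ereal u" "0 \<le> u" "lives x b u" "pth x b u = a"
        using less_expl_time_iff[OF b(1)] by auto
      have "t + e \<le> u"
      proof (rule ccontr)
        assume n: "\<not> t + e \<le> u"
        show False
        proof (cases "u \<le> t")
          case True then show False using r u by auto
        next
          case False
          then have "a < pth x b u" using n by (intro d(2)) (auto simp: e_def dist_real_def u)
          then show False using u by simp
        qed
      qed
      then show "ereal (t + e) \<le> z" using u by simp
    qed
    moreover have "ereal t < ereal (t + e)" using e by simp
    ultimately show ?thesis by (rule less_le_trans[rotated])
  qed
qed

lemma hit_time_nonneg: "0 \<le> hit_time \<alpha> x b a"
  unfolding hit_time_def by (rule Inf_greatest) auto

lemma hit_time_antimono:
  assumes b: "continuous_on {0..} b" "b 0 = 0" and a: "a' \<le> a" "a < x" "0 < x"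
  shows "hit_time \<alpha> x b a \<le> hit_time \<alpha> x b a'"
proof (rule ccontr)
  assume "\<not> ?thesis"
  then obtain t where t: "hit_time \<alpha> x b a' < ereal t" "ereal t < hit_time \<alpha> x b a"
    using ereal_dense2[of "hit_time \<alpha> x b a'" "hit_time \<alpha> x b a"] by (auto simp: not_le)
  have "0 \<le> t" using t(1) hit_time_nonneg[of x b a'] by (metis ereal_less_eq(5) less_imp_le order_trans)
  then have "ereal t < hit_time \<alpha> x b a'"
    using t(2) a less_hit_time_iff[OF b, of a x t] less_hit_time_iff[OF b, of a' x t] by fastforce
  then show False using t(1) by simp
qed

text \<open>The hitting times of 1/(n+1) are monotone once 1/(n+1) < x, which holds from some
  \<open>n0\<close> on. So the limit in \<open>T_zero\<close> is a supremum, and a strict inequality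
  becomes an existential over levels.\<close>

lemma less_T_zero_iff:
  assumes b: "continuous_on {0..} b" "b 0 = 0" and x: "0 < x" and t: "0 \<le> t"
  shows "ereal t < T_zero \<alpha> x b \<longleftrightarrow> (\<exists>n. \<forall>u\<in>{0..t}. lives x b u \<longrightarrow> 1 / real (Suc n) < pth x b u)"
proof -
  define h where "h n = hit_time \<alpha> x b (1 / real (Suc n))" for n
  obtain n0 where n0: "1 / real (Suc n0) < x" using nat_approx_posE[OF x] by blast
  have less: "1 / real (Suc (n + n0)) < x" for n
  proof -
    have "1 / real (Suc (n + n0)) \<le> 1 / real (Suc n0)" by (intro divide_left_mono) auto
    then show ?thesis using n0 by linarith
  qed
  have "incseq (\<lambda>n. h (n + n0))"
  proof (rule incseq_SucI)
    fix n
    show "h (n + n0) \<le> h (Suc n + n0)" unfolding h_def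
      by (rule hit_time_antimono[OF b _ less x]) (intro divide_left_mono, auto)
  qed
  then have "(\<lambda>n. h (n + n0)) \<longlonglongrightarrow> (SUP n. h (n + n0))" by (rule LIMSEQ_SUP)
  then have "h \<longlonglongrightarrow> (SUP n. h (n + n0))" by (rule LIMSEQ_offset)
  then have T: "T_zero \<alpha> x b = (SUP n. h (n + n0))" unfolding T_zero_def h_def by (rule limI)
  have iff: "ereal t < h (n + n0) \<longleftrightarrow> (\<forall>u\<in>{0..t}. lives x b u \<longrightarrow> 1 / real (Suc (n + n0)) < pth x b u)" for n
    unfolding h_def by (rule less_hit_time_iff[OF b less x t])
  have "ereal t < T_zero \<alpha> x b \<longleftrightarrow> (\<exists>n. \<forall>u\<in>{0..t}. lives x b u \<longrightarrow> 1 / real (Suc (n + n0)) < pth x b u)"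
    unfolding T less_SUP_iff iff by simp
  also have "\<dots> \<longleftrightarrow> (\<exists>n. \<forall>u\<in>{0..t}. lives x b u \<longrightarrow> 1 / real (Suc n) < pth x b u)"
  proof
    assume "\<exists>n. \<forall>u\<in>{0..t}. lives x b u \<longrightarrow> 1 / real (Suc n) < pth x b u"
    then obtain n where n: "\<forall>u\<in>{0..t}. lives x b u \<longrightarrow> 1 / real (Suc n) < pth x b u" by blast
    have "1 / real (Suc (n + n0)) \<le> 1 / real (Suc n)" by (intro divide_left_mono) auto
    then show "\<exists>n. \<forall>u\<in>{0..t}. lives x b u \<longrightarrow> 1 / real (Suc (n + n0)) < pth x b u"
      using n by (intro exI[of _ n]) force
  qed blast
  finally show ?thesis .
qed

lemma less_T_zero_iff_rat:
  assumes b: "continuous_on {0..} b" "b 0 = 0" and x: "0 < x" and t: "0 \<le> t"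
  shows "ereal t < T_zero \<alpha> x b \<longleftrightarrow> (\<exists>n. \<forall>q\<in>\<rat> \<inter> {0..1}. lives x b (t * q) \<longrightarrow> 1 / real (Suc n) < pth x b (t * q))"
  unfolding less_T_zero_iff[OF assms]
proof
  assume "\<exists>n. \<forall>q\<in>\<rat> \<inter> {0..1}. lives x b (t * q) \<longrightarrow> 1 / real (Suc n) < pth x b (t * q)"
  then obtain n where n: "\<forall>q\<in>\<rat> \<inter> {0..1}. lives x b (t * q) \<longrightarrow> 1 / real (Suc n) < pth x b (t * q)" by blast
  \<comment> \<open>Passing from rational to all times keeps only the weak inequality; lowering the
    level by one index restores strictness.\<close>
  have "1 / real (Suc (Suc n)) < pth x b u" if u: "u \<in> {0..t}" "lives x b u" for u
  proof -
    have c: "continuous_on {0..u} (pth x b)" using sde_solD(2)[OF lives_pth[OF u(2)]] .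
    have "pth x b u \<in> {1 / real (Suc n)..}"
    proof (rule closed_from_scaled_rationals[OF c _ _ closed_atLeast])
      fix q :: real assume q: "q \<in> \<rat> \<inter> {0..1}" "t * q \<le> u"
      have "lives x b (t * q)" using lives_mono[OF u(2) _ q(2)] q t by auto
      then show "pth x b (t * q) \<in> {1 / real (Suc n)..}" using n q(1) by force
    qed (use u in auto)
    moreover have "1 / real (Suc (Suc n)) < 1 / real (Suc n)" by (intro divide_strict_left_mono) auto
    ultimately show ?thesis by auto
  qed
  then show "\<exists>n. \<forall>u\<in>{0..t}. lives x b u \<longrightarrow> 1 / real (Suc n) < pth x b u" by blast
qed (use scaled_in_Icc[OF t] in blast)

lemma T_zero_measurable:
  assumes W: "\<And>u. 0 \<le> u \<Longrightarrow> (\<lambda>z. W z u) \<in> borel_measurable N" and t: "0 \<le> t" and x: "0 < x"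
    and c: "\<And>z. z \<in> space N \<Longrightarrow> continuous_on {0..} (W z)" "\<And>z. z \<in> space N \<Longrightarrow> W z 0 = 0"
  shows "Measurable.pred N (\<lambda>z. ereal t < T_zero \<alpha> x (W z))"
proof -
  have cc: "continuous_on {0..u} (W z)" if "z \<in> space N" for u z
    by (rule continuous_on_subset[OF c(1)[OF that]]) auto
  have q: "countable (\<rat> \<inter> {0..1::real})" by (intro countable_Int1 countable_rat)
  have "Measurable.pred N (\<lambda>z. \<exists>n. \<forall>q\<in>\<rat> \<inter> {0..1}. lives x (W z) (t * q) \<longrightarrow> 1 / real (Suc n) < pth x (W z) (t * q))"
  proof (intro pred_intros_countable(2) pred_Ball_countable[OF q])
    fix n and q :: real assume q: "q \<in> \<rat> \<inter> {0..1}"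
    have tq: "0 \<le> t * q" using q t by auto
    have [measurable]: "Measurable.pred N (\<lambda>z. lives x (W z) (t * q))"
      by (rule lives_measurable) (use W cc tq in auto)
    have [measurable]: "(\<lambda>z. pth x (W z) (t * q)) \<in> borel_measurable N"
      by (rule pth_measurable) (use W cc tq in auto)
    show "Measurable.pred N (\<lambda>z. lives x (W z) (t * q) \<longrightarrow> 1 / real (Suc n) < pth x (W z) (t * q))" by measurable
  qed
  then show ?thesis
    by (rule measurable_cong[THEN iffD1, rotated]) (use less_T_zero_iff_rat[OF c x t] in auto)
qed

text \<open>No solution starts at x <= 0, so every set of hitting times is empty. This covers the
  starting points that \<open>\<nu>\<close> does not charge but where \<open>killed_exp\<close>
  still has a value.\<close>

lemma T_zero_nonpos:
  assumes b: "continuous_on {0..} b" "b 0 = 0" and x: "x \<le> 0"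
  shows "T_zero \<alpha> x b = \<infinity>"
proof -
  have "hit_time \<alpha> x b a = \<infinity>" for a
  proof -
    have "{ereal u | u. 0 \<le> u \<and> ereal u < expl_time \<alpha> x b \<and> pth x b u = a} = {}"
      using less_expl_time_iff[OF b(1)] not_lives[of x b] x b(2) by blast
    then show ?thesis unfolding hit_time_def by (simp only: Inf_empty top_ereal_def)
  qed
  then show ?thesis unfolding T_zero_def by (simp add: limI)
qed

end

section \<open>Laws of Brownian paths\<close>

definition centred_normal :: "real \<Rightarrow> real measure" where
  "centred_normal v = density lborel (normal_density 0 (sqrt v))"

lemma centred_normal_prob: "0 < v \<Longrightarrow> prob_space (centred_normal v)"
  unfolding centred_normal_def by (rule prob_space_normal_density) simp

lemma sets_centred_normal[measurable_cong, simp]: "sets (centred_normal v) = sets borel"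
  by (simp add: centred_normal_def)

lemma space_centred_normal[simp]: "space (centred_normal v) = UNIV"
  by (simp add: centred_normal_def)

definition path_space :: "real \<Rightarrow> (real \<Rightarrow> real) measure" where
  "path_space T = (\<Pi>\<^sub>M u\<in>{0..T}. borel)"

definition path_of :: "real \<Rightarrow> (real \<Rightarrow> 'w \<Rightarrow> real) \<Rightarrow> 'w \<Rightarrow> real \<Rightarrow> real" where
  "path_of T B \<omega> = (\<lambda>u\<in>{0..T}. B u \<omega>)"

lemma path_of_measurable:
  "(\<And>u. u \<in> {0..T} \<Longrightarrow> B u \<in> borel_measurable M) \<Longrightarrow> path_of T B \<in> measurable M (path_space T)"
  unfolding path_of_def[abs_def] path_space_def by (rule measurable_restrict)

text \<open>Independent centred Gaussian increments, tested only along grids that contain the fixed time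
  \<^term>\<open>s\<close>: this is all that can be checked directly for a path pasted together at time \<^term>\<open>s\<close>.\<close>

definition gauss_grid :: "'w measure \<Rightarrow> (real \<Rightarrow> 'w \<Rightarrow> real) \<Rightarrow> real \<Rightarrow> real \<Rightarrow> bool" where
  "gauss_grid M B T s \<longleftrightarrow> prob_space M \<and> (\<forall>u\<in>{0..T}. B u \<in> borel_measurable M) \<and> (\<forall>\<omega>\<in>space M. B 0 \<omega> = 0) \<and>
     (\<forall>n ts A. ts 0 = 0 \<and> (\<forall>i<n. ts i < ts (Suc i)) \<and> ts n \<le> T \<and> s \<in> ts ` {..n} \<and> (\<forall>i<n. A i \<in> sets borel) \<longrightarrow>
        emeasure M {\<omega>\<in>space M. \<forall>i<n. B (ts (Suc i)) \<omega> - B (ts i) \<omega> \<in> A i}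
          = (\<Prod>i<n. emeasure (centred_normal (ts (Suc i) - ts i)) (A i)))"

lemma grid_mono:
  fixes ts :: "nat \<Rightarrow> real"
  assumes "\<forall>i<n. ts i < ts (Suc i)" "j \<le> k" "k \<le> n"
  shows "ts j \<le> ts k"
  using assms(2,3)
proof (induction k rule: dec_induct)
  case (step m)
  then show ?case using assms(1)[rule_format, of m] by simp
qed simp

lemma gauss_grid_increments:
  assumes g: "gauss_grid M B T s"
    and ts: "ts 0 = 0" "\<forall>i<n. ts i < ts (Suc i)" "ts n \<le> T" "s \<in> ts ` {..n}"
  shows "distr M (\<Pi>\<^sub>M i\<in>{..<n}. borel) (\<lambda>\<omega>. \<lambda>i\<in>{..<n}. B (ts (Suc i)) \<omega> - B (ts i) \<omega>)
    = (\<Pi>\<^sub>M i\<in>{..<n}. centred_normal (ts (Suc i) - ts i))" (is "distr _ _ ?D = _")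
proof -
  interpret prob_space M using g by (simp add: gauss_grid_def)
  have in_T: "ts i \<in> {0..T}" if "i \<le> n" for i
    using grid_mono[OF ts(2), of 0 i] grid_mono[OF ts(2), of i n] that ts by auto
  have Bm[measurable]: "B (ts i) \<in> borel_measurable M" if "i \<le> n" for i
    using g in_T[OF that] by (auto simp: gauss_grid_def)
  have Dm[measurable]: "?D \<in> measurable M (\<Pi>\<^sub>M i\<in>{..<n}. borel)"
    by (intro measurable_restrict borel_measurable_diff Bm) auto
  \<comment> \<open>Indices beyond the grid get a Dirac mass because the product locale asks for a
    probability measure at every index.\<close>
  define P where "P i = (if i < n then centred_normal (ts (Suc i) - ts i) else return borel 0)" for i
  interpret product_prob_space P "{..<n}"
    by (rule product_prob_spaceI) (use ts(2) in \<open>auto simp: P_def intro!: centred_normal_prob prob_space_return\<close>)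
  have setsP: "sets (P i) = sets borel" for i by (simp add: P_def)
  have sP: "sets (Pi\<^sub>M {..<n} P) = sets (\<Pi>\<^sub>M i\<in>{..<n}. borel)" by (intro sets_PiM_cong) (auto simp: setsP)
  have "distr M (\<Pi>\<^sub>M i\<in>{..<n}. borel) ?D = (\<Pi>\<^sub>M i\<in>{..<n}. P i)"
  proof (rule PiM_eqI)
    show "sets (distr M (\<Pi>\<^sub>M i\<in>{..<n}. borel) ?D) = sets (Pi\<^sub>M {..<n} P)" by (simp add: sP)
    fix A assume A: "\<And>i. i \<in> {..<n} \<Longrightarrow> A i \<in> sets (P i)"
    then have A': "\<And>i. i < n \<Longrightarrow> A i \<in> sets borel" by (auto simp: setsP)
    have "emeasure (distr M (\<Pi>\<^sub>M i\<in>{..<n}. borel) ?D) (Pi\<^sub>E {..<n} A) = emeasure M (?D -` Pi\<^sub>E {..<n} A \<inter> space M)"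
      by (rule emeasure_distr[OF Dm]) (use A' in \<open>simp add: sets_PiM_I_finite\<close>)
    also have "?D -` Pi\<^sub>E {..<n} A \<inter> space M = {\<omega>\<in>space M. \<forall>i<n. B (ts (Suc i)) \<omega> - B (ts i) \<omega> \<in> A i}"
    proof -
      have "?D \<omega> \<in> Pi\<^sub>E {..<n} A \<longleftrightarrow> (\<forall>i<n. B (ts (Suc i)) \<omega> - B (ts i) \<omega> \<in> A i)" for \<omega>
        by (simp add: PiE_iff Ball_def)
      then show ?thesis by blast
    qed
    also have "emeasure M \<dots> = (\<Prod>i<n. emeasure (centred_normal (ts (Suc i) - ts i)) (A i))"
      using g ts A' unfolding gauss_grid_def by blast
    also have "\<dots> = (\<Prod>i\<in>{..<n}. emeasure (P i) (A i))" by (intro prod.cong) (auto simp: P_def)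
    finally show "emeasure (distr M (\<Pi>\<^sub>M i\<in>{..<n}. borel) ?D) (Pi\<^sub>E {..<n} A) = (\<Prod>i\<in>{..<n}. emeasure (P i) (A i))" .
  qed simp
  also have "\<dots> = (\<Pi>\<^sub>M i\<in>{..<n}. centred_normal (ts (Suc i) - ts i))" by (intro PiM_cong) (auto simp: P_def)
  finally show ?thesis .
qed

lemma finite_set_grid:
  fixes J :: "real set"
  assumes "finite J" "0 \<in> J" "J \<subseteq> {0..T}"
  obtains n ts where "ts 0 = 0" "\<forall>i<n. ts i < ts (Suc i)" "ts n \<le> T" "ts ` {..n} = J"
proof -
  define xs where "xs = sorted_list_of_set J"
  have xs: "set xs = J" "sorted_wrt (<) xs" using assms by (auto simp: xs_def strict_sorted_list_of_set)
  then have "xs \<noteq> []" using assms by auto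
  define n where "n = length xs - 1"
  have n: "{..n} = {..<length xs}" using \<open>xs \<noteq> []\<close> by (cases xs) (auto simp: n_def)
  have im: "(!) xs ` {..n} = J" unfolding n using xs(1) by (auto simp: set_conv_nth)
  have inc: "\<forall>i<n. xs ! i < xs ! Suc i" using xs(2) by (auto simp: n_def sorted_wrt_iff_nth_less)
  have "xs ! 0 = 0"
  proof -
    have "0 \<in> (!) xs ` {..n}" using im assms by simp
    then obtain k where k: "k \<le> n" "xs ! k = 0" by auto
    have "xs ! 0 \<le> 0" using grid_mono[OF inc, of 0 k] k by simp
    moreover have "xs ! 0 \<in> J" using im by auto
    ultimately show ?thesis using assms(3) by force
  qed
  moreover have "xs ! n \<le> T" using im assms(3) by force
  ultimately show thesis using that[of "(!) xs" n] inc im by blast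
qed

text \<open>Cylinder sets determine a finite measure on the product space. The finite set of times
  is enlarged by 0 and \<open>s\<close> so that the grid condition applies; values at grid times are
  partial sums of increments, whose joint law is the same for both processes.\<close>

lemma gauss_grid_law:
  assumes g: "gauss_grid M B T s" and g': "gauss_grid M' B' T s" and s: "s \<in> {0..T}"
  shows "distr M (path_space T) (path_of T B) = distr M' (path_space T) (path_of T B')"
  unfolding path_space_def
proof (rule measure_eqI_PiM_infinite)
  have m: "path_of T B \<in> measurable M (\<Pi>\<^sub>M u\<in>{0..T}. borel)"
    using path_of_measurable[of T B M] g by (auto simp: gauss_grid_def path_space_def)
  have m': "path_of T B' \<in> measurable M' (\<Pi>\<^sub>M u\<in>{0..T}. borel)"
    using path_of_measurable[of T B' M'] g' by (auto simp: gauss_grid_def path_space_def)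
  interpret prob_space M using g by (simp add: gauss_grid_def)
  show "finite_measure (distr M (\<Pi>\<^sub>M u\<in>{0..T}. borel) (path_of T B))"
    by (rule finite_measure_distr[OF m])
  fix A :: "real \<Rightarrow> real set" and J assume J: "finite J" "J \<subseteq> {0..T}" and A: "\<And>i. i \<in> J \<Longrightarrow> A i \<in> sets borel"
  obtain n ts where ts: "ts 0 = 0" "\<forall>i<n. ts i < ts (Suc i)" "ts n \<le> T" "ts ` {..n} = insert 0 (insert s J)"
    by (rule finite_set_grid[of "insert 0 (insert s J)" T]) (use J s in auto)
  have sts: "s \<in> ts ` {..n}" using ts by simp
  define E where "E = {d\<in>space (\<Pi>\<^sub>M i\<in>{..<n}. (borel :: real measure)). \<forall>k\<in>{..n}. ts k \<in> J \<longrightarrow> (\<Sum>i<k. d i) \<in> A (ts k)}"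
  have E[measurable]: "E \<in> sets (\<Pi>\<^sub>M i\<in>{..<n}. borel)"
  proof -
    have "Measurable.pred (\<Pi>\<^sub>M i\<in>{..<n}. (borel :: real measure)) (\<lambda>d. \<forall>k\<in>{..n}. ts k \<in> J \<longrightarrow> (\<Sum>i<k. d i) \<in> A (ts k))"
    proof (rule pred_intros_finite(3))
      fix k assume k: "k \<in> {..n}"
      have [measurable]: "(\<lambda>d. \<Sum>i<k. d i) \<in> borel_measurable (\<Pi>\<^sub>M i\<in>{..<n}. (borel :: real measure))"
        by (intro borel_measurable_sum measurable_component_singleton) (use k in auto)
      show "Measurable.pred (\<Pi>\<^sub>M i\<in>{..<n}. (borel :: real measure)) (\<lambda>d. ts k \<in> J \<longrightarrow> (\<Sum>i<k. d i) \<in> A (ts k))"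
      proof (cases "ts k \<in> J")
        case True
        note [measurable] = A[OF True]
        show ?thesis by measurable
      qed simp
    qed simp
    then show ?thesis unfolding E_def pred_def .
  qed
  have key: "emeasure (distr N (\<Pi>\<^sub>M u\<in>{0..T}. borel) (path_of T C)) (prod_emb {0..T} (\<lambda>_. borel) J (Pi\<^sub>E J A))
     = emeasure (\<Pi>\<^sub>M i\<in>{..<n}. centred_normal (ts (Suc i) - ts i)) E"
    if gC: "gauss_grid N C T s" for N :: "'x measure" and C
  proof -
    have mC: "path_of T C \<in> measurable N (\<Pi>\<^sub>M u\<in>{0..T}. borel)"
      using path_of_measurable[of T C N] gC by (auto simp: gauss_grid_def path_space_def)
    have in_T: "ts i \<in> {0..T}" if "i \<le> n" for i
      using grid_mono[OF ts(2), of 0 i] grid_mono[OF ts(2), of i n] that ts by auto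
    have Dm: "(\<lambda>\<omega>. \<lambda>i\<in>{..<n}. C (ts (Suc i)) \<omega> - C (ts i) \<omega>) \<in> measurable N (\<Pi>\<^sub>M i\<in>{..<n}. borel)"
      using gC in_T by (intro measurable_restrict borel_measurable_diff) (auto simp: gauss_grid_def)
    have "emeasure (distr N (\<Pi>\<^sub>M u\<in>{0..T}. borel) (path_of T C)) (prod_emb {0..T} (\<lambda>_. borel) J (Pi\<^sub>E J A))
       = emeasure N (path_of T C -` prod_emb {0..T} (\<lambda>_. borel) J (Pi\<^sub>E J A) \<inter> space N)"
      by (rule emeasure_distr[OF mC]) (intro sets_PiM_I J ballI A)
    also have "path_of T C -` prod_emb {0..T} (\<lambda>_. borel) J (Pi\<^sub>E J A) \<inter> space N
       = (\<lambda>\<omega>. \<lambda>i\<in>{..<n}. C (ts (Suc i)) \<omega> - C (ts i) \<omega>) -` E \<inter> space N" (is "?l = ?r")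
    proof -
      have l: "\<omega> \<in> ?l \<longleftrightarrow> \<omega> \<in> space N \<and> (\<forall>j\<in>J. C j \<omega> \<in> A j)" for \<omega>
      proof -
        have "path_of T C \<omega> \<in> prod_emb {0..T} (\<lambda>_. borel) J (Pi\<^sub>E J A) \<longleftrightarrow> restrict (C' \<omega>) J \<in> Pi\<^sub>E J A" if "C' = path_of T C" for C'
          by (simp add: that prod_emb_def space_PiM path_of_def PiE_iff extensional_def)
        moreover have "path_of T C \<omega> j = C j \<omega>" if "j \<in> J" for j using that J by (auto simp: path_of_def)
        ultimately show ?thesis by (simp add: PiE_iff Ball_def) blast
      qed
      have sum: "(\<Sum>i<k. (\<lambda>i\<in>{..<n}. C (ts (Suc i)) \<omega> - C (ts i) \<omega>) i) = C (ts k) \<omega>" if "k \<le> n" "\<omega> \<in> space N" for k \<omega>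
      proof -
        have "(\<Sum>i<k. (\<lambda>i\<in>{..<n}. C (ts (Suc i)) \<omega> - C (ts i) \<omega>) i) = (\<Sum>i<k. C (ts (Suc i)) \<omega> - C (ts i) \<omega>)"
          using that by (intro sum.cong) auto
        also have "\<dots> = C (ts k) \<omega>" using gC that ts(1) by (subst sum_lessThan_telescope) (auto simp: gauss_grid_def)
        finally show ?thesis .
      qed
      have r: "\<omega> \<in> ?r \<longleftrightarrow> \<omega> \<in> space N \<and> (\<forall>k\<in>{..n}. ts k \<in> J \<longrightarrow> C (ts k) \<omega> \<in> A (ts k))" for \<omega>
        using measurable_space[OF Dm, of \<omega>] sum[of _ \<omega>] by (auto simp: E_def)
      have "(\<forall>k\<in>{..n}. ts k \<in> J \<longrightarrow> C (ts k) \<omega> \<in> A (ts k)) \<longleftrightarrow> (\<forall>j\<in>J. C j \<omega> \<in> A j)" for \<omega>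
      proof -
        have "(\<forall>k\<in>{..n}. ts k \<in> J \<longrightarrow> C (ts k) \<omega> \<in> A (ts k)) \<longleftrightarrow> (\<forall>j\<in>ts ` {..n}. j \<in> J \<longrightarrow> C j \<omega> \<in> A j)" by simp
        then show ?thesis unfolding ts(4) by blast
      qed
      note eq = this
      show ?thesis by (rule set_eqI) (simp only: l r eq)
    qed
    also have "emeasure N ?r = emeasure (distr N (\<Pi>\<^sub>M i\<in>{..<n}. borel) (\<lambda>\<omega>. \<lambda>i\<in>{..<n}. C (ts (Suc i)) \<omega> - C (ts i) \<omega>)) E"
      by (rule emeasure_distr[OF Dm E, symmetric])
    also have "\<dots> = emeasure (\<Pi>\<^sub>M i\<in>{..<n}. centred_normal (ts (Suc i) - ts i)) E"
      unfolding gauss_grid_increments[OF gC ts(1-3) sts] ..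
    finally show ?thesis .
  qed
  show "emeasure (distr M (\<Pi>\<^sub>M u\<in>{0..T}. borel) (path_of T B)) (prod_emb {0..T} (\<lambda>_. borel) J (Pi\<^sub>E J A))
      = emeasure (distr M' (\<Pi>\<^sub>M u\<in>{0..T}. borel) (path_of T B')) (prod_emb {0..T} (\<lambda>_. borel) J (Pi\<^sub>E J A))"
    unfolding key[OF g] key[OF g'] ..
qed simp_all

section \<open>Gaussian grids for Brownian motion and for pasted paths\<close>

lemma brownian_motionD:
  assumes "brownian_motion M B"
  shows "prob_space M" "\<And>t. B t \<in> borel_measurable M" "\<And>\<omega>. \<omega> \<in> space M \<Longrightarrow> B 0 \<omega> = 0"
    "\<And>\<omega>. \<omega> \<in> space M \<Longrightarrow> continuous_on {0..} (\<lambda>t. B t \<omega>)"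
    "\<And>s t. 0 \<le> s \<Longrightarrow> s < t \<Longrightarrow> distr M lborel (\<lambda>\<omega>. B t \<omega> - B s \<omega>) = centred_normal (t - s)"
    "\<And>(ts :: nat \<Rightarrow> real) n. 0 \<le> ts 0 \<Longrightarrow> \<forall>i<n. ts i < ts (Suc i) \<Longrightarrow>
        prob_space.indep_vars M (\<lambda>_. borel) (\<lambda>i \<omega>. B (ts (Suc i)) \<omega> - B (ts i) \<omega>) {..<n}"
  using assms unfolding brownian_motion_def centred_normal_def
  by (simp_all add: distributed_distr_eq_density)

lemma brownian_gauss_grid:
  assumes b: "brownian_motion M B"
  shows "gauss_grid M B T s"
  unfolding gauss_grid_def
proof (intro conjI allI impI ballI)
  note bdd_meas = brownian_motionD[OF b]
  interpret prob_space M by (rule bdd_meas)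
  note [measurable] = bdd_meas(2)
  show "prob_space M" by (rule bdd_meas)
  show "B u \<in> borel_measurable M" for u by measurable
  show "B 0 \<omega> = 0" if "\<omega> \<in> space M" for \<omega> using bdd_meas(3)[OF that] .
  fix n and ts :: "nat \<Rightarrow> real" and A :: "nat \<Rightarrow> real set"
  assume "ts 0 = 0 \<and> (\<forall>i<n. ts i < ts (Suc i)) \<and> ts n \<le> T \<and> s \<in> ts ` {..n} \<and> (\<forall>i<n. A i \<in> sets borel)"
  then have ts: "ts 0 = 0" "\<forall>i<n. ts i < ts (Suc i)" and A: "\<And>i. i < n \<Longrightarrow> A i \<in> sets borel" by auto
  define D where "D i \<omega> = B (ts (Suc i)) \<omega> - B (ts i) \<omega>" for i \<omega>
  have [measurable]: "D i \<in> borel_measurable M" for i unfolding D_def by measurable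
  have single: "emeasure M (D i -` A i \<inter> space M) = emeasure (centred_normal (ts (Suc i) - ts i)) (A i)" if i: "i < n" for i
  proof -
    have "emeasure M (D i -` A i \<inter> space M) = emeasure (distr M lborel (D i)) (A i)"
      using A[OF i] by (subst emeasure_distr) auto
    also have "distr M lborel (D i) = centred_normal (ts (Suc i) - ts i)"
      unfolding D_def using ts i grid_mono[OF ts(2), of 0 i] by (intro bdd_meas(5)) auto
    finally show ?thesis .
  qed
  have "emeasure M {\<omega>\<in>space M. \<forall>i<n. D i \<omega> \<in> A i} = (\<Prod>i<n. emeasure M (D i -` A i \<inter> space M))"
  proof (cases "n = 0")
    case True
    then show ?thesis by (simp add: emeasure_space_1)
  next
    case False
    have "{\<omega>\<in>space M. \<forall>i<n. D i \<omega> \<in> A i} = (\<Inter>i\<in>{..<n}. D i -` A i \<inter> space M)" using False by auto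
    moreover have "prob (\<Inter>i\<in>{..<n}. D i -` A i \<inter> space M) = (\<Prod>i\<in>{..<n}. prob (D i -` A i \<inter> space M))"
      by (rule indep_varsD_finite[OF bdd_meas(6)[of ts n, folded D_def]]) (use ts A False in auto)
    ultimately show ?thesis by (simp add: emeasure_eq_measure prod_ennreal)
  qed
  then show "emeasure M {\<omega>\<in>space M. \<forall>i<n. B (ts (Suc i)) \<omega> - B (ts i) \<omega> \<in> A i}
      = (\<Prod>i<n. emeasure (centred_normal (ts (Suc i) - ts i)) (A i))"
    using single unfolding D_def by simp
qed

text \<open>A grid through \<open>s\<close> splits at the index of \<open>s\<close>: earlier
  increments depend on the first coordinate only, later ones on the second only. The event is
  therefore a product set and the probabilities multiply.\<close>

lemma brownian_concat:
  assumes b: "brownian_motion M B" and s: "0 \<le> s"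
  shows "gauss_grid (M \<Otimes>\<^sub>M M) (\<lambda>u z. if u \<le> s then B u (fst z) else B s (fst z) + B (u - s) (snd z)) T s"
    (is "gauss_grid _ ?C _ _")
  unfolding gauss_grid_def
proof (intro conjI allI impI ballI)
  note bdd_meas = brownian_motionD[OF b]
  interpret prob_space M by (rule bdd_meas)
  interpret P: pair_prob_space M M ..
  note [measurable] = bdd_meas(2)
  show "prob_space (M \<Otimes>\<^sub>M M)" by (rule P.prob_space_axioms)
  show "?C u \<in> borel_measurable (M \<Otimes>\<^sub>M M)" for u by measurable
  show "?C 0 z = 0" if "z \<in> space (M \<Otimes>\<^sub>M M)" for z
    using that bdd_meas(3) s by (auto simp: space_pair_measure)
  fix n and ts :: "nat \<Rightarrow> real" and A :: "nat \<Rightarrow> real set"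
  assume "ts 0 = 0 \<and> (\<forall>i<n. ts i < ts (Suc i)) \<and> ts n \<le> T \<and> s \<in> ts ` {..n} \<and> (\<forall>i<n. A i \<in> sets borel)"
  then have ts: "ts 0 = 0" "\<forall>i<n. ts i < ts (Suc i)" and s_in: "s \<in> ts ` {..n}" and A: "\<And>i. i < n \<Longrightarrow> A i \<in> sets borel" by auto
  obtain m where m: "m \<le> n" "ts m = s" using s_in by auto
  define tt where "tt i = ts (m + i) - s" for i
  have tt: "tt 0 = 0" "\<forall>i<n-m. tt i < tt (Suc i)" using m ts by (auto simp: tt_def)
  define P1 where "P1 = {\<omega>\<in>space M. \<forall>i<m. B (ts (Suc i)) \<omega> - B (ts i) \<omega> \<in> A i}"
  define P2 where "P2 = {\<omega>\<in>space M. \<forall>i<n-m. B (tt (Suc i)) \<omega> - B (tt i) \<omega> \<in> A (m + i)}"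
  have P1: "P1 \<in> sets M" unfolding P1_def using A m
    by (intro predE pred_intros_finite(3)[of "{..<m}" , unfolded lessThan_iff Ball_def] ) (auto intro!: pred_intros_logic pred_sets2[OF A])
  have P2: "P2 \<in> sets M" unfolding P2_def using A m
    by (intro predE pred_intros_finite(3)[of "{..<n-m}" , unfolded lessThan_iff Ball_def] ) (auto intro!: pred_intros_logic pred_sets2[OF A])
  have C1: "?C (ts i) z = B (ts i) (fst z)" if "i \<le> m" for i z
    using grid_mono[OF ts(2) that m(1)] m by simp
  have C2: "?C (ts (m + j)) z = B s (fst z) + B (tt j) (snd z)" if "j \<le> n - m" "z \<in> space (M \<Otimes>\<^sub>M M)" for j z
  proof (cases "j = 0")
    case True
    then show ?thesis using that bdd_meas(3) m by (auto simp: space_pair_measure tt_def)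
  next
    case False
    have "ts m < ts (Suc m)" using ts(2) False that by auto
    also have "ts (Suc m) \<le> ts (m + j)" using False that m by (intro grid_mono[OF ts(2)]) auto
    finally show ?thesis using m by (simp add: tt_def)
  qed
  have "{z\<in>space (M \<Otimes>\<^sub>M M). \<forall>i<n. ?C (ts (Suc i)) z - ?C (ts i) z \<in> A i} = P1 \<times> P2"
  proof (intro set_eqI iffI)
    fix z assume z: "z \<in> {z\<in>space (M \<Otimes>\<^sub>M M). \<forall>i<n. ?C (ts (Suc i)) z - ?C (ts i) z \<in> A i}"
    then have zs: "z \<in> space (M \<Otimes>\<^sub>M M)" and zA: "\<And>i. i < n \<Longrightarrow> ?C (ts (Suc i)) z - ?C (ts i) z \<in> A i" by blast+
    have "B (ts (Suc i)) (fst z) - B (ts i) (fst z) \<in> A i" if "i < m" for i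
      using zA[of i] that m C1[of "Suc i" z] C1[of i z] by simp
    moreover have "B (tt (Suc i)) (snd z) - B (tt i) (snd z) \<in> A (m + i)" if "i < n - m" for i
      using zA[of "m + i"] that m C2[of "Suc i" z, unfolded add_Suc_right] C2[of i z] zs by simp
    ultimately show "z \<in> P1 \<times> P2" using zs by (auto simp: P1_def P2_def space_pair_measure)
  next
    fix z assume z: "z \<in> P1 \<times> P2"
    then have zs: "z \<in> space (M \<Otimes>\<^sub>M M)" by (auto simp: P1_def P2_def space_pair_measure)
    have "?C (ts (Suc i)) z - ?C (ts i) z \<in> A i" if "i < n" for i
    proof (cases "i < m")
      case True
      then show ?thesis using z C1[of "Suc i" z] C1[of i z] by (auto simp: P1_def)
    next
      case False
      define j where "j = i - m"
      have j: "i = m + j" "j < n - m" using False that by (auto simp: j_def)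
      then have "B (tt (Suc j)) (snd z) - B (tt j) (snd z) \<in> A (m + j)" using z by (auto simp: P2_def)
      then show ?thesis unfolding j(1) using j(2) C2[of "Suc j" z, unfolded add_Suc_right] C2[of j z] zs by (simp split del: if_split)
    qed
    then show "z \<in> {z\<in>space (M \<Otimes>\<^sub>M M). \<forall>i<n. ?C (ts (Suc i)) z - ?C (ts i) z \<in> A i}" using zs by blast
  qed
  then have "emeasure (M \<Otimes>\<^sub>M M) {z\<in>space (M \<Otimes>\<^sub>M M). \<forall>i<n. ?C (ts (Suc i)) z - ?C (ts i) z \<in> A i} = emeasure M P1 * emeasure M P2"
    using emeasure_pair_measure_Times[OF P1 P2] by simp
  also have "emeasure M P1 = (\<Prod>i<m. emeasure (centred_normal (ts (Suc i) - ts i)) (A i))"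
    unfolding P1_def
    by (rule brownian_gauss_grid[OF b, of "ts m" s, unfolded gauss_grid_def, THEN conjunct2, THEN conjunct2, THEN conjunct2, rule_format])
      (use ts m A in auto)
  also have "emeasure M P2 = (\<Prod>i<n-m. emeasure (centred_normal (tt (Suc i) - tt i)) (A (m + i)))"
    unfolding P2_def
    by (rule brownian_gauss_grid[OF b, of "tt (n-m)" 0, unfolded gauss_grid_def, THEN conjunct2, THEN conjunct2, THEN conjunct2, rule_format])
      (use tt m A in auto)
  also have "(\<Prod>i<n-m. emeasure (centred_normal (tt (Suc i) - tt i)) (A (m + i)))
      = (\<Prod>i\<in>{m..<n}. emeasure (centred_normal (ts (Suc i) - ts i)) (A i))"
    using prod.shift_bounds_nat_ivl[of "\<lambda>i. emeasure (centred_normal (ts (Suc i) - ts i)) (A i)" 0 m "n-m"] m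
    by (simp add: tt_def add.commute lessThan_atLeast0)
  also have "(\<Prod>i<m. emeasure (centred_normal (ts (Suc i) - ts i)) (A i)) * \<dots> = (\<Prod>i<n. emeasure (centred_normal (ts (Suc i) - ts i)) (A i))"
    using m by (simp add: lessThan_atLeast0 prod.atLeastLessThan_concat)
  finally show "emeasure (M \<Otimes>\<^sub>M M) {z\<in>space (M \<Otimes>\<^sub>M M). \<forall>i<n. ?C (ts (Suc i)) z - ?C (ts i) z \<in> A i}
      = (\<Prod>i<n. emeasure (centred_normal (ts (Suc i) - ts i)) (A i))" .
qed

section \<open>Cameron--Martin shift on a grid\<close>

lemma normal_density_shift:
  assumes "0 < v"
  shows "normal_density 0 (sqrt v) x * exp (- c * x - c\<^sup>2 * v / 2) = normal_density 0 (sqrt v) (x + c * v)"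
proof -
  have "- (x - 0)\<^sup>2 / (2 * (sqrt v)\<^sup>2) + (- c * x - c\<^sup>2 * v / 2) = - (x + c * v - 0)\<^sup>2 / (2 * (sqrt v)\<^sup>2)"
    using assms by (simp add: field_simps power2_eq_square)
  then show ?thesis unfolding normal_density_def by (simp add: exp_add[symmetric] mult.assoc)
qed

lemma tilted_normal:
  assumes v: "0 < v" and A[measurable]: "A \<in> sets borel"
  shows "(\<integral>\<^sup>+x. ennreal (exp (- c * x - c\<^sup>2 * v / 2)) * indicator A (x + c * v) \<partial>centred_normal v)
    = emeasure (centred_normal v) A"
proof -
  have "(\<integral>\<^sup>+x. ennreal (exp (- c * x - c\<^sup>2 * v / 2)) * indicator A (x + c * v) \<partial>centred_normal v)
    = (\<integral>\<^sup>+x. ennreal (normal_density 0 (sqrt v) x) * (ennreal (exp (- c * x - c\<^sup>2 * v / 2)) * indicator A (x + c * v)) \<partial>lborel)"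
    unfolding centred_normal_def by (subst nn_integral_density) auto
  also have "\<dots> = (\<integral>\<^sup>+x. ennreal (normal_density 0 (sqrt v) (c * v + 1 * x)) * indicator A (c * v + 1 * x) \<partial>lborel)"
    by (intro nn_integral_cong)
      (simp add: normal_density_shift[OF v, symmetric] ennreal_mult' mult.assoc add.commute)
  also have "\<dots> = (\<integral>\<^sup>+x. ennreal (normal_density 0 (sqrt v) x) * indicator A x \<partial>lborel)"
    using nn_integral_real_affine[of "\<lambda>x. ennreal (normal_density 0 (sqrt v) x) * indicator A x" 1 "c * v"] by simp
  also have "\<dots> = emeasure (centred_normal v) A"
    unfolding centred_normal_def by (subst emeasure_density) auto
  finally show ?thesis .
qed

text \<open>The weight depends on \<open>B s\<close> alone, and \<open>B s\<close> and
  \<open>s\<close> are the sums of the increments and of the step lengths. So the weight factors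
  over the grid, and each factor shifts one Gaussian back to the centre.\<close>

lemma brownian_shift_grid:
  assumes b: "brownian_motion M B" and s: "0 < s"
  shows "gauss_grid (density M (\<lambda>\<omega>. ennreal (exp (- c * B s \<omega> - c\<^sup>2 * s / 2)))) (\<lambda>u \<omega>. B u \<omega> + c * u) s s"
    (is "gauss_grid ?N ?C s s")
proof -
  note bdd_meas = brownian_motionD[OF b]
  interpret prob_space M by (rule bdd_meas)
  note [measurable] = bdd_meas(2)
  have main: "emeasure ?N {\<omega>\<in>space ?N. \<forall>i<n. ?C (ts (Suc i)) \<omega> - ?C (ts i) \<omega> \<in> A i}
          = (\<Prod>i<n. emeasure (centred_normal (ts (Suc i) - ts i)) (A i))"
    if ts: "ts 0 = 0" "\<forall>i<n. ts i < ts (Suc i)" "ts n \<le> s" "s \<in> ts ` {..n}" and A[measurable]: "\<And>i. i < n \<Longrightarrow> A i \<in> sets borel"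
    for n and ts :: "nat \<Rightarrow> real" and A :: "nat \<Rightarrow> real set"
  proof -
    \<comment> \<open>The grid contains \<open>s\<close> and stays below it, so it ends at
      \<open>s\<close>; this is what lets the weight split without remainder.\<close>
    have tsn: "ts n = s" using ts(3,4) grid_mono[OF ts(2)] by force
    define D where "D i \<omega> = B (ts (Suc i)) \<omega> - B (ts i) \<omega>" for i \<omega>
    define v where "v i = ts (Suc i) - ts i" for i
    have v: "0 < v i" if "i < n" for i using ts that by (simp add: v_def)
    have [measurable]: "D i \<in> borel_measurable M" for i unfolding D_def by measurable
    define G where "G i x = ennreal (exp (- c * x - c\<^sup>2 * v i / 2)) * indicator (A i) (x + c * v i)" for i x
    have Gm[measurable]: "G i \<in> borel_measurable borel" if "i < n" for i
      unfolding G_def using A[OF that] by measurable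
    have sumv: "(\<Sum>i<n. v i) = s" unfolding v_def sum_lessThan_telescope using tsn ts by simp
    have sumD: "(\<Sum>i<n. D i \<omega>) = B s \<omega>" if "\<omega> \<in> space M" for \<omega>
      unfolding D_def using sum_lessThan_telescope[of "\<lambda>i. B (ts i) \<omega>" n] tsn ts bdd_meas(3)[OF that] by simp
    have set: "{\<omega>\<in>space ?N. \<forall>i<n. ?C (ts (Suc i)) \<omega> - ?C (ts i) \<omega> \<in> A i} = {\<omega>\<in>space M. \<forall>i<n. D i \<omega> + c * v i \<in> A i}"
      by (simp add: D_def v_def algebra_simps)
    have [measurable]: "{\<omega>\<in>space M. \<forall>i<n. D i \<omega> + c * v i \<in> A i} \<in> sets M"
    proof -
      have "{\<omega>\<in>space M. \<forall>i\<in>{..<n}. D i \<omega> + c * v i \<in> A i} \<in> sets M"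
        by (rule sets.sets_Collect_finite_All) auto
      then show ?thesis by (simp add: Ball_def)
    qed
    have "emeasure ?N {\<omega>\<in>space M. \<forall>i<n. D i \<omega> + c * v i \<in> A i}
      = (\<integral>\<^sup>+\<omega>. ennreal (exp (- c * B s \<omega> - c\<^sup>2 * s / 2)) * indicator {\<omega>\<in>space M. \<forall>i<n. D i \<omega> + c * v i \<in> A i} \<omega> \<partial>M)"
      by (subst emeasure_density) auto
    also have "\<dots> = (\<integral>\<^sup>+\<omega>. (\<Prod>i\<in>{..<n}. G i (D i \<omega>)) \<partial>M)"
    proof (rule nn_integral_cong)
      fix \<omega> assume w: "\<omega> \<in> space M"
      have "(\<Prod>i\<in>{..<n}. G i (D i \<omega>)) = (\<Prod>i<n. ennreal (exp (- c * D i \<omega> - c\<^sup>2 * v i / 2))) * (\<Prod>i<n. indicator (A i) (D i \<omega> + c * v i))"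
        unfolding G_def by (rule prod.distrib)
      also have "(\<Prod>i<n. ennreal (exp (- c * D i \<omega> - c\<^sup>2 * v i / 2))) = ennreal (exp (\<Sum>i<n. - c * D i \<omega> - c\<^sup>2 * v i / 2))"
        by (subst prod_ennreal) (auto simp: exp_sum)
      also have "(\<Sum>i<n. - c * D i \<omega> - c\<^sup>2 * v i / 2) = - c * (\<Sum>i<n. D i \<omega>) - c\<^sup>2 * (\<Sum>i<n. v i) / 2"
        by (simp add: sum_subtractf sum_negf sum_distrib_left sum_divide_distrib)
      also have "\<dots> = - c * B s \<omega> - c\<^sup>2 * s / 2" unfolding sumv sumD[OF w] ..
      also have "(\<Prod>i<n. indicator (A i) (D i \<omega> + c * v i)) = (indicator {\<omega>\<in>space M. \<forall>i<n. D i \<omega> + c * v i \<in> A i} \<omega> :: ennreal)"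
        using w by (auto simp: indicator_def)
      finally show "ennreal (exp (- c * B s \<omega> - c\<^sup>2 * s / 2)) * indicator {\<omega>\<in>space M. \<forall>i<n. D i \<omega> + c * v i \<in> A i} \<omega> = (\<Prod>i\<in>{..<n}. G i (D i \<omega>))"
        by simp
    qed
    also have "\<dots> = (\<Prod>i\<in>{..<n}. \<integral>\<^sup>+\<omega>. G i (D i \<omega>) \<partial>M)"
    proof (rule indep_vars_nn_integral)
      have iv: "indep_vars (\<lambda>_. borel) D {..<n}" unfolding D_def using bdd_meas(6)[of ts n] ts by simp
      show "indep_vars (\<lambda>_. borel) (\<lambda>i \<omega>. G i (D i \<omega>)) {..<n}"
        by (rule indep_vars_compose2[OF iv]) (auto intro: Gm)
    qed auto
    also have "\<dots> = (\<Prod>i<n. emeasure (centred_normal (ts (Suc i) - ts i)) (A i))"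
    proof (rule prod.cong[OF refl])
      fix i assume i: "i \<in> {..<n}"
      have "(\<integral>\<^sup>+\<omega>. G i (D i \<omega>) \<partial>M) = (\<integral>\<^sup>+x. G i x \<partial>distr M lborel (D i))"
        using i by (subst nn_integral_distr) auto
      also have "distr M lborel (D i) = centred_normal (v i)"
        unfolding D_def v_def using ts i grid_mono[OF ts(2), of 0 i] by (intro bdd_meas(5)) auto
      also have "(\<integral>\<^sup>+x. G i x \<partial>centred_normal (v i)) = emeasure (centred_normal (v i)) (A i)"
        unfolding G_def using i by (intro tilted_normal v A) auto
      finally show "(\<integral>\<^sup>+\<omega>. G i (D i \<omega>) \<partial>M) = emeasure (centred_normal (ts (Suc i) - ts i)) (A i)" by (simp add: v_def)
    qed
    finally show ?thesis unfolding set .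
  qed
  \<comment> \<open>The total mass is read off from the two-point grid 0 < \<open>s\<close> with a
    trivial event.\<close>
  have "emeasure ?N (space ?N) = 1"
  proof -
    have "emeasure ?N {\<omega>\<in>space ?N. \<forall>i<1. ?C ((\<lambda>i. if i = 0 then 0 else s) (Suc i)) \<omega> - ?C ((\<lambda>i::nat. if i = 0 then 0 else s) i) \<omega> \<in> UNIV}
       = (\<Prod>i<1. emeasure (centred_normal ((\<lambda>i. if i = 0 then 0 else s) (Suc i) - (\<lambda>i::nat. if i = 0 then 0 else s) i)) UNIV)"
      by (rule main) (use s in auto)
    then show ?thesis using prob_space.emeasure_space_1[OF centred_normal_prob[OF s]] by simp
  qed
  then show ?thesis unfolding gauss_grid_def using main bdd_meas(3)
    by (auto intro!: prob_spaceI)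
qed

section \<open>Moments and a maximal inequality\<close>

lemma brownian_moments:
  assumes b: "brownian_motion M B" and st: "0 \<le> s" "s < t"
  shows "integrable M (\<lambda>\<omega>. (B t \<omega> - B s \<omega>) ^ k)"
    and "(\<integral>\<omega>. (B t \<omega> - B s \<omega>) \<partial>M) = 0" and "(\<integral>\<omega>. (B t \<omega> - B s \<omega>)\<^sup>2 \<partial>M) = t - s"
    and "(\<integral>\<omega>. (B t \<omega> - B s \<omega>) ^ 4 \<partial>M) = 3 * (t - s)\<^sup>2"
proof -
  note bdd_meas = brownian_motionD[OF b]
  note [measurable] = bdd_meas(2)
  define D where "D \<omega> = B t \<omega> - B s \<omega>" for \<omega>
  have [measurable]: "D \<in> borel_measurable M" unfolding D_def by measurable
  define \<sigma> where "\<sigma> = sqrt (t - s)"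
  have \<sigma>: "0 < \<sigma>" "\<sigma>\<^sup>2 = t - s" using st by (auto simp: \<sigma>_def)
  have d: "distr M lborel D = density lborel (normal_density 0 \<sigma>)"
    unfolding D_def \<sigma>_def using bdd_meas(5)[OF st] by (simp add: centred_normal_def)
  have i: "integrable M (\<lambda>\<omega>. D \<omega> ^ k) \<longleftrightarrow> integrable lborel (\<lambda>x. normal_density 0 \<sigma> x * (x - 0) ^ k)" for k
  proof -
    have "integrable M (\<lambda>\<omega>. D \<omega> ^ k) \<longleftrightarrow> integrable (distr M lborel D) (\<lambda>x. x ^ k)"
      by (subst integrable_distr_eq) auto
    then show ?thesis unfolding d by (subst (asm) integrable_density) auto
  qed
  have I: "(\<integral>\<omega>. D \<omega> ^ k \<partial>M) = (\<integral>x. normal_density 0 \<sigma> x * (x - 0) ^ k \<partial>lborel)" for k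
  proof -
    have "(\<integral>\<omega>. D \<omega> ^ k \<partial>M) = (\<integral>x. x ^ k \<partial>distr M lborel D)" by (subst integral_distr) auto
    then show ?thesis unfolding d by (subst (asm) integral_density) auto
  qed
  show "integrable M (\<lambda>\<omega>. (B t \<omega> - B s \<omega>) ^ k)"
    using i[of k] integrable_normal_moment[OF \<sigma>(1), of 0 k] by (simp add: D_def)
  have "(\<integral>\<omega>. D \<omega> ^ 1 \<partial>M) = 0"
    unfolding I using integral_normal_moment_odd[OF \<sigma>(1), of 0 0] by simp
  then show "(\<integral>\<omega>. (B t \<omega> - B s \<omega>) \<partial>M) = 0" by (simp add: D_def)
  have "(\<integral>\<omega>. D \<omega> ^ 2 \<partial>M) = t - s"
    unfolding I using integral_normal_moment_even[OF \<sigma>(1), of 0 1] \<sigma> by simp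
  then show "(\<integral>\<omega>. (B t \<omega> - B s \<omega>)\<^sup>2 \<partial>M) = t - s" by (simp add: D_def)
  have "(\<integral>\<omega>. D \<omega> ^ 4 \<partial>M) = 3 * (t - s)\<^sup>2"
    unfolding I using integral_normal_moment_even[OF \<sigma>(1), of 0 2] \<sigma> by (simp add: fact_numeral power_divide)
  then show "(\<integral>\<omega>. (B t \<omega> - B s \<omega>) ^ 4 \<partial>M) = 3 * (t - s)\<^sup>2" by (simp add: D_def)
qed

text \<open>A dyadic point of level k+1 is either of level k or one step to the right of such a
  point, so the bounds \<open>e k\<close> add up along the levels. Approximation from below by
  dyadic points and continuity carry the bound to every u.\<close>

lemma dyadic_chaining:
  fixes b :: "real \<Rightarrow> real"
  assumes c: "continuous_on {0..h} b" and h: "0 < h" and b0: "b 0 = 0"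
    and inc: "\<And>k j. j < 2 ^ k \<Longrightarrow> \<bar>b (real (Suc j) * h / 2 ^ k) - b (real j * h / 2 ^ k)\<bar> \<le> e k"
    and e: "\<And>k. (\<Sum>i\<le>k. e i) \<le> d" and u: "u \<in> {0..h}"
  shows "\<bar>b u\<bar> \<le> d"
proof -
  have dy: "\<bar>b (real j * h / 2 ^ k)\<bar> \<le> (\<Sum>i\<le>k. e i)" if "j \<le> 2 ^ k" for j k
    using that
  proof (induction k arbitrary: j)
    case 0
    have "\<bar>b h - b 0\<bar> \<le> e 0" using inc[of 0 0] by simp
    then have "0 \<le> e 0" by linarith
    moreover from 0 have "j = 0 \<or> j = 1" by auto
    ultimately show ?case using inc[of 0 0] b0 by auto
  next
    case (Suc k)
    have e0: "0 \<le> e (Suc k)" using inc[of 0 "Suc k"] by (simp add: order_trans[OF abs_ge_zero])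
    show ?case
    proof (cases "even j")
      case True
      then obtain i where i: "j = 2 * i" by blast
      then have "i \<le> 2 ^ k" using Suc.prems by simp
      from Suc.IH[OF this] e0 show ?thesis by (simp add: i)
    next
      case False
      then obtain i where i: "j = Suc (2 * i)" by (auto elim: oddE)
      then have "i \<le> 2 ^ k" "2 * i < 2 ^ Suc k" using Suc.prems by auto
      from Suc.IH[OF this(1)] inc[OF this(2)] show ?thesis by (simp add: i)
    qed
  qed
  define j where "j k = nat \<lfloor>u / h * 2 ^ k\<rfloor>" for k :: nat
  have uh: "0 \<le> u / h" "u / h \<le> 1" using u h by (auto simp: field_simps)
  have j: "real (j k) \<le> u / h * 2 ^ k" "u / h * 2 ^ k < real (j k) + 1" for k
  proof -
    have "0 \<le> u / h * 2 ^ k" using uh by (intro mult_nonneg_nonneg) auto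
    then have "real (j k) = of_int \<lfloor>u / h * 2 ^ k\<rfloor>" unfolding j_def by simp
    then show "real (j k) \<le> u / h * 2 ^ k" "u / h * 2 ^ k < real (j k) + 1"
      using floor_correct[of "u / h * 2 ^ k"] by linarith+
  qed
  have jle: "j k \<le> 2 ^ k" for k
  proof -
    have "u / h * 2 ^ k \<le> 1 * 2 ^ k" using uh by (intro mult_right_mono) auto
    then have "real (j k) \<le> 2 ^ k" using j(1)[of k] by linarith
    then show ?thesis by (metis of_nat_le_iff of_nat_numeral of_nat_power)
  qed
  have lim: "(\<lambda>k. real (j k) * h / 2 ^ k) \<longlonglongrightarrow> u"
  proof (rule tendsto_sandwich[of "\<lambda>k. u - h / 2 ^ k" _ _ "\<lambda>k. u"])
    show "\<forall>\<^sub>F k in sequentially. u - h / 2 ^ k \<le> real (j k) * h / 2 ^ k"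
    proof (rule always_eventually, rule allI)
      fix k
      have "u * 2 ^ k < (real (j k) + 1) * h" using j(2)[of k] h by (simp add: field_simps)
      then have "(u * 2 ^ k - h) / 2 ^ k \<le> real (j k) * h / 2 ^ k"
        by (intro divide_right_mono) (auto simp: algebra_simps)
      then show "u - h / 2 ^ k \<le> real (j k) * h / 2 ^ k" by (simp add: diff_divide_distrib)
    qed
    show "\<forall>\<^sub>F k in sequentially. real (j k) * h / 2 ^ k \<le> u"
      using j(1) h by (intro always_eventually allI) (simp add: field_simps)
    have "(\<lambda>k. h * inverse (2 ^ k)) \<longlonglongrightarrow> h * 0"
      by (intro tendsto_intros LIMSEQ_inverse_realpow_zero) auto
    from tendsto_diff[OF tendsto_const[of u] this] have "(\<lambda>k. u - h * inverse (2 ^ k)) \<longlonglongrightarrow> u - h * 0" .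
    then show "(\<lambda>k. u - h / 2 ^ k) \<longlonglongrightarrow> u" by (simp add: divide_inverse)
  qed simp
  have "(\<lambda>k. b (real (j k) * h / 2 ^ k)) \<longlonglongrightarrow> b u"
  proof (rule continuous_on_tendsto_compose[OF c lim u])
    show "\<forall>\<^sub>F k in sequentially. real (j k) * h / 2 ^ k \<in> {0..h}"
    proof (intro always_eventually allI)
      fix k
      have "real (j k) \<le> 2 ^ k" using jle[of k] by (metis of_nat_le_iff of_nat_numeral of_nat_power)
      then have "real (j k) * h \<le> 2 ^ k * h" using h by (intro mult_right_mono) auto
      then show "real (j k) * h / 2 ^ k \<in> {0..h}" using h by (simp add: field_simps)
    qed
  qed
  then have "(\<lambda>k. \<bar>b (real (j k) * h / 2 ^ k)\<bar>) \<longlonglongrightarrow> \<bar>b u\<bar>" by (rule tendsto_rabs)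
  then show ?thesis
    by (rule LIMSEQ_le_const2) (use dy[OF jle] e in \<open>auto intro: order_trans\<close>)
qed

text \<open>Markov's inequality for fourth moments at every dyadic level, followed by chaining. The
  order h^2 is the point: divided by h it still vanishes, so the exceptional event does not
  contribute to the generator.\<close>

lemma brownian_sup_bound:
  assumes b: "brownian_motion M B"
  shows "\<exists>C>0. \<forall>d>0. \<forall>h>0. \<exists>E\<in>sets M. measure M E \<le> C * h\<^sup>2 / d ^ 4 \<and> (\<forall>\<omega>\<in>space M - E. \<forall>u\<in>{0..h}. \<bar>B u \<omega>\<bar> \<le> d)"
proof -
  note bdd_meas = brownian_motionD[OF b]
  interpret prob_space M by (rule bdd_meas)
  note [measurable] = bdd_meas(2)
  \<comment> \<open>With thresholds \<open>e k\<close> = (d/10)(9/10)^k, which sum to d, level k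
    costs 2^k times 3 (h/2^k)^2 / (\<open>e k\<close>)^4, that is 30000 h^2/d^4 times r^k with r =
    (1/2)(10/9)^4 < 1.\<close>
  define r :: real where "r = 10000 / 13122"
  show ?thesis
  proof (intro exI[of _ "30000 / (1 - r)"] conjI allI impI)
    show "0 < 30000 / (1 - r)" by (simp add: r_def)
    fix d h :: real assume d: "0 < d" and h: "0 < h"
    define e where "e k = d / 10 * (9 / 10) ^ k" for k :: nat
    have e0: "0 < e k" for k using d by (simp add: e_def)
    have esum: "(\<Sum>i\<le>k. e i) \<le> d" for k
    proof -
      have "(\<Sum>i\<le>k. (9 / 10) ^ i) = (1 - (9/10) ^ Suc k) / (1 - 9/10 :: real)"
        by (subst sum_gp0) simp
      then have "(\<Sum>i\<le>k. e i) = d * (1 - (9/10) ^ Suc k)" unfolding e_def sum_distrib_left[symmetric] by simp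
      also have "\<dots> \<le> d * 1" using d by (intro mult_left_mono) auto
      finally show ?thesis by simp
    qed
    define F where "F k j = {\<omega>\<in>space M. e k ^ 4 \<le> (B (real (Suc j) * h / 2 ^ k) \<omega> - B (real j * h / 2 ^ k) \<omega>) ^ 4}" for k j :: nat
    have F[measurable]: "F k j \<in> sets M" for k j unfolding F_def by measurable
    have mF: "measure M (F k j) \<le> 3 * (h / 2 ^ k)\<^sup>2 / e k ^ 4" for k j
    proof -
      have lt: "real j * h / 2 ^ k < real (Suc j) * h / 2 ^ k" using h by (simp add: divide_strict_right_mono)
      have le: "0 \<le> real j * h / 2 ^ k" using h by simp
      have df: "real (Suc j) * h / 2 ^ k - real j * h / 2 ^ k = h / 2 ^ k" by (simp add: field_simps)
      have "measure M (F k j) \<le> (\<integral>\<omega>. (B (real (Suc j) * h / 2 ^ k) \<omega> - B (real j * h / 2 ^ k) \<omega>) ^ 4 \<partial>M) / e k ^ 4"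
        unfolding F_def
        by (rule integral_Markov_inequality_measure[where A="{}"])
          (use brownian_moments(1)[OF b le lt, of 4] e0[of k] in auto)
      then show ?thesis unfolding brownian_moments(4)[OF b le lt] df .
    qed
    define G where "G k = (\<Union>j<2^k. F k j)" for k
    have G[measurable]: "G k \<in> sets M" for k unfolding G_def by measurable
    have mG: "measure M (G k) \<le> 30000 * h\<^sup>2 / d ^ 4 * r ^ k" for k
    proof -
      have "measure M (G k) \<le> (\<Sum>j<(2::nat)^k. measure M (F k j))"
        unfolding G_def by (rule finite_measure_subadditive_finite) auto
      also have "\<dots> \<le> (\<Sum>j<(2::nat)^k. 3 * (h / 2 ^ k)\<^sup>2 / e k ^ 4)" by (intro sum_mono mF)
      also have "\<dots> = 2 ^ k * (3 * (h / 2 ^ k)\<^sup>2 / e k ^ 4)" by simp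
      also have "\<dots> = 30000 * h\<^sup>2 / d ^ 4 * r ^ k"
      proof -
        have "r ^ k = 10000 ^ k / (2 * 6561) ^ k" unfolding r_def by (simp only: power_divide) simp
        then have "r ^ k = 10000 ^ k / (2 ^ k * 6561 ^ k)" by (simp only: power_mult_distrib)
        note rk = this
        have ek: "e k ^ 4 = d ^ 4 / 10000 * (6561 ^ k / 10000 ^ k)"
        proof -
          have "((9/10) ^ k) ^ 4 = ((9/10::real) ^ 4) ^ k" by (simp only: power_mult[symmetric] mult.commute)
          also have "\<dots> = 6561 ^ k / 10000 ^ k" by (simp add: power_divide)
          finally have p: "((9/10) ^ k) ^ 4 = 6561 ^ k / (10000 ^ k :: real)" .
          have "e k ^ 4 = (d / 10) ^ 4 * ((9/10) ^ k) ^ 4" by (simp only: e_def power_mult_distrib)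
          then show ?thesis unfolding p by (simp add: power_divide)
        qed
        show ?thesis unfolding rk ek using d by (simp add: field_simps power2_eq_square)
      qed
      finally show ?thesis .
    qed
    have sr: "summable (\<lambda>k. 30000 * h\<^sup>2 / d ^ 4 * r ^ k)" by (intro summable_mult summable_geometric) (simp add: r_def)
    have sG: "summable (\<lambda>k. measure M (G k))"
      by (rule summable_comparison_test[OF _ sr]) (use mG in auto)
    have "measure M (\<Union>k. G k) \<le> (\<Sum>k. measure M (G k))"
      by (rule finite_measure_subadditive_countably) (use sG in auto)
    also have "\<dots> \<le> (\<Sum>k. 30000 * h\<^sup>2 / d ^ 4 * r ^ k)" by (rule suminf_le[OF mG sG sr])
    also have "\<dots> = 30000 / (1 - r) * h\<^sup>2 / d ^ 4"
      by (subst suminf_mult) (auto simp: r_def suminf_geometric intro: summable_geometric)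
    finally have m: "measure M (\<Union>k. G k) \<le> 30000 / (1 - r) * h\<^sup>2 / d ^ 4" .
    show "\<exists>E\<in>sets M. measure M E \<le> 30000 / (1 - r) * h\<^sup>2 / d ^ 4 \<and> (\<forall>\<omega>\<in>space M - E. \<forall>u\<in>{0..h}. \<bar>B u \<omega>\<bar> \<le> d)"
    proof (intro bexI[of _ "\<Union>k. G k"] conjI ballI m)
      fix \<omega> u assume w: "\<omega> \<in> space M - (\<Union>k. G k)" and u: "u \<in> {0..h}"
      show "\<bar>B u \<omega>\<bar> \<le> d"
      proof (rule dyadic_chaining[OF _ h _ _ esum u])
        show "continuous_on {0..h} (\<lambda>u. B u \<omega>)" using bdd_meas(4)[of \<omega>] w by (auto elim: continuous_on_subset)
        show "B 0 \<omega> = 0" using bdd_meas(3) w by auto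
        fix k j :: nat assume j: "j < 2 ^ k"
        then have "\<omega> \<notin> F k j" using w by (auto simp: G_def)
        then have "(B (real (Suc j) * h / 2 ^ k) \<omega> - B (real j * h / 2 ^ k) \<omega>) ^ 4 < e k ^ 4"
          using w by (auto simp: F_def)
        then have "\<bar>B (real (Suc j) * h / 2 ^ k) \<omega> - B (real j * h / 2 ^ k) \<omega>\<bar> ^ 4 < e k ^ 4" by (simp add: power_even_abs)
        then show "\<bar>B (real (Suc j) * h / 2 ^ k) \<omega> - B (real j * h / 2 ^ k) \<omega>\<bar> \<le> e k"
          using power_less_imp_less_base[of _ 4 "e k"] e0[of k] by (meson less_imp_le)
      qed
    qed measurable
  qed
qed

section \<open>The killed semigroup\<close>

locale killed = drift +
  fixes M :: "'w measure" and B :: "real \<Rightarrow> 'w \<Rightarrow> real"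
  assumes BM: "brownian_motion M B"
begin

sublocale prob_space M using brownian_motionD(1)[OF BM] .

lemma B_measurable[measurable]: "B u \<in> borel_measurable M" by (rule brownian_motionD(2)[OF BM])

definition surv :: "real \<Rightarrow> real \<Rightarrow> 'w \<Rightarrow> bool" where "surv x t \<omega> \<longleftrightarrow> lives x (\<lambda>u. B u \<omega>) t"
definition X :: "real \<Rightarrow> real \<Rightarrow> 'w \<Rightarrow> real" where "X x t \<omega> = pth x (\<lambda>u. B u \<omega>) t"

lemma B_continuous: "\<omega> \<in> space M \<Longrightarrow> continuous_on {0..} (\<lambda>u. B u \<omega>)" by (rule brownian_motionD(4)[OF BM])
lemma B_continuous': "\<omega> \<in> space M \<Longrightarrow> continuous_on {0..t} (\<lambda>u. B u \<omega>)"
  by (rule continuous_on_subset[OF B_continuous]) auto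
lemma B_0: "\<omega> \<in> space M \<Longrightarrow> B 0 \<omega> = 0" by (rule brownian_motionD(3)[OF BM])

lemma surv_measurable2:
  assumes Y: "Y \<in> borel_measurable N" and W: "W \<in> measurable N M" and t: "0 \<le> t"
  shows "Measurable.pred N (\<lambda>z. surv (Y z) t (W z))"
  unfolding surv_def
  by (rule lives_measurable[OF Y _ t])
    (use B_continuous' measurable_space[OF W] W in \<open>auto intro: measurable_compose[OF W B_measurable]\<close>)

lemma X_measurable2:
  assumes Y: "Y \<in> borel_measurable N" and W: "W \<in> measurable N M" and t: "0 \<le> t"
  shows "(\<lambda>z. X (Y z) t (W z)) \<in> borel_measurable N"
  unfolding X_def
  by (rule pth_measurable[OF Y _ t])
    (use B_continuous' measurable_space[OF W] W in \<open>auto intro: measurable_compose[OF W B_measurable]\<close>)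

lemma surv_measurable[measurable]: "0 \<le> t \<Longrightarrow> Measurable.pred M (surv x t)"
  using surv_measurable2[of "\<lambda>_. x" M "\<lambda>\<omega>. \<omega>" t] by simp
lemma X_measurable[measurable]: "0 \<le> t \<Longrightarrow> X x t \<in> borel_measurable M"
  using X_measurable2[of "\<lambda>_. x" M "\<lambda>\<omega>. \<omega>" t] by simp

lemma X_pos: "surv x t \<omega> \<Longrightarrow> 0 < X x t \<omega>" unfolding surv_def X_def by (rule pth_pos)
definition PP :: "real \<Rightarrow> (real \<Rightarrow> ennreal) \<Rightarrow> real \<Rightarrow> ennreal" where
  "PP t g x = (\<integral>\<^sup>+\<omega>. indicator {\<omega>. surv x t \<omega>} \<omega> * g (X x t \<omega>) \<partial>M)"

lemma PP_measurable:
  assumes [measurable]: "g \<in> borel_measurable borel" and t: "0 \<le> t"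
  shows "PP t g \<in> borel_measurable borel"
proof -
  have [measurable]: "Measurable.pred (borel \<Otimes>\<^sub>M M) (\<lambda>z. surv (fst z) t (snd z))"
    by (rule surv_measurable2[OF _ _ t]) auto
  have [measurable]: "(\<lambda>z. X (fst z) t (snd z)) \<in> borel_measurable (borel \<Otimes>\<^sub>M M)"
    by (rule X_measurable2[OF _ _ t]) auto
  have "(\<lambda>z. (if surv (fst z) t (snd z) then 1 else 0) * g (X (fst z) t (snd z))) \<in> borel_measurable (borel \<Otimes>\<^sub>M M)"
    by measurable
  from borel_measurable_nn_integral_fst[OF this]
  show ?thesis unfolding PP_def[abs_def] by (simp add: indicator_def if_distrib cong: if_cong)
qed

lemma livesq_path_of:
  assumes c: "continuous_on {0..T} (\<lambda>u. C u z)" and t: "0 \<le> t" "t \<le> T"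
  shows "livesq x (path_of T C z) t \<longleftrightarrow> lives x (\<lambda>u. C u z) t"
    "lives x (\<lambda>u. C u z) t \<Longrightarrow> posq x (path_of T C z) t = pth x (\<lambda>u. C u z) t"
proof -
  have e: "path_of T C z u = C u z" if "u \<in> {0..t}" for u using that t by (auto simp: path_of_def)
  have "continuous_on {0..t} (\<lambda>u. C u z)" by (rule continuous_on_subset[OF c]) (use t in auto)
  then have c': "continuous_on {0..t} (path_of T C z)" by (rule continuous_on_eq) (use e in auto)
  have l: "lives x (path_of T C z) t \<longleftrightarrow> lives x (\<lambda>u. C u z) t" by (rule lives_cong) (use e in auto)
  show "livesq x (path_of T C z) t \<longleftrightarrow> lives x (\<lambda>u. C u z) t" using livesq_iff[OF c' t(1)] l by simp
  assume "lives x (\<lambda>u. C u z) t"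
  then have l': "lives x (path_of T C z) t" using l by simp
  then have "pth x (path_of T C z) t = pth x (\<lambda>u. C u z) t" by (intro pth_cong) (use e in auto)
  then show "posq x (path_of T C z) t = pth x (\<lambda>u. C u z) t" using posq_eq[OF l'] by simp
qed

lemma path_law_transfer:
  assumes g: "gauss_grid N C T s" and s: "s \<in> {0..T}" and F: "F \<in> borel_measurable (path_space T)"
  shows "(\<integral>\<^sup>+\<omega>. F (path_of T B \<omega>) \<partial>M) = (\<integral>\<^sup>+z. F (path_of T C z) \<partial>N)"
proof -
  have mB: "path_of T B \<in> measurable M (path_space T)" by (rule path_of_measurable) simp
  have mC: "path_of T C \<in> measurable N (path_space T)"
    by (rule path_of_measurable) (use g in \<open>simp add: gauss_grid_def\<close>)
  have "(\<integral>\<^sup>+\<omega>. F (path_of T B \<omega>) \<partial>M) = (\<integral>\<^sup>+w. F w \<partial>distr M (path_space T) (path_of T B))"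
    by (rule nn_integral_distr[symmetric, OF mB]) (use F in simp)
  also have "\<dots> = (\<integral>\<^sup>+w. F w \<partial>distr N (path_space T) (path_of T C))"
    unfolding gauss_grid_law[OF brownian_gauss_grid[OF BM] g s] ..
  also have "\<dots> = (\<integral>\<^sup>+z. F (path_of T C z) \<partial>N)"
    by (rule nn_integral_distr[OF mC]) (use F in simp)
  finally show ?thesis .
qed

lemma path_functional_measurable:
  assumes g: "g \<in> borel_measurable borel" and k: "k \<in> borel_measurable borel" and st: "0 \<le> s" "s \<le> T"
  shows "(\<lambda>w. if livesq x w T then g (posq x w s) * k (posq x w T) else 0 :: ennreal) \<in> borel_measurable (path_space T)"
proof -
  have c: "(\<lambda>w. w u) \<in> borel_measurable (path_space T)" if "u \<in> {0..T}" for u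
    unfolding path_space_def using that by (rule measurable_component_singleton)
  note [measurable] = g k
  have [measurable]: "Measurable.pred (path_space T) (\<lambda>w. livesq x w T)"
    by (rule livesq_measurable) (use c st in auto)
  have [measurable]: "(\<lambda>w. posq x w T) \<in> borel_measurable (path_space T)" "(\<lambda>w. posq x w s) \<in> borel_measurable (path_space T)"
    by (rule posq_measurable; use c st in auto)+
  show ?thesis by measurable
qed

lemma path_functional_eq:
  assumes c: "continuous_on {0..T} (\<lambda>u. C u z)" and st: "0 \<le> s" "s \<le> T"
  shows "(if livesq x (path_of T C z) T then g (posq x (path_of T C z) s) * k (posq x (path_of T C z) T) else 0 :: ennreal)
    = indicator {z. lives x (\<lambda>u. C u z) T} z * (g (pth x (\<lambda>u. C u z) s) * k (pth x (\<lambda>u. C u z) T))"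
proof -
  have "livesq x (path_of T C z) T \<longleftrightarrow> lives x (\<lambda>u. C u z) T" by (rule livesq_path_of[of T C z T x]) (use st c in auto)
  moreover have "posq x (path_of T C z) s = pth x (\<lambda>u. C u z) s" "posq x (path_of T C z) T = pth x (\<lambda>u. C u z) T"
    if "lives x (\<lambda>u. C u z) T"
    using livesq_path_of(2)[of T C z s x] livesq_path_of(2)[of T C z T x] lives_mono[OF that] that c st by auto
  ultimately show ?thesis by auto
qed

text \<open>The path is replaced in law by one pasted at time \<open>s\<close> from two independent
  copies; this is legitimate because survival and position are expressed by measurable functionals
  on the product path space. For the pasted path the flow property separates past and future, and
  integrating out the second copy first yields \<open>PP t k\<close>.\<close>

lemma markov:
  assumes [measurable]: "g \<in> borel_measurable borel" "k \<in> borel_measurable borel" and st: "0 \<le> s" "0 \<le> t"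
  shows "(\<integral>\<^sup>+\<omega>. indicator {\<omega>. surv x (s+t) \<omega>} \<omega> * (g (X x s \<omega>) * k (X x (s+t) \<omega>)) \<partial>M)
    = PP s (\<lambda>y. g y * PP t k y) x"
proof -
  define T where "T = s + t"
  have T: "0 \<le> s" "s \<le> T" using st by (auto simp: T_def)
  define C where "C u z = (if u \<le> s then B u (fst z) else B s (fst z) + B (u - s) (snd z))" for u and z :: "'w \<times> 'w"
  interpret P: pair_prob_space M M ..
  have gC: "gauss_grid (M \<Otimes>\<^sub>M M) C T s" unfolding C_def by (rule brownian_concat[OF BM st(1)])
  have cC: "continuous_on {0..T} (\<lambda>u. C u z)" if z: "z \<in> space (M \<Otimes>\<^sub>M M)" for z
  proof -
    have zz: "fst z \<in> space M" "snd z \<in> space M" using z by (auto simp: space_pair_measure)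
    have "continuous_on ({0..s} \<union> {s..T}) (\<lambda>u. C u z)"
      unfolding C_def
    proof (rule continuous_on_If)
      show "continuous_on {s..T} (\<lambda>u. B s (fst z) + B (u - s) (snd z))"
        by (intro continuous_intros continuous_on_compose2[OF B_continuous[OF zz(2)]]) auto
    qed (use B_continuous'[OF zz(1)] B_0[OF zz(2)] in auto)
    then show ?thesis using T by (simp add: ivl_disj_un_two_touch)
  qed
  have "(\<integral>\<^sup>+\<omega>. indicator {\<omega>. surv x T \<omega>} \<omega> * (g (X x s \<omega>) * k (X x T \<omega>)) \<partial>M)
     = (\<integral>\<^sup>+\<omega>. (if livesq x (path_of T B \<omega>) T then g (posq x (path_of T B \<omega>) s) * k (posq x (path_of T B \<omega>) T) else 0) \<partial>M)"
  proof (rule nn_integral_cong)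
    fix \<omega> assume w: "\<omega> \<in> space M"
    show "indicator {\<omega>. surv x T \<omega>} \<omega> * (g (X x s \<omega>) * k (X x T \<omega>))
      = (if livesq x (path_of T B \<omega>) T then g (posq x (path_of T B \<omega>) s) * k (posq x (path_of T B \<omega>) T) else 0)"
      unfolding path_functional_eq[of T B \<omega> s x g k, OF B_continuous'[OF w] T] surv_def X_def ..
  qed
  also have "\<dots> = (\<integral>\<^sup>+z. (if livesq x (path_of T C z) T then g (posq x (path_of T C z) s) * k (posq x (path_of T C z) T) else 0) \<partial>(M \<Otimes>\<^sub>M M))"
    by (rule path_law_transfer[OF gC _ path_functional_measurable]) (use T in auto)
  also have "\<dots> = (\<integral>\<^sup>+z. indicator {\<omega>. surv x s \<omega>} (fst z) * (g (X x s (fst z)) * (indicator {\<omega>. surv (X x s (fst z)) t \<omega>} (snd z) * k (X (X x s (fst z)) t (snd z)))) \<partial>(M \<Otimes>\<^sub>M M))"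
  proof (rule nn_integral_cong)
    fix z assume z: "z \<in> space (M \<Otimes>\<^sub>M M)"
    have zz: "fst z \<in> space M" "snd z \<in> space M" using z by (auto simp: space_pair_measure)
    let ?c = "\<lambda>u. C u z"
    have e1: "?c u = B u (fst z)" if "u \<in> {0..s}" for u using that by (simp add: C_def)
    have e2: "?c (s + u) - ?c s = B u (snd z)" if "u \<in> {0..t}" for u
      using that B_0[OF zz(2)] by (auto simp: C_def)
    have l1: "lives x ?c s \<longleftrightarrow> surv x s (fst z)" unfolding surv_def by (rule lives_cong) (use e1 in auto)
    have p1: "pth x ?c s = X x s (fst z)" if "lives x ?c s" unfolding X_def by (rule pth_cong[OF _ that]) (use e1 in auto)
    have l2: "lives y (\<lambda>u. ?c (s + u) - ?c s) t \<longleftrightarrow> surv y t (snd z)" for y unfolding surv_def by (rule lives_cong) (use e2 in auto)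
    have p2: "pth y (\<lambda>u. ?c (s + u) - ?c s) t = X y t (snd z)" if "lives y (\<lambda>u. ?c (s + u) - ?c s) t" for y
      unfolding X_def by (rule pth_cong[OF _ that]) (use e2 in auto)
    have fl: "lives x ?c T \<longleftrightarrow> surv x s (fst z) \<and> surv (X x s (fst z)) t (snd z)"
    proof (cases "lives x ?c s")
      case True
      show ?thesis unfolding T_def lives_flow(1)[OF st, of x ?c] p1[OF True] l2 l1 ..
    next
      case False
      then show ?thesis unfolding T_def lives_flow(1)[OF st, of x ?c] l1 by blast
    qed
    have pf: "pth x ?c T = X (X x s (fst z)) t (snd z)" if l: "lives x ?c T"
    proof -
      have ls: "lives x ?c s" using lives_mono[OF l] T by auto
      have "pth x ?c T = pth (pth x ?c s) (\<lambda>u. ?c (s + u) - ?c s) t"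
        using lives_flow(2)[OF st, of x ?c] l unfolding T_def by simp
      also have "\<dots> = X (pth x ?c s) t (snd z)"
        using lives_flow(1)[OF st, of x ?c] l unfolding T_def by (intro p2) simp
      finally show ?thesis using p1[OF ls] by simp
    qed
    have ps: "pth x ?c s = X x s (fst z)" if l: "lives x ?c T" using p1 lives_mono[OF l] T by auto
    have r: "indicator {z. lives x (\<lambda>u. C u z) T} z * (g (pth x ?c s) * k (pth x ?c T))
      = indicator {\<omega>. surv x s \<omega>} (fst z) * (g (X x s (fst z)) * (indicator {\<omega>. surv (X x s (fst z)) t \<omega>} (snd z) * k (X (X x s (fst z)) t (snd z))))"
    proof (cases "lives x ?c T")
      case True
      then show ?thesis using fl by (simp add: pf[OF True] ps[OF True])
    next
      case False
      then show ?thesis using fl by (auto simp: indicator_def)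
    qed
    show "(if livesq x (path_of T C z) T then g (posq x (path_of T C z) s) * k (posq x (path_of T C z) T) else 0)
      = indicator {\<omega>. surv x s \<omega>} (fst z) * (g (X x s (fst z)) * (indicator {\<omega>. surv (X x s (fst z)) t \<omega>} (snd z) * k (X (X x s (fst z)) t (snd z))))"
      unfolding path_functional_eq[of T C z s x g k, OF cC[OF z] T] by (rule r)
  qed
  also have "\<dots> = (\<integral>\<^sup>+\<omega>. \<integral>\<^sup>+\<omega>'. indicator {\<omega>. surv x s \<omega>} \<omega> * (g (X x s \<omega>) * (indicator {\<omega>'. surv (X x s \<omega>) t \<omega>'} \<omega>' * k (X (X x s \<omega>) t \<omega>'))) \<partial>M \<partial>M)"
  proof -
    have [measurable]: "Measurable.pred (M \<Otimes>\<^sub>M M) (\<lambda>z. surv x s (fst z))" "(\<lambda>z. X x s (fst z)) \<in> borel_measurable (M \<Otimes>\<^sub>M M)"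
      using surv_measurable2[of "\<lambda>_. x" "M \<Otimes>\<^sub>M M" fst s] X_measurable2[of "\<lambda>_. x" "M \<Otimes>\<^sub>M M" fst s] st by auto
    have [measurable]: "Measurable.pred (M \<Otimes>\<^sub>M M) (\<lambda>z. surv (X x s (fst z)) t (snd z))"
      by (rule surv_measurable2) (use st in auto)
    have [measurable]: "(\<lambda>z. X (X x s (fst z)) t (snd z)) \<in> borel_measurable (M \<Otimes>\<^sub>M M)"
      by (rule X_measurable2) (use st in auto)
    have "(\<lambda>z. (if surv x s (fst z) then 1 else 0) * (g (X x s (fst z)) * ((if surv (X x s (fst z)) t (snd z) then 1 else 0) * k (X (X x s (fst z)) t (snd z))))) \<in> borel_measurable (M \<Otimes>\<^sub>M M)"
      by measurable
    then have "(\<lambda>z. indicator {\<omega>. surv x s \<omega>} (fst z) * (g (X x s (fst z)) * (indicator {\<omega>. surv (X x s (fst z)) t \<omega>} (snd z) * k (X (X x s (fst z)) t (snd z))))) \<in> borel_measurable (M \<Otimes>\<^sub>M M)"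
      by (simp add: indicator_def of_bool_def)
    from nn_integral_fst[OF this] show ?thesis by simp
  qed
  also have "\<dots> = (\<integral>\<^sup>+\<omega>. indicator {\<omega>. surv x s \<omega>} \<omega> * (g (X x s \<omega>) * PP t k (X x s \<omega>)) \<partial>M)"
  proof (rule nn_integral_cong)
    fix \<omega>
    have [measurable]: "(\<lambda>\<omega>'. indicator {\<omega>'. surv y t \<omega>'} \<omega>' * k (X y t \<omega>')) \<in> borel_measurable M" for y
    proof -
      have "(\<lambda>\<omega>'. (if surv y t \<omega>' then 1 else 0) * k (X y t \<omega>')) \<in> borel_measurable M" using st by measurable
      then show ?thesis by (simp add: indicator_def of_bool_def)
    qed
    show "(\<integral>\<^sup>+\<omega>'. indicator {\<omega>. surv x s \<omega>} \<omega> * (g (X x s \<omega>) * (indicator {\<omega>'. surv (X x s \<omega>) t \<omega>'} \<omega>' * k (X (X x s \<omega>) t \<omega>'))) \<partial>M)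
      = indicator {\<omega>. surv x s \<omega>} \<omega> * (g (X x s \<omega>) * PP t k (X x s \<omega>))"
      unfolding PP_def by (simp add: nn_integral_cmult)
  qed
  finally show ?thesis unfolding T_def PP_def[of s] .
qed

lemma chapman_kolmogorov:
  assumes "k \<in> borel_measurable borel" "0 \<le> s" "0 \<le> t"
  shows "PP (s+t) k x = PP s (PP t k) x"
  using markov[of "\<lambda>_. 1" k s t x] assms by (simp add: PP_def[of "s+t"])

text \<open>Hypothesis (H1) identifies explosion with reaching 0 almost surely, so t <
  \<open>T_zero\<close> may be replaced by survival of the solution.\<close>

lemma killed_exp_eq:
  assumes H: "hypH M B \<alpha>" and x: "0 < x" and st: "0 \<le> s" "s \<le> t" and f: "f \<in> borel_measurable borel"
  shows "killed_exp M B \<alpha> x s t f = (\<integral>\<omega>. indicator {\<omega>. surv x t \<omega>} \<omega> * f (X x s \<omega>) \<partial>M)"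
  unfolding killed_exp_def
proof (rule integral_cong_AE)
  note [measurable] = f
  have t: "0 \<le> t" using st by simp
  have [measurable]: "Measurable.pred M (\<lambda>\<omega>. ereal t < T_zero \<alpha> x (\<lambda>u. B u \<omega>))"
    by (rule T_zero_measurable[OF _ t x]) (use B_continuous B_0 in auto)
  have "(\<lambda>\<omega>. (if ereal t < T_zero \<alpha> x (\<lambda>u. B u \<omega>) then 1 else 0) * f (X x s \<omega>)) \<in> borel_measurable M"
    using st by measurable
  then show "(\<lambda>\<omega>. indicator {\<omega>. ereal t < T_zero \<alpha> x (\<lambda>u. B u \<omega>)} \<omega> * f (pth x (\<lambda>u. B u \<omega>) s)) \<in> borel_measurable M"
    by (simp add: indicator_def of_bool_def X_def)
  have "(\<lambda>\<omega>. (if surv x t \<omega> then 1 else 0) * f (X x s \<omega>)) \<in> borel_measurable M"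
    using st t by measurable
  then show "(\<lambda>\<omega>. indicator {\<omega>. surv x t \<omega>} \<omega> * f (X x s \<omega>)) \<in> borel_measurable M"
    by (simp add: indicator_def of_bool_def)
  have "AE \<omega> in M. expl_time \<alpha> x (\<lambda>u. B u \<omega>) = T_zero \<alpha> x (\<lambda>u. B u \<omega>)" using H x by (auto simp: hypH_def)
  then show "AE \<omega> in M. indicator {\<omega>. ereal t < T_zero \<alpha> x (\<lambda>u. B u \<omega>)} \<omega> * f (pth x (\<lambda>u. B u \<omega>) s) = indicator {\<omega>. surv x t \<omega>} \<omega> * f (X x s \<omega>)"
  proof (rule AE_mp, intro AE_I2 impI)
    fix \<omega> assume w: "\<omega> \<in> space M" and e: "expl_time \<alpha> x (\<lambda>u. B u \<omega>) = T_zero \<alpha> x (\<lambda>u. B u \<omega>)"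
    have "ereal t < T_zero \<alpha> x (\<lambda>u. B u \<omega>) \<longleftrightarrow> surv x t \<omega>"
      using less_expl_time_iff[OF B_continuous[OF w] t, of x] e by (simp add: surv_def)
    then show "indicator {\<omega>. ereal t < T_zero \<alpha> x (\<lambda>u. B u \<omega>)} \<omega> * f (pth x (\<lambda>u. B u \<omega>) s) = indicator {\<omega>. surv x t \<omega>} \<omega> * f (X x s \<omega>)"
      by (simp add: indicator_def of_bool_def X_def)
  qed
qed

lemma killed_exp_nonpos:
  assumes x: "x \<le> 0"  and s: "0 \<le> s"
  shows "killed_exp M B \<alpha> x s t f = f (THE v. False)"
proof -
  have "(\<integral>\<omega>. indicator {\<omega>. ereal t < T_zero \<alpha> x (\<lambda>u. B u \<omega>)} \<omega> * f (pth x (\<lambda>u. B u \<omega>) s) \<partial>M) = (\<integral>\<omega>. f (THE v. False) \<partial>M)"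
  proof (rule Bochner_Integration.integral_cong[OF refl])
    fix \<omega> assume w: "\<omega> \<in> space M"
    have "\<not> lives x (\<lambda>u. B u \<omega>) s" using not_lives[of x "\<lambda>u. B u \<omega>" s] x B_0[OF w] by simp
    then show "indicator {\<omega>. ereal t < T_zero \<alpha> x (\<lambda>u. B u \<omega>)} \<omega> * f (pth x (\<lambda>u. B u \<omega>) s) = f (THE v. False)"
      using T_zero_nonpos[OF B_continuous[OF w] B_0[OF w] x] pth_junk[OF s] by simp
  qed
  then show ?thesis unfolding killed_exp_def by (simp add: prob_space)
qed

end

section \<open>The generator on test functions\<close>

lemma integral_abs_le_const:
  fixes f :: "real \<Rightarrow> real"
  assumes "continuous_on {a..b} f" "a \<le> b" "\<And>u. u \<in> {a..b} \<Longrightarrow> \<bar>f u\<bar> \<le> A" "0 \<le> A"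
  shows "\<bar>integral {a..b} f\<bar> \<le> A * (b - a)"
proof -
  have "norm (integral (cbox a b) f) \<le> A * measure lborel (cbox a b)"
    by (rule integrable_bound) (use assms integrable_continuous_real[OF assms(1)] in auto)
  then show ?thesis using assms(2) by simp
qed

lemma compact_support_derivative_zero:
  fixes g g' :: "real \<Rightarrow> real"
  assumes "\<And>x. (g has_real_derivative g' x) (at x)" "\<And>x. x \<notin> {a..b} \<Longrightarrow> g x = 0" "x \<notin> {a..b}"
  shows "g' x = 0"
proof -
  have "open (- {a..b})" by auto
  have "((\<lambda>_. 0) has_real_derivative g' x) (at x)"
    by (rule has_field_derivative_transform_within_open[OF assms(1) \<open>open (- {a..b})\<close>]) (use assms in auto)
  then show ?thesis using DERIV_unique[OF _ DERIV_const[of 0]] by blast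
qed

lemma compact_support_bounded:
  fixes g :: "real \<Rightarrow> real"
  assumes "continuous_on UNIV g" "\<And>x. x \<notin> {a..b} \<Longrightarrow> g x = 0"
  shows "\<exists>C\<ge>0. \<forall>x. \<bar>g x\<bar> \<le> C"
proof -
  have "bounded (g ` {a..b})"
    by (intro compact_imp_bounded compact_continuous_image continuous_on_subset[OF assms(1)]) auto
  then obtain C where C: "\<And>x. x \<in> {a..b} \<Longrightarrow> \<bar>g x\<bar> \<le> C" by (fastforce simp: bounded_iff)
  have "\<bar>g x\<bar> \<le> max C 0" for x using C[of x] assms(2)[of x] by (cases "x \<in> {a..b}") auto
  then show ?thesis by (intro exI[of _ "max C 0"]) auto
qed

text \<open>Uniform continuity in a form suited to expectations: near points cost \<open>e\<close>,
  distant ones are absorbed by a quadratic term, so only moments of the displacement enter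
  afterwards.\<close>

lemma compact_support_modulus:
  fixes g :: "real \<Rightarrow> real"
  assumes c: "continuous_on UNIV g" and z: "\<And>x. x \<notin> {a..b} \<Longrightarrow> g x = 0" and e: "0 < e"
  shows "\<exists>K\<ge>0. \<forall>x y. \<bar>g y - g x\<bar> \<le> e + K * (y - x)\<^sup>2"
proof -
  obtain C where C: "C \<ge> 0" "\<And>x. \<bar>g x\<bar> \<le> C" using compact_support_bounded[OF c z] by blast
  have "uniformly_continuous_on {a-1..b+1} g"
    by (rule compact_uniformly_continuous) (auto intro: continuous_on_subset[OF c])
  then obtain d where d: "d > 0" "\<And>x y. x \<in> {a-1..b+1} \<Longrightarrow> y \<in> {a-1..b+1} \<Longrightarrow> dist y x < d \<Longrightarrow> dist (g y) (g x) < e"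
    using e unfolding uniformly_continuous_on_def by metis
  \<comment> \<open>The cap at 1 ensures that two points closer than \<open>r\<close> either both
    lie in the enlarged interval or both lie off the support.\<close>
  define r where "r = min d 1"
  have r: "0 < r" "r \<le> d" "r \<le> 1" using d by (auto simp: r_def)
  show ?thesis
  proof (intro exI[of _ "2 * C / r\<^sup>2"] conjI allI)
    show "0 \<le> 2 * C / r\<^sup>2" using C by simp
    fix x y
    show "\<bar>g y - g x\<bar> \<le> e + 2 * C / r\<^sup>2 * (y - x)\<^sup>2"
    proof (cases "\<bar>y - x\<bar> < r")
      case True
      have "\<bar>g y - g x\<bar> \<le> e"
      proof (cases "x \<in> {a-1..b+1} \<and> y \<in> {a-1..b+1}")
        case T: True
        then show ?thesis using d(2)[of x y] True r by (auto simp: dist_real_def)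
      next
        case False
        then have "x \<notin> {a..b}" "y \<notin> {a..b}" using True r by auto
        then show ?thesis using z e by simp
      qed
      moreover have "0 \<le> 2 * C / r\<^sup>2 * (y - x)\<^sup>2" using C by simp
      ultimately show ?thesis by linarith
    next
      case False
      have "r\<^sup>2 \<le> (y - x)\<^sup>2" using False r by (metis abs_le_square_iff abs_of_pos not_le)
      then have "2 * C / r\<^sup>2 * r\<^sup>2 \<le> 2 * C / r\<^sup>2 * (y - x)\<^sup>2" using C by (intro mult_left_mono) auto
      then have "2 * C \<le> 2 * C / r\<^sup>2 * (y - x)\<^sup>2" using r by simp
      moreover have "\<bar>g y - g x\<bar> \<le> 2 * C" using C(2)[of x] C(2)[of y] by linarith
      ultimately show ?thesis using e by linarith
    qed
  qed
qed

lemma taylor_second_order: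
  fixes g g' g'' :: "real \<Rightarrow> real"
  assumes d1: "\<And>x. (g has_real_derivative g' x) (at x)" and d2: "\<And>x. (g' has_real_derivative g'' x) (at x)"
    and m: "\<And>x y. \<bar>g'' y - g'' x\<bar> \<le> e + K * (y - x)\<^sup>2" and K: "0 \<le> K"
  shows "\<bar>g (x + D) - g x - g' x * D - g'' x * D\<^sup>2 / 2\<bar> \<le> (e + K * D\<^sup>2) * D\<^sup>2 / 2"
proof (cases "D = 0")
  case False
  define df where "df m = (if m = 0 then g else if m = 1 then g' else g'')" for m :: nat
  have "\<exists>t. (if x + D < x then x + D < t \<and> t < x else x < t \<and> t < x + D) \<and>
      g (x + D) = (\<Sum>m<2. df m x / fact m * (x + D - x) ^ m) + df 2 t / fact 2 * (x + D - x) ^ 2"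
    by (rule Taylor[where a="min x (x + D)" and b="max x (x + D)"])
      (use False d1 d2 in \<open>auto simp: df_def less_2_cases_iff\<close>)
  then obtain t where t: "if x + D < x then x + D < t \<and> t < x else x < t \<and> t < x + D"
    and eq: "g (x + D) = g x + g' x * D + g'' t / 2 * D\<^sup>2"
    by (auto simp: df_def numeral_2_eq_2)
  have "\<bar>t - x\<bar> \<le> \<bar>D\<bar>" using t by (auto split: if_splits)
  then have "(t - x)\<^sup>2 \<le> D\<^sup>2" by (rule abs_le_square_iff[THEN iffD1])
  then have "\<bar>g'' t - g'' x\<bar> \<le> e + K * D\<^sup>2" using m[of t x] mult_left_mono[OF _ K] by (smt (verit))
  then have "\<bar>g'' t - g'' x\<bar> * (D\<^sup>2 / 2) \<le> (e + K * D\<^sup>2) * (D\<^sup>2 / 2)" by (intro mult_right_mono) auto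
  moreover have eq2: "g (x + D) - g x - g' x * D - g'' x * D\<^sup>2 / 2 = (g'' t - g'' x) * (D\<^sup>2 / 2)"
    unfolding eq by (simp add: algebra_simps)
  ultimately show ?thesis unfolding eq2 abs_mult by simp
qed simp

context drift
begin

lemma tsol_deviation:
  assumes b: "continuous_on {0..h} b" and A: "bdd_lip A L (trunc_drift N)" "0 \<le> A" and u: "u \<in> {0..h}"
  shows "\<bar>tsol N x b u - x - b u\<bar> \<le> A * u"
proof -
  have "continuous_on {0..h} (\<lambda>u. trunc_drift N (tsol N x b u))"
    using continuous_on_compose[OF tsol_eq(1)[OF b] bdd_lip_continuous[OF A(1)]] by (simp add: o_def)
  then have "continuous_on {0..u} (\<lambda>u. trunc_drift N (tsol N x b u))" by (rule continuous_on_subset) (use u in auto)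
  then have "\<bar>integral {0..u} (\<lambda>u. trunc_drift N (tsol N x b u))\<bar> \<le> A * (u - 0)"
    by (rule integral_abs_le_const) (use A u in \<open>auto simp: bdd_lip_def\<close>)
  then show ?thesis using tsol_eq(2)[OF b u, of N x] by simp
qed

text \<open>While the driving path is small, the true and the truncated solution can only disagree outside the
  support of a test function: to enter \<^term>\<open>{a..b}\<close> from afar the solution would have to cross a
  region where the drift is bounded.\<close>

lemma trunc_coincide:
  assumes b: "continuous_on {0..h} b" and bd: "\<And>u. u \<in> {0..h} \<Longrightarrow> \<bar>b u\<bar> \<le> d" and h: "0 \<le> h"
    and A: "bdd_lip A L (trunc_drift N)" "0 \<le> A" "A * h \<le> d"
    and d: "0 < d" "d \<le> p / 16" "d \<le> 1" and N: "lo N \<le> p / 2" "q + 6 \<le> hi N" and x: "0 < x" and b0: "b 0 = 0"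
  shows "lives x b h \<and> pth x b h = tsol N x b h \<or>
    tsol N x b h \<notin> {p..q} \<and> (lives x b h \<longrightarrow> pth x b h \<notin> {p..q})"
proof -
  have dev: "\<bar>tsol N x b u - x\<bar> \<le> 2 * d" if u: "u \<in> {0..h}" for u
  proof -
    have "A * u \<le> A * h" using A u by (intro mult_left_mono) auto
    then show ?thesis using tsol_deviation[OF b A(1,2) u, of x] bd[OF u] A(3) by linarith
  qed
  show ?thesis
  \<comment> \<open>From a start near the support the truncated solution moves by at most 2d and
    stays where truncation is invisible. From farther away neither solution can be in the support at
    time \<open>h\<close>.\<close>
  proof (cases "x \<in> {p - 4 * d..q + 4 * d}")
    case True
    have "tsol N x b u \<in> {lo N..hi N}" if "u \<in> {0..h}" for u
      using dev[OF that] True d N by auto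
    from pth_tsol[OF b h this] h show ?thesis by auto
  next
    case False
    have "tsol N x b h \<notin> {p..q}" using dev[of h] h False d by auto
    moreover have "pth x b h \<notin> {p..q}" if l: "lives x b h"
    proof
      assume in1: "pth x b h \<in> {p..q}"
      note y = sde_solD[OF lives_pth[OF l]]
      \<comment> \<open>Times at which the solution is at least 4d away from the support. After the
        last of them the drift is bounded by \<open>A\<close>, so the remaining displacement is at
        most 3d, too little to enter the support.\<close>
      define S where "S = {0..h} \<inter> pth x b -` ({..p - 4 * d} \<union> {q + 4 * d..})"
      have "closed S" unfolding S_def by (rule continuous_closed_preimage[OF y(2)]) (auto intro: closed_Un)
      then have cS: "compact S" unfolding S_def by (intro compact_eq_bounded_closed[THEN iffD2] conjI) (auto intro: bounded_subset[OF bounded_closed_interval[of 0 h]])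
      have "0 \<in> S" using pth_0[of x b] lives_0[OF x, of b] b0 False h by (auto simp: S_def)
      then obtain \<sigma> where \<sigma>: "\<sigma> \<in> S" "\<And>u. u \<in> S \<Longrightarrow> u \<le> \<sigma>" using compact_attains_sup[OF cS] by blast
      have \<sigma>h: "0 \<le> \<sigma>" "\<sigma> \<le> h" using \<sigma>(1) by (auto simp: S_def)
      have far: "4 * d \<le> \<bar>pth x b h - pth x b \<sigma>\<bar>" using \<sigma>(1) in1 by (auto simp: S_def)
      have ne: "\<sigma> < h"
      proof -
        have "\<sigma> \<noteq> h" using far d(1) by auto
        then show ?thesis using \<sigma>h by simp
      qed
      have near: "pth x b u \<in> {p - 4 * d..q + 4 * d}" if "u \<in> {\<sigma><..h}" for u
      proof -
        have "u \<notin> S" using \<sigma>(2)[of u] that by auto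
        then show ?thesis using that \<sigma>h by (auto simp: S_def)
      qed
      have ca: "continuous_on {0..h} (\<lambda>u. \<alpha> (pth x b u))" by (rule sde_sol_continuous_drift[OF lives_pth[OF l]])
      have ca': "continuous_on {\<sigma>..h} (\<lambda>u. \<alpha> (pth x b u))" by (rule continuous_on_subset[OF ca]) (use \<sigma>h in auto)
      have cy: "continuous_on {\<sigma>..h} (pth x b)" by (rule continuous_on_subset[OF y(2)]) (use \<sigma>h in auto)
      have near\<sigma>: "pth x b u \<in> {p - 4 * d..q + 4 * d}" if "u \<in> {\<sigma>..h}" for u
      proof -
        have cl: "closure {\<sigma><..h} = {\<sigma>..h}" using ne by simp
        have "pth x b ` closure {\<sigma><..h} \<subseteq> {p - 4 * d..q + 4 * d}"
        proof (rule image_closure_subset)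
          show "continuous_on (closure {\<sigma><..h}) (pth x b)" unfolding cl by (rule cy)
          show "pth x b ` {\<sigma><..h} \<subseteq> {p - 4 * d..q + 4 * d}" by (intro image_subsetI near)
        qed simp
        then show ?thesis using that unfolding cl by (rule subsetD[OF _ imageI])
      qed
      have bnd: "\<bar>\<alpha> (pth x b u)\<bar> \<le> A" if "u \<in> {\<sigma>..h}" for u
      proof -
        have "pth x b u \<in> {lo N..hi N}" using near\<sigma>[OF that] d N by auto
        then show ?thesis using trunc_drift_eq[of "pth x b u" N] A(1) by (metis bdd_lip_def)
      qed
      have "\<bar>integral {\<sigma>..h} (\<lambda>u. \<alpha> (pth x b u))\<bar> \<le> A * (h - \<sigma>)"
        by (rule integral_abs_le_const[OF ca']) (use ne bnd A in auto)
      also have "\<dots> \<le> d" using A \<sigma>h by (smt (verit) mult_left_mono)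
      finally have i: "\<bar>integral {\<sigma>..h} (\<lambda>u. \<alpha> (pth x b u))\<bar> \<le> d" .
      have "integral {0..\<sigma>} (\<lambda>u. \<alpha> (pth x b u)) + integral {\<sigma>..h} (\<lambda>u. \<alpha> (pth x b u)) = integral {0..h} (\<lambda>u. \<alpha> (pth x b u))"
        by (rule Henstock_Kurzweil_Integration.integral_combine) (use \<sigma>h integrable_continuous_real[OF ca] in auto)
      then have "pth x b h - pth x b \<sigma> = b h - b \<sigma> - integral {\<sigma>..h} (\<lambda>u. \<alpha> (pth x b u))"
        using y(4)[of h] y(4)[of \<sigma>] \<sigma>h h by auto
      then have "\<bar>pth x b h - pth x b \<sigma>\<bar> \<le> 3 * d" using i bd[of h] bd[of \<sigma>] \<sigma>h h by auto
      then show False using far d(1) by linarith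
    qed
    ultimately show ?thesis by blast
  qed
qed

end

section \<open>Small-time expansion of the killed semigroup\<close>

context killed
begin

lemma surv_integrable:
  fixes f :: "real \<Rightarrow> real"
  assumes f: "f \<in> borel_measurable borel" "\<And>y. \<bar>f y\<bar> \<le> C" and st: "0 \<le> s" "0 \<le> t"
  shows "integrable M (\<lambda>\<omega>. indicator {\<omega>. surv x t \<omega>} \<omega> * f (X x s \<omega>))"
proof (rule integrable_const_bound[where B=C])
  note [measurable] = f(1)
  have "(\<lambda>\<omega>. (if surv x t \<omega> then 1 else 0) * f (X x s \<omega>)) \<in> borel_measurable M" using st by measurable
  then show "(\<lambda>\<omega>. indicator {\<omega>. surv x t \<omega>} \<omega> * f (X x s \<omega>)) \<in> borel_measurable M" by (simp add: indicator_def of_bool_def)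
  have "0 \<le> C" using f(2)[of 0] by linarith
  then show "AE \<omega> in M. norm (indicator {\<omega>. surv x t \<omega>} \<omega> * f (X x s \<omega>)) \<le> C"
    using f(2) by (auto simp: indicator_def abs_mult)
qed

text \<open>A Taylor expansion around x with the drift frozen at x, compared pathwise and then
  integrated. Off \<open>E\<close> the truncated solution stays within 2d of x, so freezing costs at
  most 2 L d per unit time; on \<open>E\<close> only crude bounds are used, and its probability
  appears.\<close>

lemma generator_estimate_explicit:
  assumes d1: "\<And>x. (g has_real_derivative g' x) (at x)" and d2: "\<And>x. (g' has_real_derivative g'' x) (at x)"
    and gc: "continuous_on UNIV g" and sup: "\<And>x. x \<notin> {p..q} \<Longrightarrow> g x = 0"
    and G: "\<And>x. \<bar>g x\<bar> \<le> G0" "\<And>x. \<bar>g' x\<bar> \<le> G1" "\<And>x. \<bar>g'' x\<bar> \<le> G2" "0 \<le> G0" "0 \<le> G1" "0 \<le> G2"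
    and m: "\<And>x y. \<bar>g'' y - g'' x\<bar> \<le> e1 + K * (y - x)\<^sup>2" and K: "0 \<le> K" and e1: "0 < e1" and e2: "0 < e2"
    and A: "bdd_lip A L (trunc_drift N)" "0 \<le> A" "A * h \<le> d"
    and d: "0 < d" "d \<le> p / 16" "d \<le> 1" and N: "lo N \<le> p / 2" "q + 6 \<le> hi N" and x: "0 < x" and h: "0 < h"
    and E: "E \<in> sets M" "\<And>\<omega> u. \<omega> \<in> space M - E \<Longrightarrow> u \<in> {0..h} \<Longrightarrow> \<bar>B u \<omega>\<bar> \<le> d"
  shows "\<bar>(\<integral>\<omega>. indicator {\<omega>. surv x h \<omega>} \<omega> * g (X x h \<omega>) \<partial>M) - g x - h * (g'' x / 2 - trunc_drift N x * g' x)\<bar>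
    \<le> h * (2 * L * d * G1 + G2 * A * (e2 + h / e2) + G2 * A\<^sup>2 * h / 2 + e1 * (1 + A\<^sup>2 * h) + K * (12 * h + 4 * A ^ 4 * h ^ 3))
      + (2 * G0 + 2 * A * G1 * h) * measure M E"
proof -
  have L: "0 \<le> L" using A(1) by (simp add: bdd_lip_def)
  define W where "W \<omega> = B h \<omega> - B 0 \<omega>" for \<omega>
  have Wm[measurable]: "W \<in> borel_measurable M" unfolding W_def by measurable
  have Wi: "integrable M (\<lambda>\<omega>. W \<omega> ^ k)" for k unfolding W_def by (rule brownian_moments[OF BM _ h]) simp
  have WB: "W \<omega> = B h \<omega>" if "\<omega> \<in> space M" for \<omega> using B_0[OF that] by (simp add: W_def)
  define Z where "Z \<omega> = indicator {\<omega>. surv x h \<omega>} \<omega> * g (X x h \<omega>)" for \<omega>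
  have gm: "g \<in> borel_measurable borel" using gc by (rule borel_measurable_continuous_onI)
  have Zi: "integrable M Z" unfolding Z_def by (rule surv_integrable[OF gm G(1)]) (use h in auto)
  define an where "an = trunc_drift N x"
  have an: "\<bar>an\<bar> \<le> A" using A(1) by (simp add: an_def bdd_lip_def)
  define V where "V \<omega> = g x + g' x * (W \<omega> - h * an) + g'' x * (W \<omega>)\<^sup>2 / 2" for \<omega>
  define R where "R \<omega> = h * (2 * L * d * G1) + G2 * (A * h * (e2 + (W \<omega>)\<^sup>2 / e2) + A\<^sup>2 * h\<^sup>2 / 2)
      + e1 * ((W \<omega>)\<^sup>2 + A\<^sup>2 * h\<^sup>2) + K * (4 * W \<omega> ^ 4 + 4 * A ^ 4 * h ^ 4)
      + (2 * G0 + 2 * A * G1 * h) * indicator E \<omega>" for \<omega>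
  have pw: "\<bar>Z \<omega> - V \<omega>\<bar> \<le> R \<omega>" if w: "\<omega> \<in> space M" for \<omega>
  proof -
    let ?b = "\<lambda>u. B u \<omega>"
    note cb = B_continuous'[OF w, of h]
    define D where "D = integral {0..h} (\<lambda>u. trunc_drift N (tsol N x ?b u))"
    have ct: "continuous_on {0..h} (\<lambda>u. trunc_drift N (tsol N x ?b u))"
      using continuous_on_compose[OF tsol_eq(1)[OF cb] bdd_lip_continuous[OF A(1)]] by (simp add: o_def)
    have Y: "tsol N x ?b h = x + (W \<omega> - D)" using tsol_eq(2)[OF cb, of h N x] h WB[OF w] by (simp add: D_def)
    have D: "\<bar>D\<bar> \<le> A * h" unfolding D_def
      using integral_abs_le_const[OF ct, of A] A h by (auto simp: bdd_lip_def)
    have Dan: "\<bar>D - h * an\<bar> \<le> 2 * A * h"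
    proof -
      have "\<bar>h * an\<bar> \<le> A * h" using an h by (simp add: abs_mult mult.commute)
      then show ?thesis using D by linarith
    qed
    have Dan': "\<bar>D - h * an\<bar> \<le> h * (2 * L * d)" if wE: "\<omega> \<notin> E"
    proof -
      have "D - h * an = integral {0..h} (\<lambda>u. trunc_drift N (tsol N x ?b u) - an)"
        unfolding D_def using integrable_continuous_real[OF ct] h
        by (subst Henstock_Kurzweil_Integration.integral_diff) auto
      moreover have "\<bar>integral {0..h} (\<lambda>u. trunc_drift N (tsol N x ?b u) - an)\<bar> \<le> (L * (2 * d)) * (h - 0)"
      proof (rule integral_abs_le_const)
        show "continuous_on {0..h} (\<lambda>u. trunc_drift N (tsol N x ?b u) - an)" using ct by (intro continuous_intros)
        fix u assume u: "u \<in> {0..h}"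
        have "A * u \<le> A * h" using A u by (intro mult_left_mono) auto
        then have "\<bar>tsol N x ?b u - x\<bar> \<le> 2 * d"
          using tsol_deviation[OF cb A(1,2) u, of x] E(2)[of \<omega> u] w wE u A(3) by auto
        then have "L * \<bar>tsol N x ?b u - x\<bar> \<le> L * (2 * d)" using L by (intro mult_left_mono)
        moreover have "\<bar>trunc_drift N (tsol N x ?b u) - an\<bar> \<le> L * \<bar>tsol N x ?b u - x\<bar>"
          using A(1) unfolding an_def bdd_lip_def by blast
        ultimately show "\<bar>trunc_drift N (tsol N x ?b u) - an\<bar> \<le> L * (2 * d)" by linarith
      qed (use h L d in auto)
      ultimately show ?thesis by (simp add: algebra_simps)
    qed
    have ZY: "Z \<omega> = g (x + (W \<omega> - D))" if wE: "\<omega> \<notin> E"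
    proof -
      have "lives x ?b h \<and> pth x ?b h = tsol N x ?b h \<or>
        tsol N x ?b h \<notin> {p..q} \<and> (lives x ?b h \<longrightarrow> pth x ?b h \<notin> {p..q})"
        by (rule trunc_coincide[OF cb _ _ A d N x]) (use E(2) w wE h B_0[OF w] in auto)
      then have "Z \<omega> = g (tsol N x ?b h)"
        unfolding Z_def X_def surv_def using sup by (auto simp: indicator_def)
      then show ?thesis using Y by simp
    qed
    define D' where "D' = W \<omega> - D"
    have tay: "\<bar>g (x + D') - g x - g' x * D' - g'' x * D'\<^sup>2 / 2\<bar> \<le> (e1 + K * D'\<^sup>2) * D'\<^sup>2 / 2"
      by (rule taylor_second_order[OF d1 d2 m K])
    have D2: "D\<^sup>2 \<le> A\<^sup>2 * h\<^sup>2"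
    proof -
      have "\<bar>D\<bar> \<le> \<bar>A * h\<bar>" using D by linarith
      then show ?thesis by (metis abs_le_square_iff power_mult_distrib)
    qed
    have D'2: "D'\<^sup>2 \<le> 2 * (W \<omega>)\<^sup>2 + 2 * (A\<^sup>2 * h\<^sup>2)"
    proof -
      have "D'\<^sup>2 + (W \<omega> + D)\<^sup>2 = 2 * (W \<omega>)\<^sup>2 + 2 * D\<^sup>2" by (simp add: D'_def power2_eq_square algebra_simps)
      then show ?thesis using D2 zero_le_power2[of "W \<omega> + D"] by linarith
    qed
    have D'4: "D'\<^sup>2 * D'\<^sup>2 \<le> 8 * W \<omega> ^ 4 + 8 * (A ^ 4 * h ^ 4)"
    proof -
      have "D'\<^sup>2 * D'\<^sup>2 \<le> (2 * (W \<omega>)\<^sup>2 + 2 * (A\<^sup>2 * h\<^sup>2)) * (2 * (W \<omega>)\<^sup>2 + 2 * (A\<^sup>2 * h\<^sup>2))"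
        using D'2 by (intro mult_mono) auto
      also have "\<dots> \<le> 8 * ((W \<omega>)\<^sup>2)\<^sup>2 + 8 * (A\<^sup>2 * h\<^sup>2)\<^sup>2"
        using zero_le_power2[of "(W \<omega>)\<^sup>2 - A\<^sup>2 * h\<^sup>2"] by (simp add: power2_eq_square algebra_simps)
      finally show ?thesis by (simp add: power_mult_distrib flip: power_mult)
    qed
    have t1: "(e1 + K * D'\<^sup>2) * D'\<^sup>2 / 2 \<le> e1 * ((W \<omega>)\<^sup>2 + A\<^sup>2 * h\<^sup>2) + K * (4 * W \<omega> ^ 4 + 4 * A ^ 4 * h ^ 4)"
    proof -
      have "e1 * D'\<^sup>2 \<le> e1 * (2 * (W \<omega>)\<^sup>2 + 2 * (A\<^sup>2 * h\<^sup>2))" using D'2 e1 by (intro mult_left_mono) auto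
      moreover have "K * (D'\<^sup>2 * D'\<^sup>2) \<le> K * (8 * W \<omega> ^ 4 + 8 * (A ^ 4 * h ^ 4))" using D'4 K by (intro mult_left_mono) auto
      ultimately show ?thesis by (simp add: algebra_simps)
    qed
    \<comment> \<open>The first absolute moment is avoided: |W| is at most \<open>e2\<close>, or
      else at most W^2/\<open>e2\<close>.\<close>
    have WD: "\<bar>W \<omega> * D\<bar> \<le> A * h * (e2 + (W \<omega>)\<^sup>2 / e2)"
    proof -
      have "\<bar>W \<omega>\<bar> \<le> e2 + (W \<omega>)\<^sup>2 / e2"
      proof (cases "\<bar>W \<omega>\<bar> \<le> e2")
        case True
        moreover have "0 \<le> (W \<omega>)\<^sup>2 / e2" using e2 by simp
        ultimately show ?thesis by linarith
      next
        case False
        then have "\<bar>W \<omega>\<bar> * e2 \<le> \<bar>W \<omega>\<bar> * \<bar>W \<omega>\<bar>" by (intro mult_left_mono) auto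
        then have "\<bar>W \<omega>\<bar> \<le> (W \<omega>)\<^sup>2 / e2" using e2 by (simp add: field_simps power2_eq_square)
        then show ?thesis using e2 by linarith
      qed
      then have "\<bar>W \<omega>\<bar> * \<bar>D\<bar> \<le> (e2 + (W \<omega>)\<^sup>2 / e2) * (A * h)" using D e2 by (intro mult_mono) auto
      then show ?thesis by (simp add: abs_mult mult.commute)
    qed
    have t2: "\<bar>g'' x * D'\<^sup>2 / 2 - g'' x * (W \<omega>)\<^sup>2 / 2\<bar> \<le> G2 * (A * h * (e2 + (W \<omega>)\<^sup>2 / e2) + A\<^sup>2 * h\<^sup>2 / 2)"
    proof -
      have sq: "D'\<^sup>2 = (W \<omega>)\<^sup>2 - 2 * (W \<omega> * D) + D\<^sup>2" by (simp add: D'_def power2_eq_square algebra_simps)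
      have "g'' x * D'\<^sup>2 / 2 - g'' x * (W \<omega>)\<^sup>2 / 2 = g'' x * (D\<^sup>2 / 2 - W \<omega> * D)"
        unfolding sq by (simp add: field_simps)
      moreover have "\<bar>D\<^sup>2 / 2 - W \<omega> * D\<bar> \<le> A * h * (e2 + (W \<omega>)\<^sup>2 / e2) + A\<^sup>2 * h\<^sup>2 / 2"
        using WD D2 zero_le_power2[of D] by linarith
      ultimately show ?thesis using G(3,6) by (simp add: abs_mult mult_mono)
    qed
    have t3: "\<bar>g' x * D' - g' x * (W \<omega> - h * an)\<bar> \<le> G1 * \<bar>D - h * an\<bar>"
    proof -
      have "g' x * D' - g' x * (W \<omega> - h * an) = g' x * (h * an - D)" by (simp add: D'_def algebra_simps)
      then show ?thesis using G(2)[of x] by (simp add: abs_mult mult_right_mono abs_minus_commute)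
    qed
    have main: "\<bar>g (x + D') - V \<omega>\<bar> \<le> G1 * \<bar>D - h * an\<bar> + G2 * (A * h * (e2 + (W \<omega>)\<^sup>2 / e2) + A\<^sup>2 * h\<^sup>2 / 2)
      + e1 * ((W \<omega>)\<^sup>2 + A\<^sup>2 * h\<^sup>2) + K * (4 * W \<omega> ^ 4 + 4 * A ^ 4 * h ^ 4)"
      unfolding V_def using tay t1 t2 t3 by linarith
    show ?thesis
    proof (cases "\<omega> \<in> E")
      case False
      have "G1 * \<bar>D - h * an\<bar> \<le> G1 * (h * (2 * L * d))" using Dan'[OF False] G by (intro mult_left_mono)
      then show ?thesis using main ZY[OF False] False unfolding R_def D'_def by (simp add: algebra_simps)
    next
      case True
      have "\<bar>Z \<omega> - g (x + D')\<bar> \<le> 2 * G0"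
        using G(1)[of "X x h \<omega>"] G(1)[of "x + D'"] G(4) unfolding Z_def by (auto simp: indicator_def)
      moreover have "G1 * \<bar>D - h * an\<bar> \<le> G1 * (2 * A * h)" using Dan G by (intro mult_left_mono)
      moreover have "0 \<le> h * (2 * L * d * G1)" using h L d G by auto
      ultimately show ?thesis using main True unfolding R_def by (simp add: algebra_simps)
    qed
  qed
  have i1: "integrable M W" using Wi[of 1] by simp
  have i2: "integrable M (\<lambda>\<omega>. (W \<omega>)\<^sup>2)" using Wi[of 2] by simp
  have i4: "integrable M (\<lambda>\<omega>. W \<omega> ^ 4)" using Wi[of 4] by simp
  have iE: "integrable M (indicator E :: _ \<Rightarrow> real)" using E(1) by (simp add: integrable_indicator_iff emeasure_eq_measure)
  have m1: "(\<integral>\<omega>. W \<omega> \<partial>M) = 0" "(\<integral>\<omega>. (W \<omega>)\<^sup>2 \<partial>M) = h" "(\<integral>\<omega>. W \<omega> ^ 4 \<partial>M) = 3 * h\<^sup>2"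
    unfolding W_def using brownian_moments[OF BM _ h] by auto
  have iV: "integrable M V" unfolding V_def using i1 i2 by (intro Bochner_Integration.integrable_add Bochner_Integration.integrable_diff integrable_mult_right integrable_divide) auto
  have iR: "integrable M R" unfolding R_def using i2 i4 iE
    by (intro Bochner_Integration.integrable_add Bochner_Integration.integrable_diff integrable_mult_right integrable_divide) auto
  have "(\<integral>\<omega>. Z \<omega> \<partial>M) - (\<integral>\<omega>. V \<omega> \<partial>M) = (\<integral>\<omega>. Z \<omega> - V \<omega> \<partial>M)" using Zi iV by simp
  moreover have "(\<integral>\<omega>. V \<omega> \<partial>M) = g x + h * (g'' x / 2 - an * g' x)"
    unfolding V_def using i1 i2 m1 by (simp add: algebra_simps prob_space)
  moreover have "\<bar>\<integral>\<omega>. Z \<omega> - V \<omega> \<partial>M\<bar> \<le> (\<integral>\<omega>. R \<omega> \<partial>M)"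
  proof -
    have "norm (\<integral>\<omega>. Z \<omega> - V \<omega> \<partial>M) \<le> (\<integral>\<omega>. R \<omega> \<partial>M)"
      by (rule order_trans[OF integral_norm_bound integral_mono]) (use Zi iV iR pw in auto)
    then show ?thesis by simp
  qed
  moreover have "(\<integral>\<omega>. R \<omega> \<partial>M) = h * (2 * L * d * G1) + G2 * (A * h * (e2 + h / e2) + A\<^sup>2 * h\<^sup>2 / 2)
      + e1 * (h + A\<^sup>2 * h\<^sup>2) + K * (4 * (3 * h\<^sup>2) + 4 * A ^ 4 * h ^ 4) + (2 * G0 + 2 * A * G1 * h) * measure M E"
    unfolding R_def using i2 i4 iE m1 E(1) by (simp add: prob_space)
  moreover have "h * (2 * L * d * G1) + G2 * (A * h * (e2 + h / e2) + A\<^sup>2 * h\<^sup>2 / 2)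
      + e1 * (h + A\<^sup>2 * h\<^sup>2) + K * (4 * (3 * h\<^sup>2) + 4 * A ^ 4 * h ^ 4)
     = h * (2 * L * d * G1 + G2 * A * (e2 + h / e2) + G2 * A\<^sup>2 * h / 2 + e1 * (1 + A\<^sup>2 * h) + K * (12 * h + 4 * A ^ 4 * h ^ 3))"
    by (simp add: algebra_simps power2_eq_square power3_eq_cube power4_eq_xxxx)
  ultimately show ?thesis unfolding an_def Z_def by linarith
qed

text \<open>Compact support makes the estimate uniform in x: a single truncated drift serves all
  starting points, since it agrees with \<open>\<alpha>\<close> wherever \<open>g'\<close> is
  nonzero.\<close>

lemma generator_estimate:
  assumes d1: "\<And>x. (g has_real_derivative g' x) (at x)" and d2: "\<And>x. (g' has_real_derivative g'' x) (at x)"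
    and c2: "continuous_on UNIV g''" and sup: "\<And>x. x \<notin> {p..q} \<Longrightarrow> g x = 0" and p: "0 < p" and e: "0 < e"
  shows "\<exists>h0>0. \<forall>h. 0 < h \<and> h < h0 \<longrightarrow> (\<forall>x>0. \<bar>(\<integral>\<omega>. indicator {\<omega>. surv x h \<omega>} \<omega> * g (X x h \<omega>) \<partial>M) - g x - h * (g'' x / 2 - \<alpha> x * g' x)\<bar> \<le> e * h)"
proof -
  have c0: "continuous_on UNIV g" "continuous_on UNIV g'"
    using d1 d2 by (meson DERIV_continuous_on has_field_derivative_at_within)+
  have s1: "g' x = 0" if "x \<notin> {p..q}" for x by (rule compact_support_derivative_zero[OF d1 sup that])
  have s2: "g'' x = 0" if "x \<notin> {p..q}" for x by (rule compact_support_derivative_zero[OF d2 s1 that])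
  obtain G0 where G0: "G0 \<ge> 0" "\<And>x. \<bar>g x\<bar> \<le> G0" using compact_support_bounded[OF c0(1) sup] by blast
  obtain G1 where G1: "G1 \<ge> 0" "\<And>x. \<bar>g' x\<bar> \<le> G1" using compact_support_bounded[OF c0(2) s1] by blast
  obtain G2 where G2: "G2 \<ge> 0" "\<And>x. \<bar>g'' x\<bar> \<le> G2" using compact_support_bounded[OF c2 s2] by blast
  obtain N where N: "lo N < p / 2" "q + 6 < hi N" using ex_lo_hi[of "p/2" "q + 6"] p by auto
  obtain A L where A: "0 \<le> A" "bdd_lip A L (trunc_drift N)" using bdd_lip_trunc by blast
  have L: "0 \<le> L" using A(2) by (simp add: bdd_lip_def)
  \<comment> \<open>Each of \<open>e1\<close>, \<open>e2\<close>, \<open>d\<close> keeps one term of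
    \<open>\<psi>\<close> that survives at h = 0 below e/4, so \<open>\<psi> 0\<close> is at most
    3e/4. All other terms, that of the exceptional event included, vanish at h = 0.\<close>
  define e1 where "e1 = e / 4"
  define e2 where "e2 = e / (4 * (G2 * A + 1))"
  define d where "d = min (min 1 (p / 16)) (e / (8 * (L * G1 + 1)))"
  have pos: "0 < G2 * A + 1" "0 < L * G1 + 1" using G2 G1 A L by (auto intro: add_nonneg_pos)
  have e12: "0 < e1" "0 < e2" "0 < d" "d \<le> 1" using e p pos by (auto simp: e1_def e2_def d_def)
  have e12: "0 < e1" "0 < e2" "0 < d" "d \<le> 1" "d \<le> p / 16"
  proof -
    show "d \<le> p / 16" unfolding d_def by (rule order_trans[OF min.cobounded1 min.cobounded2])
  qed (use e12 in auto)
  obtain K where K: "K \<ge> 0" "\<And>x y. \<bar>g'' y - g'' x\<bar> \<le> e1 + K * (y - x)\<^sup>2"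
    using compact_support_modulus[OF c2 s2 e12(1)] by blast
  obtain C where C: "C > 0" "\<And>d h. d > 0 \<Longrightarrow> h > 0 \<Longrightarrow> \<exists>E\<in>sets M. measure M E \<le> C * h\<^sup>2 / d ^ 4 \<and> (\<forall>\<omega>\<in>space M - E. \<forall>u\<in>{0..h}. \<bar>B u \<omega>\<bar> \<le> d)"
    using brownian_sup_bound[OF BM] by blast
  define \<psi> where "\<psi> h = 2 * L * d * G1 + G2 * A * (e2 + h / e2) + G2 * A\<^sup>2 * h / 2 + e1 * (1 + A\<^sup>2 * h) + K * (12 * h + 4 * A ^ 4 * h ^ 3)
      + (2 * G0 + 2 * A * G1 * h) * (C * h / d ^ 4)" for h
  have "isCont \<psi> 0" unfolding \<psi>_def by (intro continuous_intros) (use e12 in auto)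
  moreover have "\<psi> 0 < e"
  proof -
    have "2 * L * d * G1 \<le> e / 4"
    proof -
      have "(L * G1) * d \<le> (L * G1 + 1) * (e / (8 * (L * G1 + 1)))"
        using e12 L G1 e pos by (intro mult_mono) (auto simp: d_def)
      also have "\<dots> = e / 8"
      proof -
        have "z * (e / (8 * z)) = e / 8" if "0 < z" for z :: real using that by simp
        from this[OF pos(2)] show ?thesis .
      qed
      finally show ?thesis by (simp add: algebra_simps)
    qed
    moreover have "G2 * A * e2 \<le> e / 4"
    proof -
      have "G2 * A * e2 \<le> (G2 * A + 1) * e2" using e12 by (intro mult_right_mono) auto
      also have "\<dots> = e / 4"
      proof -
        have "z * (e / (4 * z)) = e / 4" if "0 < z" for z :: real using that by simp
        from this[OF pos(1)] show ?thesis unfolding e2_def .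
      qed
      finally show ?thesis .
    qed
    ultimately show ?thesis using e by (simp add: \<psi>_def e1_def)
  qed
  ultimately have "\<forall>\<^sub>F h in at 0. \<psi> h < e" by (intro order_tendstoD(2)) (auto simp: isCont_def)
  then obtain r where r: "r > 0" "\<And>h. h \<noteq> 0 \<Longrightarrow> \<bar>h\<bar> < r \<Longrightarrow> \<psi> h < e" by (auto simp: eventually_at dist_real_def)
  show ?thesis
  proof (intro exI[of _ "min r (d / (A + 1))"] conjI allI impI)
    show "0 < min r (d / (A + 1))" using r e12 A by auto
    fix h x :: real assume hh: "0 < h \<and> h < min r (d / (A + 1))" and x: "0 < x"
    then have h: "0 < h" "h < r" "h < d / (A + 1)" by auto
    have "h * (A + 1) < d" using h(3) A by (simp add: field_simps)
    then have Ah: "A * h \<le> d" using h by (simp add: algebra_simps)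
    obtain E where E: "E \<in> sets M" "measure M E \<le> C * h\<^sup>2 / d ^ 4" "\<forall>\<omega>\<in>space M - E. \<forall>u\<in>{0..h}. \<bar>B u \<omega>\<bar> \<le> d"
      using C(2)[OF e12(3) h(1)] by blast
    have "\<bar>(\<integral>\<omega>. indicator {\<omega>. surv x h \<omega>} \<omega> * g (X x h \<omega>) \<partial>M) - g x - h * (g'' x / 2 - trunc_drift N x * g' x)\<bar>
    \<le> h * (2 * L * d * G1 + G2 * A * (e2 + h / e2) + G2 * A\<^sup>2 * h / 2 + e1 * (1 + A\<^sup>2 * h) + K * (12 * h + 4 * A ^ 4 * h ^ 3))
      + (2 * G0 + 2 * A * G1 * h) * measure M E"
      by (rule generator_estimate_explicit[OF d1 d2 c0(1) sup G0(2) G1(2) G2(2) G0(1) G1(1) G2(1) K(2) K(1) e12(1,2) A(2,1) Ah e12(3,5,4) _ _ x h(1) E(1)])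
        (use N E(3) in auto)
    also have "\<dots> \<le> h * \<psi> h"
    proof -
      have "(2 * G0 + 2 * A * G1 * h) * measure M E \<le> (2 * G0 + 2 * A * G1 * h) * (C * h\<^sup>2 / d ^ 4)"
        using E(2) G0 G1 A h by (intro mult_left_mono) auto
      then show ?thesis unfolding \<psi>_def by (simp add: algebra_simps power2_eq_square)
    qed
    also have "\<dots> \<le> e * h" using r(2)[of h] h by (simp add: mult.commute)
    finally have *: "\<bar>(\<integral>\<omega>. indicator {\<omega>. surv x h \<omega>} \<omega> * g (X x h \<omega>) \<partial>M) - g x - h * (g'' x / 2 - trunc_drift N x * g' x)\<bar> \<le> e * h" .
    have eq: "trunc_drift N x * g' x = \<alpha> x * g' x"
    proof (cases "x \<in> {p..q}")
      case True
      then have "x \<in> {lo N..hi N}" using N p by auto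
      then show ?thesis using trunc_drift_eq by simp
    qed (use s1 in auto)
    show "\<bar>(\<integral>\<omega>. indicator {\<omega>. surv x h \<omega>} \<omega> * g (X x h \<omega>) \<partial>M) - g x - h * (g'' x / 2 - \<alpha> x * g' x)\<bar> \<le> e * h"
      using * unfolding eq .
  qed
qed

end

section \<open>Local minorization by Lebesgue measure\<close>

text \<open>Cover \<open>S\<close> by nonoverlapping intervals of total length at most |S| + e. Each
  is mapped into an interval of 2\<open>\<Lambda>\<close> times its length, centred at the image of
  the left endpoint. Stating the bound for a Borel subset \<open>A\<close> of the image avoids
  measurability of the image itself.\<close>

lemma emeasure_lipschitz_image_le:
  fixes f :: "real \<Rightarrow> real"
  assumes lip: "\<And>u v. u \<in> {l..r} \<Longrightarrow> v \<in> {l..r} \<Longrightarrow> \<bar>f u - f v\<bar> \<le> \<Lambda> * \<bar>u - v\<bar>" and \<Lambda>: "0 \<le> \<Lambda>"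
    and S: "S \<in> sets borel" "S \<subseteq> {l..r}" and A: "A \<in> sets borel" "A \<subseteq> f ` S"
  shows "emeasure lborel A \<le> ennreal (2 * \<Lambda>) * emeasure lborel S"
proof -
  have fS: "emeasure lborel S < \<infinity>"
  proof -
    have "emeasure lborel S \<le> emeasure lborel {l..r}" using S by (intro emeasure_mono) auto
    also have "\<dots> < \<infinity>" by (metis emeasure_lborel_cbox_finite cbox_interval)
    finally show ?thesis .
  qed
  have cS: "emeasure lebesgue S = emeasure lborel S" using S(1) by (simp add: main_part_sets)
  have Sl: "S \<in> lmeasurable"
    by (rule fmeasurableI) (use S(1) fS cS in \<open>simp_all add: sets_completionI_sets\<close>)
  have eS: "emeasure lborel S = ennreal (measure lebesgue S)"
    unfolding cS[symmetric] by (rule emeasure_eq_ennreal_measure) (use fS cS in simp)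
  have step: "emeasure lborel A \<le> ennreal (2 * \<Lambda> * (measure lebesgue S + e))" if e: "0 < e" for e
  proof -
    have Sc: "S \<subseteq> cbox l r" using S(2) by (simp add: cbox_interval)
    obtain \<D> where D: "countable \<D>" "\<And>K. K \<in> \<D> \<Longrightarrow> K \<subseteq> cbox l r \<and> K \<noteq> {} \<and> (\<exists>c d. K = cbox c d)"
      "pairwise (\<lambda>A B. interior A \<inter> interior B = {}) \<D>"
      "S \<subseteq> \<Union>\<D>" "\<Union>\<D> \<in> lmeasurable" "measure lebesgue (\<Union>\<D>) \<le> measure lebesgue S + e"
      by (rule measurable_outer_intervals_bounded[OF Sl Sc e]) (rule that)
    define lo' where "lo' K = Inf K" for K :: "real set"
    define hi' where "hi' K = Sup K" for K :: "real set"
    have K: "K = {lo' K..hi' K} \<and> lo' K \<le> hi' K" if KD: "K \<in> \<D>" for K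
    proof -
      obtain c d where cd: "K = {c..d}" "K \<noteq> {}" using D(2)[OF KD] by (auto simp: cbox_interval)
      then have "c \<le> d" by auto
      then show ?thesis using cd by (simp add: lo'_def hi'_def)
    qed
    define J where "J K = {f (lo' K) - \<Lambda> * (hi' K - lo' K)..f (lo' K) + \<Lambda> * (hi' K - lo' K)}" for K
    have sub: "A \<subseteq> (\<Union>K\<in>\<D>. J K)"
    proof
      fix y assume "y \<in> A"
      then obtain c where c: "c \<in> S" "y = f c" using A by auto
      then obtain K' where K': "K' \<in> \<D>" "c \<in> K'" using D(4) by auto
      have KK: "K' = {lo' K'..hi' K'}" "lo' K' \<le> hi' K'" using K[OF K'(1)] by blast+
      have lr: "K' \<subseteq> {l..r}" using D(2)[OF K'(1)] by (simp add: cbox_interval)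
      have c': "c \<in> {lo' K'..hi' K'}" using K'(2) KK(1) by simp
      have "lo' K' \<in> K'" using KK(2) by (subst KK(1)) simp
      then have "\<bar>f c - f (lo' K')\<bar> \<le> \<Lambda> * \<bar>c - lo' K'\<bar>" using lr K'(2) by (intro lip) blast+
      also have "\<dots> \<le> \<Lambda> * (hi' K' - lo' K')" using c' \<Lambda> by (intro mult_left_mono) auto
      finally show "y \<in> (\<Union>K\<in>\<D>. J K)" using K'(1) c(2) by (auto simp: J_def abs_le_iff intro!: bexI[of _ K'])
    qed
    have eJ: "emeasure lborel (J K) = ennreal (2 * \<Lambda>) * emeasure lborel (interior K)" if "K \<in> \<D>" for K
    proof -
      have le: "lo' K \<le> hi' K" using K[OF that] by blast
      then have "0 \<le> \<Lambda> * (hi' K - lo' K)" using \<Lambda> by simp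
      then have "emeasure lborel (J K) = ennreal (2 * \<Lambda> * (hi' K - lo' K))"
        unfolding J_def by (subst emeasure_lborel_Icc) (auto intro!: arg_cong[of _ _ ennreal])
      also have "\<dots> = ennreal (2 * \<Lambda>) * ennreal (hi' K - lo' K)" using le \<Lambda> by (simp add: ennreal_mult)
      also have "ennreal (hi' K - lo' K) = emeasure lborel {lo' K<..<hi' K}" using le by simp
      also have "{lo' K<..<hi' K} = interior {lo' K..hi' K}" by (simp only: interior_atLeastAtMost_real)
      also have "{lo' K..hi' K} = K" using K[OF that] by blast
      finally show ?thesis .
    qed
    have dj: "disjoint_family_on interior \<D>"
      using D(3) by (auto simp: disjoint_family_on_def pairwise_def)
    have "emeasure lborel A = (\<integral>\<^sup>+y. indicator A y \<partial>lborel)" using A(1) by simp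
    also have "\<dots> \<le> (\<integral>\<^sup>+y. \<integral>\<^sup>+K. indicator (J K) y \<partial>count_space \<D> \<partial>lborel)"
    proof (rule nn_integral_mono)
      fix y :: real
      show "indicator A y \<le> (\<integral>\<^sup>+K. indicator (J K) y \<partial>count_space \<D>)"
      proof (cases "y \<in> A")
        case True
        then obtain K' where "K' \<in> \<D>" "y \<in> J K'" using sub by blast
        then show ?thesis using nn_integral_ge_point[of K' \<D> "\<lambda>K. indicator (J K) y"] True by simp
      qed simp
    qed
    also have "\<dots> = (\<integral>\<^sup>+K. \<integral>\<^sup>+y. indicator (J K) y \<partial>lborel \<partial>count_space \<D>)"
      by (rule nn_integral_count_space_nn_integral) (use D(1) in \<open>auto simp: J_def\<close>)
    also have "\<dots> = (\<integral>\<^sup>+K. emeasure lborel (J K) \<partial>count_space \<D>)"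
      by (rule nn_integral_cong) (simp add: J_def)
    also have "\<dots> = (\<integral>\<^sup>+K. ennreal (2 * \<Lambda>) * emeasure lborel (interior K) \<partial>count_space \<D>)"
      by (rule nn_integral_cong) (use eJ in auto)
    also have "\<dots> = ennreal (2 * \<Lambda>) * (\<integral>\<^sup>+K. emeasure lborel (interior K) \<partial>count_space \<D>)"
      by (rule nn_integral_cmult) auto
    also have "(\<integral>\<^sup>+K. emeasure lborel (interior K) \<partial>count_space \<D>) = emeasure lborel (\<Union>K\<in>\<D>. interior K)"
      by (rule emeasure_UN_countable[symmetric, OF _ D(1) dj]) auto
    also have "ennreal (2 * \<Lambda>) * \<dots> \<le> ennreal (2 * \<Lambda>) * ennreal (measure lebesgue S + e)"
    proof (rule mult_left_mono)
      have "emeasure lborel (\<Union>K\<in>\<D>. interior K) = emeasure lebesgue (\<Union>K\<in>\<D>. interior K)"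
      proof -
        have "(\<Union>K\<in>\<D>. interior K) \<in> sets borel" by (rule borel_open) auto
        then show ?thesis by (simp add: main_part_sets)
      qed
      also have "\<dots> \<le> emeasure lebesgue (\<Union>\<D>)"
        using D(5) interior_subset by (intro emeasure_mono) (auto simp: fmeasurable_def)
      also have "\<dots> = ennreal (measure lebesgue (\<Union>\<D>))"
        using D(5) by (intro emeasure_eq_ennreal_measure) (auto simp: fmeasurable_def)
      also have "\<dots> \<le> ennreal (measure lebesgue S + e)" using D(6) by (rule ennreal_leI)
      finally show "emeasure lborel (\<Union>K\<in>\<D>. interior K) \<le> ennreal (measure lebesgue S + e)" .
    qed simp
    also have "\<dots> = ennreal (2 * \<Lambda> * (measure lebesgue S + e))" using \<Lambda> e by (simp add: ennreal_mult)
    finally show ?thesis .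
  qed
  have "((\<lambda>e. ennreal (2 * \<Lambda> * (measure lebesgue S + e))) \<longlongrightarrow> ennreal (2 * \<Lambda> * (measure lebesgue S + 0))) (at_right 0)"
    by (intro tendsto_intros)
  then have "emeasure lborel A \<le> ennreal (2 * \<Lambda> * (measure lebesgue S + 0))"
    by (rule tendsto_lowerbound) (auto intro!: eventually_at_right_less[THEN eventually_mono] step)
  then show ?thesis using eS \<Lambda> by (simp add: ennreal_mult)
qed

section \<open>Steering by a linear drift\<close>

context killed
begin

text \<open>Under the tilted measure the drifted path has the law of \<open>B\<close> on [0,s]. The
  left side does not involve the slope \<open>c\<close>, which leaves it free to be
  averaged.\<close>

lemma cameron_martin_PP:
  assumes g: "g \<in> borel_measurable borel" and s: "0 < s"
  shows "PP s g x = (\<integral>\<^sup>+\<omega>. ennreal (exp (- c * B s \<omega> - c\<^sup>2 * s / 2)) *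
    (indicator {\<omega>. lives x (\<lambda>u. B u \<omega> + c * u) s} \<omega> * g (pth x (\<lambda>u. B u \<omega> + c * u) s)) \<partial>M)"
proof -
  let ?C = "\<lambda>u \<omega>. B u \<omega> + c * u"
  let ?N = "density M (\<lambda>\<omega>. ennreal (exp (- c * B s \<omega> - c\<^sup>2 * s / 2)))"
  let ?F = "\<lambda>w. if livesq x w s then g (posq x w s) * 1 else 0 :: ennreal"
  have F: "?F \<in> borel_measurable (path_space s)"
    using path_functional_measurable[of g "\<lambda>_. 1" s s x] g s by simp
  have cC: "continuous_on {0..s} (\<lambda>u. ?C u \<omega>)" if "\<omega> \<in> space M" for \<omega>
    using B_continuous'[OF that] by (intro continuous_intros)
  have gm: "(\<lambda>\<omega>. ?F (path_of s ?C \<omega>)) \<in> borel_measurable M"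
    by (rule measurable_compose[OF path_of_measurable F]) measurable
  have "PP s g x = (\<integral>\<^sup>+\<omega>. ?F (path_of s B \<omega>) \<partial>M)"
    unfolding PP_def
  proof (rule nn_integral_cong)
    fix \<omega> assume w: "\<omega> \<in> space M"
    show "indicator {\<omega>. surv x s \<omega>} \<omega> * g (X x s \<omega>) = ?F (path_of s B \<omega>)"
      using path_functional_eq[of s B \<omega> s x g "\<lambda>_. 1", OF B_continuous'[OF w]] s by (simp add: surv_def X_def)
  qed
  also have "\<dots> = (\<integral>\<^sup>+\<omega>. ?F (path_of s ?C \<omega>) \<partial>?N)"
    by (rule path_law_transfer[OF brownian_shift_grid[OF BM s] _ F]) (use s in auto)
  also have "\<dots> = (\<integral>\<^sup>+\<omega>. ennreal (exp (- c * B s \<omega> - c\<^sup>2 * s / 2)) * ?F (path_of s ?C \<omega>) \<partial>M)"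
    using gm by (subst nn_integral_density) auto
  also have "\<dots> = (\<integral>\<^sup>+\<omega>. ennreal (exp (- c * B s \<omega> - c\<^sup>2 * s / 2)) *
    (indicator {\<omega>. lives x (\<lambda>u. B u \<omega> + c * u) s} \<omega> * g (pth x (\<lambda>u. B u \<omega> + c * u) s)) \<partial>M)"
  proof (rule nn_integral_cong)
    fix \<omega> assume w: "\<omega> \<in> space M"
    have "?F (path_of s ?C \<omega>) = indicator {\<omega>. lives x (\<lambda>u. B u \<omega> + c * u) s} \<omega> * g (pth x (\<lambda>u. B u \<omega> + c * u) s)"
      using path_functional_eq[of s ?C \<omega> s x g "\<lambda>_. 1", OF cC[OF w]] s by simp
    then show "ennreal (exp (- c * B s \<omega> - c\<^sup>2 * s / 2)) * ?F (path_of s ?C \<omega>) = ennreal (exp (- c * B s \<omega> - c\<^sup>2 * s / 2)) *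
      (indicator {\<omega>. lives x (\<lambda>u. B u \<omega> + c * u) s} \<omega> * g (pth x (\<lambda>u. B u \<omega> + c * u) s))" by simp
  qed
  finally show ?thesis .
qed

text \<open>For a fixed small Brownian path the endpoint is a Lipschitz function of the slope c of an added linear
  drift, and as c varies it sweeps over the whole interval; averaging the Cameron--Martin formula over c
  turns this into a lower bound by Lebesgue measure.\<close>

lemma steering_set_large:
  assumes A: "bdd_lip A0 L (trunc_drift N)" "0 \<le> A0" "A0 * s \<le> d" and d: "0 < d" "d \<le> a / 16" "d \<le> 1"
    and N: "lo N \<le> a / 2" "b + 6 \<le> hi N" and s: "0 < s" and w: "continuous_on {0..s} w" "\<And>u. u \<in> {0..s} \<Longrightarrow> \<bar>w u\<bar> \<le> d"
    and x: "x \<in> {a..b}" and D: "D \<in> sets borel" "D \<subseteq> {a..b}" and \<rho>: "\<rho> = (b - a + 3) / s"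
  shows "emeasure lborel D \<le> ennreal (2 * (s * exp (L * s))) *
    emeasure lborel {c\<in>{-\<rho>..\<rho>}. lives x (\<lambda>u. w u + c * u) s \<and> pth x (\<lambda>u. w u + c * u) s \<in> D}"
proof -
  define \<Phi> where "\<Phi> c = tsol N x (\<lambda>u. w u + c * u)" for c
  have cw: "continuous_on {0..s} (\<lambda>u. w u + c * u)" for c using w(1) by (intro continuous_intros)
  have L: "0 \<le> L" using A(1) by (simp add: bdd_lip_def)
  have dev: "\<bar>\<Phi> c u - (x + c * u)\<bar> \<le> 2 * d" if u: "u \<in> {0..s}" for c u
  proof -
    have "A0 * u \<le> A0 * s" using A u by (intro mult_left_mono) auto
    then show ?thesis using tsol_deviation[OF cw A(1,2) u, of x c] w(2)[OF u] A(3) by (simp add: \<Phi>_def)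
  qed
  have lip: "\<bar>\<Phi> c s - \<Phi> c' s\<bar> \<le> (s * exp (L * s)) * \<bar>c - c'\<bar>" for c c'
  proof -
    have "\<bar>\<Phi> c s - \<Phi> c' s\<bar> \<le> (\<bar>c - c'\<bar> * s) * exp (L * s)"
      unfolding \<Phi>_def
    proof (rule lip_stability[OF A(1) tsol_eq(1)[OF cw] tsol_eq(2)[OF cw] tsol_eq(1)[OF cw] tsol_eq(2)[OF cw]])
      fix u assume u: "u \<in> {0..s}"
      have "x + (w u + c * u) - (x + (w u + c' * u)) = (c - c') * u" by (simp add: algebra_simps)
      then show "\<bar>x + (w u + c * u) - (x + (w u + c' * u))\<bar> \<le> \<bar>c - c'\<bar> * s"
        using u by (simp add: abs_mult mult_left_mono)
    qed (use s in auto)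
    then show ?thesis by (simp add: algebra_simps)
  qed
  let ?S = "{c\<in>{-\<rho>..\<rho>}. lives x (\<lambda>u. w u + c * u) s \<and> pth x (\<lambda>u. w u + c * u) s \<in> D}"
  have Sm: "?S \<in> sets borel"
  proof -
    have [measurable]: "Measurable.pred borel (\<lambda>c. lives x (\<lambda>u. w u + c * u) s)"
      by (rule lives_measurable) (use cw s in auto)
    have [measurable]: "(\<lambda>c. pth x (\<lambda>u. w u + c * u) s) \<in> borel_measurable borel"
      by (rule pth_measurable) (use cw s in auto)
    note [measurable] = D(1)
    have "{c\<in>space borel. c \<in> {-\<rho>..\<rho>} \<and> lives x (\<lambda>u. w u + c * u) s \<and> pth x (\<lambda>u. w u + c * u) s \<in> D} \<in> sets borel"
      by measurable
    then show ?thesis by simp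
  qed
  show ?thesis
  proof (rule emeasure_lipschitz_image_le[where f="\<lambda>c. \<Phi> c s" and l="-\<rho>" and r=\<rho>])
    show "\<bar>\<Phi> u s - \<Phi> v s\<bar> \<le> s * exp (L * s) * \<bar>u - v\<bar>" for u v by (rule lip)
    show "0 \<le> s * exp (L * s)" using s by simp
    show "D \<subseteq> (\<lambda>c. \<Phi> c s) ` ?S"
    proof
      fix y assume y: "y \<in> D"
      then have yab: "y \<in> {a..b}" using D by auto
      \<comment> \<open>The extreme slopes move the endpoint by b - a + 3 with an error of at most
        2d <= 2, so they overshoot [a,b] on either side; the intermediate value theorem supplies a
        slope that ends at y.\<close>
      have \<rho>s: "\<rho> * s = b - a + 3" using \<rho> s by simp
      have "(s * exp (L * s))-lipschitz_on UNIV (\<lambda>c. \<Phi> c s)"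
        using lip s by (intro lipschitz_onI) (auto simp: dist_real_def)
      then have cont: "continuous_on UNIV (\<lambda>c. \<Phi> c s)" by (rule lipschitz_on_continuous_on)
      have \<rho>0: "- \<rho> \<le> \<rho>" using \<rho> s x by simp
      have "\<Phi> (-\<rho>) s \<le> y" using dev[of s "-\<rho>"] \<rho>s s x yab d by auto
      moreover have "y \<le> \<Phi> \<rho> s" using dev[of s \<rho>] \<rho>s s x yab d by auto
      ultimately have "\<exists>c\<ge>-\<rho>. c \<le> \<rho> \<and> \<Phi> c s = y"
        using \<rho>0 by (intro IVT') (auto intro: continuous_on_subset[OF cont])
      then obtain c where c: "c \<in> {-\<rho>..\<rho>}" "\<Phi> c s = y" by auto
      have cs: "\<bar>y - (x + c * s)\<bar> \<le> 2 * d" using dev[of s c] c s by auto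
      \<comment> \<open>The straight line with this slope stays within 2d of [a,b], being monotone
        with both ends there, so the solution never leaves the range where truncation is
        invisible.\<close>
      have rng: "\<Phi> c u \<in> {lo N..hi N}" if u: "u \<in> {0..s}" for u
      proof -
        have "x + c * u \<in> {a - 2 * d..b + 2 * d}"
        proof (cases "0 \<le> c")
          case True
          then have "0 \<le> c * u" "c * u \<le> c * s" using u by (auto intro: mult_left_mono)
          then show ?thesis using cs yab x d by auto
        next
          case False
          then have "c * u \<le> 0" "c * s \<le> c * u" using u by (auto intro: mult_left_mono_neg simp: mult_nonpos_nonneg)
          then show ?thesis using cs yab x d by auto
        qed
        then show ?thesis using dev[OF u, of c] d N by auto
      qed
      have "lives x (\<lambda>u. w u + c * u) s" "pth x (\<lambda>u. w u + c * u) s = \<Phi> c s"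
        using pth_tsol(1)[where N=N and x=x and t=s and b="\<lambda>u. w u + c * u", OF cw]
          pth_tsol(2)[where N=N and x=x and t=s and b="\<lambda>u. w u + c * u" and u=s, OF cw] rng s unfolding \<Phi>_def by auto
      then show "y \<in> (\<lambda>c. \<Phi> c s) ` ?S" using c y by (intro image_eqI[of _ _ c]) auto
    qed
  qed (use Sm D in auto)
qed

text \<open>The Cameron--Martin formula is integrated over all slopes |c| <= \<open>\<rho>\<close>.
  For each small Brownian path the slopes that land in D form a set of measure at least a multiple
  of |D|, and the weight is bounded below there; exchanging the integrals gives the bound for
  \<open>PP\<close>.\<close>

lemma minorization:
  assumes ab: "0 < a" "a \<le> b"
  shows "\<exists>s>0. \<exists>e>0. \<forall>x\<in>{a..b}. \<forall>D\<in>sets borel. ennreal e * emeasure lborel (D \<inter> {a..b}) \<le> PP s (indicator D) x"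
proof -
  define d where "d = min 1 (a / 16)"
  have d: "0 < d" "d \<le> a / 16" "d \<le> 1" using ab by (auto simp: d_def)
  obtain N where N: "lo N < a / 2" "b + 6 < hi N" using ex_lo_hi[of "a/2" "b + 6"] ab by auto
  obtain A0 L where A: "0 \<le> A0" "bdd_lip A0 L (trunc_drift N)" using bdd_lip_trunc by blast
  obtain C where C: "C > 0" "\<And>d h. d > 0 \<Longrightarrow> h > 0 \<Longrightarrow> \<exists>E\<in>sets M. measure M E \<le> C * h\<^sup>2 / d ^ 4 \<and> (\<forall>\<omega>\<in>space M - E. \<forall>u\<in>{0..h}. \<bar>B u \<omega>\<bar> \<le> d)"
    using brownian_sup_bound[OF BM] by blast
  \<comment> \<open>Two requirements: A0 s <= d, so that the drift moves the path by at most d, and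
    C s^2/d^4 <= 1/2, so that small Brownian paths have probability at least 1/2. The bound s <= 1
    serves to replace s^2 by s.\<close>
  define s where "s = min (d / (A0 + 1)) (min 1 (d ^ 4 / (2 * C)))"
  have s: "0 < s" "s \<le> 1" "s \<le> d / (A0 + 1)" "s \<le> d ^ 4 / (2 * C)" using d A C by (auto simp: s_def)
  have As: "A0 * s \<le> d"
  proof -
    have "s * (A0 + 1) \<le> d" using s(3) A by (simp add: pos_le_divide_eq)
    then show ?thesis using s(1) by (simp add: algebra_simps)
  qed
  obtain E where E: "E \<in> sets M" "measure M E \<le> C * s\<^sup>2 / d ^ 4" "\<forall>\<omega>\<in>space M - E. \<forall>u\<in>{0..s}. \<bar>B u \<omega>\<bar> \<le> d"
    using C(2)[OF d(1) s(1)] by blast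
  have mE: "measure M E \<le> 1 / 2"
  proof -
    have "s\<^sup>2 \<le> s" using s by (simp add: power2_eq_square mult_left_le)
    then have "C * s\<^sup>2 / d ^ 4 \<le> C * (d ^ 4 / (2 * C)) / d ^ 4"
      using s C d by (intro divide_right_mono mult_left_mono) auto
    moreover have "C * (d ^ 4 / (2 * C)) / d ^ 4 = 1 / 2" using C(1) d(1) by simp
    ultimately show ?thesis using E(2) by linarith
  qed
  define G where "G = space M - E"
  have G[measurable]: "G \<in> sets M" using E by (auto simp: G_def)
  have mG: "ennreal (1 / 2) \<le> emeasure M G"
    unfolding G_def emeasure_eq_measure using mE E(1) by (intro ennreal_leI) (simp add: prob_compl)
  define \<rho> where "\<rho> = (b - a + 3) / s"
  have \<rho>: "0 < \<rho>" using ab s by (simp add: \<rho>_def)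
  define \<Lambda> where "\<Lambda> = s * exp (L * s)"
  have \<Lambda>: "0 < \<Lambda>" using s by (simp add: \<Lambda>_def)
  \<comment> \<open>Lower bound for the Cameron--Martin weight when |c| <= \<open>\<rho>\<close> and
    |B s| <= d.\<close>
  define wm where "wm = exp (- \<rho> * d - \<rho>\<^sup>2 * s / 2)"
  have main: "ennreal (wm / 2) * emeasure lborel D \<le> ennreal (4 * \<Lambda> * \<rho>) * PP s (indicator D) x"
    if x: "x \<in> {a..b}" and D: "D \<in> sets borel" "D \<subseteq> {a..b}" for x D
  proof -
    note [measurable] = D(1)
    define J where "J c \<omega> = ennreal (exp (- c * B s \<omega> - c\<^sup>2 * s / 2)) *
      (indicator {\<omega>. lives x (\<lambda>u. B u \<omega> + c * u) s} \<omega> * indicator D (pth x (\<lambda>u. B u \<omega> + c * u) s))" for c \<omega>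
    interpret pair_sigma_finite lborel M ..
    have [measurable]: "Measurable.pred (lborel \<Otimes>\<^sub>M M) (\<lambda>z. lives x (\<lambda>u. B u (snd z) + fst z * u) s)"
      by (rule lives_measurable)
        (use s B_continuous' in \<open>auto simp: space_pair_measure intro!: continuous_intros\<close>)
    have [measurable]: "(\<lambda>z. pth x (\<lambda>u. B u (snd z) + fst z * u) s) \<in> borel_measurable (lborel \<Otimes>\<^sub>M M)"
      by (rule pth_measurable)
        (use s B_continuous' in \<open>auto simp: space_pair_measure intro!: continuous_intros\<close>)
    have Jm: "(\<lambda>z. indicator {-\<rho>..\<rho>} (fst z) * J (fst z) (snd z)) \<in> borel_measurable (lborel \<Otimes>\<^sub>M M)"
    proof -
      have "(\<lambda>z. indicator {-\<rho>..\<rho>} (fst z) * (ennreal (exp (- fst z * B s (snd z) - (fst z)\<^sup>2 * s / 2)) *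
        ((if lives x (\<lambda>u. B u (snd z) + fst z * u) s then 1 else 0) * indicator D (pth x (\<lambda>u. B u (snd z) + fst z * u) s))))
          \<in> borel_measurable (lborel \<Otimes>\<^sub>M M)" by measurable
      then show ?thesis by (simp add: J_def indicator_def of_bool_def)
    qed
    have "ennreal (2 * \<rho>) * PP s (indicator D) x = (\<integral>\<^sup>+c. indicator {-\<rho>..\<rho>} c * PP s (indicator D) x \<partial>lborel)"
      using \<rho> by (simp add: nn_integral_multc)
    also have "\<dots> = (\<integral>\<^sup>+c. \<integral>\<^sup>+\<omega>. indicator {-\<rho>..\<rho>} c * J c \<omega> \<partial>M \<partial>lborel)"
    proof (rule nn_integral_cong)
      fix c :: real
      have "PP s (indicator D) x = (\<integral>\<^sup>+\<omega>. J c \<omega> \<partial>M)" unfolding J_def by (rule cameron_martin_PP[OF _ s(1)]) simp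
      then show "indicator {-\<rho>..\<rho>} c * PP s (indicator D) x = (\<integral>\<^sup>+\<omega>. indicator {-\<rho>..\<rho>} c * J c \<omega> \<partial>M)"
        by (auto simp: indicator_def)
    qed
    also have "\<dots> = (\<integral>\<^sup>+\<omega>. \<integral>\<^sup>+c. indicator {-\<rho>..\<rho>} c * J c \<omega> \<partial>lborel \<partial>M)"
      using Fubini[of "\<lambda>z. indicator {-\<rho>..\<rho>} (fst z) * J (fst z) (snd z)"] Jm by simp
    finally have F: "ennreal (2 * \<rho>) * PP s (indicator D) x = (\<integral>\<^sup>+\<omega>. \<integral>\<^sup>+c. indicator {-\<rho>..\<rho>} c * J c \<omega> \<partial>lborel \<partial>M)" .
    have low: "ennreal wm * emeasure lborel D * indicator G \<omega> \<le> ennreal (2 * \<Lambda>) * (\<integral>\<^sup>+c. indicator {-\<rho>..\<rho>} c * J c \<omega> \<partial>lborel)"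
      if w: "\<omega> \<in> space M" for \<omega>
    proof (cases "\<omega> \<in> G")
      case True
      have bd: "\<bar>B u \<omega>\<bar> \<le> d" if "u \<in> {0..s}" for u using E(3) True that by (auto simp: G_def)
      let ?S = "{c\<in>{-\<rho>..\<rho>}. lives x (\<lambda>u. B u \<omega> + c * u) s \<and> pth x (\<lambda>u. B u \<omega> + c * u) s \<in> D}"
      have "emeasure lborel D \<le> ennreal (2 * \<Lambda>) * emeasure lborel ?S"
        unfolding \<Lambda>_def by (rule steering_set_large[OF A(2,1) As d _ _ s(1) B_continuous'[OF w] bd x D \<rho>_def]) (use N in auto)
      then have "ennreal wm * emeasure lborel D \<le> ennreal wm * (ennreal (2 * \<Lambda>) * emeasure lborel ?S)"
        by (rule mult_left_mono) simp
      also have "\<dots> = ennreal (2 * \<Lambda>) * (ennreal wm * emeasure lborel ?S)" by (simp add: mult_ac)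
      also have "ennreal wm * emeasure lborel ?S \<le> (\<integral>\<^sup>+c. indicator {-\<rho>..\<rho>} c * J c \<omega> \<partial>lborel)"
      proof -
        have Sm: "?S \<in> sets lborel"
        proof -
          have [measurable]: "Measurable.pred borel (\<lambda>c. lives x (\<lambda>u. B u \<omega> + c * u) s)"
            by (rule lives_measurable) (use B_continuous'[OF w] s in \<open>auto intro!: continuous_intros\<close>)
          have [measurable]: "(\<lambda>c. pth x (\<lambda>u. B u \<omega> + c * u) s) \<in> borel_measurable borel"
            by (rule pth_measurable) (use B_continuous'[OF w] s in \<open>auto intro!: continuous_intros\<close>)
          have "{c\<in>space borel. c \<in> {-\<rho>..\<rho>} \<and> lives x (\<lambda>u. B u \<omega> + c * u) s \<and> pth x (\<lambda>u. B u \<omega> + c * u) s \<in> D} \<in> sets borel"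
            by measurable
          then show ?thesis by simp
        qed
        then have "ennreal wm * emeasure lborel ?S = (\<integral>\<^sup>+c. ennreal wm * indicator ?S c \<partial>lborel)"
          by (simp add: nn_integral_cmult_indicator)
        also have "\<dots> \<le> (\<integral>\<^sup>+c. indicator {-\<rho>..\<rho>} c * J c \<omega> \<partial>lborel)"
        proof (rule nn_integral_mono)
          fix c
          have "wm \<le> exp (- c * B s \<omega> - c\<^sup>2 * s / 2)" if c: "c \<in> {-\<rho>..\<rho>}"
          proof -
            have "\<bar>c * B s \<omega>\<bar> \<le> \<rho> * d" unfolding abs_mult using c bd[of s] s \<rho> by (intro mult_mono) auto
            moreover have "c\<^sup>2 \<le> \<rho>\<^sup>2" using c by (intro abs_le_square_iff[THEN iffD1]) auto
            then have "c\<^sup>2 * s \<le> \<rho>\<^sup>2 * s" using s by (intro mult_right_mono) auto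
            ultimately show ?thesis unfolding wm_def by (subst exp_le_cancel_iff) auto
          qed
          then show "ennreal wm * indicator ?S c \<le> indicator {-\<rho>..\<rho>} c * J c \<omega>"
            by (auto simp: indicator_def J_def intro!: ennreal_leI)
        qed
        finally show ?thesis .
      qed
      finally show ?thesis using True by (simp add: mult_left_mono)
    qed simp
    have "ennreal wm * emeasure lborel D * ennreal (1/2) \<le> ennreal wm * emeasure lborel D * emeasure M G"
      using mG by (rule mult_left_mono) simp
    also have "\<dots> = (\<integral>\<^sup>+\<omega>. ennreal wm * emeasure lborel D * indicator G \<omega> \<partial>M)"
      by (simp add: nn_integral_cmult_indicator)
    also have "\<dots> \<le> (\<integral>\<^sup>+\<omega>. ennreal (2 * \<Lambda>) * (\<integral>\<^sup>+c. indicator {-\<rho>..\<rho>} c * J c \<omega> \<partial>lborel) \<partial>M)"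
      by (rule nn_integral_mono) (rule low)
    also have "\<dots> = ennreal (2 * \<Lambda>) * (\<integral>\<^sup>+\<omega>. \<integral>\<^sup>+c. indicator {-\<rho>..\<rho>} c * J c \<omega> \<partial>lborel \<partial>M)"
    proof (rule nn_integral_cmult)
      have "(\<lambda>z. indicator {-\<rho>..\<rho>} (snd z) * J (snd z) (fst z)) \<in> borel_measurable (M \<Otimes>\<^sub>M lborel)"
        using measurable_compose[OF measurable_pair_swap' Jm] by (simp add: split_beta')
      from lborel.borel_measurable_nn_integral_fst[OF this]
      show "(\<lambda>\<omega>. \<integral>\<^sup>+c. indicator {-\<rho>..\<rho>} c * J c \<omega> \<partial>lborel) \<in> borel_measurable M" by simp
    qed
    also have "\<dots> = ennreal (2 * \<Lambda>) * (ennreal (2 * \<rho>) * PP s (indicator D) x)" unfolding F ..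
    also have "\<dots> = ennreal (4 * \<Lambda> * \<rho>) * PP s (indicator D) x"
      using \<Lambda> \<rho> by (simp add: mult.assoc[symmetric] ennreal_mult[symmetric])
    finally have "ennreal wm * ennreal (1/2) * emeasure lborel D \<le> ennreal (4 * \<Lambda> * \<rho>) * PP s (indicator D) x"
      by (simp add: mult_ac)
    moreover have "ennreal wm * ennreal (1/2) = ennreal (wm / 2)"
      unfolding wm_def by (subst ennreal_mult[symmetric]) auto
    ultimately show ?thesis by simp
  qed
  show ?thesis
  proof (rule exI[of _ s], intro conjI s(1), rule exI[of _ "(wm / 2) / (4 * \<Lambda> * \<rho>)"], intro conjI ballI)
    show "0 < wm / 2 / (4 * \<Lambda> * \<rho>)" using \<Lambda> \<rho> by (simp add: wm_def)
    fix x D assume x: "x \<in> {a..b}" and D: "D \<in> sets (borel :: real measure)"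
    have "ennreal (wm / 2 / (4 * \<Lambda> * \<rho>)) * emeasure lborel (D \<inter> {a..b})
       = ennreal (1 / (4 * \<Lambda> * \<rho>)) * (ennreal (wm / 2) * emeasure lborel (D \<inter> {a..b}))"
      using \<Lambda> \<rho> by (simp add: mult.assoc[symmetric] ennreal_mult[symmetric] wm_def)
    also have "\<dots> \<le> ennreal (1 / (4 * \<Lambda> * \<rho>)) * (ennreal (4 * \<Lambda> * \<rho>) * PP s (indicator (D \<inter> {a..b})) x)"
      by (rule mult_left_mono[OF main[OF x]]) (use D in auto)
    also have "\<dots> = PP s (indicator (D \<inter> {a..b})) x"
      using \<Lambda> \<rho> by (simp add: mult.assoc[symmetric] ennreal_mult[symmetric])
    also have "\<dots> \<le> PP s (indicator D) x"
      unfolding PP_def by (intro nn_integral_mono mult_left_mono) (auto simp: indicator_def)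
    finally show "ennreal (wm / 2 / (4 * \<Lambda> * \<rho>)) * emeasure lborel (D \<inter> {a..b}) \<le> PP s (indicator D) x" .
  qed
qed

end

section \<open>Uniform ergodicity under a Doeblin condition\<close>

locale markov_kernels =
  fixes Q :: "real \<Rightarrow> real \<Rightarrow> real measure"
  assumes Q_prob: "0 < t \<Longrightarrow> prob_space (Q t x)"
    and Q_sets[measurable_cong, simp]: "sets (Q t x) = sets borel"
    and Q_kernel: "0 < t \<Longrightarrow> A \<in> sets borel \<Longrightarrow> (\<lambda>x. emeasure (Q t x) A) \<in> borel_measurable borel"
    and Q_CK: "0 < s \<Longrightarrow> 0 < t \<Longrightarrow> g \<in> borel_measurable borel \<Longrightarrow>
      (\<integral>\<^sup>+z. g z \<partial>Q (s + t) x) = (\<integral>\<^sup>+y. (\<integral>\<^sup>+z. g z \<partial>Q t y) \<partial>Q s x)"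
begin

lemma Q_space[simp]: "space (Q t x) = UNIV"
  using sets_eq_imp_space_eq[OF Q_sets[of t x]] by simp

lemma Q_subprob: "0 < t \<Longrightarrow> Q t \<in> measurable borel (subprob_algebra borel)"
  by (rule measurable_subprob_algebra) (auto intro: Q_kernel prob_space_imp_subprob_space Q_prob)

definition bdd_meas :: "real \<Rightarrow> (real \<Rightarrow> real) \<Rightarrow> bool" where
  "bdd_meas C g \<longleftrightarrow> g \<in> borel_measurable borel \<and> (\<forall>x. \<bar>g x\<bar> \<le> C)"

definition Qg :: "real \<Rightarrow> (real \<Rightarrow> real) \<Rightarrow> real \<Rightarrow> real" where
  "Qg t g x = (\<integral>y. g y \<partial>Q t x)"

lemma bdd_meas_meas[measurable_dest]: "bdd_meas C g \<Longrightarrow> g \<in> borel_measurable borel" by (simp add: bdd_meas_def)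
lemma bdd_meas_le: "bdd_meas C g \<Longrightarrow> \<bar>g x\<bar> \<le> C" by (simp add: bdd_meas_def)
lemma bdd_meas_nonneg: "bdd_meas C g \<Longrightarrow> 0 \<le> C" using bdd_meas_le[of C g 0] by linarith

lemma Qg_integrable:
  assumes "bdd_meas C g" "0 < t"
  shows "integrable (Q t x) g"
proof -
  interpret prob_space "Q t x" by (rule Q_prob[OF assms(2)])
  show ?thesis by (rule integrable_const_bound[where B=C]) (use assms in \<open>auto simp: bdd_meas_def measurable_def\<close>)
qed

lemma Qg_bounds:
  assumes g: "bdd_meas C g" and lu: "\<And>y. l \<le> g y" "\<And>y. g y \<le> u" and t: "0 < t"
  shows "l \<le> Qg t g x" "Qg t g x \<le> u"
proof -
  interpret prob_space "Q t x" by (rule Q_prob[OF t])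
  have "(\<integral>y. l \<partial>Q t x) \<le> Qg t g x" unfolding Qg_def
    by (rule integral_mono) (use Qg_integrable[OF g t] lu in auto)
  then show "l \<le> Qg t g x" using prob_space by simp
  have "Qg t g x \<le> (\<integral>y. u \<partial>Q t x)" unfolding Qg_def
    by (rule integral_mono) (use Qg_integrable[OF g t] lu in auto)
  then show "Qg t g x \<le> u" using prob_space by simp
qed

lemma Qg_bdd_meas:
  assumes g: "bdd_meas C g" and t: "0 < t"
  shows "bdd_meas C (Qg t g)"
proof -
  have "(\<lambda>M. integral\<^sup>L M g) \<in> borel_measurable (subprob_algebra borel)"
    using g by (intro integral_measurable_subprob_algebra) (simp add: bdd_meas_def)
  from measurable_compose[OF Q_subprob[OF t] this] have "Qg t g \<in> borel_measurable borel" by (simp add: Qg_def[abs_def])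
  moreover have "\<bar>Qg t g x\<bar> \<le> C" for x
    using Qg_bounds[OF g _ _ t, of "-C" C x] bdd_meas_le[OF g] by (simp add: abs_le_iff) (smt (verit))
  ultimately show ?thesis by (simp add: bdd_meas_def)
qed

lemma Qg_add: "bdd_meas C f \<Longrightarrow> bdd_meas D g \<Longrightarrow> 0 < t \<Longrightarrow> Qg t (\<lambda>y. f y + g y) x = Qg t f x + Qg t g x"
  unfolding Qg_def by (rule Bochner_Integration.integral_add) (auto intro: Qg_integrable)

lemma Qg_cmult: "Qg t (\<lambda>y. c * g y) x = c * Qg t g x"
  unfolding Qg_def by simp

lemma Qg_const: "0 < t \<Longrightarrow> Qg t (\<lambda>_. c) x = c"
  unfolding Qg_def using prob_space.prob_space[OF Q_prob, of t x] by simp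

lemma bdd_meas_const: "bdd_meas \<bar>c\<bar> (\<lambda>_. c)" by (simp add: bdd_meas_def)
lemma bdd_meas_add: "bdd_meas C f \<Longrightarrow> bdd_meas D g \<Longrightarrow> bdd_meas (C + D) (\<lambda>y. f y + g y)"
  by (auto simp: bdd_meas_def intro!: order_trans[OF abs_triangle_ineq] add_mono)
lemma bdd_meas_cmult: "bdd_meas C f \<Longrightarrow> bdd_meas (\<bar>c\<bar> * C) (\<lambda>y. c * f y)"
  by (auto simp: bdd_meas_def abs_mult intro: mult_left_mono)
lemma bdd_meas_diff: "bdd_meas C f \<Longrightarrow> bdd_meas D g \<Longrightarrow> bdd_meas (C + D) (\<lambda>y. f y - g y)"
  using bdd_meas_add[OF _ bdd_meas_cmult[of D g "-1"], of C f] by simp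
lemma bdd_meas_indicator: "A \<in> sets borel \<Longrightarrow> bdd_meas 1 (indicator A)"
  by (auto simp: bdd_meas_def indicator_def)

lemma Qg_nonneg_eq: "bdd_meas C g \<Longrightarrow> (\<And>y. 0 \<le> g y) \<Longrightarrow> 0 < t \<Longrightarrow> (\<integral>\<^sup>+y. ennreal (g y) \<partial>Q t x) = ennreal (Qg t g x)"
  unfolding Qg_def by (rule nn_integral_eq_integral) (auto intro: Qg_integrable)

lemma Qg_CK_nonneg:
  assumes g: "bdd_meas C g" "\<And>y. 0 \<le> g y" and st: "0 < s" "0 < t"
  shows "Qg (s + t) g x = Qg s (Qg t g) x"
proof -
  have nn: "0 \<le> Qg t g y" for y by (rule Qg_bounds(1)[OF g(1,2) _ st(2), of C]) (use bdd_meas_le[OF g(1)] in \<open>auto simp: abs_le_iff\<close>)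
  have "ennreal (Qg (s + t) g x) = (\<integral>\<^sup>+z. ennreal (g z) \<partial>Q (s + t) x)" using Qg_nonneg_eq[OF g] st by simp
  also have "\<dots> = (\<integral>\<^sup>+y. (\<integral>\<^sup>+z. ennreal (g z) \<partial>Q t y) \<partial>Q s x)" by (rule Q_CK) (use st g in \<open>auto simp: bdd_meas_def\<close>)
  also have "\<dots> = (\<integral>\<^sup>+y. ennreal (Qg t g y) \<partial>Q s x)" using Qg_nonneg_eq[OF g] st by simp
  also have "\<dots> = ennreal (Qg s (Qg t g) x)" by (rule Qg_nonneg_eq[OF Qg_bdd_meas[OF g(1) st(2)] nn st(1)])
  finally show ?thesis
    using nn Qg_bounds(1)[OF Qg_bdd_meas[OF g(1) st(2)] nn _ st(1), of C x] Qg_bounds(1)[OF g(1,2) _ , of C "s+t" x] st bdd_meas_le[OF g(1)] bdd_meas_le[OF Qg_bdd_meas[OF g(1) st(2)]]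
    by (auto simp: abs_le_iff)
qed

text \<open>Adding the constant C reduces to nonnegative functions, where the kernel identity
  applies.\<close>

lemma Qg_CK:
  assumes g: "bdd_meas C g" and st: "0 < s" "0 < t"
  shows "Qg (s + t) g x = Qg s (Qg t g) x"
proof -
  have C: "bdd_meas \<bar>C\<bar> (\<lambda>_. C)" by (rule bdd_meas_const)
  have b: "bdd_meas (C + \<bar>C\<bar>) (\<lambda>y. g y + C)" by (rule bdd_meas_add[OF g C])
  have nn: "0 \<le> g y + C" for y using bdd_meas_le[OF g, of y] by linarith
  have e: "Qg t (\<lambda>y. g y + C) y = Qg t g y + C" for y
    using Qg_add[OF g C st(2)] Qg_const[OF st(2)] by simp
  have "Qg (s + t) g x + C = Qg (s + t) (\<lambda>y. g y + C) x"
    using Qg_add[OF g C] Qg_const st by simp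
  also have "\<dots> = Qg s (Qg t (\<lambda>y. g y + C)) x" by (rule Qg_CK_nonneg[OF b nn st])
  also have "\<dots> = Qg s (\<lambda>y. Qg t g y + C) x" unfolding e[abs_def] ..
  also have "\<dots> = Qg s (Qg t g) x + C" using Qg_add[OF Qg_bdd_meas[OF g st(2)] C st(1)] Qg_const[OF st(1)] by simp
  finally show ?thesis by simp
qed

end

locale doeblin = markov_kernels +
  fixes T \<theta> :: real and m :: "real measure"
  assumes T: "0 < T" and \<theta>: "0 < \<theta>" and m_prob: "prob_space m" and m_sets[measurable_cong, simp]: "sets m = sets borel"
    and minor: "A \<in> sets borel \<Longrightarrow> ennreal \<theta> * emeasure m A \<le> emeasure (Q T x) A"
begin

lemma minor_integral:
  assumes g: "bdd_meas C g" "\<And>y. 0 \<le> g y"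
  shows "\<theta> * (\<integral>y. g y \<partial>m) \<le> Qg T g x"
proof -
  interpret m: prob_space m by (rule m_prob)
  have im: "integrable m g"
    by (rule m.integrable_const_bound[of _ C]) (use g(1) in \<open>auto simp: bdd_meas_def measurable_def sets_eq_imp_space_eq[OF m_sets]\<close>)
  have "ennreal (\<theta> * (\<integral>y. g y \<partial>m)) = ennreal \<theta> * (\<integral>\<^sup>+y. ennreal (g y) \<partial>m)"
    using \<theta> g im by (simp add: nn_integral_eq_integral ennreal_mult integral_nonneg)
  also have "\<dots> = (\<integral>\<^sup>+y. ennreal (g y) \<partial>scale_measure (ennreal \<theta>) m)"
    using g(1) by (subst nn_integral_scale_measure) (auto simp: bdd_meas_def)
  also have "\<dots> \<le> (\<integral>\<^sup>+y. ennreal (g y) \<partial>Q T x)"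
    by (rule nn_integral_mono_measure) (auto simp: le_measure minor)
  also have "\<dots> = ennreal (Qg T g x)" by (rule Qg_nonneg_eq[OF g T])
  finally show ?thesis
    using Qg_bounds(1)[OF g _ T, of C x] bdd_meas_le[OF g(1)] by (auto simp: abs_le_iff)
qed

text \<open>The minorization applied to g - l and to u - g raises the lower bound by
  \<open>\<theta>\<close> (k - l) and lowers the upper one by \<open>\<theta>\<close> (u - k), where
  k is the mean under \<open>m\<close>. The width shrinks by the factor 1 - \<open>\<theta>\<close>
  whatever k is.\<close>

lemma contraction:
  assumes g: "bdd_meas C g" "\<And>y. l \<le> g y" "\<And>y. g y \<le> u"
  shows "\<exists>l' u'. u' - l' \<le> (1 - \<theta>) * (u - l) \<and> (\<forall>x. l' \<le> Qg T g x \<and> Qg T g x \<le> u')"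
proof -
  interpret m: prob_space m by (rule m_prob)
  have im: "integrable m g"
    by (rule m.integrable_const_bound[of _ C]) (use g(1) in \<open>auto simp: bdd_meas_def measurable_def sets_eq_imp_space_eq[OF m_sets]\<close>)
  define k where "k = (\<integral>y. g y \<partial>m)"
  have bl: "bdd_meas \<bar>l\<bar> (\<lambda>_. l)" "bdd_meas \<bar>u\<bar> (\<lambda>_. u)" by (rule bdd_meas_const)+
  have 1: "\<theta> * (k - l) \<le> Qg T g x - l" for x
  proof -
    have "\<theta> * (\<integral>y. g y - l \<partial>m) \<le> Qg T (\<lambda>y. g y - l) x"
      by (rule minor_integral[OF bdd_meas_diff[OF g(1) bl(1)]]) (use g in auto)
    moreover have "Qg T (\<lambda>y. g y - l) x = Qg T g x - l"
      using Qg_add[OF g(1) bdd_meas_const[of "-l"] T] Qg_const[OF T, of "-l"] by simp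
    ultimately show ?thesis using im by (simp add: k_def m.prob_space)
  qed
  have 2: "\<theta> * (u - k) \<le> u - Qg T g x" for x
  proof -
    have "\<theta> * (\<integral>y. u - g y \<partial>m) \<le> Qg T (\<lambda>y. u - g y) x"
      by (rule minor_integral[OF bdd_meas_diff[OF bl(2) g(1)]]) (use g in auto)
    moreover have "Qg T (\<lambda>y. u - g y) x = u - Qg T g x"
      using Qg_add[OF bdd_meas_const[of u] bdd_meas_cmult[OF g(1), of "-1"] T] Qg_const[OF T, of u] Qg_cmult[of T "-1" g] by simp
    ultimately show ?thesis using im by (simp add: k_def m.prob_space)
  qed
  show ?thesis
    using 1 2 by (intro exI[of _ "l + \<theta> * (k - l)"] exI[of _ "u - \<theta> * (u - k)"]) (auto simp: algebra_simps)
qed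

lemma theta_le: "\<theta> \<le> 1"
proof -
  have "ennreal \<theta> * emeasure m UNIV \<le> emeasure (Q T 0) UNIV" by (rule minor) simp
  then have "ennreal \<theta> \<le> 1"
    using prob_space.emeasure_space_1[OF m_prob] prob_space.emeasure_space_1[OF Q_prob[OF T, of 0]]
    by (simp add: sets_eq_imp_space_eq[OF m_sets])
  then show ?thesis by simp
qed

text \<open>Bounds reached at one time persist, because a Markov operator preserves them. The shift
  by 1 keeps times positive already for n = 0, since the kernels are controlled for t > 0
  only.\<close>

lemma oscillation:
  assumes g: "bdd_meas C g"
  shows "\<exists>l u. u - l \<le> (1 - \<theta>) ^ n * (2 * C) \<and> (\<forall>t\<ge>real n * T + 1. \<forall>x. l \<le> Qg t g x \<and> Qg t g x \<le> u)"
proof (induction n)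
  case 0
  have "-C \<le> g y" "g y \<le> C" for y using bdd_meas_le[OF g, of y] by (auto simp: abs_le_iff)
  then show ?case using Qg_bounds[OF g, of "-C" C] by (intro exI[of _ "-C"] exI[of _ C]) auto
next
  case (Suc n)
  then obtain l u where lu: "u - l \<le> (1 - \<theta>) ^ n * (2 * C)" "\<And>t x. t \<ge> real n * T + 1 \<Longrightarrow> l \<le> Qg t g x \<and> Qg t g x \<le> u"
    by blast
  define \<tau> where "\<tau> = real n * T + 1"
  define \<tau>' where "\<tau>' = real (Suc n) * T + 1"
  have \<tau>: "0 < \<tau>" "0 < \<tau>'" "\<tau>' = T + \<tau>" using T by (auto simp: \<tau>_def \<tau>'_def algebra_simps add_nonneg_pos add_pos_nonneg)
  have b\<tau>: "bdd_meas C (Qg \<tau> g)" by (rule Qg_bdd_meas[OF g \<tau>(1)])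
  obtain l' u' where lu': "u' - l' \<le> (1 - \<theta>) * (u - l)" "\<And>x. l' \<le> Qg T (Qg \<tau> g) x \<and> Qg T (Qg \<tau> g) x \<le> u'"
    using contraction[OF b\<tau>, of l u] lu(2) by (auto simp: \<tau>_def)
  have 1: "l' \<le> Qg \<tau>' g x \<and> Qg \<tau>' g x \<le> u'" for x using lu'(2)[of x] Qg_CK[OF g T \<tau>(1), of x] \<tau>(3) by simp
  have 2: "l' \<le> Qg t g x \<and> Qg t g x \<le> u'" if t: "t \<ge> \<tau>'" for t x
  proof (cases "t = \<tau>'")
    case False
    then have "Qg t g x = Qg (t - \<tau>') (Qg \<tau>' g) x" using Qg_CK[OF g _ \<tau>(2), of "t - \<tau>'" x] t by simp
    then show ?thesis using Qg_bounds[OF Qg_bdd_meas[OF g \<tau>(2)], of l' u' "t - \<tau>'" x] 1 False t by auto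
  qed (use 1 in auto)
  have "(1 - \<theta>) * (u - l) \<le> (1 - \<theta>) * ((1 - \<theta>) ^ n * (2 * C))" using lu(1) theta_le by (intro mult_left_mono) auto
  then show ?case using lu'(1) 2 unfolding \<tau>'_def by (intro exI[of _ l'] exI[of _ u']) auto
qed

text \<open>Integer times and the starting point 0 are arbitrary choices, immaterial by the
  uniformity in \<open>erg_uniform\<close>. At this stage \<open>erg\<close> is only a functional,
  not integration against a measure.\<close>

definition erg :: "(real \<Rightarrow> real) \<Rightarrow> real" where
  "erg g = lim (\<lambda>n. Qg (real n) g 0)"

lemma erg_uniform:
  assumes g: "bdd_meas C g" and e: "0 < e"
  shows "\<exists>t0>0. \<forall>t\<ge>t0. \<forall>x. \<bar>Qg t g x - erg g\<bar> \<le> e"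
proof -
  have small: "\<exists>t0>0. \<forall>t\<ge>t0. \<forall>t'\<ge>t0. \<forall>x x'. \<bar>Qg t g x - Qg t' g x'\<bar> \<le> e" if e: "0 < e" for e
  proof -
    have "(\<lambda>n. (1 - \<theta>) ^ n * (2 * C)) \<longlonglongrightarrow> 0 * (2 * C)"
      using \<theta> theta_le by (intro tendsto_mult LIMSEQ_power_zero) auto
    then have "(\<lambda>n. (1 - \<theta>) ^ n * (2 * C)) \<longlonglongrightarrow> 0" by simp
    then have "\<forall>\<^sub>F n in sequentially. (1 - \<theta>) ^ n * (2 * C) < e" using e by (rule order_tendstoD(2))
    then obtain n where n: "(1 - \<theta>) ^ n * (2 * C) < e" by (auto simp: eventually_sequentially)
    obtain l u where lu: "u - l \<le> (1 - \<theta>) ^ n * (2 * C)" "\<And>t x. t \<ge> real n * T + 1 \<Longrightarrow> l \<le> Qg t g x \<and> Qg t g x \<le> u"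
      using oscillation[OF g, of n] by blast
    have "\<bar>Qg t g x - Qg t' g x'\<bar> \<le> e" if "t \<ge> real n * T + 1" "t' \<ge> real n * T + 1" for t t' x x'
      using lu(2)[OF that(1), of x] lu(2)[OF that(2), of x'] lu(1) n by linarith
    moreover have "0 < real n * T + 1" using T by (simp add: add_nonneg_pos)
    ultimately show ?thesis by blast
  qed
  have "Cauchy (\<lambda>n. Qg (real n) g 0)"
  proof (rule metric_CauchyI)
    fix e :: real assume "0 < e"
    then obtain t0 where t0: "\<forall>t\<ge>t0. \<forall>t'\<ge>t0. \<forall>x x'. \<bar>Qg t g x - Qg t' g x'\<bar> \<le> e/2" using small[of "e/2"] by auto
    obtain N where "t0 \<le> real N" using real_arch_simple by blast
    then have "dist (Qg (real i) g 0) (Qg (real j) g 0) < e" if "i \<ge> N" "j \<ge> N" for i j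
      using t0[rule_format, of "real i" "real j" 0 0] that \<open>0 < e\<close> by (auto simp: dist_real_def)
    then show "\<exists>N. \<forall>i\<ge>N. \<forall>j\<ge>N. dist (Qg (real i) g 0) (Qg (real j) g 0) < e" by blast
  qed
  then have lim: "(\<lambda>n. Qg (real n) g 0) \<longlonglongrightarrow> erg g" unfolding erg_def by (simp add: Cauchy_convergent_iff convergent_LIMSEQ_iff)
  obtain t0 where t0: "t0 > 0" "\<And>t t' x x'. t \<ge> t0 \<Longrightarrow> t' \<ge> t0 \<Longrightarrow> \<bar>Qg t g x - Qg t' g x'\<bar> \<le> e" using small[OF e] by blast
  have "\<bar>Qg t g x - erg g\<bar> \<le> e" if t: "t \<ge> t0" for t x
  proof (rule LIMSEQ_le_const2)
    show "(\<lambda>n. \<bar>Qg t g x - Qg (real n) g 0\<bar>) \<longlonglongrightarrow> \<bar>Qg t g x - erg g\<bar>" using lim by (intro tendsto_intros)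
    obtain N where "t0 \<le> real N" using real_arch_simple by blast
    then show "\<exists>N. \<forall>n\<ge>N. \<bar>Qg t g x - Qg (real n) g 0\<bar> \<le> e" using t0(2)[OF t] by (intro exI[of _ N]) auto
  qed
  then show ?thesis using t0(1) by blast
qed

lemma erg_tendsto: "bdd_meas C g \<Longrightarrow> ((\<lambda>t. Qg t g x) \<longlongrightarrow> erg g) at_top"
proof (rule tendstoI)
  fix e :: real assume g: "bdd_meas C g" and e: "0 < e"
  obtain t0 where "\<forall>t\<ge>t0. \<forall>x. \<bar>Qg t g x - erg g\<bar> \<le> e/2" using erg_uniform[OF g, of "e/2"] e by auto
  then show "\<forall>\<^sub>F t in at_top. dist (Qg t g x) (erg g) < e"
    unfolding eventually_at_top_linorder dist_real_def using e
    by (intro exI[of _ t0]) (auto intro: le_less_trans[of _ "e/2"])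
qed

lemma erg_unique: "bdd_meas C g \<Longrightarrow> ((\<lambda>t. Qg t g x) \<longlongrightarrow> L) at_top \<Longrightarrow> erg g = L"
  by (rule tendsto_unique[OF trivial_limit_at_top_linorder erg_tendsto])

lemma at_top_pos: "\<forall>\<^sub>F t in at_top. (0::real) < t" by (rule eventually_gt_at_top)

lemma erg_add: assumes "bdd_meas C f" "bdd_meas D g" shows "erg (\<lambda>y. f y + g y) = erg f + erg g"
proof (rule erg_unique[where x=0, OF bdd_meas_add[OF assms]])
  show "((\<lambda>t. Qg t (\<lambda>y. f y + g y) 0) \<longlongrightarrow> erg f + erg g) at_top"
    by (rule Lim_transform_eventually[OF tendsto_add[OF erg_tendsto[OF assms(1), of 0] erg_tendsto[OF assms(2), of 0]]])
      (use Qg_add[OF assms] in \<open>auto intro!: eventually_mono[OF at_top_pos]\<close>)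
qed

lemma erg_cmult: assumes "bdd_meas C f" shows "erg (\<lambda>y. c * f y) = c * erg f"
proof (rule erg_unique[where x=0, OF bdd_meas_cmult[OF assms]])
  show "((\<lambda>t. Qg t (\<lambda>y. c * f y) 0) \<longlongrightarrow> c * erg f) at_top"
    unfolding Qg_cmult by (intro tendsto_intros erg_tendsto[OF assms])
qed

lemma erg_diff: assumes "bdd_meas C f" "bdd_meas D g" shows "erg (\<lambda>y. f y - g y) = erg f - erg g"
  using erg_add[OF assms(1) bdd_meas_cmult[OF assms(2), of "-1"]] erg_cmult[OF assms(2), of "-1"] by simp

lemma erg_const: "erg (\<lambda>_. c) = c"
  by (rule erg_unique[where x=0, OF bdd_meas_const], rule tendsto_eventually) (use Qg_const in \<open>auto intro!: eventually_mono[OF at_top_pos]\<close>)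

lemma erg_invariant:
  assumes g: "bdd_meas C g" and h: "0 < h"
  shows "erg (Qg h g) = erg g"
proof (rule erg_unique[where x=0, OF Qg_bdd_meas[OF g h]])
  have "filterlim (\<lambda>t. t + h) at_top (at_top :: real filter)"
    by (rule filterlim_at_top_mono[OF filterlim_ident]) (use h in auto)
  from filterlim_compose[OF erg_tendsto[OF g, of 0] this] have "((\<lambda>t. Qg (t + h) g 0) \<longlongrightarrow> erg g) at_top" .
  then show "((\<lambda>t. Qg t (Qg h g) 0) \<longlongrightarrow> erg g) at_top"
    by (rule Lim_transform_eventually) (use Qg_CK[OF g _ h] in \<open>auto intro!: eventually_mono[OF at_top_pos]\<close>)
qed

end

section \<open>Limit functional dominated by a reference law\<close>

locale doeblin_dom = doeblin +
  fixes pi :: "real measure" and C0 :: real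
  assumes pi_prob: "prob_space pi" and pi_sets[measurable_cong, simp]: "sets pi = sets borel" and C0: "0 < C0"
    and dom: "A \<in> sets borel \<Longrightarrow> emeasure (Q 1 x) A \<le> ennreal C0 * emeasure pi A"
    and pi_pos: "emeasure pi {..0} = 0"
begin

sublocale pi: prob_space pi by (rule pi_prob)

lemma pi_space[simp]: "space pi = UNIV" using sets_eq_imp_space_eq[OF pi_sets] by simp

lemma pi_UNIV: "measure pi UNIV = 1" using pi.prob_space by simp

lemma pi_integrable: "bdd_meas C g \<Longrightarrow> integrable pi g"
  by (rule pi.integrable_const_bound[of _ C]) (auto simp: bdd_meas_def measurable_def)

lemma dom_integral:
  assumes g: "g \<in> borel_measurable borel"
  shows "(\<integral>\<^sup>+y. g y \<partial>Q 1 x) \<le> ennreal C0 * (\<integral>\<^sup>+y. g y \<partial>pi)"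
proof -
  have "(\<integral>\<^sup>+y. g y \<partial>Q 1 x) \<le> (\<integral>\<^sup>+y. g y \<partial>scale_measure (ennreal C0) pi)"
    by (rule nn_integral_mono_measure) (auto simp: le_measure dom)
  then show ?thesis using g by (subst (asm) nn_integral_scale_measure) auto
qed

text \<open>By invariance g may be replaced by its image after one unit of time, which the kernel
  bound controls uniformly by the L1(\<open>pi\<close>) norm of g. This continuity later supplies
  countable additivity of \<open>erg\<close>.\<close>

lemma erg_dominated:
  assumes g: "bdd_meas C g"
  shows "\<bar>erg g\<bar> \<le> C0 * (\<integral>y. \<bar>g y\<bar> \<partial>pi)"
proof -
  have ba: "bdd_meas C (\<lambda>y. \<bar>g y\<bar>)" using g by (auto simp: bdd_meas_def)
  have 1: "Qg 1 (\<lambda>y. \<bar>g y\<bar>) x \<le> C0 * (\<integral>y. \<bar>g y\<bar> \<partial>pi)" for x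
  proof -
    have "ennreal (Qg 1 (\<lambda>y. \<bar>g y\<bar>) x) = (\<integral>\<^sup>+y. ennreal \<bar>g y\<bar> \<partial>Q 1 x)" using Qg_nonneg_eq[OF ba, of 1] by simp
    also have "\<dots> \<le> ennreal C0 * (\<integral>\<^sup>+y. ennreal \<bar>g y\<bar> \<partial>pi)" by (rule dom_integral) (use g in \<open>auto simp: bdd_meas_def\<close>)
    also have "\<dots> = ennreal (C0 * (\<integral>y. \<bar>g y\<bar> \<partial>pi))"
      using pi_integrable[OF ba] C0 by (simp add: nn_integral_eq_integral ennreal_mult integral_nonneg)
    finally show ?thesis using C0 by (simp add: integral_nonneg)
  qed
  have abs: "\<bar>Qg 1 g x\<bar> \<le> C0 * (\<integral>y. \<bar>g y\<bar> \<partial>pi)" for x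
  proof -
    have "\<bar>Qg 1 g x\<bar> \<le> Qg 1 (\<lambda>y. \<bar>g y\<bar>) x" unfolding Qg_def by (rule integral_abs_bound)
    then show ?thesis using 1[of x] by linarith
  qed
  have b: "bdd_meas (C0 * (\<integral>y. \<bar>g y\<bar> \<partial>pi)) (Qg 1 g)" using Qg_bdd_meas[OF g, of 1] abs by (simp add: bdd_meas_def)
  have "\<bar>erg (Qg 1 g)\<bar> \<le> C0 * (\<integral>y. \<bar>g y\<bar> \<partial>pi)"
  proof (rule tendsto_upperbound)
    show "((\<lambda>t. \<bar>Qg t (Qg 1 g) 0\<bar>) \<longlongrightarrow> \<bar>erg (Qg 1 g)\<bar>) at_top" by (intro tendsto_intros erg_tendsto[OF b])
    show "\<forall>\<^sub>F t in at_top. \<bar>Qg t (Qg 1 g) 0\<bar> \<le> C0 * (\<integral>y. \<bar>g y\<bar> \<partial>pi)"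
      by (rule eventually_mono[OF at_top_pos]) (use bdd_meas_le[OF Qg_bdd_meas[OF b]] in auto)
  qed simp
  then show ?thesis using erg_invariant[OF g, of 1] by simp
qed

text \<open>Both sides are continuous in L1(\<open>pi\<close>); bounded pointwise convergence on the
  positive half-line, which carries \<open>pi\<close>, suffices by dominated convergence.\<close>

lemma erg_approx:
  assumes g: "bdd_meas C g" and U: "\<And>n. bdd_meas C (U n)" and lim: "\<And>x. 0 < x \<Longrightarrow> (\<lambda>n. U n x) \<longlonglongrightarrow> g x"
    and eq: "\<And>n. erg (U n) = \<gamma> * (\<integral>y. U n y \<partial>pi)"
  shows "erg g = \<gamma> * (\<integral>y. g y \<partial>pi)"
proof -
  have [measurable]: "g \<in> borel_measurable borel" "\<And>n. U n \<in> borel_measurable borel" using g U by (auto simp: bdd_meas_def)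
  have ae: "AE x in pi. 0 < x"
    by (rule AE_I[of _ _ "{..0}"]) (use pi_pos in \<open>auto simp: not_less\<close>)
  have "(\<lambda>n. \<integral>y. \<bar>g y - U n y\<bar> \<partial>pi) \<longlonglongrightarrow> (\<integral>y. 0 \<partial>pi)"
  proof (rule integral_dominated_convergence[where w="\<lambda>_. 2 * C"])
    show "AE x in pi. (\<lambda>n. \<bar>g x - U n x\<bar>) \<longlonglongrightarrow> 0"
      using ae
    proof eventually_elim
      case (elim x)
      have "(\<lambda>n. \<bar>g x - U n x\<bar>) \<longlonglongrightarrow> \<bar>g x - g x\<bar>" by (intro tendsto_intros lim elim)
      then show ?case by simp
    qed
    show "AE x in pi. norm \<bar>g x - U n x\<bar> \<le> 2 * C" for n
    proof (rule AE_I2)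
      fix x show "norm \<bar>g x - U n x\<bar> \<le> 2 * C" using bdd_meas_le[OF g, of x] bdd_meas_le[OF U[of n], of x] by simp
    qed
  qed auto
  then have L1: "(\<lambda>n. \<integral>y. \<bar>g y - U n y\<bar> \<partial>pi) \<longlonglongrightarrow> 0" by simp
  have "(\<lambda>n. C0 * (\<integral>y. \<bar>g y - U n y\<bar> \<partial>pi)) \<longlonglongrightarrow> C0 * 0" by (intro tendsto_intros L1)
  then have a: "(\<lambda>n. C0 * (\<integral>y. \<bar>g y - U n y\<bar> \<partial>pi)) \<longlonglongrightarrow> 0" by simp
  have "(\<lambda>n. erg g - erg (U n)) \<longlonglongrightarrow> 0"
  proof (rule Lim_null_comparison[OF _ a], intro always_eventually allI)
    fix n show "norm (erg g - erg (U n)) \<le> C0 * (\<integral>y. \<bar>g y - U n y\<bar> \<partial>pi)"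
      using erg_dominated[OF bdd_meas_diff[OF g U[of n]]] erg_diff[OF g U[of n]] by simp
  qed
  moreover have "(\<lambda>n. (\<integral>y. g y \<partial>pi) - (\<integral>y. U n y \<partial>pi)) \<longlonglongrightarrow> 0"
  proof (rule Lim_null_comparison[OF _ L1], intro always_eventually allI)
    fix n
    have "(\<integral>y. g y \<partial>pi) - (\<integral>y. U n y \<partial>pi) = (\<integral>y. g y - U n y \<partial>pi)"
      using pi_integrable[OF g] pi_integrable[OF U[of n]] by simp
    then show "norm ((\<integral>y. g y \<partial>pi) - (\<integral>y. U n y \<partial>pi)) \<le> (\<integral>y. \<bar>g y - U n y\<bar> \<partial>pi)"
      using integral_abs_bound[of pi "\<lambda>y. g y - U n y"] by simp
  qed
  ultimately have "(\<lambda>n. (erg g - erg (U n)) - \<gamma> * ((\<integral>y. g y \<partial>pi) - (\<integral>y. U n y \<partial>pi))) \<longlonglongrightarrow> 0 - \<gamma> * 0"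
    by (intro tendsto_diff tendsto_mult tendsto_const)
  then have "(\<lambda>n. erg g - \<gamma> * (\<integral>y. g y \<partial>pi)) \<longlonglongrightarrow> 0" by (simp add: eq algebra_simps)
  then have "erg g - \<gamma> * (\<integral>y. g y \<partial>pi) = 0" by (simp only: LIMSEQ_const_iff)
  then show ?thesis by simp
qed

text \<open>Trapezoids carry the proportionality to open intervals, and exhausting the line by
  intervals forces \<open>\<gamma>\<close> = 1. A Dynkin argument reaches all Borel sets and
  monotone approximation all bounded functions; each passage to a limit is
  \<open>erg_approx\<close>.\<close>

lemma erg_eq_pi:
  assumes cc: "\<And>g a b. 0 < a \<Longrightarrow> continuous_on UNIV g \<Longrightarrow> (\<And>x. x \<notin> {a..b} \<Longrightarrow> g x = 0) \<Longrightarrow> erg g = \<gamma> * (\<integral>y. g y \<partial>pi)"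
    and g: "bdd_meas C g"
  shows "erg g = (\<integral>y. g y \<partial>pi)"
proof -
  have interval: "erg (indicator {a<..<b}) = \<gamma> * (\<integral>y. indicator {a<..<b} y \<partial>pi)" for a b :: real
  proof (rule erg_approx[where C=1])
    \<comment> \<open>The left edge is kept at 1/(n+1) or more, since the assumption only covers
      supports inside the open half-line.\<close>
    define l where "l n = max a (1 / real (Suc n))" for n
    define U where "U n x = max 0 (min 1 (real n * min (x - l n) (b - x)))" for n x
    show "bdd_meas 1 (indicator {a<..<b})" by (rule bdd_meas_indicator) simp
    have c: "continuous_on UNIV (U n)" for n unfolding U_def by (intro continuous_intros)
    show "bdd_meas 1 (U n)" for n using borel_measurable_continuous_onI[OF c] by (auto simp: bdd_meas_def U_def)
    show "(\<lambda>n. U n x) \<longlonglongrightarrow> indicator {a<..<b} x" if x: "0 < x" for x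
    proof (cases "x \<in> {a<..<b}")
      case True
      obtain n1 where n1: "1 / real (Suc n1) < x" using nat_approx_posE[OF x] by blast
      define r where "r = min (x - l n1) (b - x)"
      have r: "0 < r" using True n1 by (auto simp: r_def l_def)
      obtain n2 where n2: "1 / r < real n2" using reals_Archimedean2 by blast
      have "U n x = 1" if n: "n \<ge> max n1 n2" for n
      proof -
        have "1 / real (Suc n) \<le> 1 / real (Suc n1)" using n by (intro divide_left_mono) auto
        then have "l n \<le> l n1" by (auto simp: l_def)
        then have "r \<le> min (x - l n) (b - x)" by (auto simp: r_def)
        moreover have "1 / r < real n" using n2 n by auto
        then have "1 < real n * r" using r by (simp add: field_simps)
        ultimately have "1 \<le> real n * min (x - l n) (b - x)"
          by (smt (verit) mult_left_mono of_nat_0_le_iff)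
        then show ?thesis by (simp add: U_def)
      qed
      then show ?thesis using True
        by (intro tendsto_eventually) (auto simp: eventually_sequentially intro!: exI[of _ "max n1 n2"])
    next
      case False
      have "U n x = 0" for n
      proof -
        have "min (x - l n) (b - x) \<le> 0" using False by (auto simp: l_def)
        then have "real n * min (x - l n) (b - x) \<le> 0" by (simp add: mult_nonneg_nonpos)
        then show ?thesis by (simp add: U_def)
      qed
      then show ?thesis using False by simp
    qed
    show "erg (U n) = \<gamma> * (\<integral>y. U n y \<partial>pi)" for n
    proof (rule cc[of "l n" "U n" b])
      show "0 < l n" by (simp add: l_def less_max_iff_disj)
      show "continuous_on UNIV (U n)" by (rule c)
      fix x assume "x \<notin> {l n..b}"
      then have "min (x - l n) (b - x) \<le> 0" by auto
      then have "real n * min (x - l n) (b - x) \<le> 0" by (simp add: mult_nonneg_nonpos)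
      then show "U n x = 0" by (simp add: U_def)
    qed
  qed
  have "erg (\<lambda>_. 1) = \<gamma> * (\<integral>y. 1 \<partial>pi)"
  proof (rule erg_approx[where C=1 and U="\<lambda>n. indicator {- real n<..<real n}"])
    show "bdd_meas 1 (\<lambda>_. 1)" using bdd_meas_const[of 1] by simp
    show "bdd_meas 1 (indicator {- real n<..<real n})" for n by (rule bdd_meas_indicator) simp
    show "(\<lambda>n. indicator {- real n<..<real n} x) \<longlonglongrightarrow> (1::real)" for x
    proof (rule tendsto_eventually)
      obtain N where N: "\<bar>x\<bar> < real N" using reals_Archimedean2 by blast
      then show "\<forall>\<^sub>F n in sequentially. indicator {- real n<..<real n} x = (1::real)"
        by (auto simp: eventually_sequentially indicator_def intro!: exI[of _ N])
    qed
    show "erg (indicator {- real n<..<real n}) = \<gamma> * (\<integral>y. indicator {- real n<..<real n} y \<partial>pi)" for n by (rule interval)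
  qed
  then have \<gamma>: "\<gamma> = 1" using erg_const[of 1] by (simp add: pi_UNIV)
  have set: "erg (indicator A) = (\<integral>y. indicator A y \<partial>pi)" if A: "A \<in> sets borel" for A :: "real set"
  proof -
    have st: "Int_stable (range (\<lambda>(a, b). {a<..<b::real}))"
    proof (rule Int_stableI, elim imageE, clarify)
      fix a b c d :: real
      have "{a<..<b} \<inter> {c<..<d} = {max a c<..<min b d}" by auto
      then show "{a<..<b} \<inter> {c<..<d} \<in> range (\<lambda>(a, b). {a<..<b})" by (auto intro!: image_eqI[of _ _ "(max a c, min b d)"])
    qed
    have sb: "sets (borel :: real measure) = sigma_sets UNIV (range (\<lambda>(a, b). {a<..<b::real}))"
    proof -
      have "(\<lambda>(a, b). box a b :: real set) = (\<lambda>(a, b). {a<..<b})" by (auto simp: fun_eq_iff)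
      then show ?thesis using arg_cong[OF borel_eq_box[where 'a=real], of sets] by simp
    qed
    have A': "A \<in> sigma_sets UNIV (range (\<lambda>(a, b). {a<..<b}))" using A sb by simp
    have sub: "range (\<lambda>(a, b). {a<..<b::real}) \<subseteq> Pow UNIV" by simp
    from st sub A' show ?thesis
    proof (induction rule: sigma_sets_induct_disjoint)
      case (basic A)
      then show ?case using interval \<gamma> by auto
    next
      case empty
      then show ?case using erg_const[of 0] by simp
    next
      case (compl A)
      note 4 = compl
      have Am: "A \<in> sets borel" using 4(1) sb by simp
      have "(indicator (UNIV - A) :: real \<Rightarrow> real) = (\<lambda>y. 1 - indicator A y)" by (auto simp: indicator_def)
      then show ?case using erg_diff[OF bdd_meas_const[of 1] bdd_meas_indicator[OF Am]] erg_const[of 1] 4(2) pi_integrable[OF bdd_meas_indicator[OF Am]]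
        by (simp add: pi_UNIV)
    next
      case (union A)
      note 5 = union
      have Am: "A i \<in> sets borel" for i using 5(2) sb by blast
      define V where "V n = (\<Union>i<n. A i)" for n :: nat
      have Vm: "V n \<in> sets borel" for n using Am by (auto simp: V_def)
      have "erg (indicator (\<Union>i. A i)) = 1 * (\<integral>y. indicator (\<Union>i. A i) y \<partial>pi)"
      proof (rule erg_approx[where C=1 and U="\<lambda>n. indicator (V n)"])
        show "bdd_meas 1 (indicator (\<Union>i. A i))" using Am by (intro bdd_meas_indicator) auto
        show "bdd_meas 1 (indicator (V n))" for n by (rule bdd_meas_indicator[OF Vm])
        show "(\<lambda>n. indicator (V n) x) \<longlonglongrightarrow> (indicator (\<Union>i. A i) x :: real)" for x
          unfolding V_def using LIMSEQ_indicator_UN[of A x] by simp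
        show "erg (indicator (V n)) = 1 * (\<integral>y. indicator (V n) y \<partial>pi)" for n
        proof (induction n)
          case 0 then show ?case using erg_const[of 0] by (simp add: V_def)
        next
          case (Suc n)
          have e: "(indicator (V (Suc n)) :: real \<Rightarrow> real) = (\<lambda>y. indicator (V n) y + indicator (A n) y)"
          proof
            fix y
            have "V n \<inter> A n = {}"
              unfolding V_def using disjoint_family_onD[OF 5(1), of _ n] by (fastforce simp: disjoint_iff)
            moreover have "V (Suc n) = V n \<union> A n" by (auto simp: V_def less_Suc_eq)
            ultimately show "(indicator (V (Suc n)) y :: real) = indicator (V n) y + indicator (A n) y"
              by (auto simp: indicator_def)
          qed
          show ?case unfolding e using erg_add[OF bdd_meas_indicator[OF Vm] bdd_meas_indicator[OF Am], of n n] Suc 5(3)[of n]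
            pi_integrable[OF bdd_meas_indicator[OF Vm]] pi_integrable[OF bdd_meas_indicator[OF Am]] by simp
        qed
      qed
      then show ?case by simp
    qed
  qed
  have nonneg: "erg u = (\<integral>y. u y \<partial>pi)" if u: "u \<in> borel_measurable borel" "\<And>x. 0 \<le> u x" and ub: "\<exists>D. bdd_meas D u" for u
    using u ub
  proof (induction rule: borel_measurable_induct_real)
    case (set A) then show ?case using \<open>\<And>A. A \<in> sets borel \<Longrightarrow> erg (indicator A) = (\<integral>y. indicator A y \<partial>pi)\<close> by simp
  next
    case (mult u c)
    show ?case
    proof (cases "c = 0")
      case True then show ?thesis using erg_const[of 0] by simp
    next
      case False
      then have c: "0 < c" using mult by simp
      obtain D where D: "bdd_meas D (\<lambda>x. c * u x)" using mult by blast
      have "bdd_meas (\<bar>1/c\<bar> * D) (\<lambda>x. 1/c * (c * u x))" by (rule bdd_meas_cmult[OF D])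
      then have b: "bdd_meas (\<bar>1/c\<bar> * D) u" using c by simp
      then show ?thesis using mult erg_cmult[OF b, of c] by auto
    qed
  next
    case (add u v)
    obtain D where D: "bdd_meas D (\<lambda>x. v x + u x)" using add by blast
    have bu: "bdd_meas D u" "bdd_meas D v"
    proof -
      have "\<bar>u x\<bar> \<le> D" "\<bar>v x\<bar> \<le> D" for x using bdd_meas_le[OF D, of x] add(2)[of x] add(5)[of x] by (auto simp: abs_le_iff)
      then show "bdd_meas D u" "bdd_meas D v" using add by (auto simp: bdd_meas_def)
    qed
    have "erg u = (\<integral>y. u y \<partial>pi)" "erg v = (\<integral>y. v y \<partial>pi)" using add.IH bu by blast+
    then show ?case using erg_add[OF bu(2,1)] pi_integrable[OF bu(1)] pi_integrable[OF bu(2)] by simp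
  next
    case (seq U)
    obtain D where D: "bdd_meas D u" using seq by blast
    have le: "U i x \<le> u x" for i x
    proof (rule incseq_le)
      show "incseq (\<lambda>i. U i x)" using seq by (auto simp: incseq_def le_fun_def)
      show "(\<lambda>i. U i x) \<longlonglongrightarrow> u x" using seq by simp
    qed
    have b: "bdd_meas D (U i)" for i
      using seq le[of i] D by (auto simp: bdd_meas_def) (smt (verit))
    have "erg (U i) = (\<integral>y. U i y \<partial>pi)" for i using seq.IH b by blast
    then show ?case using seq by (intro erg_approx[where \<gamma>=1, simplified, OF D b]) auto
  qed
  have C: "bdd_meas \<bar>C\<bar> (\<lambda>_. C)" by (rule bdd_meas_const)
  have "erg (\<lambda>y. g y + C) = (\<integral>y. g y + C \<partial>pi)"
  proof (rule nonneg)
    show "(\<lambda>y. g y + C) \<in> borel_measurable borel" using g by (auto simp: bdd_meas_def)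
    show "0 \<le> g x + C" for x using bdd_meas_le[OF g, of x] by linarith
    show "\<exists>D. bdd_meas D (\<lambda>y. g y + C)" using bdd_meas_add[OF g C] by blast
  qed
  then show ?thesis using erg_add[OF g C] erg_const[of C] pi_integrable[OF g] by (simp add: pi_UNIV)
qed

end

section \<open>The ground state transform\<close>

lemma sets_mu[measurable_cong, simp]: "sets (mu \<alpha>) = sets borel" by (simp add: mu_def)
lemma space_mu[simp]: "space (mu \<alpha>) = UNIV" by (simp add: mu_def)

lemma (in drift) Qpot_deriv:
  assumes y: "0 < y"
  shows "(Qpot \<alpha> has_real_derivative 2 * \<alpha> y) (at y)"
proof -
  define a where "a = min y 1 / 2"
  define b where "b = max y 1 + 1"
  have ab: "0 < a" "a < y" "a < 1" "y < b" "1 < b" using y by (auto simp: a_def b_def)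
  have c: "continuous_on {a..b} (\<lambda>u. 2 * \<alpha> u)"
    by (intro continuous_intros continuous_on_subset[OF continuous_drift]) (use ab in auto)
  have "((\<lambda>u. LBINT y=ereal 1..ereal u. 2 * \<alpha> y) has_vector_derivative 2 * \<alpha> y) (at y within {a..b})"
    by (rule interval_integral_FTC2[OF _ _ c]) (use ab in auto)
  then have "((\<lambda>u. LBINT y=ereal 1..ereal u. 2 * \<alpha> y) has_vector_derivative 2 * \<alpha> y) (at y)"
    using ab by (simp add: at_within_Icc_at)
  then show ?thesis
    unfolding Qpot_def[abs_def] has_real_derivative_iff_has_vector_derivative .
qed

lemma (in drift) Qpot_continuous: "continuous_on {0<..} (Qpot \<alpha>)"
  by (rule continuous_at_imp_continuous_on) (auto intro: DERIV_isCont[OF Qpot_deriv])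

locale ground_state = killed +
  fixes r :: "real \<Rightarrow> real \<Rightarrow> real \<Rightarrow> real" and \<eta> :: "real \<Rightarrow> real" and lam :: real
  assumes H: "hypH M B \<alpha>"
    and r_dens: "\<forall>t>0. \<forall>x>0. (\<forall>y>0. 0 \<le> r t x y) \<and> integrable (mu \<alpha>) (r t x)
                   \<and> (\<forall>g. g \<in> borel_measurable borel \<and> (\<exists>C. \<forall>y. \<bar>g y\<bar> \<le> C) \<longrightarrow>
                        killed_exp M B \<alpha> x t t g = (\<integral>y. r t x y * g y \<partial>mu \<alpha>))"
    and eta_pos: "\<forall>y>0. 0 < \<eta> y"
    and eta_meas[measurable]: "\<eta> \<in> borel_measurable borel"
    and eta_L2: "integrable (mu \<alpha>) (\<lambda>y. (\<eta> y)\<^sup>2)" "(\<integral>y. (\<eta> y)\<^sup>2 \<partial>mu \<alpha>) = 1"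
    and lam_pos: "0 < lam"
    and eta_ode: "\<exists>\<eta>' \<eta>''. \<forall>y>0. (\<eta> has_real_derivative \<eta>' y) (at y)
                       \<and> (\<eta>' has_real_derivative \<eta>'' y) (at y)
                       \<and> \<eta>'' y / 2 - \<alpha> y * \<eta>' y = - lam * \<eta> y"
    and eta_eig: "\<forall>t>0. \<forall>x>0. killed_exp M B \<alpha> x t t \<eta> = exp (- lam * t) * \<eta> x"
    and IU: "\<forall>t>0. \<exists>c>0. \<forall>x>0. \<forall>y>0. r t x y \<le> c * \<eta> x * \<eta> y"
begin

lemma eta_pos': "0 < y \<Longrightarrow> 0 < \<eta> y" using eta_pos by blast

lemma eta_continuous: "continuous_on {0<..} \<eta>"
  using eta_ode by (meson DERIV_isCont continuous_at_imp_continuous_on greaterThan_iff)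

lemma AE_mu_pos: "AE y in mu \<alpha>. 0 < y"
proof -
  have "(\<integral>\<^sup>+y. ennreal (indicator {0<..} y * exp (- Qpot \<alpha> y)) * indicator {..0} y \<partial>lborel) = (\<integral>\<^sup>+y. 0 \<partial>(lborel :: real measure))"
    by (rule nn_integral_cong) (auto simp: indicator_def)
  moreover have "(\<lambda>y. ennreal (indicator {0<..} y * exp (- Qpot \<alpha> y))) \<in> borel_measurable lborel"
  proof -
    have "(\<lambda>y. indicator {0<..} y *\<^sub>R exp (- Qpot \<alpha> y)) \<in> borel_measurable borel"
      by (rule borel_measurable_continuous_on_indicator) (auto intro!: continuous_intros Qpot_continuous)
    then show ?thesis by simp
  qed
  ultimately have "emeasure (mu \<alpha>) {..0} = 0" unfolding mu_def by (subst emeasure_density) auto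
  then show ?thesis by (intro AE_I[of _ _ "{..0}"]) (auto simp: not_less)
qed

definition pi :: "real measure" where
  "pi = density (mu \<alpha>) (\<lambda>y. ennreal ((\<eta> y)\<^sup>2))"

lemma sets_pi[measurable_cong, simp]: "sets pi = sets borel" by (simp add: pi_def)
lemma space_pi[simp]: "space pi = UNIV" by (simp add: pi_def)

lemma nn_integral_pi: "g \<in> borel_measurable borel \<Longrightarrow> (\<integral>\<^sup>+y. g y \<partial>pi) = (\<integral>\<^sup>+y. ennreal ((\<eta> y)\<^sup>2) * g y \<partial>mu \<alpha>)"
  unfolding pi_def by (subst nn_integral_density) auto

lemma pi_prob: "prob_space pi"
proof
  have "emeasure pi (space pi) = (\<integral>\<^sup>+y. ennreal ((\<eta> y)\<^sup>2) \<partial>mu \<alpha>)"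
    unfolding pi_def by (subst emeasure_density) auto
  also have "\<dots> = 1" using eta_L2 by (subst nn_integral_eq_integral) auto
  finally show "emeasure pi (space pi) = 1" .
qed

lemma AE_pi_pos: "AE y in pi. 0 < y"
  unfolding pi_def by (subst AE_density) (use AE_mu_pos in auto)

lemma pi_nonpos: "emeasure pi {..0} = 0"
  using AE_pi_pos by (subst (asm) AE_iff_measurable[of "{..0}"]) (auto simp: not_less)

lemma surv_nn_measurable:
  assumes g: "g \<in> borel_measurable borel" and t: "0 \<le> t"
  shows "(\<lambda>\<omega>. indicator {\<omega>. surv x t \<omega>} \<omega> * (g (X x t \<omega>) :: ennreal)) \<in> borel_measurable M"
proof -
  note [measurable] = g
  have "(\<lambda>\<omega>. (if surv x t \<omega> then 1 else 0) * g (X x t \<omega>)) \<in> borel_measurable M" using t by measurable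
  then show ?thesis by (simp add: indicator_def of_bool_def)
qed

lemma PP_cong: "(\<And>y. 0 < y \<Longrightarrow> f y = g y) \<Longrightarrow> PP t f x = PP t g x"
  unfolding PP_def by (intro nn_integral_cong) (auto simp: indicator_def X_pos)

lemma PP_mono: "(\<And>y. 0 < y \<Longrightarrow> f y \<le> g y) \<Longrightarrow> PP t f x \<le> PP t g x"
  unfolding PP_def by (intro nn_integral_mono) (auto simp: indicator_def X_pos)

lemma PP_cmult: "g \<in> borel_measurable borel \<Longrightarrow> 0 \<le> t \<Longrightarrow> PP t (\<lambda>y. c * g y) x = c * PP t g x"
  unfolding PP_def using nn_integral_cmult[OF surv_nn_measurable, of g t c x] by (simp add: mult_ac)

lemma PP_le_1: "0 \<le> t \<Longrightarrow> (\<And>y. 0 < y \<Longrightarrow> g y \<le> 1) \<Longrightarrow> PP t g x \<le> 1"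
proof -
  assume t: "0 \<le> t" and g: "\<And>y. 0 < y \<Longrightarrow> g y \<le> 1"
  have "PP t g x \<le> (\<integral>\<^sup>+\<omega>. 1 \<partial>M)" unfolding PP_def
    by (rule nn_integral_mono) (auto simp: indicator_def X_pos g)
  then show ?thesis by (simp add: emeasure_space_1)
qed

lemma PP_eta:
  assumes x: "0 < x" and t: "0 < t"
  shows "PP t (\<lambda>y. ennreal (\<eta> y)) x = ennreal (exp (- lam * t) * \<eta> x)"
proof -
  let ?f = "\<lambda>\<omega>. indicator {\<omega>. surv x t \<omega>} \<omega> * \<eta> (X x t \<omega>)"
  have e: "(\<integral>\<omega>. ?f \<omega> \<partial>M) = exp (- lam * t) * \<eta> x"
    using eta_eig x t killed_exp_eq[OF H x, of t t \<eta>] by simp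
  \<comment> \<open>A Bochner integral of a nonintegrable function is 0 by convention, so the
    nonzero value certifies integrability; \<open>\<eta>\<close> is not yet known to be
    bounded.\<close>
  have "(\<integral>\<omega>. ?f \<omega> \<partial>M) \<noteq> 0" using e eta_pos' x less_imp_neq[OF eta_pos'[OF x]] by simp
  then have i: "integrable M ?f" using not_integrable_integral_eq by blast
  have "PP t (\<lambda>y. ennreal (\<eta> y)) x = (\<integral>\<^sup>+\<omega>. ennreal (?f \<omega>) \<partial>M)"
    unfolding PP_def by (rule nn_integral_cong) (auto simp: indicator_def)
  also have "\<dots> = ennreal (\<integral>\<omega>. ?f \<omega> \<partial>M)"
    by (rule nn_integral_eq_integral[OF i]) (use eta_pos X_pos in \<open>auto simp: indicator_def intro!: less_imp_le\<close>)
  finally show ?thesis using e by simp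
qed

definition kern :: "real \<Rightarrow> real \<Rightarrow> real measure" where
  "kern t x = distr (density M (\<lambda>\<omega>. indicator {\<omega>. surv x t \<omega>} \<omega>)) borel (X x t)"

lemma sets_kern[measurable_cong, simp]: "sets (kern t x) = sets borel" by (simp add: kern_def)

lemma nn_integral_kern:
  assumes g: "g \<in> borel_measurable borel" and t: "0 \<le> t"
  shows "(\<integral>\<^sup>+y. g y \<partial>kern t x) = PP t g x"
proof -
  have [measurable]: "(\<lambda>\<omega>. indicator {\<omega>. surv x t \<omega>} \<omega> :: ennreal) \<in> borel_measurable M"
    using surv_nn_measurable[of "\<lambda>_. 1" t x] t by simp
  have Xm: "X x t \<in> measurable (density M (\<lambda>\<omega>. indicator {\<omega>. surv x t \<omega>} \<omega>)) borel" using t by simp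
  have "(\<integral>\<^sup>+y. g y \<partial>kern t x) = (\<integral>\<^sup>+\<omega>. g (X x t \<omega>) \<partial>density M (\<lambda>\<omega>. indicator {\<omega>. surv x t \<omega>} \<omega>))"
    unfolding kern_def by (rule nn_integral_distr[OF Xm]) (use g in simp)
  also have "\<dots> = PP t g x" unfolding PP_def
    using g t by (subst nn_integral_density) (auto intro!: measurable_compose[OF X_measurable])
  finally show ?thesis .
qed

lemma kern_density:
  assumes x: "0 < x" and t: "0 < t"
  shows "kern t x = density (mu \<alpha>) (\<lambda>y. ennreal (r t x y))"
proof (rule measure_eqI)
  fix A assume "A \<in> sets (kern t x)"
  then have A[measurable]: "A \<in> sets borel" by simp
  have ri: "integrable (mu \<alpha>) (r t x)" and rp: "\<And>y. 0 < y \<Longrightarrow> 0 \<le> r t x y" using r_dens x t by auto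
  have rm[measurable]: "r t x \<in> borel_measurable borel"
    using borel_measurable_integrable[OF ri] by (simp add: measurable_def)
  have si: "integrable M (\<lambda>\<omega>. indicator {\<omega>. surv x t \<omega>} \<omega> * indicator A (X x t \<omega>) :: real)"
    by (rule surv_integrable[of _ 1]) (use t in \<open>auto simp: indicator_def\<close>)
  have "emeasure (kern t x) A = PP t (indicator A) x"
    using nn_integral_kern[of "indicator A" t x] t A by simp
  also have "\<dots> = (\<integral>\<^sup>+\<omega>. ennreal (indicator {\<omega>. surv x t \<omega>} \<omega> * indicator A (X x t \<omega>)) \<partial>M)"
    unfolding PP_def by (rule nn_integral_cong) (auto simp: indicator_def)
  also have "\<dots> = ennreal (\<integral>\<omega>. indicator {\<omega>. surv x t \<omega>} \<omega> * indicator A (X x t \<omega>) \<partial>M)"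
    by (rule nn_integral_eq_integral[OF si]) auto
  also have "(\<integral>\<omega>. indicator {\<omega>. surv x t \<omega>} \<omega> * indicator A (X x t \<omega>) \<partial>M) = (\<integral>y. r t x y * indicator A y \<partial>mu \<alpha>)"
  proof -
    have "(indicator A :: real \<Rightarrow> real) \<in> borel_measurable borel \<and> (\<exists>C. \<forall>y. \<bar>indicator A y :: real\<bar> \<le> C)"
      by (auto intro!: exI[of _ 1] simp: indicator_def)
    then have "killed_exp M B \<alpha> x t t (indicator A) = (\<integral>y. r t x y * indicator A y \<partial>mu \<alpha>)" using r_dens x t by blast
    then show ?thesis using killed_exp_eq[OF H x, of t t "indicator A"] t A by simp
  qed
  also have "ennreal \<dots> = (\<integral>\<^sup>+y. ennreal (r t x y * indicator A y) \<partial>mu \<alpha>)"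
  proof (rule nn_integral_eq_integral[symmetric])
    show "integrable (mu \<alpha>) (\<lambda>y. r t x y * indicator A y)"
      using integrable_mult_indicator[OF _ ri, of A] by (simp add: mult.commute)
    show "AE y in mu \<alpha>. 0 \<le> r t x y * indicator A y" using AE_mu_pos by eventually_elim (auto simp: rp)
  qed
  also have "\<dots> = emeasure (density (mu \<alpha>) (\<lambda>y. ennreal (r t x y))) A"
    by (subst emeasure_density) (auto intro!: nn_integral_cong simp: indicator_def)
  finally show "emeasure (kern t x) A = emeasure (density (mu \<alpha>) (\<lambda>y. ennreal (r t x y))) A" .
qed simp

lemma PP_upper:
  assumes t: "0 < t"
  shows "\<exists>c>0. \<forall>x>0. \<forall>g\<in>borel_measurable borel. PP t g x \<le> ennreal (c * \<eta> x) * (\<integral>\<^sup>+y. ennreal (\<eta> y) * g y \<partial>mu \<alpha>)"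
proof -
  have "\<exists>c>0. \<forall>x>0. \<forall>y>0. r t x y \<le> c * \<eta> x * \<eta> y" using IU t by simp
  then obtain c where c: "c > 0" "\<forall>x>0. \<forall>y>0. r t x y \<le> c * \<eta> x * \<eta> y" by blast
  have "PP t g x \<le> ennreal (c * \<eta> x) * (\<integral>\<^sup>+y. ennreal (\<eta> y) * g y \<partial>mu \<alpha>)" if x: "0 < x" and g[measurable]: "g \<in> borel_measurable borel" for x g
  proof -
    have ri: "integrable (mu \<alpha>) (r t x)" using r_dens x t by auto
    have rm[measurable]: "r t x \<in> borel_measurable borel"
      using borel_measurable_integrable[OF ri] by (simp add: measurable_def)
    have "PP t g x = (\<integral>\<^sup>+y. g y \<partial>kern t x)" using nn_integral_kern[OF g, of t x] t by simp
    also have "\<dots> = (\<integral>\<^sup>+y. ennreal (r t x y) * g y \<partial>mu \<alpha>)" unfolding kern_density[OF x t] by (subst nn_integral_density) auto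
    also have "\<dots> \<le> (\<integral>\<^sup>+y. ennreal (c * \<eta> x) * (ennreal (\<eta> y) * g y) \<partial>mu \<alpha>)"
    proof (rule nn_integral_mono_AE)
      show "AE y in mu \<alpha>. ennreal (r t x y) * g y \<le> ennreal (c * \<eta> x) * (ennreal (\<eta> y) * g y)"
        using AE_mu_pos
      proof eventually_elim
        case (elim y)
        have "ennreal (r t x y) \<le> ennreal (c * \<eta> x * \<eta> y)" using c(2) x elim by (intro ennreal_leI) simp
        also have "\<dots> = ennreal (c * \<eta> x) * ennreal (\<eta> y)" using c(1) eta_pos'[OF x] eta_pos'[OF elim] by (intro ennreal_mult) simp_all
        finally have "ennreal (r t x y) * g y \<le> ennreal (c * \<eta> x) * ennreal (\<eta> y) * g y" by (rule mult_right_mono) simp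
        then show ?case by (simp add: mult.assoc)
      qed
    qed
    also have "\<dots> = ennreal (c * \<eta> x) * (\<integral>\<^sup>+y. ennreal (\<eta> y) * g y \<partial>mu \<alpha>)" by (rule nn_integral_cmult) auto
    finally show ?thesis .
  qed
  then show ?thesis using c(1) by blast
qed

text \<open>The kernel is extended to nonpositive starting points by the kernel at 1, so that it is a Markov
  kernel on the whole line.\<close>

definition base :: "real \<Rightarrow> real" where "base x = (if 0 < x then x else 1)"

lemma base_pos: "0 < base x" by (simp add: base_def)
lemma base_measurable[measurable]: "base \<in> borel_measurable borel" unfolding base_def by measurable

definition Q :: "real \<Rightarrow> real \<Rightarrow> real measure" where
  "Q t x = density (kern t (base x)) (\<lambda>y. ennreal (exp (lam * t) / \<eta> (base x)) * ennreal (\<eta> y))"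

lemma sets_Q[measurable_cong, simp]: "sets (Q t x) = sets borel" by (simp add: Q_def)

lemma nn_integral_Q:
  assumes g[measurable]: "g \<in> borel_measurable borel" and t: "0 \<le> t"
  shows "(\<integral>\<^sup>+y. g y \<partial>Q t x) = ennreal (exp (lam * t) / \<eta> (base x)) * PP t (\<lambda>y. ennreal (\<eta> y) * g y) (base x)"
proof -
  have "(\<integral>\<^sup>+y. g y \<partial>Q t x) = (\<integral>\<^sup>+y. ennreal (exp (lam * t) / \<eta> (base x)) * ennreal (\<eta> y) * g y \<partial>kern t (base x))"
    unfolding Q_def by (subst nn_integral_density) auto
  also have "\<dots> = PP t (\<lambda>y. ennreal (exp (lam * t) / \<eta> (base x)) * (ennreal (\<eta> y) * g y)) (base x)"
    by (subst nn_integral_kern[OF _ t]) (auto simp: mult.assoc)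
  also have "\<dots> = ennreal (exp (lam * t) / \<eta> (base x)) * PP t (\<lambda>y. ennreal (\<eta> y) * g y) (base x)"
    by (rule PP_cmult) (use t in auto)
  finally show ?thesis .
qed

text \<open>Total mass 1 is the eigenfunction identity. Chapman--Kolmogorov is inherited from the
  killed semigroup because the factors \<open>\<eta>\<close> and 1/\<open>\<eta>\<close> cancel at
  the intermediate point, which is positive, so \<open>base\<close> acts there as the
  identity.\<close>

sublocale mk?: markov_kernels Q
proof (rule markov_kernels.intro)
  fix t x :: real assume t: "0 < t"
  have "emeasure (Q t x) (space (Q t x)) = (\<integral>\<^sup>+y. 1 \<partial>Q t x)" by simp
  also have "\<dots> = ennreal (exp (lam * t) / \<eta> (base x)) * PP t (\<lambda>y. ennreal (\<eta> y)) (base x)"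
    using nn_integral_Q[of "\<lambda>_. 1" t x] t by simp
  also have "\<dots> = ennreal (exp (lam * t) / \<eta> (base x)) * ennreal (exp (- lam * t) * \<eta> (base x))"
    by (subst PP_eta[OF base_pos t]) simp
  also have "\<dots> = ennreal (exp (lam * t) / \<eta> (base x) * (exp (- lam * t) * \<eta> (base x)))"
    using eta_pos'[OF base_pos[of x]] by (intro ennreal_mult[symmetric]) simp_all
  also have "exp (lam * t) / \<eta> (base x) * (exp (- lam * t) * \<eta> (base x)) = 1"
    using eta_pos'[OF base_pos[of x]] by (simp add: exp_minus field_simps)
  finally show "prob_space (Q t x)" by (intro prob_spaceI) simp
next
  fix t :: real and A :: "real set" assume t: "0 < t" and A[measurable]: "A \<in> sets borel"
  have "emeasure (Q t x) A = ennreal (exp (lam * t) / \<eta> (base x)) * PP t (\<lambda>y. ennreal (\<eta> y) * indicator A y) (base x)" for x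
    using nn_integral_Q[of "indicator A" t x] t by simp
  moreover have [measurable]: "PP t (\<lambda>y. ennreal (\<eta> y) * indicator A y) \<in> borel_measurable borel"
    by (rule PP_measurable) (use t in auto)
  have "(\<lambda>x. ennreal (exp (lam * t) / \<eta> (base x)) * PP t (\<lambda>y. ennreal (\<eta> y) * indicator A y) (base x)) \<in> borel_measurable borel"
    by measurable
  ultimately show "(\<lambda>x. emeasure (Q t x) A) \<in> borel_measurable borel" by simp
next
  fix s t x :: real and g :: "real \<Rightarrow> ennreal" assume st: "0 < s" "0 < t" and g[measurable]: "g \<in> borel_measurable borel"
  have gm: "(\<lambda>y. ennreal (\<eta> y) * g y) \<in> borel_measurable borel" by measurable
  have Pm[measurable]: "PP t (\<lambda>y. ennreal (\<eta> y) * g y) \<in> borel_measurable borel" by (rule PP_measurable[OF gm]) (use st in simp)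
  have "(\<integral>\<^sup>+y. (\<integral>\<^sup>+z. g z \<partial>Q t y) \<partial>Q s x)
     = (\<integral>\<^sup>+y. ennreal (exp (lam * t) / \<eta> (base y)) * PP t (\<lambda>y. ennreal (\<eta> y) * g y) (base y) \<partial>Q s x)"
    using nn_integral_Q[OF g, of t] st by simp
  also have "\<dots> = ennreal (exp (lam * s) / \<eta> (base x)) *
      PP s (\<lambda>y. ennreal (\<eta> y) * (ennreal (exp (lam * t) / \<eta> (base y)) * PP t (\<lambda>y. ennreal (\<eta> y) * g y) (base y))) (base x)"
    by (rule nn_integral_Q) (use st in auto)
  also have "PP s (\<lambda>y. ennreal (\<eta> y) * (ennreal (exp (lam * t) / \<eta> (base y)) * PP t (\<lambda>y. ennreal (\<eta> y) * g y) (base y))) (base x)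
     = PP s (\<lambda>y. ennreal (exp (lam * t)) * PP t (\<lambda>y. ennreal (\<eta> y) * g y) y) (base x)"
  proof (rule PP_cong)
    fix y :: real assume y: "0 < y"
    have "ennreal (\<eta> y) * ennreal (exp (lam * t) / \<eta> y) = ennreal (exp (lam * t))"
      using eta_pos'[OF y] by (subst ennreal_mult[symmetric]) simp_all
    then show "ennreal (\<eta> y) * (ennreal (exp (lam * t) / \<eta> (base y)) * PP t (\<lambda>y. ennreal (\<eta> y) * g y) (base y))
      = ennreal (exp (lam * t)) * PP t (\<lambda>y. ennreal (\<eta> y) * g y) y" using y by (simp add: base_def mult.assoc[symmetric])
  qed
  also have "\<dots> = ennreal (exp (lam * t)) * PP s (PP t (\<lambda>y. ennreal (\<eta> y) * g y)) (base x)"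
    by (rule PP_cmult) (use st in auto)
  also have "PP s (PP t (\<lambda>y. ennreal (\<eta> y) * g y)) (base x) = PP (s + t) (\<lambda>y. ennreal (\<eta> y) * g y) (base x)"
    by (rule chapman_kolmogorov[symmetric, OF gm]) (use st in auto)
  also have "ennreal (exp (lam * s) / \<eta> (base x)) * (ennreal (exp (lam * t)) * PP (s + t) (\<lambda>y. ennreal (\<eta> y) * g y) (base x))
     = ennreal (exp (lam * (s + t)) / \<eta> (base x)) * PP (s + t) (\<lambda>y. ennreal (\<eta> y) * g y) (base x)"
    using eta_pos'[OF base_pos[of x]]
    by (simp add: mult.assoc[symmetric] ennreal_mult[symmetric] exp_add[symmetric] distrib_left)
  also have "\<dots> = (\<integral>\<^sup>+z. g z \<partial>Q (s + t) x)" using nn_integral_Q[OF g, of "s + t" x] st by simp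
  finally show "(\<integral>\<^sup>+z. g z \<partial>Q (s + t) x) = (\<integral>\<^sup>+y. (\<integral>\<^sup>+z. g z \<partial>Q t y) \<partial>Q s x)" by simp
qed simp

lemma Q_upper:
  assumes t: "0 < t"
  shows "\<exists>C>0. \<forall>x. \<forall>A\<in>sets borel. emeasure (Q t x) A \<le> ennreal C * emeasure pi A"
proof -
  obtain c where c: "c > 0" "\<And>x g. x > 0 \<Longrightarrow> g \<in> borel_measurable borel \<Longrightarrow> PP t g x \<le> ennreal (c * \<eta> x) * (\<integral>\<^sup>+y. ennreal (\<eta> y) * g y \<partial>mu \<alpha>)"
    using PP_upper[OF t] by blast
  have "emeasure (Q t x) A \<le> ennreal (exp (lam * t) * c) * emeasure pi A" if A[measurable]: "A \<in> sets borel" for x A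
  proof -
    have "emeasure (Q t x) A = ennreal (exp (lam * t) / \<eta> (base x)) * PP t (\<lambda>y. ennreal (\<eta> y) * indicator A y) (base x)"
      using nn_integral_Q[of "indicator A" t x] t by simp
    also have "\<dots> \<le> ennreal (exp (lam * t) / \<eta> (base x)) * (ennreal (c * \<eta> (base x)) * (\<integral>\<^sup>+y. ennreal (\<eta> y) * (ennreal (\<eta> y) * indicator A y) \<partial>mu \<alpha>))"
      by (intro mult_left_mono c base_pos) auto
    also have "(\<integral>\<^sup>+y. ennreal (\<eta> y) * (ennreal (\<eta> y) * indicator A y) \<partial>mu \<alpha>) = (\<integral>\<^sup>+y. ennreal ((\<eta> y)\<^sup>2) * indicator A y \<partial>mu \<alpha>)"
    proof (rule nn_integral_cong_AE)
      show "AE y in mu \<alpha>. ennreal (\<eta> y) * (ennreal (\<eta> y) * indicator A y) = ennreal ((\<eta> y)\<^sup>2) * indicator A y"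
        using AE_mu_pos
      proof eventually_elim
        case (elim y)
        then have "ennreal (\<eta> y) * ennreal (\<eta> y) = ennreal ((\<eta> y)\<^sup>2)"
          using eta_pos'[OF elim] by (subst ennreal_mult[symmetric]) (simp_all add: power2_eq_square)
        then show ?case by (simp add: mult.assoc[symmetric])
      qed
    qed
    also have "\<dots> = emeasure pi A" unfolding pi_def by (subst emeasure_density) auto
    also have "ennreal (exp (lam * t) / \<eta> (base x)) * (ennreal (c * \<eta> (base x)) * emeasure pi A) = ennreal (exp (lam * t) * c) * emeasure pi A"
    proof -
      have p: "0 < \<eta> (base x)" using eta_pos base_pos by blast
      have "ennreal (exp (lam * t) / \<eta> (base x)) * ennreal (c * \<eta> (base x)) = ennreal (exp (lam * t) / \<eta> (base x) * (c * \<eta> (base x)))"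
        using p c by (intro ennreal_mult[symmetric]) auto
      also have "exp (lam * t) / \<eta> (base x) * (c * \<eta> (base x)) = exp (lam * t) * c" using p by simp
      finally show ?thesis by (simp add: mult.assoc[symmetric])
    qed
    finally show ?thesis .
  qed
  then show ?thesis using c(1) by (intro exI[of _ "exp (lam * t) * c"]) auto
qed

end

section \<open>Doeblin condition for the transformed semigroup\<close>

context ground_state
begin

text \<open>Lebesgue density of \<open>pi\<close> on the half-line, and at the same time the weight
  m in the divergence form (1/(2m)) (m u')' of the transformed generator.\<close>

definition mden :: "real \<Rightarrow> real" where "mden y = (\<eta> y)\<^sup>2 * exp (- Qpot \<alpha> y)"

lemma mden_pos: "0 < y \<Longrightarrow> 0 < mden y" using eta_pos'[of y] by (simp add: mden_def)

lemma mden_continuous: "continuous_on {0<..} mden"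
  unfolding mden_def by (intro continuous_intros eta_continuous Qpot_continuous)

lemma mu_weight_measurable[measurable]: "(\<lambda>y. indicator {0<..} y * exp (- Qpot \<alpha> y)) \<in> borel_measurable borel"
proof -
  have "(\<lambda>y. indicator {0<..} y *\<^sub>R exp (- Qpot \<alpha> y)) \<in> borel_measurable borel"
    by (rule borel_measurable_continuous_on_indicator) (auto intro!: continuous_intros Qpot_continuous)
  then show ?thesis by simp
qed

lemma nn_integral_pi_lborel:
  assumes [measurable]: "g \<in> borel_measurable borel"
  shows "(\<integral>\<^sup>+y. g y \<partial>pi) = (\<integral>\<^sup>+y. indicator {0<..} y * (ennreal (mden y) * g y) \<partial>lborel)"
proof -
  have "(\<integral>\<^sup>+y. g y \<partial>pi) = (\<integral>\<^sup>+y. ennreal ((\<eta> y)\<^sup>2) * g y \<partial>mu \<alpha>)" by (rule nn_integral_pi) simp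
  also have "\<dots> = (\<integral>\<^sup>+y. ennreal (indicator {0<..} y * exp (- Qpot \<alpha> y)) * (ennreal ((\<eta> y)\<^sup>2) * g y) \<partial>lborel)"
    unfolding mu_def by (rule nn_integral_density) auto
  also have "\<dots> = (\<integral>\<^sup>+y. indicator {0<..} y * (ennreal (mden y) * g y) \<partial>lborel)"
    by (rule nn_integral_cong)
      (auto simp: indicator_def mden_def ennreal_mult mult_ac)
  finally show ?thesis .
qed

lemma Icc_bounds:
  assumes f: "continuous_on {0<..} (f :: real \<Rightarrow> real)" "\<And>y. 0 < y \<Longrightarrow> 0 < f y" and ab: "0 < a" "a \<le> b"
  shows "\<exists>l u. 0 < l \<and> l \<le> u \<and> (\<forall>y\<in>{a..b}. l \<le> f y \<and> f y \<le> u)"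
proof -
  have c: "continuous_on {a..b} f" by (rule continuous_on_subset[OF f(1)]) (use ab in auto)
  obtain y1 where y1: "y1 \<in> {a..b}" "\<And>y. y \<in> {a..b} \<Longrightarrow> f y1 \<le> f y"
    using continuous_attains_inf[of "{a..b}" f] c ab by auto
  obtain y2 where y2: "y2 \<in> {a..b}" "\<And>y. y \<in> {a..b} \<Longrightarrow> f y \<le> f y2"
    using continuous_attains_sup[of "{a..b}" f] c ab by auto
  have "0 < f y1" using y1(1) ab by (intro f(2)) auto
  moreover have "f y1 \<le> f y2" using y1(2)[OF y2(1)] .
  ultimately show ?thesis using y1(2) y2(2) by blast
qed

lemma pi_exhaust:
  assumes e: "0 < e"
  shows "\<exists>a b. 0 < a \<and> a \<le> b \<and> measure pi (- {a..b}) \<le> e"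
proof -
  interpret pi: prob_space pi by (rule pi_prob)
  have "(\<lambda>N. measure pi {lo N..hi N}) \<longlonglongrightarrow> measure pi (\<Union>N. {lo N..hi N})"
  proof (rule pi.finite_Lim_measure_incseq)
    show "incseq (\<lambda>N. {lo N..hi N})"
    proof (rule incseq_SucI)
      fix N show "{lo N..hi N} \<subseteq> {lo (Suc N)..hi (Suc N)}" using lo_hi_mono(3,4)[of N "Suc N"] by auto
    qed
  qed auto
  also have "(\<Union>N. {lo N..hi N}) = {0::real<..}"
  proof (intro equalityI subsetI)
    fix x :: real assume "x \<in> {0<..}"
    then obtain N where "lo N < x" "x < hi N" using ex_lo_hi[of x x] by auto
    then show "x \<in> (\<Union>N. {lo N..hi N})" by (auto intro!: exI[of _ N])
  qed (use lo_hi in \<open>auto intro: less_le_trans\<close>)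
  also have "measure pi {0<..} = 1" using AE_pi_pos by (subst pi.prob_eq_1) auto
  finally have "\<forall>\<^sub>F N in sequentially. 1 - e < measure pi {lo N..hi N}" using e by (intro order_tendstoD(1)) auto
  then obtain N where N: "1 - e < measure pi {lo N..hi N}" by (auto simp: eventually_sequentially)
  have "measure pi (- {lo N..hi N}) = 1 - measure pi {lo N..hi N}"
    using pi.prob_compl[of "{lo N..hi N}"] by (simp add: Compl_eq_Diff_UNIV)
  then show ?thesis using N lo_hi[of N] by (intro exI[of _ "lo N"] exI[of _ "hi N"]) auto
qed

text \<open>On a compact interval \<open>\<eta>\<close> and \<open>mden\<close> lie between positive
  constants, so the Lebesgue minorization of the killed kernel passes to \<open>Q\<close> and
  \<open>pi\<close>.\<close>

lemma local_minorization:
  assumes ab: "0 < a" "a \<le> b"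
  shows "\<exists>s>0. \<exists>e>0. \<forall>x\<in>{a..b}. \<forall>D\<in>sets borel. ennreal e * emeasure pi (D \<inter> {a..b}) \<le> emeasure (Q s x) D"
proof -
  obtain s e where s: "0 < s" and e: "0 < e"
    and m: "\<And>x D. x \<in> {a..b} \<Longrightarrow> D \<in> sets borel \<Longrightarrow> ennreal e * emeasure lborel (D \<inter> {a..b}) \<le> PP s (indicator D) x"
    using minorization[OF ab] by blast
  obtain l u where lu: "0 < l" "l \<le> u" "\<And>y. y \<in> {a..b} \<Longrightarrow> l \<le> \<eta> y \<and> \<eta> y \<le> u"
    using Icc_bounds[OF eta_continuous eta_pos' ab] by blast
  obtain l' u' where lu': "0 < l'" "l' \<le> u'" "\<And>y. y \<in> {a..b} \<Longrightarrow> l' \<le> mden y \<and> mden y \<le> u'"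
    using Icc_bounds[OF mden_continuous mden_pos ab] by blast
  define c where "c = exp (lam * s) / u * l"
  have c: "0 < c" using lu by (simp add: c_def)
  have "ennreal (c * e / u') * emeasure pi (D \<inter> {a..b}) \<le> emeasure (Q s x) D" if x: "x \<in> {a..b}" and D[measurable]: "D \<in> sets borel" for x D
  proof -
    have x0: "0 < x" using x ab by auto
    then have bx: "base x = x" by (simp add: base_def)
    have "emeasure pi (D \<inter> {a..b}) = (\<integral>\<^sup>+y. indicator (D \<inter> {a..b}) y \<partial>pi)" by simp
    also have "\<dots> = (\<integral>\<^sup>+y. indicator {0<..} y * (ennreal (mden y) * indicator (D \<inter> {a..b}) y) \<partial>lborel)"
      by (rule nn_integral_pi_lborel) auto
    also have "\<dots> \<le> (\<integral>\<^sup>+y. ennreal u' * indicator (D \<inter> {a..b}) y \<partial>lborel)"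
      by (rule nn_integral_mono) (use lu'(3) in \<open>auto simp: indicator_def intro!: ennreal_leI\<close>)
    also have "\<dots> = ennreal u' * emeasure lborel (D \<inter> {a..b})" by (simp add: nn_integral_cmult_indicator)
    finally have p: "emeasure pi (D \<inter> {a..b}) \<le> ennreal u' * emeasure lborel (D \<inter> {a..b})" .
    have "ennreal (c * e / u') * emeasure pi (D \<inter> {a..b}) \<le> ennreal (c * e / u') * (ennreal u' * emeasure lborel (D \<inter> {a..b}))"
      by (rule mult_left_mono[OF p]) simp
    also have "\<dots> = ennreal c * (ennreal e * emeasure lborel (D \<inter> {a..b} \<inter> {a..b}))"
      using c e lu' by (simp add: mult.assoc[symmetric] ennreal_mult[symmetric])
    also have "\<dots> \<le> ennreal c * PP s (indicator (D \<inter> {a..b})) x" by (intro mult_left_mono m[OF x]) auto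
    also have "\<dots> = ennreal (exp (lam * s) / u) * PP s (\<lambda>y. ennreal l * indicator (D \<inter> {a..b}) y) x"
      using lu s by (subst PP_cmult) (auto simp: c_def mult.assoc[symmetric] ennreal_mult[symmetric])
    also have "\<dots> \<le> ennreal (exp (lam * s) / \<eta> x) * PP s (\<lambda>y. ennreal (\<eta> y) * indicator D y) x"
    proof (rule mult_mono)
      show "ennreal (exp (lam * s) / u) \<le> ennreal (exp (lam * s) / \<eta> x)"
        using lu(3)[OF x] eta_pos'[OF x0] by (intro ennreal_leI divide_left_mono) auto
      show "PP s (\<lambda>y. ennreal l * indicator (D \<inter> {a..b}) y) x \<le> PP s (\<lambda>y. ennreal (\<eta> y) * indicator D y) x"
        by (rule PP_mono) (use lu(3) in \<open>auto simp: indicator_def intro!: ennreal_leI\<close>)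
    qed auto
    also have "\<dots> = emeasure (Q s x) D" using nn_integral_Q[of "indicator D" s x] s bx by simp
    finally show ?thesis .
  qed
  moreover have "0 < c * e / u'" using c e lu' by simp
  ultimately show ?thesis using s by blast
qed

text \<open>After one unit of time at least half of the mass is in a fixed interval, from every
  start, since the complement is small for \<open>pi\<close> and hence for \<open>Q 1 x\<close>; a
  further time \<open>s\<close> applies the local minorization. The inequality for the complement is
  exported because the lower kernel bound later uses the same interval.\<close>

lemma doeblin_exists:
  "\<exists>T \<theta> a b C0. 0 < a \<and> a \<le> b \<and> C0 * measure pi (- {a..b}) \<le> 1 / 2 \<and>
     doeblin_dom Q T \<theta> (uniform_measure pi {a..b}) pi C0"
proof -
  interpret pi: prob_space pi by (rule pi_prob)
  obtain C where C: "C > 0" "\<And>x A. A \<in> sets borel \<Longrightarrow> emeasure (Q 1 x) A \<le> ennreal C * emeasure pi A"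
    using Q_upper[of 1] by auto
  have C1: "1 \<le> C"
  proof -
    have "emeasure (Q 1 0) UNIV \<le> ennreal C * emeasure pi UNIV" by (rule C(2)) simp
    then show ?thesis using prob_space.emeasure_space_1[OF mk.Q_prob, of 1 0] pi.emeasure_space_1 by simp
  qed
  obtain a b where ab: "0 < a" "a \<le> b" "measure pi (- {a..b}) \<le> 1 / (2 * C)"
    using pi_exhaust[of "1 / (2 * C)"] C(1) by auto
  have half: "C * measure pi (- {a..b}) \<le> 1 / 2"
  proof -
    have "C * measure pi (- {a..b}) \<le> C * (1 / (2 * C))" using ab(3) C(1) by (intro mult_left_mono) auto
    then show ?thesis using C(1) by simp
  qed
  have compl: "measure pi (- {a..b}) = 1 - measure pi {a..b}"
    using pi.prob_compl[of "{a..b}"] by (simp add: Compl_eq_Diff_UNIV)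
  have "1 / (2 * C) \<le> 1 / 2" using C1 by (simp add: field_simps)
  then have piK: "1 / 2 \<le> measure pi {a..b}" using ab(3) compl by linarith
  obtain s e where s: "0 < s" and e: "0 < e"
    and m: "\<And>x D. x \<in> {a..b} \<Longrightarrow> D \<in> sets borel \<Longrightarrow> ennreal e * emeasure pi (D \<inter> {a..b}) \<le> emeasure (Q s x) D"
    using local_minorization[OF ab(1,2)] by blast
  have QK: "ennreal (1 / 2) \<le> emeasure (Q 1 x) {a..b}" for x
  proof -
    interpret q: prob_space "Q 1 x" by (rule mk.Q_prob) simp
    have "emeasure (Q 1 x) (- {a..b}) \<le> ennreal C * emeasure pi (- {a..b})" by (rule C(2)) auto
    also have "\<dots> = ennreal (C * measure pi (- {a..b}))" using C(1) by (simp add: pi.emeasure_eq_measure ennreal_mult)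
    also have "\<dots> \<le> ennreal (1 / 2)" using half by (rule ennreal_leI)
    finally have "ennreal (measure (Q 1 x) (- {a..b})) \<le> ennreal (1 / 2)" unfolding q.emeasure_eq_measure .
    then have "measure (Q 1 x) (- {a..b}) \<le> 1 / 2" by (subst (asm) ennreal_le_iff) auto
    moreover have "measure (Q 1 x) (- {a..b}) = 1 - measure (Q 1 x) {a..b}"
      using q.prob_compl[of "{a..b}"] by (simp add: Compl_eq_Diff_UNIV)
    ultimately show ?thesis unfolding q.emeasure_eq_measure by (intro ennreal_leI) linarith
  qed
  define \<theta> where "\<theta> = e / 2 * measure pi {a..b}"
  have \<theta>: "0 < \<theta>" using e piK by (simp add: \<theta>_def)
  have "doeblin_dom Q (1 + s) \<theta> (uniform_measure pi {a..b}) pi C"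
  proof (intro doeblin_dom.intro doeblin.intro doeblin_axioms.intro doeblin_dom_axioms.intro mk.markov_kernels_axioms)
    show "0 < 1 + s" using s by simp
    show "prob_space (uniform_measure pi {a..b})"
      by (rule prob_space_uniform_measure) (use piK in \<open>auto simp: pi.emeasure_eq_measure\<close>)
    fix D :: "real set" and x assume D[measurable]: "D \<in> sets borel"
    have "ennreal \<theta> * emeasure (uniform_measure pi {a..b}) D = ennreal (e / 2) * emeasure pi (D \<inter> {a..b})"
    proof -
      have "emeasure (uniform_measure pi {a..b}) D = ennreal (measure pi (D \<inter> {a..b}) / measure pi {a..b})"
        using piK by (subst emeasure_uniform_measure) (auto simp: pi.emeasure_eq_measure divide_ennreal Int_commute)
      then have "ennreal \<theta> * emeasure (uniform_measure pi {a..b}) D = ennreal \<theta> * ennreal (measure pi (D \<inter> {a..b}) / measure pi {a..b})"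
        by (rule arg_cong)
      also have "\<dots> = ennreal (\<theta> * (measure pi (D \<inter> {a..b}) / measure pi {a..b}))"
        by (rule ennreal_mult[symmetric]) (use \<theta> in auto)
      also have "\<theta> * (measure pi (D \<inter> {a..b}) / measure pi {a..b}) = e / 2 * measure pi (D \<inter> {a..b})"
        using piK by (simp add: \<theta>_def)
      also have "ennreal (e / 2 * measure pi (D \<inter> {a..b})) = ennreal (e / 2) * ennreal (measure pi (D \<inter> {a..b}))"
        by (rule ennreal_mult) (use e in auto)
      finally show ?thesis unfolding pi.emeasure_eq_measure .
    qed
    also have "\<dots> = ennreal e * emeasure pi (D \<inter> {a..b}) * ennreal (1 / 2)"
    proof -
      have "ennreal (e / 2) = ennreal e * ennreal (1 / 2)" using e by (subst ennreal_mult[symmetric]) auto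
      then show ?thesis by (simp add: mult_ac)
    qed
    also have "\<dots> \<le> ennreal e * emeasure pi (D \<inter> {a..b}) * emeasure (Q 1 x) {a..b}" by (rule mult_left_mono[OF QK]) simp
    also have "\<dots> = (\<integral>\<^sup>+y. ennreal e * emeasure pi (D \<inter> {a..b}) * indicator {a..b} y \<partial>Q 1 x)"
      by (simp add: nn_integral_cmult_indicator)
    also have "\<dots> \<le> (\<integral>\<^sup>+y. emeasure (Q s y) D \<partial>Q 1 x)"
      by (rule nn_integral_mono) (use m[OF _ D] in \<open>auto simp: indicator_def\<close>)
    also have "\<dots> = emeasure (Q (1 + s) x) D"
      using mk.Q_CK[of 1 s "indicator D" x] s by simp
    finally show "ennreal \<theta> * emeasure (uniform_measure pi {a..b}) D \<le> emeasure (Q (1 + s) x) D" .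
  qed (use \<theta> C pi_prob pi_nonpos in auto)
  then show ?thesis using ab half by blast
qed

end

locale ground_state_doeblin = ground_state +
  fixes T \<theta> a b C0 :: real
  assumes ab: "0 < a" "a \<le> b" and tail: "C0 * measure pi (- {a..b}) \<le> 1 / 2"
    and doeblin_dom: "doeblin_dom Q T \<theta> (uniform_measure pi {a..b}) pi C0"
begin

sublocale doeblin_dom Q T \<theta> "uniform_measure pi {a..b}" pi C0 by (rule doeblin_dom)

lemma inverse_eta_Q:
  assumes t: "0 \<le> t"
  shows "(\<integral>\<^sup>+y. ennreal (1 / \<eta> y) \<partial>Q t x) = ennreal (exp (lam * t) / \<eta> (base x)) * PP t (\<lambda>_. 1) (base x)"
proof -
  have "(\<integral>\<^sup>+y. ennreal (1 / \<eta> y) \<partial>Q t x) = ennreal (exp (lam * t) / \<eta> (base x)) * PP t (\<lambda>y. ennreal (\<eta> y) * ennreal (1 / \<eta> y)) (base x)"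
    by (rule nn_integral_Q[OF _ t]) auto
  also have "PP t (\<lambda>y. ennreal (\<eta> y) * ennreal (1 / \<eta> y)) (base x) = PP t (\<lambda>_. 1) (base x)"
  proof (rule PP_cong)
    fix y :: real assume "0 < y"
    from eta_pos'[OF this] show "ennreal (\<eta> y) * ennreal (1 / \<eta> y) = 1"
      by (subst ennreal_mult[symmetric]) simp_all
  qed
  finally show ?thesis .
qed

lemma inverse_eta_Q_le:
  assumes t: "0 \<le> t"
  shows "(\<integral>\<^sup>+y. ennreal (1 / \<eta> y) \<partial>Q t x) \<le> ennreal (exp (lam * t) / \<eta> (base x))"
  unfolding inverse_eta_Q[OF t]
  using mult_left_mono[OF PP_le_1[OF t, of "\<lambda>_. 1" "base x"], of "ennreal (exp (lam * t) / \<eta> (base x))"] by simp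

text \<open>Two bounds for \<open>Qg T k y\<close> with k = min(1/\<open>\<eta>\<close>, 1) are
  compared: the Doeblin condition bounds it below by \<open>\<theta> * k1\<close>, while
  \<open>\<eta>\<close> k <= 1 bounds it above by exp(\<open>lam\<close> T)/\<open>\<eta> y\<close>.
  The cap at 1 keeps k bounded, as the Doeblin estimate asks.\<close>

lemma eta_bounded: "\<exists>H>0. \<forall>y>0. \<eta> y \<le> H"
proof -
  obtain l u where lu: "0 < l" "l \<le> u" "\<And>y. y \<in> {a..b} \<Longrightarrow> l \<le> \<eta> y \<and> \<eta> y \<le> u"
    using Icc_bounds[OF eta_continuous eta_pos' ab] by blast
  define k where "k y = (if 0 < y then min (1 / \<eta> y) 1 else 0)" for y
  have k0: "0 \<le> k y" "k y \<le> 1" for y using eta_pos'[of y] by (auto simp: k_def)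
  have km: "k \<in> borel_measurable borel" unfolding k_def by measurable
  have kb: "bdd_meas 1 k" using k0 km by (auto simp: bdd_meas_def)
  define k1 where "k1 = min (1 / u) 1"
  have k1: "0 < k1" "k1 \<le> 1" using lu by (simp_all add: k1_def)
  interpret m: prob_space "uniform_measure pi {a..b}" by (rule m_prob)
  have piK: "0 < measure pi {a..b}"
  proof -
    have "1 - measure pi {a..b} = measure pi (- {a..b})" using pi.prob_compl[of "{a..b}"] by (simp add: Compl_eq_Diff_UNIV)
    moreover have "1 \<le> C0"
    proof -
      have "emeasure (Q 1 0) UNIV \<le> ennreal C0 * emeasure pi UNIV" by (rule dom) simp
      then show ?thesis using prob_space.emeasure_space_1[OF Q_prob, of 1 0] pi.emeasure_space_1 by simp
    qed
    then have "measure pi (- {a..b}) \<le> C0 * measure pi (- {a..b})" by (simp add: mult_right_mono[of 1 C0, simplified])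
    ultimately show ?thesis using tail by linarith
  qed
  have "AE y in uniform_measure pi {a..b}. k1 \<le> k y"
  proof (rule AE_uniform_measureI)
    show "AE y in pi. y \<in> {a..b} \<longrightarrow> k1 \<le> k y"
    proof (rule AE_I2, rule impI)
      fix y assume y: "y \<in> {a..b}"
      then have "0 < y" "1 / u \<le> 1 / \<eta> y" using ab lu(3)[OF y] lu(1) by (auto intro!: divide_left_mono mult_pos_pos)
      then show "k1 \<le> k y" by (auto simp: k_def k1_def)
    qed
  qed simp
  then have "(\<integral>y. k1 \<partial>uniform_measure pi {a..b}) \<le> (\<integral>y. k y \<partial>uniform_measure pi {a..b})"
    using k0 km k1 by (intro integral_mono_AE m.integrable_const_bound[where B=1]) (auto simp: abs_le_iff intro: order_trans)
  then have kk: "k1 \<le> (\<integral>y. k y \<partial>uniform_measure pi {a..b})" using m.prob_space by simp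
  have "\<eta> y \<le> exp (lam * T) / (\<theta> * k1)" if y: "0 < y" for y
  proof -
    have "ennreal (\<theta> * k1) \<le> ennreal (Qg T k y)"
    proof (rule ennreal_leI)
      have "\<theta> * k1 \<le> \<theta> * (\<integral>y. k y \<partial>uniform_measure pi {a..b})" using kk \<theta> by (intro mult_left_mono) auto
      also have "\<dots> \<le> Qg T k y" by (rule minor_integral[OF kb k0(1)])
      finally show "\<theta> * k1 \<le> Qg T k y" .
    qed
    also have "\<dots> = (\<integral>\<^sup>+z. ennreal (k z) \<partial>Q T y)" by (rule Qg_nonneg_eq[symmetric, OF kb k0(1) T])
    also have "\<dots> = ennreal (exp (lam * T) / \<eta> (base y)) * PP T (\<lambda>z. ennreal (\<eta> z) * ennreal (k z)) (base y)"
      by (rule nn_integral_Q) (use T km in auto)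
    also have "\<dots> \<le> ennreal (exp (lam * T) / \<eta> (base y)) * 1"
    proof (intro mult_left_mono PP_le_1)
      fix z :: real assume z: "0 < z"
      have "ennreal (\<eta> z) * ennreal (k z) \<le> ennreal (\<eta> z) * ennreal (1 / \<eta> z)"
        using z by (intro mult_left_mono ennreal_leI) (auto simp: k_def)
      also have "\<dots> = 1" using eta_pos'[OF z] by (subst ennreal_mult[symmetric]) simp_all
      finally show "ennreal (\<eta> z) * ennreal (k z) \<le> 1" .
    qed (use T in auto)
    also have "\<dots> = ennreal (exp (lam * T) / \<eta> y)" using y by (simp add: base_def)
    finally have "\<theta> * k1 \<le> exp (lam * T) / \<eta> y" using eta_pos'[OF y] by simp
    then show ?thesis using eta_pos'[OF y] \<theta> k1 by (simp add: field_simps)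
  qed
  moreover have "0 < exp (lam * T) / (\<theta> * k1)" using \<theta> k1 by simp
  ultimately show ?thesis by blast
qed

end

section \<open>Identification of the limit law\<close>

lemma exp_small_bounds:
  assumes "0 \<le> z" "z \<le> (1::real)"
  shows "0 \<le> exp z - 1 - z" "exp z - 1 - z \<le> z\<^sup>2" "0 \<le> exp z - 1" "exp z - 1 \<le> 2 * z" "exp z \<le> 3"
proof -
  have b: "exp z \<le> 1 + z + z\<^sup>2" using exp_bound[of z] assms by simp
  have z2: "z\<^sup>2 \<le> z" using assms by (simp add: power2_eq_square mult_left_le)
  show "0 \<le> exp z - 1 - z" "0 \<le> exp z - 1" using exp_ge_add_one_self[of z] assms by linarith+
  show "exp z - 1 - z \<le> z\<^sup>2" using b by simp
  show "exp z - 1 \<le> 2 * z" "exp z \<le> 3" using b z2 assms by auto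
qed

context ground_state_doeblin
begin

lemma Qg_eq:
  assumes \<phi>: "bdd_meas C \<phi>" and t: "0 < t" and x: "0 < x" and g: "g \<in> borel_measurable borel" "\<And>y. 0 < y \<Longrightarrow> g y = \<eta> y * \<phi> y"
  shows "Qg t \<phi> x = exp (lam * t) / \<eta> x * (\<integral>\<omega>. indicator {\<omega>. surv x t \<omega>} \<omega> * g (X x t \<omega>) \<partial>M)"
proof -
  have [measurable]: "\<phi> \<in> borel_measurable borel" using \<phi> by (rule bdd_meas_meas)
  note [measurable] = g(1)
  define c where "c = exp (lam * t) / \<eta> x"
  have c: "0 < c" using eta_pos'[OF x] by (simp add: c_def)
  have bx: "base x = x" using x by (simp add: base_def)
  have t0: "0 \<le> t" using t by simp
  have im: "(\<lambda>\<omega>. indicator {\<omega>. surv x t \<omega>} \<omega> :: real) \<in> borel_measurable M"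
  proof -
    have "(\<lambda>\<omega>. if surv x t \<omega> then 1 else 0 :: real) \<in> borel_measurable M" using t0 by measurable
    then show ?thesis by (simp add: indicator_def of_bool_def)
  qed
  have Xm: "X x t \<in> borel_measurable M" using t by simp
  \<comment> \<open>The positive part matters only off the half-line, where the sign of
    \<open>\<eta>\<close> is unspecified; it makes the real density nonnegative.\<close>
  have Q: "Q t x = density (kern t x) (\<lambda>y. ennreal (c * max 0 (\<eta> y)))"
    unfolding Q_def bx c_def[symmetric]
  proof (rule density_cong)
    show "AE y in kern t x. ennreal c * ennreal (\<eta> y) = ennreal (c * max 0 (\<eta> y))"
      using c by (intro AE_I2) (auto simp: ennreal_mult[symmetric] max_def ennreal_neg)
  qed auto
  have k: "kern t x = distr (density M (\<lambda>\<omega>. ennreal (indicator {\<omega>. surv x t \<omega>} \<omega>))) borel (X x t)"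
    unfolding kern_def by (simp add: ennreal_indicator)
  have "Qg t \<phi> x = (\<integral>y. \<phi> y \<partial>density (kern t x) (\<lambda>y. ennreal (c * max 0 (\<eta> y))))" unfolding Qg_def Q ..
  also have "\<dots> = (\<integral>y. (c * max 0 (\<eta> y)) *\<^sub>R \<phi> y \<partial>kern t x)"
    by (rule integral_density) (use c in auto)
  also have "\<dots> = (\<integral>\<omega>. (c * max 0 (\<eta> (X x t \<omega>))) *\<^sub>R \<phi> (X x t \<omega>) \<partial>density M (\<lambda>\<omega>. ennreal (indicator {\<omega>. surv x t \<omega>} \<omega>)))"
    unfolding k by (rule integral_distr) (use Xm in auto)
  also have "\<dots> = (\<integral>\<omega>. indicator {\<omega>. surv x t \<omega>} \<omega> *\<^sub>R ((c * max 0 (\<eta> (X x t \<omega>))) *\<^sub>R \<phi> (X x t \<omega>)) \<partial>M)"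
    by (rule integral_density) (use im Xm in \<open>auto intro!: measurable_compose[OF Xm]\<close>)
  also have "\<dots> = (\<integral>\<omega>. c * (indicator {\<omega>. surv x t \<omega>} \<omega> * g (X x t \<omega>)) \<partial>M)"
  proof (rule Bochner_Integration.integral_cong[OF refl])
    fix \<omega>
    show "indicator {\<omega>. surv x t \<omega>} \<omega> *\<^sub>R ((c * max 0 (\<eta> (X x t \<omega>))) *\<^sub>R \<phi> (X x t \<omega>)) = c * (indicator {\<omega>. surv x t \<omega>} \<omega> * g (X x t \<omega>))"
    proof (cases "surv x t \<omega>")
      case True
      from X_pos[OF True] show ?thesis using True eta_pos'[OF X_pos[OF True]] g(2) by (simp add: max_def)
    qed (simp add: indicator_def)
  qed
  also have "\<dots> = c * (\<integral>\<omega>. indicator {\<omega>. surv x t \<omega>} \<omega> * g (X x t \<omega>) \<partial>M)" by simp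
  finally show ?thesis by (simp add: c_def)
qed

text \<open>Multiplied by \<open>\<eta>\<close>, the transformed semigroup becomes
  exp(\<open>lam\<close> h) times the killed one acting on g = \<open>\<eta>\<close>
  \<open>\<phi>\<close>, where the generator estimate is uniform. Dividing back leaves the weight
  1/\<open>\<eta>\<close>, which may be unbounded but is integrable under every
  \<open>Q s 1\<close>.\<close>

lemma dynkin_error:
  assumes d1: "\<And>x. (g has_real_derivative g' x) (at x)" and d2: "\<And>x. (g' has_real_derivative g'' x) (at x)"
    and c2: "continuous_on UNIV g''" and sup: "\<And>x. x \<notin> {p..q} \<Longrightarrow> g x = 0" and p: "0 < p"
    and \<phi>: "bdd_meas C \<phi>" "\<And>y. 0 < y \<Longrightarrow> g y = \<eta> y * \<phi> y"
    and F: "\<And>y. 0 < y \<Longrightarrow> \<eta> y * F y = g'' y / 2 - \<alpha> y * g' y + lam * g y"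
    and G: "\<And>y. \<bar>g y\<bar> \<le> G0" "\<And>y. 0 < y \<Longrightarrow> \<bar>g'' y / 2 - \<alpha> y * g' y\<bar> \<le> G3" and e: "0 < e"
  shows "\<exists>h0>0. \<forall>h. 0 < h \<and> h < h0 \<longrightarrow> (\<forall>y>0. \<bar>Qg h \<phi> y - \<phi> y - h * F y\<bar> \<le> e * h * (1 / \<eta> y))"
proof -
  have G0: "0 \<le> G0" using G(1)[of 0] by linarith
  have G3: "0 \<le> G3" using G(2)[of 1] by linarith
  have c0: "continuous_on UNIV g" using d1 by (meson DERIV_continuous_on has_field_derivative_at_within)
  have gm: "g \<in> borel_measurable borel" using c0 by (rule borel_measurable_continuous_onI)
  obtain h1 where h1: "h1 > 0" "\<And>h x. 0 < h \<Longrightarrow> h < h1 \<Longrightarrow> x > 0 \<Longrightarrow> \<bar>(\<integral>\<omega>. indicator {\<omega>. surv x h \<omega>} \<omega> * g (X x h \<omega>) \<partial>M) - g x - h * (g'' x / 2 - \<alpha> x * g' x)\<bar> \<le> e / 6 * h"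
  proof -
    have "\<exists>h0>0. \<forall>h. 0 < h \<and> h < h0 \<longrightarrow> (\<forall>x>0. \<bar>(\<integral>\<omega>. indicator {\<omega>. surv x h \<omega>} \<omega> * g (X x h \<omega>) \<partial>M) - g x - h * (g'' x / 2 - \<alpha> x * g' x)\<bar> \<le> e / 6 * h)"
      by (rule generator_estimate[OF d1 d2 c2 _ p]) (use sup e in auto)
    then show ?thesis using that by blast
  qed
  \<comment> \<open>For h < e/z the second-order terms from expanding exp(\<open>lam\<close> h) are
    at most h e/2. The other half is three times the generator error e h/6, as
    exp(\<open>lam\<close> h) <= 3.\<close>
  define z where "z = 2 * (lam\<^sup>2 * G0 + 2 * lam * G3) + 1"
  have z: "0 < z" using G0 G3 lam_pos by (auto simp: z_def intro!: add_nonneg_pos)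
  define h0 where "h0 = min h1 (min (1 / lam) (e / z))"
  have h0: "0 < h0" using h1 lam_pos e z by (simp add: h0_def)
  have "\<bar>Qg h \<phi> y - \<phi> y - h * F y\<bar> \<le> e * h * (1 / \<eta> y)" if h: "0 < h" "h < h0" and y: "0 < y" for h y
  proof -
    have hs: "h < h1" "h < 1 / lam" "h < e / z" using h by (auto simp: h0_def)
    define I where "I = (\<integral>\<omega>. indicator {\<omega>. surv y h \<omega>} \<omega> * g (X y h \<omega>) \<partial>M)"
    define Lg where "Lg = g'' y / 2 - \<alpha> y * g' y"
    have lh: "0 \<le> lam * h" "lam * h \<le> 1" using h lam_pos hs(2) by (auto simp: field_simps)
    note ex = exp_small_bounds[OF lh]
    have 1: "\<bar>I - g y - h * Lg\<bar> \<le> e / 6 * h" unfolding I_def Lg_def by (rule h1(2)[OF h(1) hs(1) y])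
    have "Qg h \<phi> y = exp (lam * h) / \<eta> y * I" unfolding I_def by (rule Qg_eq[OF \<phi>(1) h(1) y gm]) (rule \<phi>(2))
    then have a: "\<eta> y * Qg h \<phi> y = exp (lam * h) * I" using eta_pos'[OF y] by simp
    have "\<eta> y * (Qg h \<phi> y - \<phi> y - h * F y) = \<eta> y * Qg h \<phi> y - \<eta> y * \<phi> y - h * (\<eta> y * F y)" by (simp add: algebra_simps)
    also have "\<dots> = exp (lam * h) * I - g y - h * (Lg + lam * g y)" unfolding a F[OF y] \<phi>(2)[OF y, symmetric] Lg_def ..
    also have "\<dots> = exp (lam * h) * (I - g y - h * Lg) + (exp (lam * h) - 1 - lam * h) * g y + h * ((exp (lam * h) - 1) * Lg)"
      by (simp add: algebra_simps)
    finally have eq: "\<eta> y * (Qg h \<phi> y - \<phi> y - h * F y) = exp (lam * h) * (I - g y - h * Lg) + (exp (lam * h) - 1 - lam * h) * g y + h * ((exp (lam * h) - 1) * Lg)" .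
    have t1: "\<bar>exp (lam * h) * (I - g y - h * Lg)\<bar> \<le> 3 * (e / 6 * h)"
      unfolding abs_mult using ex(5) 1 by (intro mult_mono) auto
    have t2: "\<bar>(exp (lam * h) - 1 - lam * h) * g y\<bar> \<le> (lam * h)\<^sup>2 * G0"
      unfolding abs_mult using ex(1,2) G(1)[of y] by (intro mult_mono) auto
    have t3: "\<bar>h * ((exp (lam * h) - 1) * Lg)\<bar> \<le> h * (2 * (lam * h) * G3)"
      unfolding abs_mult using ex(3,4) G(2)[OF y] h(1) lh by (intro mult_mono) (auto simp: Lg_def)
    have "(lam * h)\<^sup>2 * G0 + h * (2 * (lam * h) * G3) = h * (h * (lam\<^sup>2 * G0 + 2 * lam * G3))"
      by (simp add: algebra_simps power2_eq_square)
    also have "\<dots> \<le> h * (e / 2)"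
    proof (rule mult_left_mono)
      have "h * z \<le> e" using hs(3) z by (simp add: field_simps)
      then show "h * (lam\<^sup>2 * G0 + 2 * lam * G3) \<le> e / 2" using h(1) unfolding z_def by (simp add: algebra_simps)
    qed (use h in simp)
    finally have t4: "(lam * h)\<^sup>2 * G0 + h * (2 * (lam * h) * G3) \<le> h * (e / 2)" .
    have "\<bar>\<eta> y * (Qg h \<phi> y - \<phi> y - h * F y)\<bar> \<le> e * h"
    proof -
      have tri: "\<bar>u + v + w\<bar> \<le> d" if "\<bar>u\<bar> \<le> d1" "\<bar>v\<bar> \<le> d2" "\<bar>w\<bar> \<le> d3" "d1 + d2 + d3 \<le> d" for u v w d d1 d2 d3 :: real
        using that by linarith
      have "3 * (e / 6 * h) = h * (e / 2)" "h * (e / 2) + h * (e / 2) = e * h" by (simp_all add: field_simps)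
      then have "3 * (e / 6 * h) + (lam * h)\<^sup>2 * G0 + h * (2 * (lam * h) * G3) \<le> e * h" using t4 by linarith
      then show ?thesis unfolding eq by (rule tri[OF t1 t2 t3])
    qed
    then have "\<eta> y * \<bar>Qg h \<phi> y - \<phi> y - h * F y\<bar> \<le> e * h" using eta_pos'[OF y] by (simp add: abs_mult)
    then show ?thesis using eta_pos'[OF y] by (simp add: field_simps)
  qed
  then show ?thesis using h0 by blast
qed

lemma Q_AE_pos: "0 < t \<Longrightarrow> AE y in Q t x. 0 < y"
proof -
  assume t: "0 < t"
  have "emeasure (Q t x) {..0} = ennreal (exp (lam * t) / \<eta> (base x)) * PP t (\<lambda>y. ennreal (\<eta> y) * indicator {..0} y) (base x)"
    using nn_integral_Q[of "indicator {..0}" t x] t by simp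
  also have "PP t (\<lambda>y. ennreal (\<eta> y) * indicator {..0} y) (base x) = PP t (\<lambda>y. 0) (base x)"
    by (rule PP_cong) (auto simp: indicator_def)
  also have "\<dots> = 0" by (simp add: PP_def)
  finally show ?thesis by (intro AE_I[of _ _ "{..0}"]) (auto simp: not_less)
qed

lemma Qg_diff: "bdd_meas C f \<Longrightarrow> bdd_meas D g \<Longrightarrow> 0 < t \<Longrightarrow> Qg t (\<lambda>y. f y - g y) x = Qg t f x - Qg t g x"
  using Qg_add[of C f "\<bar>-1\<bar> * D" "\<lambda>y. - 1 * g y" t x] bdd_meas_cmult[of D g "-1"] Qg_cmult[of t "-1" g x] by simp

text \<open>The weight 1/\<open>\<eta>\<close> integrates to at most exp(\<open>lam\<close>
  s)/\<open>\<eta> 1\<close> under \<open>Q s 1\<close>. This bound grows with s, so the estimate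
  serves on bounded time windows.\<close>

lemma dynkin_increment:
  assumes \<phi>: "bdd_meas C \<phi>" and F: "bdd_meas D F" and h: "0 < h" and s: "0 < s" and e: "0 \<le> e"
    and err: "\<And>y. 0 < y \<Longrightarrow> \<bar>Qg h \<phi> y - \<phi> y - h * F y\<bar> \<le> e * h * (1 / \<eta> y)"
  shows "\<bar>Qg (s + h) \<phi> 1 - Qg s \<phi> 1 - h * Qg s F 1\<bar> \<le> e * h * (exp (lam * s) / \<eta> 1)"
proof -
  define R where "R y = Qg h \<phi> y - \<phi> y - h * F y" for y
  have b1: "bdd_meas (C + C) (\<lambda>y. Qg h \<phi> y - \<phi> y)" by (rule bdd_meas_diff[OF Qg_bdd_meas[OF \<phi> h] \<phi>])
  have bR: "bdd_meas (C + C + \<bar>h\<bar> * D) R" unfolding R_def by (rule bdd_meas_diff[OF b1 bdd_meas_cmult[OF F]])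
  have ba: "bdd_meas (C + C + \<bar>h\<bar> * D) (\<lambda>y. \<bar>R y\<bar>)" using bR by (auto simp: bdd_meas_def)
  have "Qg s R 1 = Qg s (\<lambda>y. Qg h \<phi> y - \<phi> y) 1 - Qg s (\<lambda>y. h * F y) 1"
    unfolding R_def by (rule Qg_diff[OF b1 bdd_meas_cmult[OF F] s])
  also have "Qg s (\<lambda>y. Qg h \<phi> y - \<phi> y) 1 = Qg s (Qg h \<phi>) 1 - Qg s \<phi> 1"
    by (rule Qg_diff[OF Qg_bdd_meas[OF \<phi> h] \<phi> s])
  also have "Qg s (Qg h \<phi>) 1 = Qg (s + h) \<phi> 1" by (rule Qg_CK[symmetric, OF \<phi> s h])
  finally have eq: "Qg s R 1 = Qg (s + h) \<phi> 1 - Qg s \<phi> 1 - h * Qg s F 1" by (simp add: Qg_cmult)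
  have "\<bar>Qg s R 1\<bar> \<le> Qg s (\<lambda>y. \<bar>R y\<bar>) 1" unfolding Qg_def by (rule integral_abs_bound)
  moreover have "ennreal (Qg s (\<lambda>y. \<bar>R y\<bar>) 1) \<le> ennreal (e * h * (exp (lam * s) / \<eta> 1))"
  proof -
    have "ennreal (Qg s (\<lambda>y. \<bar>R y\<bar>) 1) = (\<integral>\<^sup>+y. ennreal \<bar>R y\<bar> \<partial>Q s 1)" by (rule Qg_nonneg_eq[symmetric, OF ba _ s]) simp
    also have "\<dots> \<le> (\<integral>\<^sup>+y. ennreal (e * h) * ennreal (1 / \<eta> y) \<partial>Q s 1)"
    proof (rule nn_integral_mono_AE)
      show "AE y in Q s 1. ennreal \<bar>R y\<bar> \<le> ennreal (e * h) * ennreal (1 / \<eta> y)"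
        using Q_AE_pos[OF s, of 1]
      proof eventually_elim
        case (elim y)
        have "ennreal \<bar>R y\<bar> \<le> ennreal (e * h * (1 / \<eta> y))" unfolding R_def by (rule ennreal_leI[OF err[OF elim]])
        also have "\<dots> = ennreal (e * h) * ennreal (1 / \<eta> y)" using e h eta_pos'[OF elim] by (intro ennreal_mult) simp_all
        finally show ?case .
      qed
    qed
    also have "\<dots> = ennreal (e * h) * (\<integral>\<^sup>+y. ennreal (1 / \<eta> y) \<partial>Q s 1)" by (rule nn_integral_cmult) auto
    also have "\<dots> \<le> ennreal (e * h) * ennreal (exp (lam * s) / \<eta> (base 1))"
      by (rule mult_left_mono[OF inverse_eta_Q_le]) (use s in auto)
    also have "\<dots> = ennreal (e * h * (exp (lam * s) / \<eta> 1))"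
      using e h eta_pos'[of 1] by (simp add: base_def ennreal_mult[symmetric])
    finally show ?thesis .
  qed
  then have "Qg s (\<lambda>y. \<bar>R y\<bar>) 1 \<le> e * h * (exp (lam * s) / \<eta> 1)"
    using e h eta_pos'[of 1] by (simp add: ennreal_le_iff)
  ultimately show ?thesis unfolding eq[symmetric] by linarith
qed

text \<open>A bounded function of time whose derivative converges must have derivative tending to 0.\<close>

lemma erg_generator_zero:
  assumes d1: "\<And>x. (g has_real_derivative g' x) (at x)" and d2: "\<And>x. (g' has_real_derivative g'' x) (at x)"
    and c2: "continuous_on UNIV g''" and sup: "\<And>x. x \<notin> {p..q} \<Longrightarrow> g x = 0" and p: "0 < p"
    and \<phi>: "bdd_meas C \<phi>" "\<And>y. 0 < y \<Longrightarrow> g y = \<eta> y * \<phi> y"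
    and F: "bdd_meas D F" "\<And>y. 0 < y \<Longrightarrow> \<eta> y * F y = g'' y / 2 - \<alpha> y * g' y + lam * g y"
    and G: "\<And>y. \<bar>g y\<bar> \<le> G0" "\<And>y. 0 < y \<Longrightarrow> \<bar>g'' y / 2 - \<alpha> y * g' y\<bar> \<le> G3"
  shows "erg F = 0"
proof (rule ccontr)
  define f where "f = erg F"
  assume "erg F \<noteq> 0"
  then have f: "0 < \<bar>f\<bar>" by (simp add: f_def)
  have C: "0 \<le> C" using bdd_meas_nonneg[OF \<phi>(1)] .
  obtain S where S: "S > 0" "\<And>t x. t \<ge> S \<Longrightarrow> \<bar>Qg t F x - f\<bar> \<le> \<bar>f\<bar> / 4"
    using erg_uniform[OF F(1), of "\<bar>f\<bar> / 4"] f unfolding f_def by auto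
  \<comment> \<open>Over a window of this length, increments at a rate of at least |f|/2 accumulate
    2C + 1, more than a function bounded by C can vary. The window is fixed before \<open>e\<close>
    and \<open>h\<close>, so exp(\<open>lam\<close> s) stays bounded on it.\<close>
  define L where "L = (2 * C + 1) * 2 / \<bar>f\<bar>"
  have L: "0 < L" "L * \<bar>f\<bar> / 2 = 2 * C + 1" using f C by (auto simp: L_def)
  define K where "K = exp (lam * (S + L)) / \<eta> 1"
  have K: "0 < K" using eta_pos'[of 1] by (simp add: K_def)
  define e where "e = \<bar>f\<bar> / (4 * K)"
  have e: "0 < e" "e * K = \<bar>f\<bar> / 4" using f K by (auto simp: e_def)
  obtain h0 where h0: "h0 > 0" "\<And>h y. 0 < h \<Longrightarrow> h < h0 \<Longrightarrow> 0 < y \<Longrightarrow> \<bar>Qg h \<phi> y - \<phi> y - h * F y\<bar> \<le> e * h * (1 / \<eta> y)"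
  proof -
    have "\<exists>h0>0. \<forall>h. 0 < h \<and> h < h0 \<longrightarrow> (\<forall>y>0. \<bar>Qg h \<phi> y - \<phi> y - h * F y\<bar> \<le> e * h * (1 / \<eta> y))"
      by (rule dynkin_error[OF d1 d2 c2 _ p \<phi>(1) _ _ _ _ e(1)]) (fact sup \<phi>(2) F(2) G)+
    then show ?thesis using that by blast
  qed
  obtain n where n: "L / h0 < real n" using reals_Archimedean2 by blast
  have n0: "0 < real n" using n L h0 by (smt (verit) divide_pos_pos)
  define h where "h = L / real n"
  have h: "0 < h" "h < h0" "real n * h = L"
    using L n0 n h0 by (auto simp: h_def field_simps)
  define s where "s k = S + real k * h" for k :: nat
  have inc: "\<bar>Qg (s (Suc k)) \<phi> 1 - Qg (s k) \<phi> 1 - h * f\<bar> \<le> h * (\<bar>f\<bar> / 2)" if k: "k < n" for k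
  proof -
    have kh: "0 \<le> real k * h" "real k * h \<le> L" using h k n0 mult_right_mono[of "real k" "real n" h] by auto
    have sk: "0 < s k" "S \<le> s k" "s k \<le> S + L" using S kh by (auto simp: s_def)
    have ss: "s (Suc k) = s k + h" by (simp add: s_def algebra_simps)
    have "\<bar>Qg (s k + h) \<phi> 1 - Qg (s k) \<phi> 1 - h * Qg (s k) F 1\<bar> \<le> e * h * (exp (lam * s k) / \<eta> 1)"
      by (rule dynkin_increment[OF \<phi>(1) F(1) h(1) sk(1) less_imp_le[OF e(1)] h0(2)[OF h(1,2)]])
    also have "\<dots> \<le> e * h * K"
      unfolding K_def using e h eta_pos'[of 1] lam_pos sk(3) by (intro mult_left_mono divide_right_mono) auto
    also have "\<dots> = h * (\<bar>f\<bar> / 4)" using e(2) by (simp add: mult_ac)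
    finally have 1: "\<bar>Qg (s k + h) \<phi> 1 - Qg (s k) \<phi> 1 - h * Qg (s k) F 1\<bar> \<le> h * (\<bar>f\<bar> / 4)" .
    have "\<bar>h * Qg (s k) F 1 - h * f\<bar> = h * \<bar>Qg (s k) F 1 - f\<bar>" using h by (simp add: abs_mult right_diff_distrib[symmetric])
    also have "\<dots> \<le> h * (\<bar>f\<bar> / 4)" using S(2)[OF sk(2)] h by (intro mult_left_mono) auto
    finally show ?thesis using 1 unfolding ss by linarith
  qed
  have "\<bar>Qg (s n) \<phi> 1 - Qg (s 0) \<phi> 1 - real n * (h * f)\<bar> \<le> real n * (h * (\<bar>f\<bar> / 2))"
  proof -
    have eq: "Qg (s n) \<phi> 1 - Qg (s 0) \<phi> 1 - real n * (h * f) = (\<Sum>k<n. Qg (s (Suc k)) \<phi> 1 - Qg (s k) \<phi> 1 - h * f)"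
      using sum_lessThan_telescope[of "\<lambda>k. Qg (s k) \<phi> 1" n] by (simp add: sum_subtractf)
    have "\<bar>Qg (s n) \<phi> 1 - Qg (s 0) \<phi> 1 - real n * (h * f)\<bar> \<le> (\<Sum>k<n. \<bar>Qg (s (Suc k)) \<phi> 1 - Qg (s k) \<phi> 1 - h * f\<bar>)"
      unfolding eq by (rule sum_abs)
    also have "\<dots> \<le> (\<Sum>k<n. h * (\<bar>f\<bar> / 2))" by (rule sum_mono, rule inc) simp
    also have "\<dots> = real n * (h * (\<bar>f\<bar> / 2))" by simp
    finally show ?thesis .
  qed
  then have "\<bar>Qg (s n) \<phi> 1 - Qg (s 0) \<phi> 1 - L * f\<bar> \<le> L * (\<bar>f\<bar> / 2)" using h(3) by (simp add: mult.assoc[symmetric])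
  moreover have "\<bar>Qg (s n) \<phi> 1\<bar> \<le> C" "\<bar>Qg (s 0) \<phi> 1\<bar> \<le> C"
    using bdd_meas_le[OF Qg_bdd_meas[OF \<phi>(1)]] S h n0 by (auto simp: s_def add_pos_nonneg)
  moreover have "\<bar>L * f\<bar> = L * \<bar>f\<bar>" using L by (simp add: abs_mult)
  ultimately show False using L(2) by linarith
qed

end

section \<open>Test functions with prescribed image under the generator\<close>

lemma compact_support_antiderivative:
  fixes f :: "real \<Rightarrow> real"
  assumes c: "continuous_on UNIV f" and z: "\<And>x. x \<notin> {p..q} \<Longrightarrow> f x = 0" and p: "0 < p" "p \<le> q"
  shows "((\<lambda>x. integral {0..x} f) has_real_derivative f x) (at x)"
    and "x < p \<Longrightarrow> integral {0..x} f = 0" and "q \<le> x \<Longrightarrow> integral {0..x} f = integral {0..q} f"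
proof -
  have zero: "integral {0..x} f = 0" if "x < p" for x
  proof -
    have "integral {0..x} f = integral {0..x} (\<lambda>_. 0)" by (rule integral_cong) (use z that in auto)
    then show ?thesis by simp
  qed
  then show "x < p \<Longrightarrow> integral {0..x} f = 0" .
  have i: "f integrable_on {u..v}" for u v by (rule integrable_continuous_real, rule continuous_on_subset[OF c]) auto
  show "integral {0..x} f = integral {0..q} f" if "q \<le> x"
  proof -
    have "integral {q..x} f = integral {q..x} (\<lambda>_. 0)"
    proof (rule integral_spike[of "{q}"])
      fix u assume "u \<in> {q..x} - {q}"
      then show "0 = f u" using z[of u] by simp
    qed simp
    then show ?thesis using Henstock_Kurzweil_Integration.integral_combine[of 0 q x f] i that p by simp
  qed
  show "((\<lambda>x. integral {0..x} f) has_real_derivative f x) (at x)"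
  proof (cases "x < p")
    case True
    have "((\<lambda>_. 0) has_real_derivative 0) (at x)" by simp
    then have "((\<lambda>x. integral {0..x} f) has_real_derivative 0) (at x)"
      by (rule has_field_derivative_transform_within_open[where S="{..<p}"]) (use True zero in auto)
    then show ?thesis using z[of x] True by simp
  next
    case False
    have "((\<lambda>x. integral {0..x} f) has_real_derivative f x) (at x within {0..x+1})"
      by (rule integral_has_real_derivative) (use False p c in \<open>auto intro: continuous_on_subset\<close>)
    then show ?thesis using False p by (simp add: at_within_Icc_at)
  qed
qed

lemma continuous_on_glue:
  fixes f :: "real \<Rightarrow> real"
  assumes "continuous_on {0<..} f" "\<And>x. x < p \<Longrightarrow> f x = 0" "0 < p"
  shows "continuous_on UNIV f"
proof -
  have "continuous_on {..<p} f" by (rule continuous_on_eq[of _ "\<lambda>_. 0"]) (use assms in auto)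
  then have "continuous_on ({..<p} \<union> {0<..}) f" using assms(1) by (intro continuous_on_open_Un) auto
  moreover have "{..<p} \<union> {0<..} = UNIV" using assms(3) by auto
  ultimately show ?thesis by simp
qed

context ground_state_doeblin
begin

lemma weight_glue:
  assumes c: "continuous_on UNIV f" and z: "\<And>x. x < p \<Longrightarrow> f x = 0" and p: "0 < p"
  shows "continuous_on UNIV (\<lambda>x. if 0 < x then f x / mden x else 0)"
    and "continuous_on UNIV (\<lambda>x. if 0 < x then mden x * f x else 0)"
proof -
  have cf: "continuous_on {0<..} f" by (rule continuous_on_subset[OF c]) auto
  have nz: "\<And>x. x \<in> {0<..} \<Longrightarrow> mden x \<noteq> 0" using mden_pos by fastforce
  show "continuous_on UNIV (\<lambda>x. if 0 < x then f x / mden x else 0)"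
  proof (rule continuous_on_glue[OF _ _ p])
    have "continuous_on {0<..} (\<lambda>x. f x / mden x)" using cf mden_continuous nz by (intro continuous_on_divide) auto
    then show "continuous_on {0<..} (\<lambda>x. if 0 < x then f x / mden x else 0)" by (rule continuous_on_eq) auto
  qed (use z in auto)
  show "continuous_on UNIV (\<lambda>x. if 0 < x then mden x * f x else 0)"
  proof (rule continuous_on_glue[OF _ _ p])
    have "continuous_on {0<..} (\<lambda>x. mden x * f x)" using cf mden_continuous by (intro continuous_on_mult) auto
    then show "continuous_on {0<..} (\<lambda>x. if 0 < x then mden x * f x else 0)" by (rule continuous_on_eq) auto
  qed (use z in auto)
qed

lemma compact_support_bdd_meas:
  assumes "continuous_on UNIV f" "\<And>x. x \<notin> {p..q} \<Longrightarrow> f x = 0"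
  shows "\<exists>C. bdd_meas C f"
proof -
  have "\<exists>C\<ge>0. \<forall>x. \<bar>f x\<bar> \<le> C" by (rule compact_support_bounded[OF assms])
  then show ?thesis using borel_measurable_continuous_onI[OF assms(1)] by (auto simp: bdd_meas_def)
qed

text \<open>With m = \<open>mden\<close>, the equation (m u')' = \<open>\<xi>\<close> is solved by
  two integrations, m u' = \<open>\<psi>\<close> and u = \<open>\<phi>\<close>. The two vanishing
  integrals make \<open>\<psi>\<close> and then \<open>\<phi>\<close> compactly supported, so
  \<open>erg_generator_zero\<close> applies to the generator image
  \<open>\<xi>\<close>/(2m).\<close>

lemma erg_test_function:
  assumes \<xi>: "continuous_on UNIV \<xi>" "\<And>x. x \<notin> {p..q} \<Longrightarrow> \<xi> x = 0" and p: "0 < p" "p \<le> q"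
    and \<psi>: "\<And>x. \<psi> x = integral {0..x} \<xi>" "\<psi> q = 0"
    and k: "\<And>x. k x = (if 0 < x then \<psi> x / mden x else 0)" "integral {0..q} k = 0"
  shows "erg (\<lambda>y. if 0 < y then \<xi> y / (2 * mden y) else 0) = 0"
proof -
  obtain \<eta>' \<eta>'' where ode: "\<And>y. 0 < y \<Longrightarrow> (\<eta> has_real_derivative \<eta>' y) (at y)"
      "\<And>y. 0 < y \<Longrightarrow> (\<eta>' has_real_derivative \<eta>'' y) (at y)"
      "\<And>y. 0 < y \<Longrightarrow> \<eta>'' y / 2 - \<alpha> y * \<eta>' y = - lam * \<eta> y" using eta_ode by blast
  have c\<eta>': "continuous_on {0<..} \<eta>'"
    by (rule continuous_at_imp_continuous_on) (auto intro: DERIV_isCont[OF ode(2)])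
  have c\<eta>'': "continuous_on {0<..} \<eta>''"
  proof (rule continuous_on_eq)
    show "continuous_on {0<..} (\<lambda>y. 2 * (\<alpha> y * \<eta>' y - lam * \<eta> y))"
      by (intro continuous_intros continuous_drift c\<eta>' eta_continuous)
  qed (use ode(3) in force)
  have d\<psi>: "(\<psi> has_real_derivative \<xi> x) (at x)" for x
    using compact_support_antiderivative(1)[OF \<xi> p, of x] unfolding \<psi>(1)[symmetric] .
  have z\<psi>: "\<psi> x = 0" if "x \<notin> {p..q}" for x
    using compact_support_antiderivative(2,3)[OF \<xi> p, of x] \<psi> that by (cases "x < p") auto
  have c\<psi>: "continuous_on UNIV \<psi>" using d\<psi> by (meson DERIV_continuous_on has_field_derivative_at_within)
  have ck: "continuous_on UNIV k" unfolding k(1)[abs_def] by (rule weight_glue(1)[OF c\<psi> _ p(1)]) (use z\<psi> in auto)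
  have zk: "k x = 0" if "x \<notin> {p..q}" for x using z\<psi>[OF that] k(1) by simp
  define \<phi> where "\<phi> x = integral {0..x} k" for x
  have d\<phi>: "(\<phi> has_real_derivative k x) (at x)" for x
    using compact_support_antiderivative(1)[OF ck zk p, of x] unfolding \<phi>_def[abs_def] by simp
  have z\<phi>: "\<phi> x = 0" if "x \<notin> {p..q}" for x
    using compact_support_antiderivative(2,3)[OF ck zk p, of x] k(2) that unfolding \<phi>_def by (cases "x < p") auto
  have c\<phi>: "continuous_on UNIV \<phi>" using d\<phi> by (meson DERIV_continuous_on has_field_derivative_at_within)
  \<comment> \<open>The derivative of \<open>\<psi>\<close>/m on the half-line, by m'/m = 2
    \<open>\<eta>'\<close>/\<open>\<eta>\<close> - 2 \<open>\<alpha>\<close>.\<close>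
  define k' where "k' x = \<xi> x / mden x - k x * (2 * \<eta>' x / \<eta> x - 2 * \<alpha> x)" for x
  define g where "g x = \<eta> x * \<phi> x" for x
  define g' where "g' x = (if 0 < x then \<eta>' x * \<phi> x + \<eta> x * k x else 0)" for x
  define g'' where "g'' x = (if 0 < x then \<eta>'' x * \<phi> x + 2 * \<eta>' x * k x + \<eta> x * k' x else 0)" for x
  have dm: "(mden has_real_derivative mden x * (2 * \<eta>' x / \<eta> x - 2 * \<alpha> x)) (at x)" if x: "0 < x" for x
  proof -
    have "(mden has_real_derivative (2 * \<eta> x ^ (2 - 1) * \<eta>' x) * exp (- Qpot \<alpha> x) + exp (- Qpot \<alpha> x) * (- (2 * \<alpha> x)) * (\<eta> x)\<^sup>2) (at x)"
      unfolding mden_def[abs_def] using ode(1)[OF x] Qpot_deriv[OF x] by (auto intro!: derivative_eq_intros)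
    then show ?thesis
      by (rule DERIV_cong) (use eta_pos'[OF x] in \<open>simp add: mden_def field_simps power2_eq_square\<close>)
  qed
  have dk: "(k has_real_derivative k' x) (at x)" if x: "0 < x" for x
  proof -
    have m0: "mden x \<noteq> 0" using mden_pos[OF x] by simp
    have "((\<lambda>x. \<psi> x / mden x) has_real_derivative (\<xi> x * mden x - \<psi> x * (mden x * (2 * \<eta>' x / \<eta> x - 2 * \<alpha> x))) / (mden x * mden x)) (at x)"
      by (rule DERIV_divide[OF d\<psi> dm[OF x] m0])
    moreover have "(\<xi> x * mden x - \<psi> x * (mden x * (2 * \<eta>' x / \<eta> x - 2 * \<alpha> x))) / (mden x * mden x) = k' x"
    proof -
      have kx: "k x = \<psi> x / mden x" using x k(1) by simp
      have "(\<xi> x * mden x - \<psi> x * (mden x * c)) / (mden x * mden x) = \<xi> x / mden x - \<psi> x / mden x * c" for c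
        using m0 by (simp add: field_simps)
      then show ?thesis unfolding k'_def kx by blast
    qed
    ultimately have "((\<lambda>x. \<psi> x / mden x) has_real_derivative k' x) (at x)" by simp
    then show ?thesis
      by (rule has_field_derivative_transform_within_open[where S="{0<..}"]) (use x k(1) in auto)
  qed
  have low: "g x = 0" "g' x = 0" "g'' x = 0" if "x < p" for x
  proof -
    have "\<phi> x = 0" "k x = 0" "\<psi> x = 0" "\<xi> x = 0" using that z\<phi> zk z\<psi> \<xi>(2) by auto
    then show "g x = 0" "g' x = 0" "g'' x = 0" by (auto simp: g_def g'_def g''_def k'_def)
  qed
  have d1: "(g has_real_derivative g' x) (at x)" for x
  proof (cases "x < p")
    case True
    have "((\<lambda>_. 0) has_real_derivative 0) (at x)" by simp
    then have "(g has_real_derivative 0) (at x)"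
      by (rule has_field_derivative_transform_within_open[where S="{..<p}"]) (use True low in auto)
    then show ?thesis using low(2)[OF True] by simp
  next
    case False
    then have x: "0 < x" using p by simp
    have "((\<lambda>x. \<eta> x * \<phi> x) has_real_derivative \<eta>' x * \<phi> x + k x * \<eta> x) (at x)" by (rule DERIV_mult[OF ode(1)[OF x] d\<phi>])
    then show ?thesis using x by (simp add: g_def[abs_def] g'_def mult.commute)
  qed
  have d2: "(g' has_real_derivative g'' x) (at x)" for x
  proof (cases "x < p")
    case True
    have "((\<lambda>_. 0) has_real_derivative 0) (at x)" by simp
    then have "(g' has_real_derivative 0) (at x)"
      by (rule has_field_derivative_transform_within_open[where S="{..<p}"]) (use True low in auto)
    then show ?thesis using low(3)[OF True] by simp
  next
    case False
    then have x: "0 < x" using p by simp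
    have "((\<lambda>x. \<eta>' x * \<phi> x + \<eta> x * k x) has_real_derivative (\<eta>'' x * \<phi> x + k x * \<eta>' x) + (\<eta>' x * k x + k' x * \<eta> x)) (at x)"
      by (intro DERIV_add DERIV_mult ode(1,2) d\<phi> dk x)
    then have "((\<lambda>x. \<eta>' x * \<phi> x + \<eta> x * k x) has_real_derivative g'' x) (at x)"
      by (rule DERIV_cong) (use x in \<open>simp add: g''_def algebra_simps\<close>)
    then show ?thesis
      by (rule has_field_derivative_transform_within_open[where S="{0<..}"]) (use x in \<open>auto simp: g'_def\<close>)
  qed
  have c2: "continuous_on UNIV g''"
  proof (rule continuous_on_glue[OF _ _ p(1)])
    have nz: "mden x \<noteq> 0" "\<eta> x \<noteq> 0" if "x \<in> {0<..}" for x using mden_pos[of x] eta_pos'[of x] that by auto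
    have s: "continuous_on {0<..} f" if "continuous_on UNIV f" for f :: "real \<Rightarrow> real" by (rule continuous_on_subset[OF that]) auto
    have "continuous_on {0<..} (\<lambda>x. \<eta>'' x * \<phi> x + 2 * \<eta>' x * k x + \<eta> x * k' x)"
      unfolding k'_def
      by (intro continuous_intros s[OF c\<phi>] s[OF ck] s[OF \<xi>(1)] c\<eta>' c\<eta>'' eta_continuous mden_continuous continuous_drift ballI nz)
    then show "continuous_on {0<..} g''" by (rule continuous_on_eq) (auto simp: g''_def)
  qed (rule low)
  define F where "F y = (if 0 < y then \<xi> y / (2 * mden y) else 0)" for y
  have cF: "continuous_on UNIV F"
  proof -
    have "continuous_on UNIV (\<lambda>x. (1/2) * (if 0 < x then \<xi> x / mden x else 0))"
      by (intro continuous_intros weight_glue(1)[OF \<xi>(1) _ p(1)]) (use \<xi>(2) in auto)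
    then show ?thesis by (rule continuous_on_eq) (auto simp: F_def)
  qed
  have zF: "F x = 0" if "x \<notin> {p..q}" for x using \<xi>(2)[OF that] by (simp add: F_def)
  obtain D where D: "bdd_meas D F" using compact_support_bdd_meas[OF cF zF] by blast
  obtain C where C: "bdd_meas C \<phi>" using compact_support_bdd_meas[OF c\<phi> z\<phi>] by blast
  have zg: "g x = 0" if "x \<notin> {p..q}" for x using z\<phi>[OF that] by (simp add: g_def)
  have cg: "continuous_on UNIV g" using d1 by (meson DERIV_continuous_on has_field_derivative_at_within)
  obtain G0 where G0: "\<And>y. \<bar>g y\<bar> \<le> G0" using compact_support_bounded[OF cg zg] by blast
  obtain H where H: "0 < H" "\<And>y. 0 < y \<Longrightarrow> \<eta> y \<le> H" using eta_bounded by blast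
  \<comment> \<open>The eigenvalue equation for \<open>\<eta>\<close> removes the terms with
    undifferentiated \<open>\<phi>\<close>; what remains is \<open>\<eta>\<close> times the
    transformed generator.\<close>
  have eqF: "\<eta> y * F y = g'' y / 2 - \<alpha> y * g' y + lam * g y" if y: "0 < y" for y
  proof -
    have e0: "\<eta> y \<noteq> 0" using eta_pos'[OF y] by simp
    have "g'' y / 2 - \<alpha> y * g' y + lam * g y = \<phi> y * (\<eta>'' y / 2 - \<alpha> y * \<eta>' y + lam * \<eta> y) + \<eta>' y * k y + \<eta> y * k' y / 2 - \<alpha> y * \<eta> y * k y"
      using y by (simp add: g''_def g'_def g_def algebra_simps add_divide_distrib)
    also have "\<eta>'' y / 2 - \<alpha> y * \<eta>' y + lam * \<eta> y = 0" using ode(3)[OF y] by simp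
    also have "\<phi> y * 0 + \<eta>' y * k y + \<eta> y * k' y / 2 - \<alpha> y * \<eta> y * k y = \<eta> y * (\<xi> y / mden y) / 2"
      unfolding k'_def using e0 by (simp add: field_simps)
    finally show ?thesis using y by (simp add: F_def)
  qed
  have "erg F = 0"
  proof (rule erg_generator_zero[OF d1 d2 c2 _ p(1) C _ D])
    show "\<bar>g'' y / 2 - \<alpha> y * g' y\<bar> \<le> H * D + lam * G0" if y: "0 < y" for y
    proof -
      have "g'' y / 2 - \<alpha> y * g' y = \<eta> y * F y - lam * g y" using eqF[OF y] by simp
      moreover have "\<bar>\<eta> y * F y\<bar> \<le> H * D"
        unfolding abs_mult using H(2)[OF y] eta_pos'[OF y] bdd_meas_le[OF D, of y] H(1) by (intro mult_mono) auto
      moreover have "\<bar>lam * g y\<bar> \<le> lam * G0" using G0[of y] lam_pos by (simp add: abs_mult)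
      ultimately show ?thesis by linarith
    qed
  qed (use zg G0 eqF in \<open>auto simp: g_def\<close>)
  then show ?thesis unfolding F_def[abs_def] .
qed

text \<open>If the integrals of exp(Q) were bounded, exp(Q) + exp(-Q) >= 2 would make those of
  exp(-Q) diverge. The inner integral in (H3) would then be infinite for y <=
  \<open>\<beta>\<close>, in particular on [1,2], and so would the outer one.\<close>

lemma exp_Qpot_integral_unbounded:
  assumes \<beta>: "2 \<le> \<beta>"
  shows "\<exists>n>\<beta>. R < integral {\<beta>..n} (\<lambda>y. exp (Qpot \<alpha> y))"
proof (rule ccontr)
  assume neg: "\<not> ?thesis"
  have cQ: "continuous_on {\<beta>..n} (\<lambda>y. exp (Qpot \<alpha> y))" "continuous_on {\<beta>..n} (\<lambda>y. exp (- Qpot \<alpha> y))" for n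
    by (intro continuous_intros continuous_on_subset[OF Qpot_continuous]; use \<beta> in auto)+
  let ?in = "\<lambda>y. (\<integral>\<^sup>+z. indicator {y..} z * ennreal (exp (- Qpot \<alpha> z)) \<partial>lborel)"
  have big: "2 * (n - \<beta>) - R \<le> integral {\<beta>..n} (\<lambda>y. exp (- Qpot \<alpha> y))" if n: "n > \<beta>" for n
  proof -
    have "integral {\<beta>..n} (\<lambda>y. exp (Qpot \<alpha> y)) \<le> R" using neg n by (meson not_le)
    moreover have "integral {\<beta>..n} (\<lambda>y. 2) \<le> integral {\<beta>..n} (\<lambda>y. exp (Qpot \<alpha> y) + exp (- Qpot \<alpha> y))"
    proof (rule integral_le)
      show "(\<lambda>y. exp (Qpot \<alpha> y) + exp (- Qpot \<alpha> y)) integrable_on {\<beta>..n}"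
        by (rule integrable_continuous_real, rule continuous_on_add[OF cQ])
      fix y
      have "exp (Qpot \<alpha> y) \<ge> 1 + Qpot \<alpha> y" "exp (- Qpot \<alpha> y) \<ge> 1 - Qpot \<alpha> y"
        using exp_ge_add_one_self[of "Qpot \<alpha> y"] exp_ge_add_one_self[of "- Qpot \<alpha> y"] by auto
      then show "2 \<le> exp (Qpot \<alpha> y) + exp (- Qpot \<alpha> y)" by linarith
    qed auto
    moreover have "integral {\<beta>..n} (\<lambda>y. exp (Qpot \<alpha> y) + exp (- Qpot \<alpha> y)) = integral {\<beta>..n} (\<lambda>y. exp (Qpot \<alpha> y)) + integral {\<beta>..n} (\<lambda>y. exp (- Qpot \<alpha> y))"
      by (rule Henstock_Kurzweil_Integration.integral_add) (auto intro!: integrable_continuous_real cQ)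
    ultimately show ?thesis using n by simp
  qed
  have inner_n: "ennreal (2 * (n - \<beta>) - R) \<le> ?in y" if n: "n > \<beta>" and y: "y \<le> \<beta>" for n y
  proof -
    have hi: "((\<lambda>z. exp (- Qpot \<alpha> z)) has_integral integral {\<beta>..n} (\<lambda>y. exp (- Qpot \<alpha> y))) {\<beta>..n}"
      using cQ(2) by (intro integrable_integral integrable_continuous_real)
    have "ennreal (2 * (n - \<beta>) - R) \<le> ennreal (integral {\<beta>..n} (\<lambda>y. exp (- Qpot \<alpha> y)))" by (rule ennreal_leI[OF big[OF n]])
    also have "\<dots> = (\<integral>\<^sup>+z. ennreal (indicator {\<beta>..n} z * exp (- Qpot \<alpha> z)) \<partial>lborel)"
    proof -
      have si: "set_integrable lborel {\<beta>..n} (\<lambda>z. exp (- Qpot \<alpha> z))" by (rule borel_integrable_atLeastAtMost'[OF cQ(2)])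
      have "integral {\<beta>..n} (\<lambda>y. exp (- Qpot \<alpha> y)) = (LINT z:{\<beta>..n}|lborel. exp (- Qpot \<alpha> z))"
        by (rule set_borel_integral_eq_integral(2)[symmetric, OF si])
      also have "ennreal \<dots> = (\<integral>\<^sup>+z. ennreal (indicator {\<beta>..n} z *\<^sub>R exp (- Qpot \<alpha> z)) \<partial>lborel)"
        unfolding set_lebesgue_integral_def
        by (rule nn_integral_eq_integral[symmetric]) (use si in \<open>auto simp: set_integrable_def\<close>)
      finally show ?thesis by simp
    qed
    also have "\<dots> \<le> ?in y" by (rule nn_integral_mono) (use y in \<open>auto simp: indicator_def\<close>)
    finally show ?thesis .
  qed
  have inner: "?in y = \<infinity>" if y: "y \<le> \<beta>" for y
  proof (rule ccontr)
    assume "?in y \<noteq> \<infinity>"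
    then obtain r where r: "?in y = ennreal r" "0 \<le> r" by (cases "?in y") auto
    define n where "n = \<beta> + (\<bar>R\<bar> + r + 1)"
    have n: "n > \<beta>" using r by (simp add: n_def)
    from inner_n[OF n y] have "ennreal (2 * (n - \<beta>) - R) \<le> ennreal r" unfolding r(1) .
    then have "2 * (n - \<beta>) - R \<le> r" using r(2) by (simp add: ennreal_le_iff2) (smt (verit))
    then show False using r(2) by (simp add: n_def)
  qed
  have "(\<integral>\<^sup>+y. indicator {1..2::real} y * \<infinity> \<partial>lborel) \<le> (\<integral>\<^sup>+y. indicator {1..} y * ennreal (exp (Qpot \<alpha> y)) * ?in y \<partial>lborel)"
  proof (rule nn_integral_mono)
    fix y :: real
    show "indicator {1..2} y * \<infinity> \<le> indicator {1..} y * ennreal (exp (Qpot \<alpha> y)) * ?in y"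
      using inner[of y] \<beta> by (auto simp: indicator_def ennreal_mult_top)
  qed
  moreover have "(\<integral>\<^sup>+y. indicator {1..2::real} y * \<infinity> \<partial>lborel) = \<infinity>"
    by (subst nn_integral_multc) auto
  ultimately show False using H unfolding hypH_def by auto
qed

text \<open>Since \<open>\<eta>\<close> is bounded by some K, 1/\<open>mden\<close> is at least
  exp(Q)/K^2. The integral of 1/\<open>mden\<close> is the scale function of the transformed
  diffusion.\<close>

lemma scale_unbounded:
  assumes \<beta>: "2 \<le> \<beta>"
  shows "\<exists>n>\<beta>. R \<le> integral {\<beta>..n} (\<lambda>y. 1 / mden y)"
proof -
  obtain K where K: "0 < K" "\<And>y. 0 < y \<Longrightarrow> \<eta> y \<le> K" using eta_bounded by blast
  obtain n where n: "n > \<beta>" "R * K\<^sup>2 < integral {\<beta>..n} (\<lambda>y. exp (Qpot \<alpha> y))" using exp_Qpot_integral_unbounded[OF \<beta>] by blast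
  have cQ: "continuous_on {\<beta>..n} (\<lambda>y. exp (Qpot \<alpha> y) / K\<^sup>2)"
    by (intro continuous_intros continuous_on_subset[OF Qpot_continuous]) (use \<beta> K in auto)
  have cm: "continuous_on {\<beta>..n} (\<lambda>y. 1 / mden y)"
    by (intro continuous_intros continuous_on_subset[OF mden_continuous]) (use \<beta> mden_pos in \<open>auto simp: less_imp_neq[symmetric]\<close>)
  have "integral {\<beta>..n} (\<lambda>y. exp (Qpot \<alpha> y) / K\<^sup>2) \<le> integral {\<beta>..n} (\<lambda>y. 1 / mden y)"
  proof (rule integral_le)
    fix y assume y: "y \<in> {\<beta>..n}"
    then have y0: "0 < y" using \<beta> by simp
    have "(\<eta> y)\<^sup>2 \<le> K\<^sup>2" using K(2)[OF y0] eta_pos'[OF y0] by (intro power_mono) auto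
    then have "exp (Qpot \<alpha> y) / K\<^sup>2 \<le> exp (Qpot \<alpha> y) / (\<eta> y)\<^sup>2" using eta_pos'[OF y0] K by (intro divide_left_mono) auto
    also have "\<dots> = 1 / mden y" by (simp add: mden_def exp_minus field_simps)
    finally show "exp (Qpot \<alpha> y) / K\<^sup>2 \<le> 1 / mden y" .
  qed (auto intro!: integrable_continuous_real cQ cm)
  moreover have "integral {\<beta>..n} (\<lambda>y. exp (Qpot \<alpha> y) / K\<^sup>2) = integral {\<beta>..n} (\<lambda>y. exp (Qpot \<alpha> y)) / K\<^sup>2" by simp
  moreover have "R \<le> integral {\<beta>..n} (\<lambda>y. exp (Qpot \<alpha> y)) / K\<^sup>2" using n(2) K(1) by (simp add: field_simps)
  ultimately show ?thesis using n(1) by (intro exI[of _ n]) auto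
qed

end

section \<open>Bumps, the far correction, and proportionality to \<open>pi\<close>\<close>

definition hump :: "real \<Rightarrow> real" where "hump x = max 0 (x * (1 - x))"

lemma hump_continuous: "continuous_on UNIV hump" unfolding hump_def by (intro continuous_intros)
lemma hump_nonneg: "0 \<le> hump x" by (simp add: hump_def)
lemma hump_zero': "x \<le> 0 \<or> 1 \<le> x \<Longrightarrow> hump x = 0"
proof -
  assume "x \<le> 0 \<or> 1 \<le> x"
  then have "x * (1 - x) \<le> 0" by (auto intro: mult_nonpos_nonneg mult_nonneg_nonpos)
  then show ?thesis by (simp add: hump_def)
qed
lemma hump_zero: "x \<notin> {0..1} \<Longrightarrow> hump x = 0" by (rule hump_zero') auto

lemma hump_integral: "integral {0..1} hump = 1 / 6"
proof -
  have "((\<lambda>x. x - x\<^sup>2) has_integral ((1\<^sup>2 / 2 - 1 ^ 3 / 3) - (0\<^sup>2 / 2 - 0 ^ 3 / 3))) {0..1::real}"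
  proof (rule fundamental_theorem_of_calculus)
    fix x :: real
    show "((\<lambda>x. x\<^sup>2 / 2 - x ^ 3 / 3) has_vector_derivative x - x\<^sup>2) (at x within {0..1})"
      unfolding has_real_derivative_iff_has_vector_derivative[symmetric]
      by (auto intro!: derivative_eq_intros)
  qed simp
  then have "integral {0..1} (\<lambda>x::real. x - x\<^sup>2) = 1 / 6" by (simp add: integral_unique)
  moreover have "integral {0..1} hump = integral {0..1} (\<lambda>x. x - x\<^sup>2)"
    by (rule integral_cong) (auto simp: hump_def max_def power2_eq_square algebra_simps mult_left_le)
  ultimately show ?thesis by simp
qed

lemma hump_shift:
  assumes s: "0 \<le> s"
  shows "x \<le> s \<Longrightarrow> integral {0..x} (\<lambda>u. hump (u - s)) = 0"
    and "s + 1 \<le> x \<Longrightarrow> integral {0..x} (\<lambda>u. hump (u - s)) = 1 / 6"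
    and "0 \<le> integral {0..x} (\<lambda>u. hump (u - s))" "integral {0..x} (\<lambda>u. hump (u - s)) \<le> 1 / 6"
proof -
  have c: "continuous_on S (\<lambda>u. hump (u - s))" for S
    by (rule continuous_on_compose2[OF hump_continuous]) (auto intro!: continuous_intros)
  have i: "(\<lambda>u. hump (u - s)) integrable_on {u..v}" for u v by (rule integrable_continuous_real[OF c])
  have z: "integral {0..x} (\<lambda>u. hump (u - s)) = 0" if "x \<le> s" for x
  proof -
    have "integral {0..x} (\<lambda>u. hump (u - s)) = integral {0..x} (\<lambda>_. 0)"
      by (rule integral_cong) (use that in \<open>auto intro!: hump_zero'\<close>)
    then show ?thesis by simp
  qed
  show "x \<le> s \<Longrightarrow> integral {0..x} (\<lambda>u. hump (u - s)) = 0" by (rule z)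
  have o: "integral {0..x} (\<lambda>u. hump (u - s)) = 1 / 6" if x: "s + 1 \<le> x" for x
  proof -
    have "integral {0..1} ((\<lambda>u. hump (u - s)) \<circ> (\<lambda>x. x + s)) = integral {0 + s..1 + s} (\<lambda>u. hump (u - s))"
      by (rule integral_shift[OF c])
    then have 1: "integral {s..s+1} (\<lambda>u. hump (u - s)) = 1 / 6" using hump_integral by (simp add: o_def add.commute)
    have 2: "integral {s+1..x} (\<lambda>u. hump (u - s)) = 0"
    proof -
      have "integral {s+1..x} (\<lambda>u. hump (u - s)) = integral {s+1..x} (\<lambda>_. 0)"
        by (rule integral_cong) (auto intro!: hump_zero')
      then show ?thesis by simp
    qed
    have "integral {0..s} (\<lambda>u. hump (u - s)) + integral {s..x} (\<lambda>u. hump (u - s)) = integral {0..x} (\<lambda>u. hump (u - s))"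
      by (rule Henstock_Kurzweil_Integration.integral_combine) (use s x i in auto)
    moreover have "integral {s..s+1} (\<lambda>u. hump (u - s)) + integral {s+1..x} (\<lambda>u. hump (u - s)) = integral {s..x} (\<lambda>u. hump (u - s))"
      by (rule Henstock_Kurzweil_Integration.integral_combine) (use s x i in auto)
    ultimately show ?thesis using 1 2 z[of s] by simp
  qed
  show "s + 1 \<le> x \<Longrightarrow> integral {0..x} (\<lambda>u. hump (u - s)) = 1 / 6" by (rule o)
  show "0 \<le> integral {0..x} (\<lambda>u. hump (u - s))" by (rule Henstock_Kurzweil_Integration.integral_nonneg[OF i]) (simp add: hump_nonneg)
  show "integral {0..x} (\<lambda>u. hump (u - s)) \<le> 1 / 6"
  proof -
    have "integral {0..x} (\<lambda>u. hump (u - s)) \<le> integral {0..max x (s+1)} (\<lambda>u. hump (u - s))"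
      by (rule integral_subset_le) (auto intro: i hump_nonneg)
    also have "\<dots> = 1 / 6" by (rule o) simp
    finally show ?thesis .
  qed
qed

context ground_state_doeblin
begin

lemma pi_density: "pi = density lborel (\<lambda>y. ennreal (indicator {0<..} y * mden y))"
proof (rule measure_eqI)
  have mm: "(\<lambda>y. indicator {0<..} y * mden y) \<in> borel_measurable borel"
    using borel_measurable_continuous_on_indicator[OF _ mden_continuous] by simp
  fix A assume "A \<in> sets pi"
  then have A[measurable]: "A \<in> sets borel" by simp
  have "emeasure pi A = (\<integral>\<^sup>+y. indicator A y \<partial>pi)" by simp
  also have "\<dots> = (\<integral>\<^sup>+y. indicator {0<..} y * (ennreal (mden y) * indicator A y) \<partial>lborel)" by (rule nn_integral_pi_lborel) simp
  also have "\<dots> = (\<integral>\<^sup>+y. ennreal (indicator {0<..} y * mden y) * indicator A y \<partial>lborel)"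
    by (rule nn_integral_cong) (auto simp: indicator_def)
  also have "\<dots> = emeasure (density lborel (\<lambda>y. ennreal (indicator {0<..} y * mden y))) A"
    using mm by (subst emeasure_density) auto
  finally show "emeasure pi A = emeasure (density lborel (\<lambda>y. ennreal (indicator {0<..} y * mden y))) A" .
qed simp

lemma pi_integral:
  assumes f: "f \<in> borel_measurable borel" and c: "continuous_on UNIV F" and F: "\<And>x. F x = (if 0 < x then mden x * f x else 0)"
    and z: "\<And>x. x \<notin> {p..q} \<Longrightarrow> F x = 0" and p: "0 < p" "p \<le> q"
  shows "(\<integral>y. f y \<partial>pi) = integral {0..q} F"
proof -
  have mm: "(\<lambda>y. indicator {0<..} y * mden y) \<in> borel_measurable borel"
    using borel_measurable_continuous_on_indicator[OF _ mden_continuous] by simp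
  have "(\<integral>y. f y \<partial>pi) = (\<integral>y. (indicator {0<..} y * mden y) *\<^sub>R f y \<partial>lborel)"
    unfolding pi_density using f mm mden_pos by (intro integral_density) (auto simp: indicator_def less_imp_le)
  also have "\<dots> = (LINT y:{0..q}|lborel. F y)"
    unfolding set_lebesgue_integral_def
  proof (rule Bochner_Integration.integral_cong[OF refl])
    fix y
    show "(indicator {0<..} y * mden y) *\<^sub>R f y = indicator {0..q} y *\<^sub>R F y"
      using F[of y] z[of y] p by (auto simp: indicator_def)
  qed
  also have "\<dots> = integral {0..q} F"
    by (rule set_borel_integral_eq_integral(2)[OF borel_integrable_atLeastAtMost'])
      (rule continuous_on_subset[OF c], simp)
  finally show ?thesis .
qed

text \<open>Mean zero settles the first integration, but the second leaves a defect
  \<open>d\<close>. A pair of opposite bumps at \<open>\<beta>\<close> and \<open>n\<close> cancels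
  it: the scale integral between them is large, so the coefficient d/J is small, while the
  L1(\<open>pi\<close>) size of the correction is at most 1/6 for every such \<open>n\<close>.
  Domination of \<open>erg\<close> then contradicts a nonzero \<open>erg f\<close>.\<close>

lemma erg_mean_zero:
  assumes f: "continuous_on UNIV f" "\<And>x. x \<notin> {p..q} \<Longrightarrow> f x = 0" and p: "0 < p" "p \<le> q" and mean: "(\<integral>y. f y \<partial>pi) = 0"
  shows "erg f = 0"
proof (rule ccontr)
  assume ne: "erg f \<noteq> 0"
  obtain Cf where Cf: "bdd_meas Cf f" using compact_support_bdd_meas[OF f] by blast
  define mf where "mf x = (if 0 < x then mden x * f x else 0)" for x
  have cmf: "continuous_on UNIV mf" unfolding mf_def[abs_def] by (rule weight_glue(2)[OF f(1) _ p(1)]) (use f(2) in auto)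
  have zmf: "mf x = 0" if "x \<notin> {p..q}" for x using f(2)[OF that] by (simp add: mf_def)
  have Imf: "integral {0..q} mf = 0"
    using pi_integral[OF bdd_meas_meas[OF Cf] cmf mf_def zmf p] mean by simp
  define \<psi>1 where "\<psi>1 x = integral {0..x} (\<lambda>u. 2 * mf u)" for x
  have c2m: "continuous_on UNIV (\<lambda>u. 2 * mf u)" using cmf by (intro continuous_intros)
  have z2m: "2 * mf u = 0" if "u \<notin> {p..q}" for u using zmf[OF that] by simp
  have \<psi>1q: "\<psi>1 q = 0" using Imf by (simp add: \<psi>1_def)
  have z\<psi>1: "\<psi>1 x = 0" if "x \<notin> {p..q}" for x
    using compact_support_antiderivative(2,3)[OF c2m z2m p, of x] \<psi>1q that unfolding \<psi>1_def by (cases "x < p") auto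
  have c\<psi>1: "continuous_on UNIV \<psi>1"
    using compact_support_antiderivative(1)[OF c2m z2m p] unfolding \<psi>1_def[abs_def]
    by (meson DERIV_continuous_on has_field_derivative_at_within)
  define k1 where "k1 x = (if 0 < x then \<psi>1 x / mden x else 0)" for x
  have ck1: "continuous_on UNIV k1" unfolding k1_def[abs_def] by (rule weight_glue(1)[OF c\<psi>1 _ p(1)]) (use z\<psi>1 in auto)
  have zk1: "k1 x = 0" if "x \<notin> {p..q}" for x using z\<psi>1[OF that] by (simp add: k1_def)
  define d where "d = integral {0..q} k1"
  define \<beta> where "\<beta> = max q 2"
  have \<beta>: "q \<le> \<beta>" "2 \<le> \<beta>" by (auto simp: \<beta>_def)
  \<comment> \<open>Chosen so that the upper bound |d| C0/6 for |\<open>erg f\<close>| J falls short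
    of the lower bound |\<open>erg f\<close>| R/6 = (|d| C0 + 1)/6.\<close>
  define R where "R = (\<bar>d\<bar> * C0 + 1) / \<bar>erg f\<bar>"
  obtain n where n: "n > \<beta> + 1" "R \<le> integral {\<beta>+1..n} (\<lambda>y. 1 / mden y)"
    using scale_unbounded[of "\<beta> + 1" R] \<beta> by auto
  define v where "v x = hump (x - \<beta>) - hump (x - n)" for x
  have chs: "continuous_on UNIV (\<lambda>x. hump (x - s))" for s
    by (rule continuous_on_compose2[OF hump_continuous]) (auto intro!: continuous_intros)
  have ih: "(\<lambda>x. hump (x - s)) integrable_on {u..w}" for s u w
    by (rule integrable_continuous_real, rule continuous_on_subset[OF chs]) auto
  have cv: "continuous_on UNIV v" unfolding v_def[abs_def] by (intro continuous_on_diff chs)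
  have zv: "v x = 0" if "x \<notin> {\<beta>..n+1}" for x
    using hump_zero[of "x - \<beta>"] hump_zero[of "x - n"] that n by (auto simp: v_def)
  have zvp: "v x = 0" if "x \<notin> {p..n+1}" for x using zv[of x] that \<beta> p by auto
  define \<psi>2 where "\<psi>2 x = integral {0..x} v" for x
  have \<psi>2: "\<psi>2 x = integral {0..x} (\<lambda>u. hump (u - \<beta>)) - integral {0..x} (\<lambda>u. hump (u - n))" for x
    unfolding \<psi>2_def v_def by (rule Henstock_Kurzweil_Integration.integral_diff[OF ih ih])
  have \<beta>0: "0 \<le> \<beta>" "0 \<le> n" using \<beta> n by auto
  \<comment> \<open>Between the bumps the antiderivative carries the full mass 1/6 of the left
    one.\<close>
  have \<psi>2_mid: "\<psi>2 x = 1 / 6" if "x \<in> {\<beta>+1..n}" for x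
    using hump_shift(2)[OF \<beta>0(1), of x] hump_shift(1)[OF \<beta>0(2), of x] that unfolding \<psi>2 by simp
  have \<psi>2_nonneg: "0 \<le> \<psi>2 x" for x
  proof (cases "x \<le> n")
    case True
    then show ?thesis using hump_shift(3)[OF \<beta>0(1), of x] hump_shift(1)[OF \<beta>0(2), of x] unfolding \<psi>2 by simp
  next
    case False
    then show ?thesis using hump_shift(2)[OF \<beta>0(1), of x] hump_shift(4)[OF \<beta>0(2), of x] n unfolding \<psi>2 by simp
  qed
  have \<psi>2_end: "\<psi>2 (n + 1) = 0"
    using hump_shift(2)[OF \<beta>0(1), of "n+1"] hump_shift(2)[OF \<beta>0(2), of "n+1"] n unfolding \<psi>2 by simp
  have pn: "p \<le> n + 1" using p \<beta> n by linarith
  have z\<psi>2: "\<psi>2 x = 0" if "x < p" for x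
    using compact_support_antiderivative(2)[OF cv zvp p(1) pn, of x] that by (simp add: \<psi>2_def)
  have c\<psi>2: "continuous_on UNIV \<psi>2"
    using compact_support_antiderivative(1)[OF cv zvp p(1) pn] unfolding \<psi>2_def[abs_def]
    by (meson DERIV_continuous_on has_field_derivative_at_within)
  define k2 where "k2 x = (if 0 < x then \<psi>2 x / mden x else 0)" for x
  have ck2: "continuous_on UNIV k2" unfolding k2_def[abs_def] by (rule weight_glue(1)[OF c\<psi>2 z\<psi>2 p(1)])
  have i1: "k1 integrable_on {u..w}" for u w by (rule integrable_continuous_real, rule continuous_on_subset[OF ck1]) auto
  have i2: "k2 integrable_on {u..w}" for u w by (rule integrable_continuous_real, rule continuous_on_subset[OF ck2]) auto
  define J where "J = integral {0..n+1} k2"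
  have J: "R / 6 \<le> J"
  proof -
    have "integral {\<beta>+1..n} (\<lambda>y. 1 / 6 * (1 / mden y)) \<le> integral {0..n+1} k2"
    proof -
      have "integral {\<beta>+1..n} (\<lambda>y. 1 / 6 * (1 / mden y)) = integral {\<beta>+1..n} k2"
      proof (rule integral_cong)
        fix x assume x: "x \<in> {\<beta>+1..n}"
        then have "0 < x" using \<beta> by simp
        then show "1 / 6 * (1 / mden x) = k2 x" by (simp add: k2_def \<psi>2_mid[OF x])
      qed
      also have "\<dots> \<le> integral {0..n+1} k2"
      proof (rule integral_subset_le)
        show "{\<beta>+1..n} \<subseteq> {0..n+1}" using \<beta> by auto
        show "k2 integrable_on {\<beta>+1..n}" "k2 integrable_on {0..n+1}" by (rule i2)+
        show "\<forall>x\<in>{0..n+1}. 0 \<le> k2 x"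
        proof
          fix x :: real
          show "0 \<le> k2 x"
          proof (cases "0 < x")
            case True
            show ?thesis unfolding k2_def using True \<psi>2_nonneg[of x] mden_pos[OF True] by simp
          qed (simp add: k2_def)
        qed
      qed
      finally show ?thesis .
    qed
    moreover have "integral {\<beta>+1..n} (\<lambda>y. 1 / 6 * (1 / mden y)) = 1 / 6 * integral {\<beta>+1..n} (\<lambda>y. 1 / mden y)"
      by (rule Henstock_Kurzweil_Integration.integral_mult_right)
    ultimately show ?thesis using n(2) unfolding J_def by linarith
  qed
  have R: "0 < R" using ne C0 by (auto simp: R_def intro!: divide_pos_pos add_nonneg_pos)
  then have J0: "0 < J" using J by linarith
  define \<tau> where "\<tau> = d / J"
  define \<xi> where "\<xi> x = 2 * mf x - \<tau> * v x" for x
  define \<psi> where "\<psi> x = integral {0..x} \<xi>" for x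
  have im: "(\<lambda>u. 2 * mf u) integrable_on {u..w}" for u w by (rule integrable_continuous_real, rule continuous_on_subset[OF c2m]) auto
  have iv: "v integrable_on {u..w}" for u w by (rule integrable_continuous_real, rule continuous_on_subset[OF cv]) auto
  have \<psi>: "\<psi> x = \<psi>1 x - \<tau> * \<psi>2 x" for x
  proof -
    have "(\<lambda>u. \<tau> * v u) integrable_on {0..x}" using integrable_on_cmult_left[OF iv, of \<tau> 0 x] by simp
    then have "\<psi> x = \<psi>1 x - integral {0..x} (\<lambda>u. \<tau> * v u)"
      unfolding \<psi>_def \<psi>1_def \<xi>_def by (rule Henstock_Kurzweil_Integration.integral_diff[OF im])
    then show ?thesis by (simp add: \<psi>2_def)
  qed
  define k where "k x = (if 0 < x then \<psi> x / mden x else 0)" for x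
  have k: "k x = k1 x - \<tau> * k2 x" for x by (simp add: k_def k1_def k2_def \<psi> diff_divide_distrib)
  have "erg (\<lambda>y. if 0 < y then \<xi> y / (2 * mden y) else 0) = 0"
  proof (rule erg_test_function[where p=p and q="n+1" and \<psi>=\<psi> and k=k])
    show "continuous_on UNIV \<xi>" unfolding \<xi>_def[abs_def] by (intro continuous_intros cmf cv)
    show "\<xi> x = 0" if "x \<notin> {p..n+1}" for x using zmf[of x] zvp[OF that] that \<beta> n by (auto simp: \<xi>_def)
    show "\<psi> (n + 1) = 0" using z\<psi>1[of "n+1"] \<psi>2_end \<beta> n by (simp add: \<psi>)
    show "integral {0..n+1} k = 0"
    proof -
      have "(\<lambda>u. \<tau> * k2 u) integrable_on {0..n+1}" using integrable_on_cmult_left[OF i2, of \<tau> 0 "n+1"] by simp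
      then have "integral {0..n+1} k = integral {0..n+1} k1 - integral {0..n+1} (\<lambda>u. \<tau> * k2 u)"
        unfolding k[abs_def] by (rule Henstock_Kurzweil_Integration.integral_diff[OF i1])
      moreover have "integral {0..n+1} k1 = d"
        unfolding d_def using compact_support_antiderivative(3)[OF ck1 zk1 p, of "n+1"] \<beta> n by simp
      ultimately show ?thesis using J0 by (simp add: J_def[symmetric] \<tau>_def)
    qed
  qed (use p pn \<psi>_def k_def in auto)
  moreover define w where "w y = (if 0 < y then v y / (2 * mden y) else 0)" for y
  have "(if 0 < y then \<xi> y / (2 * mden y) else 0) = f y - \<tau> * w y" for y
  proof (cases "0 < y")
    case True
    then have "mden y \<noteq> 0" using mden_pos[OF True] by simp
    then show ?thesis using True by (simp add: \<xi>_def w_def mf_def field_simps)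
  next
    case False
    then have "f y = 0" using f(2)[of y] p by simp
    then show ?thesis using False by (simp add: w_def)
  qed
  ultimately have e0: "erg (\<lambda>y. f y - \<tau> * w y) = 0" by simp
  have cw: "continuous_on UNIV w"
  proof -
    have "continuous_on UNIV (\<lambda>x. (1/2) * (if 0 < x then v x / mden x else 0))"
      by (intro continuous_intros weight_glue(1)[OF cv _ p(1)]) (use zvp in auto)
    then show ?thesis by (rule continuous_on_eq) (auto simp: w_def)
  qed
  have zw: "w x = 0" if "x \<notin> {p..n+1}" for x using zvp[OF that] by (simp add: w_def)
  obtain Cw where Cw: "bdd_meas Cw w" using compact_support_bdd_meas[OF cw zw] by blast
  have ef: "erg f = \<tau> * erg w"
    using e0 erg_diff[OF Cf bdd_meas_cmult[OF Cw, of \<tau>]] erg_cmult[OF Cw, of \<tau>] by simp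
  have "(\<integral>y. \<bar>w y\<bar> \<partial>pi) = integral {0..n+1} (\<lambda>x. \<bar>v x\<bar> / 2)"
  proof (rule pi_integral[where p=p])
    show "(\<lambda>y. \<bar>w y\<bar>) \<in> borel_measurable borel" using Cw by (auto simp: bdd_meas_def)
    show "continuous_on UNIV (\<lambda>x. \<bar>v x\<bar> / 2)" using cv by (intro continuous_intros) auto
    show "\<bar>v x\<bar> / 2 = (if 0 < x then mden x * \<bar>w x\<bar> else 0)" for x
    proof (cases "0 < x")
      case True
      then show ?thesis using mden_pos[OF True] by (simp add: w_def abs_mult)
    next
      case False
      then show ?thesis using zvp[of x] p by simp
    qed
    show "\<bar>v x\<bar> / 2 = 0" if "x \<notin> {p..n+1}" for x using zvp[OF that] by simp
  qed (use p pn in auto)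
  also have "\<dots> \<le> integral {0..n+1} (\<lambda>x. hump (x - \<beta>) / 2 + hump (x - n) / 2)"
  proof (rule integral_le)
    show "(\<lambda>x. \<bar>v x\<bar> / 2) integrable_on {0..n+1}"
      by (rule integrable_continuous_real, rule continuous_on_subset[of UNIV]) (use cv in \<open>auto intro!: continuous_intros\<close>)
    show "(\<lambda>x. hump (x - \<beta>) / 2 + hump (x - n) / 2) integrable_on {0..n+1}"
      by (rule integrable_continuous_real, rule continuous_on_subset[of UNIV]) (use chs in \<open>auto intro!: continuous_intros\<close>)
    show "\<bar>v x\<bar> / 2 \<le> hump (x - \<beta>) / 2 + hump (x - n) / 2" for x
      using hump_nonneg[of "x - \<beta>"] hump_nonneg[of "x - n"] by (auto simp: v_def)
  qed
  also have "\<dots> = integral {0..n+1} (\<lambda>x. hump (x - \<beta>)) / 2 + integral {0..n+1} (\<lambda>x. hump (x - n)) / 2"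
    using ih[of \<beta> 0 "n+1"] ih[of n 0 "n+1"]
    by (subst Henstock_Kurzweil_Integration.integral_add) (auto intro: integrable_on_divide)
  also have "\<dots> = 1 / 6"
    using hump_shift(2)[OF \<beta>0(1), of "n+1"] hump_shift(2)[OF \<beta>0(2), of "n+1"] n by simp
  finally have w1: "(\<integral>y. \<bar>w y\<bar> \<partial>pi) \<le> 1 / 6" .
  have "\<bar>erg w\<bar> \<le> C0 * (1 / 6)"
    using erg_dominated[OF Cw] mult_left_mono[OF w1, of C0] C0 by linarith
  then have "\<bar>erg f\<bar> \<le> \<bar>\<tau>\<bar> * (C0 / 6)" unfolding ef abs_mult by (intro mult_left_mono) auto
  then have "\<bar>erg f\<bar> * J \<le> \<bar>d\<bar> * (C0 / 6)" using J0 by (simp add: \<tau>_def field_simps)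
  moreover have "\<bar>erg f\<bar> * (R / 6) \<le> \<bar>erg f\<bar> * J" using J by (intro mult_left_mono) auto
  moreover have "\<bar>erg f\<bar> * (R / 6) = (\<bar>d\<bar> * C0 + 1) / 6" using ne by (simp add: R_def)
  ultimately show False by simp
qed

text \<open>Subtracting a multiple of one fixed bump \<open>f1\<close> on [1,2] makes any test
  function mean zero, so \<open>erg\<close> is proportional to \<open>pi\<close> on test functions;
  \<open>erg_eq_pi\<close> does the rest.\<close>

lemma erg_eq:
  assumes g: "bdd_meas C g"
  shows "erg g = (\<integral>y. g y \<partial>pi)"
proof -
  define f1 where "f1 x = hump (x - 1)" for x
  have c1: "continuous_on UNIV f1" unfolding f1_def[abs_def]
    by (rule continuous_on_compose2[OF hump_continuous]) (auto intro!: continuous_intros)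
  have z1: "f1 x = 0" if "x \<notin> {1..2}" for x using hump_zero[of "x - 1"] that by (simp add: f1_def)
  obtain C1 where C1: "bdd_meas C1 f1" using compact_support_bdd_meas[OF c1 z1] by blast
  define I where "I = (\<integral>y. f1 y \<partial>pi)"
  have I: "0 < I"
  proof -
    obtain l u where lu: "0 < l" "\<And>y. y \<in> {1..2} \<Longrightarrow> l \<le> mden y" using Icc_bounds[OF mden_continuous mden_pos, of 1 2] by auto
    have cm: "continuous_on UNIV (\<lambda>x. if 0 < x then mden x * f1 x else 0)" by (rule weight_glue(2)[OF c1, of 1]) (use z1 in auto)
    have eq1: "I = integral {0..2} (\<lambda>x. if 0 < x then mden x * f1 x else 0)"
      unfolding I_def by (rule pi_integral[OF bdd_meas_meas[OF C1] cm refl, of 1 2]) (use z1 in auto)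
    have le2: "integral {0..2} (\<lambda>x. l * f1 x) \<le> integral {0..2} (\<lambda>x. if 0 < x then mden x * f1 x else 0)"
    proof (rule integral_le)
      show "(\<lambda>x. l * f1 x) integrable_on {0..2}"
        by (rule integrable_continuous_real, rule continuous_on_subset[of UNIV]) (use c1 in \<open>auto intro!: continuous_intros\<close>)
      show "(\<lambda>x. if 0 < x then mden x * f1 x else 0) integrable_on {0..2}"
        by (rule integrable_continuous_real, rule continuous_on_subset[OF cm]) auto
      show "l * f1 x \<le> (if 0 < x then mden x * f1 x else 0)" for x
      proof (cases "x \<in> {1..2}")
        case True
        then show ?thesis using lu(2)[OF True] hump_nonneg[of "x - 1"] by (simp add: f1_def mult_right_mono)
      qed (use z1 in auto)
    qed
    have eq3: "integral {0..2} (\<lambda>x. l * f1 x) = l * (1 / 6)"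
      using hump_shift(2)[of 1 2] by (simp add: f1_def)
    show ?thesis using le2 lu(1) unfolding eq1 eq3 by linarith
  qed
  show ?thesis
  proof (rule erg_eq_pi[OF _ g])
    fix f :: "real \<Rightarrow> real" and a b :: real
    assume a: "0 < a" and cf: "continuous_on UNIV f" and zf: "\<And>x. x \<notin> {a..b} \<Longrightarrow> f x = 0"
    define p where "p = min a 1"
    define q where "q = max b 2"
    have pq: "0 < p" "p \<le> q" using a by (auto simp: p_def q_def)
    obtain Cf where Cf: "bdd_meas Cf f" using compact_support_bdd_meas[OF cf zf] by blast
    define c where "c = (\<integral>y. f y \<partial>pi) / I"
    have "erg (\<lambda>y. f y - c * f1 y) = 0"
    proof (rule erg_mean_zero[OF _ _ pq])
      show "continuous_on UNIV (\<lambda>y. f y - c * f1 y)" using cf c1 by (intro continuous_intros)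
      show "f x - c * f1 x = 0" if "x \<notin> {p..q}" for x
      proof -
        have "x \<notin> {a..b}" "x \<notin> {1..2}" using that unfolding p_def q_def by auto
        then show ?thesis using zf z1 by simp
      qed
      show "(\<integral>y. f y - c * f1 y \<partial>pi) = 0"
        using pi_integrable[OF Cf] pi_integrable[OF C1] I by (simp add: c_def I_def[symmetric])
    qed
    then have "erg f = c * erg f1" using erg_diff[OF Cf bdd_meas_cmult[OF C1, of c]] erg_cmult[OF C1, of c] by simp
    then show "erg f = (erg f1 / I) * (\<integral>y. f y \<partial>pi)" by (simp add: c_def)
  qed
qed

end

section \<open>The conditional limit\<close>

text \<open>Here uniformity in the starting point is spent: it allows an arbitrary initial
  law.\<close>

lemma uniform_integral_tendsto:
  fixes A :: "real \<Rightarrow> real \<Rightarrow> real"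
  assumes \<nu>: "prob_space \<nu>" and e: "integrable \<nu> e" "\<And>x. 0 \<le> e x" and m: "\<forall>\<^sub>F t in at_top. A t \<in> borel_measurable \<nu>"
    and u: "\<And>d. 0 < d \<Longrightarrow> \<exists>t0. \<forall>t\<ge>t0. \<forall>x. \<bar>A t x - a\<bar> \<le> d"
  shows "((\<lambda>t. \<integral>x. e x * A t x \<partial>\<nu>) \<longlongrightarrow> (\<integral>x. e x \<partial>\<nu>) * a) at_top"
proof (rule tendstoI)
  interpret prob_space \<nu> by (rule \<nu>)
  fix d :: real assume d: "0 < d"
  define E where "E = (\<integral>x. e x \<partial>\<nu>)"
  have E: "0 \<le> E" unfolding E_def by (rule Bochner_Integration.integral_nonneg) (rule e)
  define d' where "d' = d / (2 * (E + 1))"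
  have d': "0 < d'" using d E by (simp add: d'_def)
  obtain t0 where t0: "\<And>t x. t \<ge> t0 \<Longrightarrow> \<bar>A t x - a\<bar> \<le> d'" using u[OF d'] by blast
  show "\<forall>\<^sub>F t in at_top. dist (\<integral>x. e x * A t x \<partial>\<nu>) ((\<integral>x. e x \<partial>\<nu>) * a) < d"
    using m eventually_ge_at_top[of t0]
  proof eventually_elim
    case (elim t)
    note [measurable] = elim(1)
    have i: "integrable \<nu> (\<lambda>x. e x * A t x)"
    proof (rule Bochner_Integration.integrable_bound)
      show "integrable \<nu> (\<lambda>x. e x * (\<bar>a\<bar> + d'))" using e(1) by simp
      show "(\<lambda>x. e x * A t x) \<in> borel_measurable \<nu>" using borel_measurable_integrable[OF e(1)] by measurable
      show "AE x in \<nu>. norm (e x * A t x) \<le> norm (e x * (\<bar>a\<bar> + d'))"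
      proof (rule AE_I2)
        fix x
        have "\<bar>A t x\<bar> \<le> \<bar>a\<bar> + d'" using t0[OF elim(2), of x] by linarith
        then show "norm (e x * A t x) \<le> norm (e x * (\<bar>a\<bar> + d'))"
          using e(2)[of x] d' by (simp add: abs_mult mult_left_mono)
      qed
    qed
    have "(\<integral>x. e x * A t x \<partial>\<nu>) - (\<integral>x. e x \<partial>\<nu>) * a = (\<integral>x. e x * A t x - e x * a \<partial>\<nu>)"
      using i e(1) by simp
    moreover have "\<bar>\<integral>x. e x * A t x - e x * a \<partial>\<nu>\<bar> \<le> (\<integral>x. e x * d' \<partial>\<nu>)"
    proof -
      have "norm (\<integral>x. e x * A t x - e x * a \<partial>\<nu>) \<le> (\<integral>x. e x * d' \<partial>\<nu>)"
      proof (rule order_trans[OF integral_norm_bound integral_mono])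
        show "integrable \<nu> (\<lambda>x. norm (e x * A t x - e x * a))" using i e(1) by simp
        show "integrable \<nu> (\<lambda>x. e x * d')" using e(1) by simp
        fix x
        have "e x * A t x - e x * a = e x * (A t x - a)" by (simp add: algebra_simps)
        then show "norm (e x * A t x - e x * a) \<le> e x * d'"
          using t0[OF elim(2), of x] e(2)[of x] by (simp add: abs_mult mult_left_mono)
      qed
      then show ?thesis by simp
    qed
    moreover have "(\<integral>x. e x * d' \<partial>\<nu>) = E * d'" by (simp add: E_def)
    moreover have "E * d' < d"
    proof -
      have "E * d' \<le> (E + 1) * d'" using d' by (intro mult_right_mono) auto
      also have "\<dots> = d / 2"
      proof -
        have z: "z * (d / (2 * z)) = d / 2" if "0 < z" for z using that by simp
        show ?thesis unfolding d'_def by (rule z) (use E in simp)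
      qed
      finally show ?thesis using d by linarith
    qed
    ultimately show ?case unfolding dist_real_def by linarith
  qed
qed

context ground_state_doeblin
begin

text \<open>Available only after the identification: \<open>erg\<close> is invariant as a limit over
  time, and it equals integration against \<open>pi\<close>.\<close>

lemma pi_invariant: "bdd_meas C g \<Longrightarrow> 0 < h \<Longrightarrow> (\<integral>y. Qg h g y \<partial>pi) = (\<integral>y. g y \<partial>pi)"
  using erg_invariant[of C g h] erg_eq[OF Qg_bdd_meas[of C g h]] erg_eq[of C g] by simp

lemma C0_ge_1: "1 \<le> C0"
proof -
  have "emeasure (Q 1 0) UNIV \<le> ennreal C0 * emeasure pi UNIV" by (rule dom) simp
  then show ?thesis using prob_space.emeasure_space_1[OF Q_prob, of 1 0] pi.emeasure_space_1 by simp
qed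

lemma pi_Icc_pos: "0 < measure pi {a..b}"
proof -
  have "1 - measure pi {a..b} = measure pi (- {a..b})" using pi.prob_compl[of "{a..b}"] by (simp add: Compl_eq_Diff_UNIV)
  moreover have "measure pi (- {a..b}) \<le> C0 * measure pi (- {a..b})"
    using mult_right_mono[OF C0_ge_1, of "measure pi (- {a..b})"] by simp
  ultimately show ?thesis using tail by linarith
qed

text \<open>Invariance turns the upper bound on the kernel into a lower bound: most of the mass that pi sends to a
  set comes from \<^term>\<open>{a..b}\<close>.\<close>

lemma Q_lower:
  assumes A[measurable]: "A \<in> sets borel"
  shows "ennreal (\<theta> / 2) * emeasure pi A \<le> emeasure (Q (T + 1) x) A"
proof -
  have bA: "bdd_meas 1 (indicator A)" by (rule bdd_meas_indicator[OF A])
  define q where "q = Qg 1 (indicator A)"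
  have bq: "bdd_meas 1 q" unfolding q_def by (rule Qg_bdd_meas[OF bA]) simp
  have q0: "0 \<le> q y" for y unfolding q_def by (rule Qg_bounds(1)[OF bA, of 0 1]) (auto simp: indicator_def)
  have qC: "q y \<le> C0 * measure pi A" for y
  proof -
    have "ennreal (q y) = emeasure (Q 1 y) A"
      unfolding q_def using Qg_nonneg_eq[OF bA, of 1 y] by (simp add: ennreal_indicator)
    also have "\<dots> \<le> ennreal C0 * emeasure pi A" by (rule dom[OF A])
    also have "\<dots> = ennreal (C0 * measure pi A)" using C0 by (simp add: pi.emeasure_eq_measure ennreal_mult)
    finally show ?thesis using C0 by (simp add: ennreal_le_iff)
  qed
  have [measurable]: "q \<in> borel_measurable borel" using bq by (rule bdd_meas_meas)
  have b1: "bdd_meas 1 (\<lambda>y. indicator {a..b} y * q y)" using bq q0 by (auto simp: bdd_meas_def indicator_def)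
  have b2: "bdd_meas 1 (\<lambda>y. indicator (- {a..b}) y * q y)" using bq q0 by (auto simp: bdd_meas_def indicator_def)
  have "measure pi A = (\<integral>y. indicator A y \<partial>pi)" by simp
  also have "\<dots> = (\<integral>y. q y \<partial>pi)" unfolding q_def by (rule pi_invariant[symmetric, OF bA]) simp
  also have "\<dots> = (\<integral>y. indicator {a..b} y * q y + indicator (- {a..b}) y * q y \<partial>pi)"
    by (rule Bochner_Integration.integral_cong) (auto simp: indicator_def)
  also have "\<dots> = (\<integral>y. indicator {a..b} y * q y \<partial>pi) + (\<integral>y. indicator (- {a..b}) y * q y \<partial>pi)"
    by (rule Bochner_Integration.integral_add[OF pi_integrable[OF b1] pi_integrable[OF b2]])
  also have "(\<integral>y. indicator (- {a..b}) y * q y \<partial>pi) \<le> (\<integral>y. indicator (- {a..b}) y * (C0 * measure pi A) \<partial>pi)"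
  proof (rule integral_mono[OF pi_integrable[OF b2]])
    have "bdd_meas \<bar>C0 * measure pi A\<bar> (\<lambda>y. indicator (- {a..b}) y * (C0 * measure pi A))" by (auto simp: bdd_meas_def indicator_def)
    then show "integrable pi (\<lambda>y. indicator (- {a..b}) y * (C0 * measure pi A))" by (rule pi_integrable)
  qed (use qC in \<open>auto simp: indicator_def\<close>)
  also have "(\<integral>y. indicator (- {a..b}) y * (C0 * measure pi A) \<partial>pi) = (C0 * measure pi (- {a..b})) * measure pi A" by simp
  \<comment> \<open>The choice of the interval with C0 times the mass of its complement at most 1/2
    lets this part be absorbed on the left.\<close>
  also have "\<dots> \<le> 1 / 2 * measure pi A" using tail by (intro mult_right_mono) auto
  finally have half: "measure pi A / 2 \<le> (\<integral>y. indicator {a..b} y * q y \<partial>pi)" by simp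
  have "ennreal (\<integral>y. indicator {a..b} y * q y \<partial>pi) \<le> ennreal (\<integral>y. q y \<partial>uniform_measure pi {a..b})"
  proof -
    interpret m: prob_space "uniform_measure pi {a..b}" by (rule m_prob)
    have nn: "ennreal (\<integral>y. indicator {a..b} y * q y \<partial>pi) = (\<integral>\<^sup>+y. ennreal (indicator {a..b} y * q y) \<partial>pi)"
      by (rule nn_integral_eq_integral[symmetric, OF pi_integrable[OF b1]]) (use q0 in auto)
    have "ennreal (\<integral>y. q y \<partial>uniform_measure pi {a..b}) = (\<integral>\<^sup>+y. ennreal (q y) \<partial>uniform_measure pi {a..b})"
      by (rule nn_integral_eq_integral[symmetric])
        (use q0 bdd_meas_le[OF bq] in \<open>auto intro!: m.integrable_const_bound[where B=1]\<close>)
    also have "\<dots> = (\<integral>\<^sup>+y. ennreal (q y) * indicator {a..b} y \<partial>pi) / emeasure pi {a..b}"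
      by (rule nn_integral_uniform_measure) auto
    also have "(\<integral>\<^sup>+y. ennreal (q y) * indicator {a..b} y \<partial>pi) = ennreal (\<integral>y. indicator {a..b} y * q y \<partial>pi)"
      unfolding nn by (rule nn_integral_cong) (auto simp: indicator_def)
    also have "ennreal (\<integral>y. indicator {a..b} y * q y \<partial>pi) / emeasure pi {a..b} = ennreal ((\<integral>y. indicator {a..b} y * q y \<partial>pi) / measure pi {a..b})"
      unfolding pi.emeasure_eq_measure
      by (rule divide_ennreal) (use pi_Icc_pos half in \<open>auto intro: order_trans[OF _ half]\<close>)
    also have "\<dots> \<ge> ennreal (\<integral>y. indicator {a..b} y * q y \<partial>pi)"
    proof (rule ennreal_leI)
      have nnI: "0 \<le> (\<integral>y. indicator {a..b} y * q y \<partial>pi)" using half measure_nonneg[of pi A] by linarith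
      show "(\<integral>y. indicator {a..b} y * q y \<partial>pi) \<le> (\<integral>y. indicator {a..b} y * q y \<partial>pi) / measure pi {a..b}"
        using nnI pi_Icc_pos pi.prob_le_1[of "{a..b}"] by (simp add: le_divide_eq mult_left_le)
    qed
    finally show ?thesis .
  qed
  then have "(\<integral>y. indicator {a..b} y * q y \<partial>pi) \<le> (\<integral>y. q y \<partial>uniform_measure pi {a..b})"
    by (subst (asm) ennreal_le_iff) (use q0 in \<open>auto intro!: Bochner_Integration.integral_nonneg\<close>)
  then have "\<theta> * (measure pi A / 2) \<le> \<theta> * (\<integral>y. q y \<partial>uniform_measure pi {a..b})" using half \<theta> by (intro mult_left_mono) auto
  also have "\<dots> \<le> Qg T q x" by (rule minor_integral[OF bq q0])
  also have "\<dots> = Qg (T + 1) (indicator A) x" unfolding q_def by (rule Qg_CK[symmetric, OF bA T]) simp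
  finally have "ennreal (\<theta> / 2 * measure pi A) \<le> ennreal (Qg (T + 1) (indicator A) x)" by (intro ennreal_leI) simp
  also have "\<dots> = emeasure (Q (T + 1) x) A"
    using Qg_nonneg_eq[OF bA, of "T + 1" x] T by (simp add: ennreal_indicator)
  finally show ?thesis
    unfolding pi.emeasure_eq_measure using \<theta> measure_nonneg[of pi A] by (subst ennreal_mult[symmetric]) simp_all
qed

text \<open>The lower kernel bound transfers integrability of 1/\<open>\<eta>\<close> to
  \<open>pi\<close> from \<open>Q (T + 1) 1\<close>, under which its integral is a survival
  probability times a constant.\<close>

lemma inverse_eta_pi_finite: "\<exists>V\<ge>0. (\<integral>\<^sup>+y. ennreal (1 / \<eta> y) \<partial>pi) = ennreal V"
proof -
  have "ennreal (\<theta> / 2) * (\<integral>\<^sup>+y. ennreal (1 / \<eta> y) \<partial>pi) = (\<integral>\<^sup>+y. ennreal (1 / \<eta> y) \<partial>scale_measure (ennreal (\<theta> / 2)) pi)"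
    by (subst nn_integral_scale_measure) auto
  also have "\<dots> \<le> (\<integral>\<^sup>+y. ennreal (1 / \<eta> y) \<partial>Q (T + 1) 1)"
    by (rule nn_integral_mono_measure) (auto simp: le_measure Q_lower)
  also have "\<dots> \<le> ennreal (exp (lam * (T + 1)) / \<eta> (base 1))" by (rule inverse_eta_Q_le) (use T in simp)
  finally have le: "ennreal (\<theta> / 2) * (\<integral>\<^sup>+y. ennreal (1 / \<eta> y) \<partial>pi) \<le> ennreal (exp (lam * (T + 1)) / \<eta> (base 1))" .
  have "(\<integral>\<^sup>+y. ennreal (1 / \<eta> y) \<partial>pi) \<noteq> \<infinity>"
  proof
    assume "(\<integral>\<^sup>+y. ennreal (1 / \<eta> y) \<partial>pi) = \<infinity>"
    then have "ennreal (\<theta> / 2) * (\<integral>\<^sup>+y. ennreal (1 / \<eta> y) \<partial>pi) = \<infinity>" using \<theta> by (simp add: ennreal_mult_top)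
    then show False using le by (simp add: top_unique)
  qed
  then show ?thesis by (cases "\<integral>\<^sup>+y. ennreal (1 / \<eta> y) \<partial>pi") auto
qed

text \<open>For positive x this is exp(\<open>lam\<close>)/\<open>\<eta> x\<close> times the
  probability of surviving one unit of time. Spending that unit replaces 1/\<open>\<eta>\<close> by
  a function between two positive constants.\<close>

definition surv_mass :: "real \<Rightarrow> real" where "surv_mass x = enn2real (\<integral>\<^sup>+y. ennreal (1 / \<eta> y) \<partial>Q 1 x)"

lemma surv_mass_props: "\<exists>C. bdd_meas C surv_mass" "(\<integral>\<^sup>+y. ennreal (1 / \<eta> y) \<partial>Q 1 x) = ennreal (surv_mass x)" "\<exists>l>0. \<forall>x. l \<le> surv_mass x"
proof -
  obtain V where V: "V \<ge> 0" "(\<integral>\<^sup>+y. ennreal (1 / \<eta> y) \<partial>pi) = ennreal V" using inverse_eta_pi_finite by blast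
  have le: "(\<integral>\<^sup>+y. ennreal (1 / \<eta> y) \<partial>Q 1 x) \<le> ennreal (C0 * V)" for x
  proof -
    have "(\<integral>\<^sup>+y. ennreal (1 / \<eta> y) \<partial>Q 1 x) \<le> ennreal C0 * ennreal V"
      unfolding V(2)[symmetric] by (rule dom_integral) measurable
    then show ?thesis using C0 V by (simp add: ennreal_mult)
  qed
  have fin: "(\<integral>\<^sup>+y. ennreal (1 / \<eta> y) \<partial>Q 1 x) < top" for x
    using le[of x] by (rule le_less_trans) simp
  show eq: "(\<integral>\<^sup>+y. ennreal (1 / \<eta> y) \<partial>Q 1 x) = ennreal (surv_mass x)" for x using fin[of x] by (simp add: surv_mass_def)
  have v0: "0 \<le> surv_mass x" for x by (simp add: surv_mass_def)
  have vC: "surv_mass x \<le> C0 * V" for x using le[of x] V C0 unfolding eq by (simp add: ennreal_le_iff)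
  have "(\<lambda>M. integral\<^sup>N M (\<lambda>y. ennreal (1 / \<eta> y))) \<in> borel_measurable (subprob_algebra borel)"
    by (rule nn_integral_measurable_subprob_algebra) measurable
  from measurable_compose[OF Q_subprob this] have "(\<lambda>x. \<integral>\<^sup>+y. ennreal (1 / \<eta> y) \<partial>Q 1 x) \<in> borel_measurable borel" by simp
  then have "surv_mass \<in> borel_measurable borel" unfolding surv_mass_def[abs_def] by measurable
  then show "\<exists>C. bdd_meas C surv_mass" using v0 vC by (intro exI[of _ "C0 * V"]) (auto simp: bdd_meas_def)
  obtain H where H: "0 < H" "\<And>y. 0 < y \<Longrightarrow> \<eta> y \<le> H" using eta_bounded by blast
  have "1 / H \<le> surv_mass x" for x
  proof -
    interpret q: prob_space "Q 1 x" by (rule Q_prob) simp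
    have "ennreal (1 / H) = (\<integral>\<^sup>+y. ennreal (1 / H) \<partial>Q 1 x)" using q.emeasure_space_1 by simp
    also have "\<dots> \<le> (\<integral>\<^sup>+y. ennreal (1 / \<eta> y) \<partial>Q 1 x)"
    proof (rule nn_integral_mono_AE)
      show "AE y in Q 1 x. ennreal (1 / H) \<le> ennreal (1 / \<eta> y)"
        using Q_AE_pos[of 1 x, simplified]
      proof eventually_elim
        case (elim y)
        then show ?case using H(2)[OF elim] eta_pos'[OF elim] by (intro ennreal_leI divide_left_mono) auto
      qed
    qed
    finally show ?thesis using v0 unfolding eq by (simp add: ennreal_le_iff)
  qed
  then show "\<exists>l>0. \<forall>x. l \<le> surv_mass x" using H(1) by (intro exI[of _ "1 / H"]) auto
qed

lemma survival_formula:
  assumes x: "0 < x" and t: "1 < t"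
  shows "PP t (\<lambda>_. 1) x = ennreal (exp (- lam * t) * \<eta> x * Qg (t - 1) surv_mass x)"
proof -
  obtain C where C: "bdd_meas C surv_mass" using surv_mass_props(1) by blast
  obtain l where l: "0 < l" "\<And>x. l \<le> surv_mass x" using surv_mass_props(3) by blast
  have v0: "0 \<le> surv_mass y" for y using l(1) l(2)[of y] by linarith
  have q0: "0 \<le> Qg (t - 1) surv_mass x" by (rule Qg_bounds(1)[OF C v0, of C]) (use bdd_meas_le[OF C] t in \<open>auto simp: abs_le_iff\<close>)
  have bx: "base x = x" using x by (simp add: base_def)
  have "ennreal (Qg (t - 1) surv_mass x) = (\<integral>\<^sup>+y. ennreal (surv_mass y) \<partial>Q (t - 1) x)"
    by (rule Qg_nonneg_eq[symmetric, OF C v0]) (use t in simp)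
  also have "\<dots> = (\<integral>\<^sup>+y. (\<integral>\<^sup>+z. ennreal (1 / \<eta> z) \<partial>Q 1 y) \<partial>Q (t - 1) x)" unfolding surv_mass_props(2) ..
  also have "\<dots> = (\<integral>\<^sup>+z. ennreal (1 / \<eta> z) \<partial>Q (t - 1 + 1) x)" by (rule Q_CK[symmetric]) (use t in auto)
  also have "\<dots> = ennreal (exp (lam * t) / \<eta> x) * PP t (\<lambda>_. 1) x" using inverse_eta_Q[of t x] t bx by simp
  finally have e: "ennreal (Qg (t - 1) surv_mass x) = ennreal (exp (lam * t) / \<eta> x) * PP t (\<lambda>_. 1) x" .
  have "ennreal (exp (- lam * t) * \<eta> x * Qg (t - 1) surv_mass x) = ennreal (exp (- lam * t) * \<eta> x) * ennreal (Qg (t - 1) surv_mass x)"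
    using q0 eta_pos'[OF x] by (intro ennreal_mult) simp_all
  also have "\<dots> = (ennreal (exp (- lam * t) * \<eta> x) * ennreal (exp (lam * t) / \<eta> x)) * PP t (\<lambda>_. 1) x"
    unfolding e by (simp add: mult.assoc)
  also have "ennreal (exp (- lam * t) * \<eta> x) * ennreal (exp (lam * t) / \<eta> x) = 1"
    using eta_pos'[OF x] by (subst ennreal_mult[symmetric]) (simp_all add: exp_minus field_simps)
  finally show ?thesis by simp
qed

text \<open>The Markov property at time \<open>s\<close>, with the survival probability over the
  remaining \<open>t\<close> rewritten by \<open>survival_formula\<close>; t > 1 leaves the last
  unit for \<open>surv_mass\<close>.\<close>

lemma killed_formula_nonneg:
  assumes x: "0 < x" and s: "0 < s" and t: "1 < t" and f: "bdd_meas C f" "\<And>y. 0 \<le> f y"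
  shows "killed_exp M B \<alpha> x s (s + t) f = exp (- lam * (s + t)) * \<eta> x * Qg s (\<lambda>y. f y * Qg (t - 1) surv_mass y) x"
proof -
  obtain Cv where Cv: "bdd_meas Cv surv_mass" using surv_mass_props(1) by blast
  obtain l where l: "0 < l" "\<And>x. l \<le> surv_mass x" using surv_mass_props(3) by blast
  have v0: "0 \<le> surv_mass y" for y using l(1) l(2)[of y] by linarith
  define w where "w = Qg (t - 1) surv_mass"
  have bw: "bdd_meas Cv w" unfolding w_def by (rule Qg_bdd_meas[OF Cv]) (use t in simp)
  have w0: "0 \<le> w y" for y unfolding w_def by (rule Qg_bounds(1)[OF Cv v0, of Cv]) (use bdd_meas_le[OF Cv] t in \<open>auto simp: abs_le_iff\<close>)
  have [measurable]: "f \<in> borel_measurable borel" "w \<in> borel_measurable borel" using f(1) bw by (auto simp: bdd_meas_def)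
  have bfw: "bdd_meas (C * Cv) (\<lambda>y. f y * w y)"
    using bdd_meas_le[OF f(1)] bdd_meas_le[OF bw] bdd_meas_nonneg[OF f(1)] by (auto simp: bdd_meas_def abs_mult intro!: mult_mono)
  have fw0: "0 \<le> f y * w y" for y using f(2) w0 by simp
  have bx: "base x = x" using x by (simp add: base_def)
  have i: "integrable M (\<lambda>\<omega>. indicator {\<omega>. surv x (s + t) \<omega>} \<omega> * f (X x s \<omega>))"
    by (rule surv_integrable[OF _ bdd_meas_le[OF f(1)]]) (use s t in auto)
  have "ennreal (\<integral>\<omega>. indicator {\<omega>. surv x (s + t) \<omega>} \<omega> * f (X x s \<omega>) \<partial>M)
      = (\<integral>\<^sup>+\<omega>. ennreal (indicator {\<omega>. surv x (s + t) \<omega>} \<omega> * f (X x s \<omega>)) \<partial>M)"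
    by (rule nn_integral_eq_integral[symmetric, OF i]) (use f(2) in auto)
  also have "\<dots> = (\<integral>\<^sup>+\<omega>. indicator {\<omega>. surv x (s + t) \<omega>} \<omega> * (ennreal (f (X x s \<omega>)) * 1) \<partial>M)"
    by (rule nn_integral_cong) (auto simp: indicator_def)
  also have "\<dots> = PP s (\<lambda>y. ennreal (f y) * PP t (\<lambda>_. 1) y) x"
    by (rule markov[of "\<lambda>y. ennreal (f y)" "\<lambda>_. 1"]) (use s t in auto)
  also have "\<dots> = PP s (\<lambda>y. ennreal (exp (- lam * t)) * (ennreal (\<eta> y) * ennreal (f y * w y))) x"
  proof (rule PP_cong)
    fix y :: real assume y: "0 < y"
    have "ennreal (f y) * PP t (\<lambda>_. 1) y = ennreal (f y) * ennreal (exp (- lam * t) * \<eta> y * w y)"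
      unfolding survival_formula[OF y t] w_def ..
    also have "\<dots> = ennreal (f y * (exp (- lam * t) * \<eta> y * w y))"
      using f(2) w0 eta_pos'[OF y] by (intro ennreal_mult[symmetric]) simp_all
    also have "f y * (exp (- lam * t) * \<eta> y * w y) = exp (- lam * t) * (\<eta> y * (f y * w y))" by simp
    also have "ennreal (exp (- lam * t) * (\<eta> y * (f y * w y))) = ennreal (exp (- lam * t)) * ennreal (\<eta> y * (f y * w y))"
      using fw0[of y] eta_pos'[OF y] by (intro ennreal_mult) simp_all
    also have "ennreal (\<eta> y * (f y * w y)) = ennreal (\<eta> y) * ennreal (f y * w y)"
      using fw0[of y] eta_pos'[OF y] by (intro ennreal_mult) simp_all
    finally show "ennreal (f y) * PP t (\<lambda>_. 1) y = ennreal (exp (- lam * t)) * (ennreal (\<eta> y) * ennreal (f y * w y))" .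
  qed
  also have "\<dots> = ennreal (exp (- lam * t)) * PP s (\<lambda>y. ennreal (\<eta> y) * ennreal (f y * w y)) x"
    by (rule PP_cmult) (use s in auto)
  also have "\<dots> = ennreal (exp (- lam * (s + t)) * \<eta> x) * (\<integral>\<^sup>+y. ennreal (f y * w y) \<partial>Q s x)"
  proof -
    have "(\<integral>\<^sup>+y. ennreal (f y * w y) \<partial>Q s x) = ennreal (exp (lam * s) / \<eta> x) * PP s (\<lambda>y. ennreal (\<eta> y) * ennreal (f y * w y)) x"
      using nn_integral_Q[of "\<lambda>y. ennreal (f y * w y)" s x] s bx by simp
    moreover have "ennreal (exp (- lam * (s + t)) * \<eta> x) * ennreal (exp (lam * s) / \<eta> x) = ennreal (exp (- lam * t))"
      using eta_pos'[OF x] by (subst ennreal_mult[symmetric]) (simp_all add: exp_add[symmetric] algebra_simps)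
    ultimately show ?thesis by (simp add: mult.assoc[symmetric])
  qed
  also have "(\<integral>\<^sup>+y. ennreal (f y * w y) \<partial>Q s x) = ennreal (Qg s (\<lambda>y. f y * w y) x)"
    by (rule Qg_nonneg_eq[OF bfw fw0 s])
  also have q0: "0 \<le> Qg s (\<lambda>y. f y * w y) x"
    by (rule Qg_bounds(1)[OF bfw fw0 _ s, of "C * Cv"]) (use bdd_meas_le[OF bfw] in \<open>auto simp: abs_le_iff\<close>)
  then have "ennreal (exp (- lam * (s + t)) * \<eta> x) * ennreal (Qg s (\<lambda>y. f y * w y) x) = ennreal (exp (- lam * (s + t)) * \<eta> x * Qg s (\<lambda>y. f y * w y) x)"
    using eta_pos'[OF x] by (intro ennreal_mult[symmetric]) simp_all
  finally have "ennreal (\<integral>\<omega>. indicator {\<omega>. surv x (s + t) \<omega>} \<omega> * f (X x s \<omega>) \<partial>M) = ennreal (exp (- lam * (s + t)) * \<eta> x * Qg s (\<lambda>y. f y * w y) x)" .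
  then have "(\<integral>\<omega>. indicator {\<omega>. surv x (s + t) \<omega>} \<omega> * f (X x s \<omega>) \<partial>M) = exp (- lam * (s + t)) * \<eta> x * Qg s (\<lambda>y. f y * w y) x"
    using f(2) q0 eta_pos'[OF x]
    by (subst (asm) ennreal_inj) (auto intro!: Bochner_Integration.integral_nonneg mult_nonneg_nonneg simp: less_imp_le)
  then show ?thesis unfolding w_def[symmetric] using killed_exp_eq[OF H x, of s "s + t" f] s t f(1) by (simp add: bdd_meas_def)
qed

lemma killed_formula:
  assumes x: "0 < x" and s: "0 < s" and t: "1 < t" and f: "bdd_meas C f"
  shows "killed_exp M B \<alpha> x s (s + t) f = exp (- lam * (s + t)) * \<eta> x * Qg s (\<lambda>y. f y * Qg (t - 1) surv_mass y) x"
proof -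
  obtain Cv where Cv: "bdd_meas Cv surv_mass" using surv_mass_props(1) by blast
  have bw: "bdd_meas Cv (Qg (t - 1) surv_mass)" by (rule Qg_bdd_meas[OF Cv]) (use t in simp)
  have bC: "bdd_meas \<bar>C\<bar> (\<lambda>_. C)" by (rule bdd_meas_const)
  have bfC: "bdd_meas (C + \<bar>C\<bar>) (\<lambda>y. f y + C)" by (rule bdd_meas_add[OF f bC])
  have prod: "bdd_meas (D * Cv) (\<lambda>y. g y * Qg (t - 1) surv_mass y)" if g: "bdd_meas D g" for D g
    using bdd_meas_le[OF g] bdd_meas_le[OF bw] bdd_meas_nonneg[OF g] g bw by (auto simp: bdd_meas_def abs_mult intro!: mult_mono)
  have C0': "0 \<le> C" by (rule bdd_meas_nonneg[OF f])
  have 1: "killed_exp M B \<alpha> x s (s + t) (\<lambda>y. f y + C) = exp (- lam * (s + t)) * \<eta> x * Qg s (\<lambda>y. (f y + C) * Qg (t - 1) surv_mass y) x"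
    by (rule killed_formula_nonneg[OF x s t bfC]) (use bdd_meas_le[OF f] in \<open>auto simp: abs_le_iff; smt (verit)\<close>)
  have 2: "killed_exp M B \<alpha> x s (s + t) (\<lambda>_. C) = exp (- lam * (s + t)) * \<eta> x * Qg s (\<lambda>y. C * Qg (t - 1) surv_mass y) x"
    by (rule killed_formula_nonneg[OF x s t bC C0'])
  have i1: "integrable M (\<lambda>\<omega>. indicator {\<omega>. surv x (s + t) \<omega>} \<omega> * f (X x s \<omega>))"
    by (rule surv_integrable[OF bdd_meas_meas[OF f] bdd_meas_le[OF f]]) (use s t in auto)
  have i2: "integrable M (\<lambda>\<omega>. indicator {\<omega>. surv x (s + t) \<omega>} \<omega> * C)"
    using surv_integrable[of "\<lambda>_. C" "\<bar>C\<bar>" s "s + t" x] s t by simp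
  have "killed_exp M B \<alpha> x s (s + t) (\<lambda>y. f y + C) = killed_exp M B \<alpha> x s (s + t) f + killed_exp M B \<alpha> x s (s + t) (\<lambda>_. C)"
    using killed_exp_eq[OF H x, of s "s + t"] s t bdd_meas_meas[OF f] i1 i2
    by (simp add: distrib_left)
  moreover have "Qg s (\<lambda>y. (f y + C) * Qg (t - 1) surv_mass y) x = Qg s (\<lambda>y. f y * Qg (t - 1) surv_mass y) x + Qg s (\<lambda>y. C * Qg (t - 1) surv_mass y) x"
    using Qg_add[OF prod[OF f] prod[OF bC] s, of x] by (simp add: distrib_right)
  ultimately show ?thesis using 1 2 by (simp add: distrib_left)
qed

text \<open>Numerator and denominator carry the same factor exp(-\<open>lam\<close> t). Without it
  they tend to E L V and E V, where E is the \<open>\<nu>\<close>-mean of \<open>\<eta>\<close>, L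
  the claimed limit and V the limit of the \<open>surv_mass\<close> terms; E and V are
  positive.\<close>

lemma conditional_limit:
  assumes q: "0 < q" "q < 1" and \<nu>: "prob_space \<nu>" "sets \<nu> = sets borel" "emeasure \<nu> {..0} = 0"
    and f: "f \<in> borel_measurable borel" "\<exists>C. \<forall>y. \<bar>f y\<bar> \<le> C"
  shows "((\<lambda>t. (\<integral>x. killed_exp M B \<alpha> x (q * t) t f \<partial>\<nu>) / (\<integral>x. killed_exp M B \<alpha> x t t (\<lambda>_. 1) \<partial>\<nu>))
          \<longlongrightarrow> (\<integral>y. f y * (\<eta> y)\<^sup>2 \<partial>mu \<alpha>)) at_top"
proof -
  interpret \<nu>: prob_space \<nu> by (rule \<nu>(1))
  have [measurable_cong]: "sets \<nu> = sets borel" by (rule \<nu>(2))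
  have s\<nu>: "space \<nu> = UNIV" using sets_eq_imp_space_eq[OF \<nu>(2)] by simp
  obtain C where C: "bdd_meas C f" using f by (auto simp: bdd_meas_def)
  have C0': "0 \<le> C" by (rule bdd_meas_nonneg[OF C])
  obtain Cv where Cv: "bdd_meas Cv surv_mass" using surv_mass_props(1) by blast
  obtain l where l: "0 < l" "\<And>x. l \<le> surv_mass x" using surv_mass_props(3) by blast
  obtain Hb where Hb: "0 < Hb" "\<And>y. 0 < y \<Longrightarrow> \<eta> y \<le> Hb" using eta_bounded by blast
  define V where "V = erg surv_mass"
  have V: "0 < V"
  proof -
    have "l \<le> V" unfolding V_def
    proof (rule tendsto_lowerbound[OF erg_tendsto[OF Cv, of 0]])
      show "\<forall>\<^sub>F t in at_top. l \<le> Qg t surv_mass 0"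
        by (rule eventually_mono[OF at_top_pos]) (use Qg_bounds(1)[OF Cv l(2), of Cv] bdd_meas_le[OF Cv] in \<open>auto simp: abs_le_iff\<close>)
    qed simp
    then show ?thesis using l by simp
  qed
  define L where "L = (\<integral>y. f y * (\<eta> y)\<^sup>2 \<partial>mu \<alpha>)"
  have L: "erg f = L"
  proof -
    have "erg f = (\<integral>y. f y \<partial>pi)" by (rule erg_eq[OF C])
    also have "\<dots> = (\<integral>y. (\<eta> y)\<^sup>2 *\<^sub>R f y \<partial>mu \<alpha>)" unfolding pi_def by (rule integral_density) (use f(1) in auto)
    finally show ?thesis by (simp add: L_def mult.commute)
  qed
  \<comment> \<open>Set to 0 on the nonpositive half-line, where \<open>\<eta>\<close> is
    unspecified and \<open>\<nu>\<close> has no mass; this makes it bounded and nonnegative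
    everywhere.\<close>
  define e where "e x = (if 0 < x then \<eta> x else 0)" for x
  have e0: "0 \<le> e x" "e x \<le> Hb" for x using Hb eta_pos'[of x] by (auto simp: e_def less_imp_le)
  have em[measurable]: "e \<in> borel_measurable borel" unfolding e_def[abs_def] by measurable
  have ei: "integrable \<nu> e" by (rule \<nu>.integrable_const_bound[where B=Hb]) (use e0 in auto)
  have ae\<nu>: "AE x in \<nu>. 0 < x" by (rule AE_I[of _ _ "{..0}"]) (use \<nu> in \<open>auto simp: not_less\<close>)
  define E where "E = (\<integral>x. e x \<partial>\<nu>)"
  have E: "0 < E"
  proof -
    have "E \<noteq> 0"
    proof
      assume "E = 0"
      then have "AE x in \<nu>. e x = 0" unfolding E_def using integral_nonneg_eq_0_iff_AE[OF ei] e0 by auto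
      then have "AE x in \<nu>. False" using ae\<nu> by eventually_elim (use eta_pos' in \<open>auto simp: e_def less_imp_neq[symmetric]\<close>)
      then show False by (simp add: \<nu>.AE_False)
    qed
    moreover have "0 \<le> E" unfolding E_def by (rule Bochner_Integration.integral_nonneg) (rule e0)
    ultimately show ?thesis by simp
  qed
  define A where "A t = Qg (q * t) (\<lambda>y. f y * Qg ((1 - q) * t - 1) surv_mass y)" for t
  define D where "D t = Qg (t - 1) surv_mass" for t
  \<comment> \<open>From here on the remaining time (1 - q) t exceeds 1, so a positive time is left
    after the unit reserved for \<open>surv_mass\<close>.\<close>
  define t1 where "t1 = 2 / (1 - q) + 2"
  have t1: "1 < (1 - q) * t" "1 < t" "0 < q * t" if "t \<ge> t1" for t
  proof -
    have t2: "2 / (1 - q) \<le> t" "2 \<le> t" using that q by (auto simp: t1_def) (smt (verit) divide_nonneg_pos)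
    have "2 \<le> (1 - q) * t" using t2(1) q by (simp add: field_simps)
    then show "1 < (1 - q) * t" by simp
    show "1 < t" "0 < q * t" using t2(2) q by auto
  qed
  have prod: "bdd_meas (C * Cv) (\<lambda>y. f y * Qg s surv_mass y)" if s: "0 < s" for s
    using bdd_meas_le[OF C] bdd_meas_le[OF Qg_bdd_meas[OF Cv s]] C0' C Qg_bdd_meas[OF Cv s] by (auto simp: bdd_meas_def abs_mult intro!: mult_mono)
  have bA: "bdd_meas (C * Cv) (A t)" if "t \<ge> t1" for t unfolding A_def using t1[OF that] by (intro Qg_bdd_meas prod) auto
  have bD: "bdd_meas Cv (D t)" if "t \<ge> t1" for t unfolding D_def using t1[OF that] by (intro Qg_bdd_meas[OF Cv]) auto
  have uA: "\<exists>t0. \<forall>t\<ge>t0. \<forall>x. \<bar>A t x - L * V\<bar> \<le> d" if d: "0 < d" for d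
  proof -
    define r where "r = d / (C + V + 1)"
    have r: "0 < r" "(C + V) * r \<le> d"
    proof -
      have p: "0 < C + V + 1" using C0' V by linarith
      show r0: "0 < r" using d p by (simp add: r_def)
      have "(C + V) * r \<le> (C + V + 1) * r" using r0 by (intro mult_right_mono) auto
      also have "\<dots> = d" using p by (simp add: r_def)
      finally show "(C + V) * r \<le> d" .
    qed
    obtain s1 where s1: "\<And>t x. t \<ge> s1 \<Longrightarrow> \<bar>Qg t surv_mass x - V\<bar> \<le> r" using erg_uniform[OF Cv r(1)] unfolding V_def by blast
    obtain s2 where s2: "\<And>t x. t \<ge> s2 \<Longrightarrow> \<bar>Qg t f x - L\<bar> \<le> r" using erg_uniform[OF C r(1)] unfolding L by blast
    show ?thesis
    proof (intro exI allI impI)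
      fix t x assume t: "max t1 (max ((s1 + 1) / (1 - q)) (s2 / q)) \<le> t"
      then have tt: "t1 \<le> t" "(s1 + 1) / (1 - q) \<le> t" "s2 / q \<le> t" by auto
      note t1' = t1[OF tt(1)]
      have "s1 \<le> (1 - q) * t - 1" using tt(2) q by (simp add: field_simps)
      note w = s1[OF this]
      have "s2 \<le> q * t" using tt(3) q by (simp add: field_simps)
      note ff = s2[OF this, of x]
      \<comment> \<open>The inner semigroup term is replaced by its limit V at the uniform cost C r;
        what remains is V times \<open>Qg (q * t) f\<close>, which converges to L V.\<close>
      define u where "u y = f y * (Qg ((1 - q) * t - 1) surv_mass y - V)" for y
      have bV: "bdd_meas (\<bar>V\<bar> * C) (\<lambda>y. V * f y)" by (rule bdd_meas_cmult[OF C])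
      have bp: "bdd_meas (C * Cv) (\<lambda>y. f y * Qg ((1 - q) * t - 1) surv_mass y)" using t1' by (intro prod) auto
      have ule: "\<bar>u y\<bar> \<le> C * r" for y unfolding u_def abs_mult using bdd_meas_le[OF C, of y] w[of y] C0' by (intro mult_mono) auto
      have bu: "bdd_meas (C * r) u"
      proof -
        have "u = (\<lambda>y. f y * Qg ((1 - q) * t - 1) surv_mass y - V * f y)" by (auto simp: u_def algebra_simps)
        then have "u \<in> borel_measurable borel" using bdd_meas_meas[OF bdd_meas_diff[OF bp bV]] by simp
        then show ?thesis using ule by (simp add: bdd_meas_def)
      qed
      have "A t x = Qg (q * t) (\<lambda>y. u y + V * f y) x" unfolding A_def u_def by (simp add: algebra_simps)
      also have "\<dots> = Qg (q * t) u x + V * Qg (q * t) f x" using Qg_add[OF bu bV t1'(3)] Qg_cmult by simp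
      finally have eq: "A t x - L * V = Qg (q * t) u x + V * (Qg (q * t) f x - L)" by (simp add: algebra_simps)
      have "\<bar>Qg (q * t) u x\<bar> \<le> C * r" using bdd_meas_le[OF Qg_bdd_meas[OF bu t1'(3)]] .
      moreover have "\<bar>V * (Qg (q * t) f x - L)\<bar> \<le> V * r" unfolding abs_mult using ff V by (intro mult_mono) auto
      ultimately have "\<bar>A t x - L * V\<bar> \<le> C * r + V * r" unfolding eq by linarith
      then show "\<bar>A t x - L * V\<bar> \<le> d" using r(2) by (simp add: distrib_right)
    qed
  qed
  have uD: "\<exists>t0. \<forall>t\<ge>t0. \<forall>x. \<bar>D t x - V\<bar> \<le> d" if d: "0 < d" for d
  proof -
    obtain s1 where "\<And>t x. t \<ge> s1 \<Longrightarrow> \<bar>Qg t surv_mass x - V\<bar> \<le> d" using erg_uniform[OF Cv d] unfolding V_def by blast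
    then show ?thesis unfolding D_def by (intro exI[of _ "s1 + 1"]) auto
  qed
  have evA: "\<forall>\<^sub>F t in at_top. A t \<in> borel_measurable \<nu>"
    unfolding measurable_cong_sets[OF \<nu>(2) refl] by (rule eventually_mono[OF eventually_ge_at_top[of t1]]) (rule bdd_meas_meas[OF bA])
  have evD: "\<forall>\<^sub>F t in at_top. D t \<in> borel_measurable \<nu>"
    unfolding measurable_cong_sets[OF \<nu>(2) refl] by (rule eventually_mono[OF eventually_ge_at_top[of t1]]) (rule bdd_meas_meas[OF bD])
  have limA: "((\<lambda>t. \<integral>x. e x * A t x \<partial>\<nu>) \<longlongrightarrow> E * (L * V)) at_top"
    unfolding E_def by (rule uniform_integral_tendsto[OF \<nu>(1) ei e0(1) evA uA])
  have limD: "((\<lambda>t. \<integral>x. e x * D t x \<partial>\<nu>) \<longlongrightarrow> E * V) at_top"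
    unfolding E_def by (rule uniform_integral_tendsto[OF \<nu>(1) ei e0(1) evD uD])
  have "((\<lambda>t. (\<integral>x. e x * A t x \<partial>\<nu>) / (\<integral>x. e x * D t x \<partial>\<nu>)) \<longlongrightarrow> E * (L * V) / (E * V)) at_top"
    by (rule tendsto_divide[OF limA limD]) (use E V in auto)
  then have lim: "((\<lambda>t. (\<integral>x. e x * A t x \<partial>\<nu>) / (\<integral>x. e x * D t x \<partial>\<nu>)) \<longlongrightarrow> L) at_top" using E V by simp
  have num: "(\<integral>x. killed_exp M B \<alpha> x (q * t) t f \<partial>\<nu>) = exp (- lam * t) * (\<integral>x. e x * A t x \<partial>\<nu>)" if t: "t \<ge> t1" for t
  proof -
    note t1' = t1[OF t]
    have form: "killed_exp M B \<alpha> x (q * t) t f = (if 0 < x then exp (- lam * t) * (e x * A t x) else f (THE v. False))" for x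
    proof (cases "0 < x")
      case True
      have "q * t + (1 - q) * t = t" by (simp add: algebra_simps)
      then show ?thesis using killed_formula[OF True t1'(3) t1'(1) C] True by (simp add: e_def A_def)
    qed (use killed_exp_nonpos[of x "q * t"] t1' in auto)
    have [measurable]: "A t \<in> borel_measurable borel" using bA[OF t] by (simp add: bdd_meas_def)
    have "(\<integral>x. killed_exp M B \<alpha> x (q * t) t f \<partial>\<nu>) = (\<integral>x. exp (- lam * t) * (e x * A t x) \<partial>\<nu>)"
      unfolding form
      by (rule integral_cong_AE) (use ae\<nu> in \<open>auto elim!: eventually_mono\<close>)
    then show ?thesis by simp
  qed
  have den: "(\<integral>x. killed_exp M B \<alpha> x t t (\<lambda>_. 1) \<partial>\<nu>) = exp (- lam * t) * (\<integral>x. e x * D t x \<partial>\<nu>)" if t: "t \<ge> t1" for t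
  proof -
    note t1' = t1[OF t]
    have form: "killed_exp M B \<alpha> x t t (\<lambda>_. 1) = (if 0 < x then exp (- lam * t) * (e x * D t x) else 1)" for x
    proof (cases "0 < x")
      case True
      have s: "q * t + (1 - q) * t = t" by (simp add: algebra_simps)
      have b1: "bdd_meas \<bar>1\<bar> (\<lambda>_. 1)" by (rule bdd_meas_const)
      \<comment> \<open>For the constant 1 the observation time does not matter, so the denominator
        is another instance of \<open>killed_formula\<close>.\<close>
      have "killed_exp M B \<alpha> x t t (\<lambda>_. 1) = killed_exp M B \<alpha> x (q * t) t (\<lambda>_. 1)"
      proof -
        have "q * t \<le> t" using t1'(1) by (simp add: algebra_simps)
        then show ?thesis
          using killed_exp_eq[OF H True, of t t "\<lambda>_. 1"] killed_exp_eq[OF H True, of "q * t" t "\<lambda>_. 1"] t1'(2,3) by simp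
      qed
      also have "\<dots> = exp (- lam * t) * \<eta> x * Qg (q * t) (\<lambda>y. 1 * Qg ((1 - q) * t - 1) surv_mass y) x"
        using killed_formula[OF True t1'(3) t1'(1) b1] unfolding s .
      also have "Qg (q * t) (\<lambda>y. 1 * Qg ((1 - q) * t - 1) surv_mass y) x = Qg (q * t + ((1 - q) * t - 1)) surv_mass x"
        using Qg_CK[OF Cv, of "q * t" "(1 - q) * t - 1" x] t1' by simp
      also have "q * t + ((1 - q) * t - 1) = t - 1" by (simp add: algebra_simps)
      finally show ?thesis using True by (simp add: e_def D_def)
    qed (use killed_exp_nonpos[of x t] t1' in auto)
    have [measurable]: "D t \<in> borel_measurable borel" using bD[OF t] by (simp add: bdd_meas_def)
    have "(\<integral>x. killed_exp M B \<alpha> x t t (\<lambda>_. 1) \<partial>\<nu>) = (\<integral>x. exp (- lam * t) * (e x * D t x) \<partial>\<nu>)"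
      unfolding form
      by (rule integral_cong_AE) (use ae\<nu> in \<open>auto elim!: eventually_mono\<close>)
    then show ?thesis by simp
  qed
  show ?thesis unfolding L_def[symmetric]
  proof (rule Lim_transform_eventually[OF lim])
    show "\<forall>\<^sub>F t in at_top. (\<integral>x. e x * A t x \<partial>\<nu>) / (\<integral>x. e x * D t x \<partial>\<nu>) = (\<integral>x. killed_exp M B \<alpha> x (q * t) t f \<partial>\<nu>) / (\<integral>x. killed_exp M B \<alpha> x t t (\<lambda>_. 1) \<partial>\<nu>)"
      using eventually_ge_at_top[of t1] by eventually_elim (simp add: num den)
  qed
qed

end

theorem theorem3p1:
  fixes M :: "'w measure" and B :: "real \<Rightarrow> 'w \<Rightarrow> real" and \<alpha> :: "real \<Rightarrow> real"
    and r :: "real \<Rightarrow> real \<Rightarrow> real \<Rightarrow> real" and \<eta>1 :: "real \<Rightarrow> real" and lam1 :: real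
    and q :: real and \<nu> :: "real measure" and f :: "real \<Rightarrow> real"
  assumes BM: "brownian_motion M B"
    and C1: "\<exists>\<alpha>'. (\<forall>x>0. (\<alpha> has_real_derivative \<alpha>' x) (at x)) \<and> continuous_on {0<..} \<alpha>'"
    and H: "hypH M B \<alpha>"
    and r_dens: "\<forall>t>0. \<forall>x>0. (\<forall>y>0. 0 \<le> r t x y) \<and> integrable (mu \<alpha>) (r t x)
                   \<and> integrable (mu \<alpha>) (\<lambda>y. (r t x y)\<^sup>2)
                   \<and> (\<forall>g. g \<in> borel_measurable borel \<and> (\<exists>C. \<forall>y. \<bar>g y\<bar> \<le> C) \<longrightarrow>
                        killed_exp M B \<alpha> x t t g = (\<integral>y. r t x y * g y \<partial>mu \<alpha>))"
    and eta_pos: "\<forall>y>0. 0 < \<eta>1 y"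
    and eta_meas: "\<eta>1 \<in> borel_measurable borel"
    and eta_L2: "integrable (mu \<alpha>) (\<lambda>y. (\<eta>1 y)\<^sup>2)" "(\<integral>y. (\<eta>1 y)\<^sup>2 \<partial>mu \<alpha>) = 1"
    and lam_pos: "0 < lam1"
    and eta_ode: "\<exists>\<eta>' \<eta>''. \<forall>y>0. (\<eta>1 has_real_derivative \<eta>' y) (at y)
                       \<and> (\<eta>' has_real_derivative \<eta>'' y) (at y)
                       \<and> \<eta>'' y / 2 - \<alpha> y * \<eta>' y = - lam1 * \<eta>1 y"
    and eta_eig: "\<forall>t>0. \<forall>x>0. killed_exp M B \<alpha> x t t \<eta>1 = exp (- lam1 * t) * \<eta>1 x"
    and IU: "\<forall>t>0. \<exists>c>0. \<forall>x>0. \<forall>y>0. r t x y \<le> c * \<eta>1 x * \<eta>1 y"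
    and q: "0 < q" "q < 1"
    and nu: "prob_space \<nu>" "sets \<nu> = sets borel" "emeasure \<nu> {..0} = 0"
    and f: "f \<in> borel_measurable borel" "\<exists>C. \<forall>y. \<bar>f y\<bar> \<le> C"
  shows "((\<lambda>t. (\<integral>x. killed_exp M B \<alpha> x (q * t) t f \<partial>\<nu>)
               / (\<integral>x. killed_exp M B \<alpha> x t t (\<lambda>_. 1) \<partial>\<nu>))
          \<longlongrightarrow> (\<integral>y. f y * (\<eta>1 y)\<^sup>2 \<partial>mu \<alpha>)) at_top"
proof -
  have gs: "ground_state \<alpha> M B r \<eta>1 lam1"
  proof (intro ground_state.intro killed.intro drift.intro killed_axioms.intro ground_state_axioms.intro)
    show "\<forall>t>0. \<forall>x>0. (\<forall>y>0. 0 \<le> r t x y) \<and> integrable (mu \<alpha>) (r t x)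
                   \<and> (\<forall>g. g \<in> borel_measurable borel \<and> (\<exists>C. \<forall>y. \<bar>g y\<bar> \<le> C) \<longrightarrow>
                        killed_exp M B \<alpha> x t t g = (\<integral>y. r t x y * g y \<partial>mu \<alpha>))"
      using r_dens by (intro allI impI) blast
  qed fact+
  interpret ground_state \<alpha> M B r \<eta>1 lam1 by (rule gs)
  obtain T \<theta> a b C0 where "0 < a" "a \<le> b" "C0 * measure pi (- {a..b}) \<le> 1 / 2"
    "doeblin_dom Q T \<theta> (uniform_measure pi {a..b}) pi C0"
    using doeblin_exists by blast
  then interpret ground_state_doeblin \<alpha> M B r \<eta>1 lam1 T \<theta> a b C0
    by (intro ground_state_doeblin.intro gs ground_state_doeblin_axioms.intro)
  show ?thesis by (rule conditional_limit[OF q nu f])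
qed

end
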